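(* Let $n\ge2$ and $m\ge1$ be integers. If the Fefferman--Szegő metric on $E_{n,m}$ has constant scalar curvature, then $m=1$. Consequently, if its Ricci endomorphism has constant eigenvalues, then $m=1$. Conversely, for $m=1$ the scalar curvature and the Ricci eigenvalues are constant.
   Context: $E_{n,m}=\{(z,w)\in\mathbb C^{n-1}\times\mathbb C: |z|^2+|w|^{2m}<1\}$. The Fefferman--Szegő kernel $S_{n,m}$: with $\rho(z,w)=|z|^2+|w|^{2m}-1$, let $M(\rho)=-\det\begin{pmatrix}0&\rho_{\bar \ell}\\ \rho_j&\rho_{j\bar \ell}\end{pmatrix}_{1\le j,\ell\le n}$ be the $(n+1)\times(n+1)$ complex bordered Hessian determinant on $\partial E_{n,m}$, and $d\mu_F=M(\rho)^{1/(n+1)}\,d\sigma/|\nabla\rho|$ with $d\sigma$ Euclidean hypersurface measure and $|\nabla\rho|$ the Euclidean length of the real gradient. $H_F^2(E_{n,m})$ is the closure in $L^2(\partial E_{n,m},d\mu_F)$ of the holomorphic functions defined in a neighbourhood of $\overline{E_{n,m}}$; it is a reproducing-kernel Hilbert space of functions on $E_{n,m}$ and $S_{n,m}$ is its reproducing kernel: $f(q)=\langle f,S_{n,m}(\cdot,q)\rangle_{L^2(d\mu_F)}$. The Fefferman--Szegő metric is the Kähler metric with form $\omega_{FS}=\sqrt{-1}\,\partial\bar\partial\Phi$ on $E_{n,m}$, $\Phi(p)=\log S_{n,m}(p,p)$ (it is positive definite), with Hermitian matrix $g=(\Phi_{j\bar\ell})$ in the coordinates $(z_1,\dots,z_{n-1},w)$.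 Its Ricci form is $\operatorname{Ric}(\omega_{FS})=-\sqrt{-1}\,\partial\bar\partial\log\det(\Phi_{j\bar\ell})$, i.e. $R_{j\bar\ell}=-\partial_j\partial_{\bar\ell}\log\det g$; the Ricci endomorphism is obtained from $(R_{j\bar\ell})$ by raising an index with $g$, and the scalar curvature is its trace $g^{j\bar\ell}R_{j\bar\ell}$ (the sum of the $n$ Ricci eigenvalues). *)

theory Defs
  imports "HOL-Analysis.Analysis" "HOL-Computational_Algebra.Polynomial"
begin

text \<open>
  The space $C^n = C^{n-1} \times C$ is rendered as the type below, with $n - 1$ the cardinality
  of the finite index type; hence \<open>n = CARD('k) + 1 = CARD('k option)\<close>, and $n \ge 2$ holds
  automatically because types are non-empty.  Its library norm is the Euclidean norm.  The complex
  coordinates $(z_1, \dots, z_{n-1}, w)$ are indexed by the option type: \<open>Some i\<close> for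
  $z_i$ and \<open>None\<close> for $w$.
\<close>

type_synonym 'k pt = "(complex ^ 'k) \<times> complex"

definition defining_fun :: "nat \<Rightarrow> 'k::finite pt \<Rightarrow> real" where
  "defining_fun m p = (norm (fst p))\<^sup>2 + norm (snd p) ^ (2 * m) - 1"

definition egg :: "nat \<Rightarrow> 'k::finite pt set" where
  "egg m = {p. (norm (fst p))\<^sup>2 + norm (snd p) ^ (2 * m) < 1}"


section \<open>Complex differentiation in several variables\<close>

fun coord_vec :: "'k option \<Rightarrow> complex \<Rightarrow> 'k::finite pt" where
  "coord_vec (Some i) c = (axis i c, 0)"
| "coord_vec None c = (0, c)"

definition partial_deriv :: "'k::finite pt \<Rightarrow> ('k pt \<Rightarrow> complex) \<Rightarrow> 'k pt \<Rightarrow> complex" where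
  "partial_deriv v f p = vector_derivative (\<lambda>t::real. f (p + t *\<^sub>R v)) (at 0)"

text \<open>Wirtinger operators: $\partial_j = \frac12(\partial_{x_j} - i\,\partial_{y_j})$ and
  $\partial_{\bar j} = \frac12(\partial_{x_j} + i\,\partial_{y_j})$.\<close>

definition wirt :: "'k option \<Rightarrow> ('k::finite pt \<Rightarrow> complex) \<Rightarrow> 'k pt \<Rightarrow> complex" where
  "wirt j f p = (partial_deriv (coord_vec j 1) f p - \<i> * partial_deriv (coord_vec j \<i>) f p) / 2"

definition wirt_bar :: "'k option \<Rightarrow> ('k::finite pt \<Rightarrow> complex) \<Rightarrow> 'k pt \<Rightarrow> complex" where
  "wirt_bar j f p = (partial_deriv (coord_vec j 1) f p + \<i> * partial_deriv (coord_vec j \<i>) f p) / 2"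

definition holomorphic_several_on :: "('k::finite pt \<Rightarrow> complex) \<Rightarrow> 'k pt set \<Rightarrow> bool" where
  "holomorphic_several_on f U \<longleftrightarrow>
     (\<forall>p\<in>U. \<exists>D. (f has_derivative D) (at p) \<and>
        (\<forall>c v. D (c *s fst v, c * snd v) = c * D v))"

definition holomorphic_near_closure :: "nat \<Rightarrow> ('k::finite pt \<Rightarrow> complex) \<Rightarrow> bool" where
  "holomorphic_near_closure m f \<longleftrightarrow>
     (\<exists>U. open U \<and> closure (egg m) \<subseteq> U \<and> holomorphic_several_on f U)"


section \<open>Euclidean hypersurface measure\<close>

definition gradient :: "('a::euclidean_space \<Rightarrow> real) \<Rightarrow> 'a \<Rightarrow> 'a" where
  "gradient f x = (\<Sum>b\<in>Basis. frechet_derivative f (at x) b *\<^sub>R b)"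

text \<open>
  The Euclidean surface measure on a hypersurface \<open>S\<close> in $C^n = R^{2n}$ is the Borel measure
  carried by \<open>S\<close> which, on every $C^1$ graph contained in \<open>S\<close> over an open
  subset \<open>U\<close> of a real hyperplane, has the area element $\sqrt{1 + |\nabla h|^2}\,dx$.
  A linear isometry \<open>L\<close> from $R^{2n-1} = C^{n-1} \times R$ onto the hyperplane orthogonal to
  the unit vector \<open>\<nu>\<close> provides the Euclidean coordinates.  An embedded $C^1$
  hypersurface is covered by countably many such graphs, so the measure is unique.
\<close>

definition is_hypersurface_measure :: "'k::finite pt set \<Rightarrow> 'k pt measure \<Rightarrow> bool" where
  "is_hypersurface_measure S \<sigma> \<longleftrightarrow>
     sets \<sigma> = sets borel \<and> emeasure \<sigma> (- S) = 0 \<and>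
     (\<forall>(L :: (complex ^ 'k) \<times> real \<Rightarrow> 'k pt) \<nu> U h.
        linear L \<and> (\<forall>x. norm (L x) = norm x) \<and> norm \<nu> = 1 \<and> (\<forall>x. L x \<bullet> \<nu> = 0) \<and>
        open U \<and> (\<forall>x\<in>U. h differentiable (at x)) \<and> continuous_on U (gradient h) \<and>
        (\<lambda>x. L x + h x *\<^sub>R \<nu>) ` U \<subseteq> S \<longrightarrow>
        (\<forall>B\<in>sets borel. B \<subseteq> (\<lambda>x. L x + h x *\<^sub>R \<nu>) ` U \<longrightarrow>
           emeasure \<sigma> B =
             (\<integral>\<^sup>+x\<in>U. ennreal (sqrt (1 + (norm (gradient h x))\<^sup>2)) * indicator B (L x + h x *\<^sub>R \<nu>) \<partial>lborel)))"

definition hypersurface_measure :: "'k::finite pt set \<Rightarrow> 'k pt measure" where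
  "hypersurface_measure S = (THE \<sigma>. is_hypersurface_measure S \<sigma>)"


section \<open>The Fefferman measure\<close>

text \<open>The bordered complex Hessian; index \<open>None\<close> is the border.\<close>

definition bordered_hessian :: "('k::finite pt \<Rightarrow> real) \<Rightarrow> 'k pt \<Rightarrow> complex ^ ('k option option) ^ ('k option option)" where
  "bordered_hessian r p = (\<chi> a b.
     (case (a, b) of
        (None, None) \<Rightarrow> 0
      | (None, Some l) \<Rightarrow> wirt_bar l (\<lambda>q. complex_of_real (r q)) p
      | (Some j, None) \<Rightarrow> wirt j (\<lambda>q. complex_of_real (r q)) p
      | (Some j, Some l) \<Rightarrow> wirt j (wirt_bar l (\<lambda>q. complex_of_real (r q))) p))"

text \<open>The bordered Hessian is Hermitian, so its determinant is real.\<close>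

definition fefferman_M :: "('k::finite pt \<Rightarrow> real) \<Rightarrow> 'k pt \<Rightarrow> real" where
  "fefferman_M r p = - Re (det (bordered_hessian r p))"

definition fefferman_measure :: "nat \<Rightarrow> 'k::finite pt measure" where
  "fefferman_measure m =
     density (restrict_space (hypersurface_measure (frontier (egg m))) (frontier (egg m)))
       (\<lambda>p. ennreal (fefferman_M (defining_fun m) p powr (1 / (real CARD('k option) + 1))
                       / norm (gradient (defining_fun m) p)))"


section \<open>The Hardy space and its reproducing kernel\<close>

text \<open>
  An element of the Hardy space is represented by a single function whose restriction to the
  boundary is an $L^2$-limit of functions holomorphic near the closure, and whose values inside the
  domain are the corresponding limits.  Point evaluations being $L^2$-bounded, the interior values
  are determined by the boundary values up to null sets.
\<close>

definition hardy_space :: "nat \<Rightarrow> ('k::finite pt \<Rightarrow> complex) set" where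
  "hardy_space m = {u. u \<in> borel_measurable (fefferman_measure m) \<and>
     (\<exists>f :: nat \<Rightarrow> 'k pt \<Rightarrow> complex.
        (\<forall>i. holomorphic_near_closure m (f i)) \<and>
        (\<lambda>i. \<integral>\<^sup>+p. ennreal ((norm (f i p - u p))\<^sup>2) \<partial>fefferman_measure m) \<longlonglongrightarrow> 0 \<and>
        (\<forall>q\<in>egg m. (\<lambda>i. f i q) \<longlonglongrightarrow> u q))}"

definition is_reproducing_kernel :: "nat \<Rightarrow> ('k::finite pt \<Rightarrow> 'k pt \<Rightarrow> complex) \<Rightarrow> bool" where
  "is_reproducing_kernel m K \<longleftrightarrow>
     (\<forall>q\<in>egg m. (\<lambda>p. K p q) \<in> hardy_space m \<and>
        (\<forall>u\<in>hardy_space m. u q = (\<integral>p. u p * cnj (K p q) \<partial>fefferman_measure m)))"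

text \<open>The values on pairs of points of the domain are uniquely determined; only the boundary values
  depend, up to null sets, on the choice.\<close>

definition fs_kernel :: "nat \<Rightarrow> 'k::finite pt \<Rightarrow> 'k pt \<Rightarrow> complex" where
  "fs_kernel m = (SOME K. is_reproducing_kernel m K)"


section \<open>The Fefferman--Szego metric and its curvature\<close>

definition fs_potential :: "nat \<Rightarrow> 'k::finite pt \<Rightarrow> real" where
  "fs_potential m p = ln (Re (fs_kernel m p p))"

definition complex_hessian :: "('k::finite pt \<Rightarrow> real) \<Rightarrow> 'k pt \<Rightarrow> complex ^ ('k option) ^ ('k option)" where
  "complex_hessian \<Phi> p = (\<chi> j l. wirt j (wirt_bar l (\<lambda>q. complex_of_real (\<Phi> q))) p)"

definition fs_metric :: "nat \<Rightarrow> 'k::finite pt \<Rightarrow> complex ^ ('k option) ^ ('k option)" where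
  "fs_metric m = complex_hessian (fs_potential m)"

text \<open>\<open>fs_metric\<close> is Hermitian positive definite on the domain, so its determinant is a positive real.\<close>

definition ricci_form :: "nat \<Rightarrow> 'k::finite pt \<Rightarrow> complex ^ ('k option) ^ ('k option)" where
  "ricci_form m p = - complex_hessian (\<lambda>q. ln (Re (det (fs_metric m q)))) p"

text \<open>With $g^{k\bar l} g_{j\bar l} = \delta_j^k$, the number $g^{k\bar l}$ is the $(l,k)$ entry of
  the inverse matrix, so the product below has the entries $R_{j\bar l}\, g^{k\bar l}$.\<close>

definition ricci_endo :: "nat \<Rightarrow> 'k::finite pt \<Rightarrow> complex ^ ('k option) ^ ('k option)" where
  "ricci_endo m p = ricci_form m p ** matrix_inv (fs_metric m p)"

definition scalar_curvature :: "nat \<Rightarrow> 'k::finite pt \<Rightarrow> complex" where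
  "scalar_curvature m p = trace (ricci_endo m p)"

definition charpoly :: "'a::comm_ring_1 ^ 'n ^ 'n::finite \<Rightarrow> 'a poly" where
  "charpoly A = det (\<chi> i j. (if i = j then [:0, 1:] else 0) - [:A $ i $ j:])"

text \<open>The $n$ eigenvalues, counted with algebraic multiplicity.\<close>

definition ricci_eigenvalues :: "nat \<Rightarrow> 'k::finite pt \<Rightarrow> complex multiset" where
  "ricci_eigenvalues m p = proots (charpoly (ricci_endo m p))"

end

theory Submission
  imports Defs "HOL-Complex_Analysis.Complex_Analysis" "HOL-Computational_Algebra.Fundamental_Theorem_Algebra"
begin

text \<open>
  Write $d = n - 1$, $h = 1/m$, $a = |z|^2$, $b = |w|^2$. The proof computes the kernel, reduces the
  curvature to one function of one variable, and shows that this function would have to be a rational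
  function with incompatible poles.

  The Fefferman density on the boundary is a power of $|w|$, and the boundary measure is
  invariant under $U(d) \times U(1)$. Hence the functions $\langle z, e \rangle^j w^k$ are orthogonal in
  the Hardy space; their norms are quotients of Gamma functions, obtained by writing the surface
  measure as the image of a weighted Lebesgue measure under the weighted radial projection
  (\<open>hypersurface_measure_eq_sphere_measure\<close>, \<open>nn_integral_boundary_moment\<close>). Averaging a
  holomorphic function over rotations and using Cauchy's formula shows that the resulting series
  reproduces (\<open>egg_kernel_reproducing\<close>). Summed on the diagonal it gives
  $S(p,p) = C (1-a)^{-A} F(x)$ with $x = b (1-a)^{-h}$, $A = d + hc$, $c = 1 + (m-1)/(d+2)$, where
  $F(x) = p(x) / (1-x)^{d+1}$ for a polynomial $p$ that is constant exactly when $m = 1$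
  (\<open>fs_potential_eq\<close>, \<open>pochhammer_numerator_nonconstant\<close>).

  For a potential $-A \log(1-a) + \psi(x)$ put $P = A + h x \psi'$. The determinant of the
  metric is $P^d P' h^{-1} (1-a)^{-(d+1+h)}$, so $\log\det$ has again the form of such a potential, and at the
  points with $z = 0$ both the metric and the Ricci form are diagonal. The scalar curvature there is an
  explicit differential expression in $P$. Constancy of the curvature, with value $S$, becomes a
  polynomial identity in $x$, $P$, $P'$, $P''$, $P^{(3)}$. Since $P$ is rational, this identity extends to
  complex $x$ and can be read off at a pole: a simple pole forces a relation between $S$ and the residue of $P$
  (\<open>curvature_pole\<close>). The pole of $F$ at $x = 1$ gives $S = -(d+2)$, while a zero of $p$ of order
  $\mu$ gives $S \mu = (d+1)(d+2)$. The signs disagree, so $p$ has no zero, is constant, and $m = 1$.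

  For $m = 1$ the domain is the ball, $S(p,p) = C (1-a-b)^{-(d+1)}$, and $\log\det$ of the metric is
  $(d+2)/(d+1)$ times the potential up to a constant, so the metric is Einstein. The statement on
  eigenvalues reduces to that on scalar curvature because the trace is their sum.
\<close>

section \<open>Linear changes of variables for Lebesgue measure\<close>

text \<open>Uniqueness of Haar measure in the form needed here: both measures are compared by integrating the indicators of a set and of a ball over the product and exchanging the order of integration.\<close>

lemma translation_invariant_eq_lborel:
  fixes M :: "'a::euclidean_space measure"
  assumes sets[measurable_cong]: "sets M = sets borel" 
    and inv: "\<And>c. distr M borel ((+) c) = M"
    and ball: "emeasure M (ball 0 1) = emeasure lborel (ball 0 1 :: 'a set)"
    and fin: "\<And>r. emeasure M (ball 0 r) < \<infinity>"
  shows "M = lborel"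
proof -
  have sf: "sigma_finite_measure M"
  proof
    have "range (\<lambda>n::nat. ball (0::'a) (real n)) \<subseteq> sets M" by (auto simp: sets)
    moreover have "\<Union>(range (\<lambda>n::nat. ball (0::'a) (real n))) = space M"
      using reals_Archimedean2 by (auto simp: sets_eq_imp_space_eq[OF sets])
    ultimately show "\<exists>A. countable A \<and> A \<subseteq> sets M \<and> \<Union>A = space M \<and> (\<forall>a\<in>A. emeasure M a \<noteq> \<infinity>)"
      using fin by (intro exI[of _ "range (\<lambda>n::nat. ball (0::'a) (real n))"]) (auto simp: less_top)
  qed
  interpret M: sigma_finite_measure M by (rule sf)
  interpret P: pair_sigma_finite lborel M
    by (simp add: pair_sigma_finite_def sf sigma_finite_lborel)
  define A where "A = ball (0::'a) 1"
  have [measurable]: "A \<in> sets borel" by (simp add: A_def)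
  have trM: "(\<integral>\<^sup>+y. f (x + y) \<partial>M) = (\<integral>\<^sup>+y. f y \<partial>M)" if [measurable]: "f \<in> borel_measurable borel" for f x
  proof -
    have "(\<integral>\<^sup>+y. f y \<partial>M) = (\<integral>\<^sup>+y. f y \<partial>distr M borel ((+) x))" by (simp add: inv)
    also have "\<dots> = (\<integral>\<^sup>+y. f (x + y) \<partial>M)" by (subst nn_integral_distr) auto
    finally show ?thesis by simp
  qed
  have trL: "(\<integral>\<^sup>+y. f (x + y) \<partial>lborel) = (\<integral>\<^sup>+y. f y \<partial>lborel)" if [measurable]: "f \<in> borel_measurable borel" for f and x :: 'a
  proof -
    have "(\<integral>\<^sup>+y. f y \<partial>lborel) = (\<integral>\<^sup>+y. f y \<partial>distr lborel borel ((+) x))" by (simp add: lborel_distr_plus)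
    also have "\<dots> = (\<integral>\<^sup>+y. f (x + y) \<partial>lborel)" by (subst nn_integral_distr) auto
    finally show ?thesis by simp
  qed
  have MA: "(\<integral>\<^sup>+y. indicator A (x - y) \<partial>M) = emeasure M A" for x
  proof -
    have "(\<integral>\<^sup>+y. indicator A (x - y) \<partial>M) = (\<integral>\<^sup>+y. indicator A (x - (x + y)) \<partial>M)"
      by (rule trM[symmetric]) measurable
    also have "\<dots> = (\<integral>\<^sup>+y. indicator A y \<partial>M)"
      by (intro nn_integral_cong) (auto simp: A_def indicator_def)
    finally show ?thesis by (simp add: sets)
  qed
  show ?thesis
  proof (rule measure_eqI)
    show "sets M = sets lborel" by (simp add: sets)
    fix B assume "B \<in> sets M"
    then have [measurable]: "B \<in> sets borel" by (simp add: sets)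
    have "emeasure lborel A * emeasure M B = (\<integral>\<^sup>+x. indicator A x * emeasure M B \<partial>lborel)"
      by (simp add: nn_integral_multc)
    also have "\<dots> = (\<integral>\<^sup>+x. (\<integral>\<^sup>+y. indicator A x * indicator B (x + y) \<partial>M) \<partial>lborel)"
      by (intro nn_integral_cong) (simp add: nn_integral_cmult trM sets)
    also have "\<dots> = (\<integral>\<^sup>+y. (\<integral>\<^sup>+x. indicator A x * indicator B (x + y) \<partial>lborel) \<partial>M)"
      by (rule P.Fubini'[symmetric]) measurable
    also have "\<dots> = (\<integral>\<^sup>+y. (\<integral>\<^sup>+x. indicator A (x - y) * indicator B x \<partial>lborel) \<partial>M)"
    proof (rule nn_integral_cong)
      fix y
      have "(\<integral>\<^sup>+x. indicator A (x - y) * indicator B x \<partial>lborel) = 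
         (\<integral>\<^sup>+x. indicator A ((y + x) - y) * indicator B (y + x) \<partial>lborel :: ennreal)"
        by (rule trL[symmetric]) measurable
      then show "(\<integral>\<^sup>+x. indicator A x * indicator B (x + y) \<partial>lborel) = (\<integral>\<^sup>+x. indicator A (x - y) * indicator B x \<partial>lborel :: ennreal)"
        by (simp add: add.commute)
    qed
    also have "\<dots> = (\<integral>\<^sup>+x. (\<integral>\<^sup>+y. indicator A (x - y) * indicator B x \<partial>M) \<partial>lborel)"
      by (rule P.Fubini') measurable
    also have "\<dots> = (\<integral>\<^sup>+x. emeasure M A * indicator B x \<partial>lborel)"
      by (intro nn_integral_cong) (simp add: nn_integral_multc MA)
    also have "\<dots> = emeasure lborel A * emeasure lborel B"
      by (simp add: nn_integral_cmult ball A_def)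
    finally have "emeasure lborel A * emeasure M B = emeasure lborel A * emeasure lborel B" .
    moreover have "emeasure lborel A \<noteq> 0" "emeasure lborel A \<noteq> \<infinity>"
      using less_imp_neq[OF unit_ball_vol_pos[of "real DIM('a)"]] by (auto simp: A_def emeasure_ball simp del: unit_ball_vol_pos)
    ultimately show "emeasure M B = emeasure lborel B"
      by (simp add: ennreal_mult_cancel_left)
  qed
qed

text \<open>An isometry need not be an endomorphism, so the determinant formula does not apply; the image measure is translation invariant and gives the unit ball its volume.\<close>

lemma lborel_distr_isometry:
  fixes f :: "'a::euclidean_space \<Rightarrow> 'b::euclidean_space"
  assumes lin: "linear f" and iso: "\<And>x. norm (f x) = norm x" and dim: "DIM('a) = DIM('b)"
  shows "distr lborel borel f = lborel"
proof -
  have [measurable]: "f \<in> borel_measurable borel"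
    using lin linear_continuous_on linear_conv_bounded_linear by (blast intro: borel_measurable_continuous_onI)
  have "inj f" using lin iso by (metis linear_injective_0 norm_eq_zero)
  then have "dim (range f) = DIM('b)"
    using dim_image_eq[OF lin, of UNIV] dim by simp
  then have "span (range f) = UNIV" by (simp only: dim_eq_full)
  then have surj: "surj f" using linear_span_image[OF lin, of UNIV] by simp
  have eb: "emeasure (distr lborel borel f) (ball 0 r) = emeasure lborel (ball (0::'b) r)" for r
  proof -
    have "f -` ball 0 r = ball 0 r" by (auto simp: iso)
    then have "emeasure (distr lborel borel f) (ball 0 r) = emeasure lborel (ball (0::'a) r)"
      by (subst emeasure_distr) auto
    also have "\<dots> = emeasure lborel (ball (0::'b) r)"
      by (cases "r \<ge> 0") (auto simp: emeasure_ball dim ball_empty)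
    finally show ?thesis .
  qed
  show ?thesis
  proof (rule translation_invariant_eq_lborel)
    fix c :: 'b
    obtain c' where c: "c = f c'" using surj by auto
    have "distr (distr lborel borel f) borel ((+) c) = distr lborel borel (\<lambda>x. c + f x)"
      by (subst distr_distr) (auto simp: o_def)
    also have "(\<lambda>x. c + f x) = (\<lambda>x. f (c' + x))" using lin by (auto simp: c linear_add)
    also have "distr lborel borel \<dots> = distr (distr lborel borel ((+) c')) borel f"
      by (subst distr_distr) (auto simp: o_def)
    finally show "distr (distr lborel borel f) borel ((+) c) = distr lborel borel f"
      by (simp add: lborel_distr_plus)
  qed (use eb emeasure_lborel_ball_finite in \<open>auto simp: less_top[symmetric]\<close>)
qed

text \<open>This plays the role of \<open>\<bar>det M\<bar> = c\<close> for maps between different Euclidean spaces of equal dimension, where no matrix is at hand.\<close>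

definition scales_volume :: "('a::euclidean_space \<Rightarrow> 'b::euclidean_space) \<Rightarrow> real \<Rightarrow> bool" where
  "scales_volume M c \<longleftrightarrow> (\<forall>\<phi>::'b \<Rightarrow> ennreal. \<phi> \<in> borel_measurable borel \<longrightarrow>
     (\<integral>\<^sup>+y. \<phi> y \<partial>lborel) = ennreal c * (\<integral>\<^sup>+x. \<phi> (M x) \<partial>lborel))"

lemma scales_volumeD:
  "scales_volume M c \<Longrightarrow> \<phi> \<in> borel_measurable borel \<Longrightarrow> (\<integral>\<^sup>+y. \<phi> y \<partial>lborel) = ennreal c * (\<integral>\<^sup>+x. \<phi> (M x) \<partial>lborel)"
  by (auto simp: scales_volume_def)

lemma scales_volume_isometry:
  fixes f :: "'a::euclidean_space \<Rightarrow> 'b::euclidean_space"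
  assumes lin: "linear f" and iso: "\<And>x. norm (f x) = norm x" and dim: "DIM('a) = DIM('b)"
  shows "scales_volume f 1"
  unfolding scales_volume_def
proof safe
  fix \<phi> :: "'b \<Rightarrow> ennreal" assume [measurable]: "\<phi> \<in> borel_measurable borel"
  have [measurable]: "f \<in> borel_measurable borel"
    using lin linear_continuous_on linear_conv_bounded_linear by (blast intro: borel_measurable_continuous_onI)
  show "(\<integral>\<^sup>+y. \<phi> y \<partial>lborel) = ennreal 1 * (\<integral>\<^sup>+x. \<phi> (f x) \<partial>lborel)"
    by (subst lborel_distr_isometry[OF assms, symmetric], subst nn_integral_distr) auto
qed

lemma scales_volume_compose:
  fixes f :: "'b::euclidean_space \<Rightarrow> 'c::euclidean_space" and g :: "'a::euclidean_space \<Rightarrow> 'b"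
  assumes "scales_volume f c" "scales_volume g e" "f \<in> borel_measurable borel" "c \<ge> 0"
  shows "scales_volume (f \<circ> g) (c * e)"
  unfolding scales_volume_def
proof safe
  fix \<phi> :: "'c \<Rightarrow> ennreal" assume [measurable]: "\<phi> \<in> borel_measurable borel"
  note [measurable] = assms(3)
  have "(\<integral>\<^sup>+y. \<phi> y \<partial>lborel) = ennreal c * (ennreal e * (\<integral>\<^sup>+x. \<phi> (f (g x)) \<partial>lborel))"
    by (subst scales_volumeD[OF assms(1)], simp, subst scales_volumeD[OF assms(2)], simp_all)
  then show "(\<integral>\<^sup>+y. \<phi> y \<partial>lborel) = ennreal (c * e) * (\<integral>\<^sup>+x. \<phi> ((f \<circ> g) x) \<partial>lborel)"
    using assms(4) by (simp add: ennreal_mult' mult.assoc)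
qed

text \<open>Compatibility with determinants, needed to feed a Jacobian found through \<open>scales_volume\<close> into the change of variables formula.\<close>

lemma scales_volume_det:
  fixes M :: "real ^ 'n::{finite,wellorder} \<Rightarrow> real ^ 'n::_"
  assumes lin: "linear M" and sc: "scales_volume M c" and c: "c > 0"
  shows "\<bar>det (matrix M)\<bar> = c"
proof -
  have mes[measurable]: "M \<in> borel_measurable borel"
    using lin linear_continuous_on linear_conv_bounded_linear by (blast intro: borel_measurable_continuous_onI)
  let ?B = "cball (0 :: (real,'n) vec) 1"
  have Bpos: "measure lebesgue ?B > 0" 
    by (simp add: content_cball[of 1 "0 :: (real,'n) vec"] measure_completion)
  have comp: "compact (M ` ?B)"
    by (rule compact_continuous_image[OF linear_continuous_on[OF lin[unfolded linear_conv_bounded_linear]] compact_cball])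
  have img[measurable]: "M ` ?B \<in> sets borel" using comp by (simp add: borel_compact)
  have fin: "emeasure lborel (M ` ?B) < \<infinity>" using emeasure_compact_finite[OF comp] by (simp add: less_top)
  have inj: "inj M"
  proof (rule ccontr)
    assume "\<not> inj M"
    then have ns: "range M \<noteq> UNIV" by (rule contrapos_nn) (rule linear_surjective_imp_injective[OF lin], simp_all)
    have sub: "subspace (range M)" by (rule linear_subspace_image[OF lin subspace_UNIV])
    then have "span (range M) \<noteq> UNIV" using ns by (simp only: span_eq_iff[THEN iffD2, OF sub] not_False_eq_True)
    then have "dim (range M) < DIM((real,'n) vec)"
      using dim_eq_full[of "range M"] dim_subset_UNIV[of "range M"] by linarith
    then have neg: "negligible (range M)" by (rule negligible_lowdim)
    have "range M \<in> sets borel" using sub by (simp add: closed_subspace borel_closed)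
    then have "emeasure lborel (range M) = 0"
      using neg by (simp add: negligible_iff_null_sets null_sets_completion_iff null_setsD1)
    moreover have "(\<integral>\<^sup>+y. indicator (range M) y \<partial>lborel) = ennreal c * (\<integral>\<^sup>+x. indicator (range M) (M x) \<partial>lborel)"
      using \<open>range M \<in> sets borel\<close> by (intro scales_volumeD[OF sc]) simp
    moreover note \<open>range M \<in> sets borel\<close>
    ultimately have "0 = ennreal c * (\<integral>\<^sup>+x. 1 \<partial>(lborel :: (real,'n) vec measure))" by simp
    then show False using c by simp
  qed
  have "emeasure lborel (M ` ?B) = ennreal c * (\<integral>\<^sup>+x. indicator (M ` ?B) (M x) \<partial>lborel)"
    by (subst scales_volumeD[OF sc, symmetric]) auto
  also have "(\<integral>\<^sup>+x. indicator (M ` ?B) (M x) \<partial>lborel) = (\<integral>\<^sup>+x. indicator ?B x \<partial>(lborel::(real,'n) vec measure))"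
    using inj by (intro nn_integral_cong) (auto simp: indicator_def inj_image_mem_iff)
  finally have "emeasure lborel (M ` ?B) = ennreal c * emeasure lborel ?B" by simp
  then have "measure lborel (M ` ?B) = c * measure lborel ?B"
    using c by (simp add: measure_def enn2real_mult)
  moreover have "measure lebesgue (M ` ?B) = \<bar>det (matrix M)\<bar> * measure lebesgue ?B"
    by (rule measure_linear_image[OF lin]) simp
  ultimately show ?thesis using Bpos by (simp add: measure_completion)
qed

lemma nn_integral_set_absolutely_integrable:
  fixes h :: "'a::euclidean_space \<Rightarrow> real"
  assumes "h absolutely_integrable_on A" "\<And>x. x \<in> A \<Longrightarrow> h x \<ge> 0"
  shows "(\<integral>\<^sup>+x. ennreal (indicator A x * h x) \<partial>lebesgue) = ennreal (integral A h)"
proof -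
  have "(\<integral>\<^sup>+x. ennreal (indicator A x * h x) \<partial>lebesgue) = ennreal (\<integral>x. indicator A x * h x \<partial>lebesgue)"
    using assms by (intro nn_integral_eq_integral) (auto simp: set_integrable_def indicator_def)
  also have "(\<integral>x. indicator A x * h x \<partial>lebesgue) = integral A h"
    using set_lebesgue_integral_eq_integral(2)[OF assms(1)] by (simp add: set_lebesgue_integral_def)
  finally show ?thesis .
qed

lemma absolute_change_of_variables_real:
  fixes f :: "real^'m::{finite,wellorder} \<Rightarrow> real" and g :: "real^'m::_ \<Rightarrow> real^'m::_"
  assumes S: "S \<in> sets lebesgue"
    and der_g: "\<And>x. x \<in> S \<Longrightarrow> (g has_derivative g' x) (at x within S)"
    and inj: "inj_on g S" and f: "f absolutely_integrable_on (g ` S)"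
  shows "(\<lambda>x. \<bar>det (matrix (g' x))\<bar> * f (g x)) absolutely_integrable_on S"
    "integral S (\<lambda>x. \<bar>det (matrix (g' x))\<bar> * f (g x)) = integral (g ` S) f"
proof -
  define F :: "real^'m::_ \<Rightarrow> real^1" where "F = (\<lambda>y. vec (f y))"
  have bl: "bounded_linear (vec :: real \<Rightarrow> real^1)" 
    by (rule bounded_linear_intro[where K=1]) (auto simp: vec_eq_iff norm_vec_def L2_set_def)
  have bl': "bounded_linear (\<lambda>v::real^1. v $ 1)" by (rule bounded_linear_vec_nth)
  have F: "F absolutely_integrable_on (g ` S)"
    using absolutely_integrable_linear[OF f bl] by (simp add: F_def o_def)
  have *: "(\<lambda>x. \<bar>det (matrix (g' x))\<bar> *\<^sub>R F(g x)) absolutely_integrable_on S \<and>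
           integral S (\<lambda>x. \<bar>det (matrix (g' x))\<bar> *\<^sub>R F(g x)) = integral (g ` S) F"
    using has_absolute_integral_change_of_variables[OF S der_g inj, where f=F and b="integral (g ` S) F"] F
    by blast
  have eq: "(\<lambda>v::real^1. v $ 1) \<circ> (\<lambda>x. \<bar>det (matrix (g' x))\<bar> *\<^sub>R F(g x)) = (\<lambda>x. \<bar>det (matrix (g' x))\<bar> * f (g x))"
    "(\<lambda>v::real^1. v $ 1) \<circ> F = f"
    by (auto simp: F_def)
  show "(\<lambda>x. \<bar>det (matrix (g' x))\<bar> * f (g x)) absolutely_integrable_on S"
    using absolutely_integrable_linear[OF conjunct1[OF *] bl'] by (simp only: eq)
  have "integral S ((\<lambda>v::real^1. v $ 1) \<circ> (\<lambda>x. \<bar>det (matrix (g' x))\<bar> *\<^sub>R F(g x))) = integral (g ` S) F $ 1"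
    using integral_linear[OF set_lebesgue_integral_eq_integral(1)[OF conjunct1[OF *]] bl'] * by simp
  also have "\<dots> = integral (g ` S) ((\<lambda>v::real^1. v $ 1) \<circ> F)"
    using integral_linear[OF set_lebesgue_integral_eq_integral(1)[OF F] bl'] by simp
  finally show "integral S (\<lambda>x. \<bar>det (matrix (g' x))\<bar> * f (g x)) = integral (g ` S) f"
    by (simp only: eq)
qed

lemma borel_measurable_linear:
  fixes f :: "'a::euclidean_space \<Rightarrow> 'b::euclidean_space"
  shows "linear f \<Longrightarrow> f \<in> borel_measurable borel"
  by (intro borel_measurable_continuous_onI linear_continuous_on) (simp add: linear_conv_bounded_linear)

lemma isometry_exists:
  assumes "DIM('a::euclidean_space) = DIM('b::euclidean_space)"
  obtains f :: "'a::euclidean_space \<Rightarrow> 'b::euclidean_space" and g :: "'b::euclidean_space \<Rightarrow> 'a::euclidean_space" where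
    "linear f" "linear g" "\<And>x. norm (f x) = norm x" "\<And>x. norm (g x) = norm x" "\<And>x. g (f x) = x" "\<And>x. f (g x) = x"
proof -
  have "dim (UNIV::'a set) = dim (UNIV :: 'b set)" using assms by simp
  from isometries_subspaces[OF subspace_UNIV subspace_UNIV this] show ?thesis
    using that by (metis UNIV_I)
qed

text \<open>The library formula concerns endomorphisms of coordinate space. Conjugating with isometries transports it to an injective map between two spaces whose derivative multiplies volume by a known factor.\<close>

theorem nn_integral_change_of_variables:
  fixes g :: "'a::euclidean_space \<Rightarrow> 'b::euclidean_space" and f :: "'b \<Rightarrow> real"
  assumes dim: "DIM('a) = CARD('n::{finite,wellorder})" "DIM('b) = CARD('n)"
    and S[measurable]: "S \<in> sets borel" and gS[measurable]: "g ` S \<in> sets borel"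
    and der: "\<And>x. x \<in> S \<Longrightarrow> (g has_derivative g' x) (at x)"
    and inj: "inj_on g S"
    and scale: "\<And>x. x \<in> S \<Longrightarrow> scales_volume (g' x) (J x)" "\<And>x. x \<in> S \<Longrightarrow> J x > 0"
    and f: "integrable lborel f" "\<And>x. f x \<ge> 0"
    and Jf[measurable]: "(\<lambda>x. indicator S x * (J x * f (g x))) \<in> borel_measurable borel"
  shows "(\<integral>\<^sup>+y. ennreal (indicator (g ` S) y * f y) \<partial>lborel) = (\<integral>\<^sup>+x. ennreal (indicator S x * (J x * f (g x))) \<partial>lborel)"
proof -
  have dim': "DIM((real,'n) vec) = DIM('a)" "DIM('b) = DIM((real,'n) vec)" using dim by simp_all
  obtain a :: "(real,'n) vec \<Rightarrow> 'a" and a' where a: "linear a" "linear a'" "\<And>x. norm (a x) = norm x" "\<And>x. norm (a' x) = norm x"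
    "\<And>x. a' (a x) = x" "\<And>x. a (a' x) = x" using isometry_exists[OF dim'(1)] by metis
  obtain b :: "'b \<Rightarrow> (real,'n) vec" and b' where b: "linear b" "linear b'" "\<And>x. norm (b x) = norm x" "\<And>x. norm (b' x) = norm x"
    "\<And>x. b' (b x) = x" "\<And>x. b (b' x) = x" using isometry_exists[OF dim'(2)] by metis
  note [measurable] = borel_measurable_linear[OF a(1)] borel_measurable_linear[OF a(2)]
    borel_measurable_linear[OF b(1)] borel_measurable_linear[OF b(2)]
  have fm[measurable]: "f \<in> borel_measurable borel" using f(1) by auto
  have sa: "scales_volume a 1" and sb: "scales_volume b' 1" and sb2: "scales_volume b 1"
    using a b dim' by (auto intro!: scales_volume_isometry)
  define G where "G = b \<circ> g \<circ> a"
  define T where "T = a' ` S"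
  have T_eq: "T = a -` S" using a(5,6) by (auto simp: T_def image_iff) metis
  have T[measurable]: "T \<in> sets borel" unfolding T_eq using measurable_sets[OF borel_measurable_linear[OF a(1)] S] by simp
  have GT: "G ` T = b' -` (g ` S)" 
    using a(5,6) b(5,6) by (auto simp: G_def T_def image_iff image_image) (metis)+
  have GTm[measurable]: "G ` T \<in> sets borel" unfolding GT using measurable_sets[OF borel_measurable_linear[OF b(2)] gS] by simp
  have derG: "(G has_derivative (b \<circ> g' (a x) \<circ> a)) (at x)" if "x \<in> T" for x
  proof -
    have "a x \<in> S" using that T_eq by auto
    have da: "(a has_derivative a) (at x)" 
      using a(1) by (intro bounded_linear_imp_has_derivative) (simp add: linear_conv_bounded_linear)
    have db: "(b has_derivative b) (at (g (a x)))"
      using b(1) by (intro bounded_linear_imp_has_derivative) (simp add: linear_conv_bounded_linear)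
    show ?thesis unfolding G_def comp_assoc
      by (rule diff_chain_at) (use diff_chain_at[OF da der[OF \<open>a x \<in> S\<close>]] db in \<open>auto simp: o_def\<close>)
  qed
  have injG: "inj_on G T"
  proof (rule inj_onI)
    fix x y assume "x \<in> T" "y \<in> T" "G x = G y"
    then have "g (a x) = g (a y)" "a x \<in> S" "a y \<in> S" using b(5) T_eq by (auto simp: G_def) metis
    then show "x = y" using inj a(5) by (metis inj_onD)
  qed
  have detG: "\<bar>det (matrix (b \<circ> g' (a x) \<circ> a))\<bar> = J (a x)" if "x \<in> T" for x
  proof -
    have "a x \<in> S" using that T_eq by auto
    note l = has_derivative_linear[OF der[OF this]]
    have "scales_volume ((b \<circ> g' (a x)) \<circ> a) (1 * J (a x) * 1)"
      using \<open>a x \<in> S\<close> scale sa sb2 l b(1) less_imp_le[OF scale(2)[OF \<open>a x \<in> S\<close>]]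
      by (intro scales_volume_compose borel_measurable_linear linear_compose) auto
    moreover have "linear ((b \<circ> g' (a x)) \<circ> a)" using l a b by (intro linear_compose) auto
    ultimately show ?thesis using scales_volume_det[of "(b \<circ> g' (a x)) \<circ> a" "J (a x)"] scale(2)[OF \<open>a x \<in> S\<close>] by simp
  qed
  have fb: "(\<lambda>y. f (b' y)) absolutely_integrable_on (G ` T)"
  proof -
    have "integrable lborel (\<lambda>y. f (b' y))"
      using f(1) lborel_distr_isometry[OF b(2) b(4)] dim by (subst integrable_distr_eq[of b' lborel borel f, symmetric]) auto
    then have "integrable lborel (\<lambda>y. indicator (G ` T) y *\<^sub>R f (b' y))"
      by (intro integrable_mult_indicator) auto
    then show ?thesis unfolding set_integrable_def by (subst integrable_completion) auto
  qed
  note cv = absolute_change_of_variables_real[OF _ has_derivative_at_withinI[OF derG] injG fb, simplified]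
  have "(\<integral>\<^sup>+y. ennreal (indicator (g ` S) y * f y) \<partial>lborel) = (\<integral>\<^sup>+y. ennreal (indicator (g ` S) (b' y) * f (b' y)) \<partial>lborel)"
    using scales_volumeD[OF sb, of "\<lambda>y. ennreal (indicator (g ` S) y * f y)"] by simp
  also have "\<dots> = (\<integral>\<^sup>+y. ennreal (indicator (G ` T) y * f (b' y)) \<partial>lebesgue)"
    by (subst nn_integral_completion) (simp add: GT indicator_def vimage_def)
  also have "\<dots> = ennreal (integral (G ` T) (\<lambda>y. f (b' y)))"
    using fb f(2) by (intro nn_integral_set_absolutely_integrable) auto
  also have "\<dots> = ennreal (integral T (\<lambda>x. \<bar>det (matrix (b \<circ> g' (a x) \<circ> a))\<bar> * f (b' (G x))))"
    using cv(2) by simp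
  also have "\<dots> = (\<integral>\<^sup>+x. ennreal (indicator T x * (\<bar>det (matrix (b \<circ> g' (a x) \<circ> a))\<bar> * f (b' (G x)))) \<partial>lebesgue)"
    using cv(1) f(2) by (intro nn_integral_set_absolutely_integrable[symmetric]) auto
  also have "\<dots> = (\<integral>\<^sup>+x. ennreal (indicator S (a x) * (J (a x) * f (g (a x)))) \<partial>lebesgue)"
    using detG b(5) by (intro nn_integral_cong) (auto simp: G_def T_eq indicator_def)
  also have "\<dots> = (\<integral>\<^sup>+x. ennreal (indicator S x * (J x * f (g x))) \<partial>lborel)"
    by (subst nn_integral_completion, subst scales_volumeD[OF sa]) auto
  finally show ?thesis .
qed

section \<open>Graphs over hyperplanes\<close>

lemma scales_volume_scaleR:
  assumes "c > 0"
  shows "scales_volume (\<lambda>x::'a::euclidean_space. c *\<^sub>R x) (c ^ DIM('a))"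
  unfolding scales_volume_def
proof safe
  fix \<phi> :: "'a \<Rightarrow> ennreal" assume [measurable]: "\<phi> \<in> borel_measurable borel"
  have "(\<integral>\<^sup>+y. \<phi> y \<partial>lborel) = (\<integral>\<^sup>+y. \<phi> y \<partial>density (distr lborel borel (\<lambda>x. 0 + c *\<^sub>R x)) (\<lambda>_. ennreal (\<bar>c\<bar> ^ DIM('a))))"
    using lborel_affine[of c "0::'a"] assms by simp
  also have "\<dots> = ennreal (c ^ DIM('a)) * (\<integral>\<^sup>+y. \<phi> (c *\<^sub>R y) \<partial>lborel)"
    using assms by (simp add: nn_integral_density nn_integral_distr nn_integral_cmult)
  finally show "(\<integral>\<^sup>+y. \<phi> y \<partial>lborel) = ennreal (c ^ DIM('a)) * (\<integral>\<^sup>+y. \<phi> (c *\<^sub>R y) \<partial>lborel)" .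
qed

lemma nn_integral_lborel_pair:
  fixes \<phi> :: "'a::euclidean_space \<times> 'b::euclidean_space \<Rightarrow> ennreal"
  assumes [measurable]: "\<phi> \<in> borel_measurable borel"
  shows "(\<integral>\<^sup>+p. \<phi> p \<partial>lborel) = (\<integral>\<^sup>+x. (\<integral>\<^sup>+y. \<phi> (x, y) \<partial>lborel) \<partial>lborel)"
    and "(\<integral>\<^sup>+p. \<phi> p \<partial>lborel) = (\<integral>\<^sup>+y. (\<integral>\<^sup>+x. \<phi> (x, y) \<partial>lborel) \<partial>lborel)"
proof -
  have [measurable]: "\<phi> \<in> borel_measurable (lborel \<Otimes>\<^sub>M lborel)"
    using assms by (simp add: lborel_prod)
  show "(\<integral>\<^sup>+p. \<phi> p \<partial>lborel) = (\<integral>\<^sup>+x. (\<integral>\<^sup>+y. \<phi> (x, y) \<partial>lborel) \<partial>lborel)"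
    by (simp add: lborel_prod[symmetric] lborel_pair.nn_integral_fst lborel.nn_integral_fst)
  show "(\<integral>\<^sup>+p. \<phi> p \<partial>lborel) = (\<integral>\<^sup>+y. (\<integral>\<^sup>+x. \<phi> (x, y) \<partial>lborel) \<partial>lborel)"
    by (simp add: lborel_prod[symmetric] lborel_pair.nn_integral_snd)
qed

lemma scales_volume_map_prod:
  fixes f :: "'a::euclidean_space \<Rightarrow> 'c::euclidean_space" and g :: "'b::euclidean_space \<Rightarrow> 'd::euclidean_space"
  assumes f: "scales_volume f c" and g: "scales_volume g e" and "c \<ge> 0"
    and [measurable]: "f \<in> borel_measurable borel" "g \<in> borel_measurable borel"
  shows "scales_volume (map_prod f g) (c * e)"
  unfolding scales_volume_def
proof safe
  fix \<phi> :: "'c \<times> 'd \<Rightarrow> ennreal" assume [measurable]: "\<phi> \<in> borel_measurable borel"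
  have [measurable]: "\<phi> \<in> borel_measurable (borel \<Otimes>\<^sub>M borel)" by (simp add: borel_prod)
  have [measurable]: "(\<lambda>p. \<phi> (f (fst p), g (snd p))) \<in> borel_measurable borel"
    by (simp add: borel_prod[symmetric])
  have "(\<integral>\<^sup>+p. \<phi> p \<partial>lborel) = (\<integral>\<^sup>+x. (\<integral>\<^sup>+y. \<phi> (x, y) \<partial>lborel) \<partial>lborel)"
    by (rule nn_integral_lborel_pair) simp
  also have "\<dots> = (\<integral>\<^sup>+x. ennreal e * (\<integral>\<^sup>+y. \<phi> (x, g y) \<partial>lborel) \<partial>lborel)"
    by (intro nn_integral_cong scales_volumeD[OF g]) simp
  also have "\<dots> = ennreal c * (\<integral>\<^sup>+x. ennreal e * (\<integral>\<^sup>+y. \<phi> (f x, g y) \<partial>lborel) \<partial>lborel)"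
    by (rule scales_volumeD[OF f]) measurable
  also have "\<dots> = ennreal (c * e) * (\<integral>\<^sup>+x. (\<integral>\<^sup>+y. \<phi> (f x, g y) \<partial>lborel) \<partial>lborel)"
    using \<open>c \<ge> 0\<close> by (simp add: nn_integral_cmult ennreal_mult' mult.assoc)
  also have "(\<integral>\<^sup>+x. (\<integral>\<^sup>+y. \<phi> (f x, g y) \<partial>lborel) \<partial>lborel) = (\<integral>\<^sup>+p. \<phi> (f (fst p), g (snd p)) \<partial>lborel)"
    by (subst nn_integral_lborel_pair) auto
  finally show "(\<integral>\<^sup>+p. \<phi> p \<partial>lborel) = ennreal (c * e) * (\<integral>\<^sup>+p. \<phi> (map_prod f g p) \<partial>lborel)"
    by (simp add: map_prod_def split_beta)
qed

lemma scales_volume_shear_fst: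
  fixes b :: "'a::euclidean_space"
  shows "scales_volume (\<lambda>(x, t::real). (x + t *\<^sub>R b, t)) 1"
  unfolding scales_volume_def
proof safe
  fix \<phi> :: "'a \<times> real \<Rightarrow> ennreal" assume [measurable]: "\<phi> \<in> borel_measurable borel"
  have [measurable]: "\<phi> \<in> borel_measurable (borel \<Otimes>\<^sub>M borel)" by (simp add: borel_prod)
  have [measurable]: "(\<lambda>p. \<phi> (fst p + snd p *\<^sub>R b, snd p)) \<in> borel_measurable borel"
    by (simp add: borel_prod[symmetric])
  have "(\<integral>\<^sup>+p. \<phi> p \<partial>lborel) = (\<integral>\<^sup>+t. (\<integral>\<^sup>+x. \<phi> (x, t) \<partial>lborel) \<partial>lborel)"
    by (rule nn_integral_lborel_pair) simp
  also have "\<dots> = (\<integral>\<^sup>+t. (\<integral>\<^sup>+x. \<phi> (x + t *\<^sub>R b, t) \<partial>lborel) \<partial>lborel)"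
  proof (rule nn_integral_cong)
    fix t
    have "(\<integral>\<^sup>+x. \<phi> (x, t) \<partial>lborel) = (\<integral>\<^sup>+x. \<phi> (x, t) \<partial>distr lborel borel ((+) (t *\<^sub>R b)))"
      by (simp add: lborel_distr_plus)
    also have "\<dots> = (\<integral>\<^sup>+x. \<phi> (x + t *\<^sub>R b, t) \<partial>lborel)"
      by (subst nn_integral_distr) (auto simp: add.commute)
    finally show "(\<integral>\<^sup>+x. \<phi> (x, t) \<partial>lborel) = (\<integral>\<^sup>+x. \<phi> (x + t *\<^sub>R b, t) \<partial>lborel)" .
  qed
  also have "\<dots> = (\<integral>\<^sup>+p. \<phi> (fst p + snd p *\<^sub>R b, snd p) \<partial>lborel)"
    by (subst nn_integral_lborel_pair(2)) auto
  finally show "(\<integral>\<^sup>+p. \<phi> p \<partial>lborel) = ennreal 1 * (\<integral>\<^sup>+p. \<phi> (case p of (x, t) \<Rightarrow> (x + t *\<^sub>R b, t)) \<partial>lborel)"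
    by (simp add: split_beta)
qed

lemma scales_volume_shear_snd:
  fixes a :: "'a::euclidean_space"
  assumes "k \<noteq> 0"
  shows "scales_volume (\<lambda>(x, t::real). (x, a \<bullet> x + k * t)) \<bar>k\<bar>"
  unfolding scales_volume_def
proof safe
  fix \<phi> :: "'a \<times> real \<Rightarrow> ennreal" assume [measurable]: "\<phi> \<in> borel_measurable borel"
  have [measurable]: "\<phi> \<in> borel_measurable (borel \<Otimes>\<^sub>M borel)" by (simp add: borel_prod)
  have [measurable]: "(\<lambda>p. \<phi> (fst p, a \<bullet> fst p + k * snd p)) \<in> borel_measurable borel"
    by (simp add: borel_prod[symmetric])
  have "(\<integral>\<^sup>+p. \<phi> p \<partial>lborel) = (\<integral>\<^sup>+x. (\<integral>\<^sup>+t. \<phi> (x, t) \<partial>lborel) \<partial>lborel)"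
    by (rule nn_integral_lborel_pair) simp
  also have "\<dots> = (\<integral>\<^sup>+x. \<bar>k\<bar> * (\<integral>\<^sup>+t. \<phi> (x, a \<bullet> x + k * t) \<partial>lborel) \<partial>lborel)"
    by (intro nn_integral_cong nn_integral_real_affine assms) simp
  also have "\<dots> = ennreal \<bar>k\<bar> * (\<integral>\<^sup>+p. \<phi> (fst p, a \<bullet> fst p + k * snd p) \<partial>lborel)"
    by (subst nn_integral_cmult, measurable) (subst nn_integral_lborel_pair(1), auto)
  finally show "(\<integral>\<^sup>+p. \<phi> p \<partial>lborel) = ennreal \<bar>k\<bar> * (\<integral>\<^sup>+p. \<phi> (case p of (x, t) \<Rightarrow> (x, a \<bullet> x + k * t)) \<partial>lborel)"
    by (simp add: split_beta)
qed

lemma linear_isometry_inner: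
  assumes "linear L" "\<And>x. norm (L x) = norm (x :: 'a::real_inner)"
  shows "L x \<bullet> L y = x \<bullet> y"
  using assms by (simp add: dot_norm linear_add[symmetric])

text \<open>Euclidean coordinates adapted to a unit normal: \<open>L\<close> parametrises the hyperplane orthogonal to \<open>\<nu>\<close>.\<close>

locale hyperplane_coordinates =
  fixes L :: "'a::euclidean_space \<Rightarrow> 'b::euclidean_space" and \<nu> :: 'b
  assumes lin: "linear L" and iso: "\<And>x. norm (L x) = norm x" and unit: "norm \<nu> = 1"
    and orth: "\<And>x. L x \<bullet> \<nu> = 0" and dim: "DIM('b) = Suc (DIM('a))"
begin

lemma inner_L: "L x \<bullet> L y = x \<bullet> y"
  by (rule linear_isometry_inner) (use lin iso in auto)

lemma unit_inner: "\<nu> \<bullet> \<nu> = 1"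
  using unit by (simp add: norm_eq_1)

definition coords :: "'a \<times> real \<Rightarrow> 'b" where "coords p = L (fst p) + snd p *\<^sub>R \<nu>"

lemma linear_coords: "linear coords"
  using lin by (auto intro!: linearI simp: coords_def linear_add linear_scale algebra_simps)

lemma norm_coords: "norm (coords p) = norm p"
proof -
  have "coords p \<bullet> coords p = p \<bullet> p"
    using orth[of "fst p"] by (simp add: coords_def inner_add_left inner_add_right inner_L unit_inner inner_prod_def inner_commute)
  then show ?thesis by (simp add: norm_eq)
qed

lemma dim_coords: "DIM('a \<times> real) = DIM('b)" using dim by simp

lemma inj_coords: "inj coords"
  using linear_injective_0[OF linear_coords] norm_coords by (metis norm_eq_zero)

lemma surj_coords: "surj coords"
proof -
  have "dim (range coords) = DIM('b)"
    using dim_image_eq[OF linear_coords, of UNIV] inj_coords dim_coords by simp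
  then have "span (range coords) = UNIV" by (simp only: dim_eq_full)
  then show ?thesis using linear_span_image[OF linear_coords, of UNIV] by simp
qed

lemma decompose: obtains x where "Z = L x + (Z \<bullet> \<nu>) *\<^sub>R \<nu>"
proof -
  obtain p where p: "Z = coords p" using surj_coords by (metis surjD)
  then have "Z \<bullet> \<nu> = snd p" using orth by (simp add: coords_def inner_add_left unit_inner)
  then show ?thesis using that p by (simp add: coords_def)
qed

text \<open>\<open>D\<close> is normal to the graph whose tangent map is \<open>v \<mapsto> L v + (a \<bullet> v) \<nu>\<close>.\<close>

context
  fixes D :: 'b and a :: 'a
  assumes tangent: "\<And>v. D \<bullet> L v + (a \<bullet> v) * (D \<bullet> \<nu>) = 0" and nz: "D \<bullet> \<nu> \<noteq> 0"
begin

text \<open>The upward normal of a graph is \<open>(- a, 1)\<close>, so the area density is the length of any normal vector divided by its vertical component.\<close>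

lemma graph_area_element: "sqrt (1 + (norm a)\<^sup>2) = norm D / \<bar>D \<bullet> \<nu>\<bar>"
proof -
  obtain d where d: "D = L d + (D \<bullet> \<nu>) *\<^sub>R \<nu>" by (rule decompose)
  have "d \<bullet> v = - (D \<bullet> \<nu>) * (a \<bullet> v)" for v
  proof -
    have "D \<bullet> L v = d \<bullet> v" using orth[of v] by (subst d) (simp add: inner_add_left inner_L inner_commute[of \<nu>])
    then show ?thesis using tangent[of v] by (simp add: algebra_simps)
  qed
  then have "(d + (D \<bullet> \<nu>) *\<^sub>R a) \<bullet> v = 0" for v by (simp add: inner_add_left)
  then have "d + (D \<bullet> \<nu>) *\<^sub>R a = 0" using inner_eq_zero_iff by blast
  then have "d = - ((D \<bullet> \<nu>) *\<^sub>R a)" by (simp add: eq_neg_iff_add_eq_0)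
  moreover have "D \<bullet> D = d \<bullet> d + (D \<bullet> \<nu>)\<^sup>2"
    using orth[of d] by (subst (1 2) d) (simp add: inner_add_left inner_add_right inner_L unit_inner inner_commute power2_eq_square)
  ultimately have "(norm D)\<^sup>2 = (D \<bullet> \<nu>)\<^sup>2 * (1 + (norm a)\<^sup>2)"
    by (simp add: power2_norm_eq_inner) (simp add: algebra_simps power2_eq_square)
  then have "norm D = \<bar>D \<bullet> \<nu>\<bar> * sqrt (1 + (norm a)\<^sup>2)"
    by (metis norm_ge_zero real_sqrt_abs real_sqrt_mult real_sqrt_power abs_of_nonneg real_sqrt_pow2_iff)
  then show ?thesis using nz by simp
qed

text \<open>The volume of the box spanned by the tangent plane of a graph and a transversal vector \<open>Z\<close>. The map is an isometry composed with two shears.\<close>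

lemma scales_volume_graph:
  assumes "D \<bullet> Z \<noteq> 0"
  shows "scales_volume (\<lambda>(v, t). L v + (a \<bullet> v) *\<^sub>R \<nu> + t *\<^sub>R Z) \<bar>(D \<bullet> Z) / (D \<bullet> \<nu>)\<bar>"
proof -
  obtain z where z: "Z = L z + (Z \<bullet> \<nu>) *\<^sub>R \<nu>" by (rule decompose)
  let ?k = "Z \<bullet> \<nu> - a \<bullet> z"
  have "D \<bullet> Z = D \<bullet> L z + (Z \<bullet> \<nu>) * (D \<bullet> \<nu>)"
    by (subst z) (simp add: inner_add_right)
  then have k: "?k = (D \<bullet> Z) / (D \<bullet> \<nu>)" using tangent[of z] nz by (simp add: field_simps)
  then have "?k \<noteq> 0" using assms nz by simp
  have "scales_volume (coords \<circ> ((\<lambda>(x, t::real). (x, a \<bullet> x + ?k * t)) \<circ> (\<lambda>(x, t::real). (x + t *\<^sub>R z, t)))) (1 * (\<bar>?k\<bar> * 1))"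
    using \<open>?k \<noteq> 0\<close> 
    by (intro scales_volume_compose scales_volume_isometry[OF linear_coords norm_coords dim_coords] scales_volume_shear_fst 
       scales_volume_shear_snd borel_measurable_linear[OF linear_coords])
      (auto intro!: borel_measurable_continuous_onI continuous_intros simp: split_beta)
  also have "coords \<circ> ((\<lambda>(x, t::real). (x, a \<bullet> x + ?k * t)) \<circ> (\<lambda>(x, t::real). (x + t *\<^sub>R z, t))) = 
     (\<lambda>(v, t). L v + (a \<bullet> v) *\<^sub>R \<nu> + t *\<^sub>R Z)" (is "?l = ?r")
  proof
    fix p :: "'a \<times> real"
    obtain v t where p: "p = (v, t)" by (cases p)
    show "?l p = ?r p" by (subst z) (simp add: p coords_def linear_add[OF lin] linear_scale[OF lin] algebra_simps)
  qed
  finally show ?thesis using k by simp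
qed

end
end

section \<open>Gaussian moments\<close>

text \<open>The area of a disc gives the distribution function of \<open>norm w ^ (2 * m)\<close>, and a measure on the line is determined by its values on half-lines.\<close>

lemma nn_integral_norm_power_complex:
  fixes \<phi> :: "real \<Rightarrow> ennreal"
  assumes m: "m \<ge> 1" and [measurable]: "\<phi> \<in> borel_measurable borel"
  shows "(\<integral>\<^sup>+w. \<phi> (norm w ^ (2 * m)) \<partial>(lborel :: complex measure)) =
    (\<integral>\<^sup>+s. ennreal (indicator {0<..} s * (pi / real m * s powr (1 / real m - 1))) * \<phi> s \<partial>lborel)"
proof -
  let ?M1 = "distr lborel borel (\<lambda>w::complex. norm w ^ (2 * m))"
  let ?d = "\<lambda>s. ennreal (indicator {0<..} s * (pi / real m * s powr (1 / real m - 1)))"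
  let ?M2 = "density lborel ?d"
  let ?E = "range (\<lambda>a::real. {..a})"
  have e1: "emeasure ?M1 {..a} = (if a \<ge> 0 then ennreal (pi * a powr (1 / real m)) else 0)" for a
  proof (cases "a \<ge> 0")
    case True
    have "(\<lambda>w::complex. norm w ^ (2 * m)) -` {..a} = cball 0 (root (2 * m) a)"
    proof (safe; simp)
      fix w :: complex
      show "norm w \<le> root (2 * m) a" if "norm w ^ (2 * m) \<le> a"
        using that m real_root_le_mono[of "2 * m" "norm w ^ (2 * m)" a] by (simp add: real_root_power_cancel)
      show "norm w ^ (2 * m) \<le> a" if "norm w \<le> root (2 * m) a"
        using power_mono[OF that, of "2 * m"] m True by simp
    qed
    then have "emeasure ?M1 {..a} = emeasure lborel (cball (0::complex) (root (2 * m) a))"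
      by (subst emeasure_distr) auto
    also have "\<dots> = ennreal (pi * root (2 * m) a ^ 2)"
      using True m by (subst emeasure_cball) (auto simp: unit_ball_vol_2 intro!: real_root_ge_zero)
    also have "root (2 * m) a ^ 2 = a powr (1 / real m)"
    proof (cases "a = 0")
      case False
      then show ?thesis using True m
        by (simp add: root_powr_inverse powr_power field_simps)
    qed (use m in simp)
    finally show ?thesis using True by simp
  next
    case False
    then have "\<not> norm w ^ (2 * m) \<le> a" for w :: complex
      using zero_le_power[OF norm_ge_zero, of w "2 * m"] by linarith
    then have "(\<lambda>w::complex. norm w ^ (2 * m)) -` {..a} = {}" by auto
    then show ?thesis using False by (subst emeasure_distr) auto
  qed
  have e2: "emeasure ?M2 {..a} = (if a \<ge> 0 then ennreal (pi * a powr (1 / real m)) else 0)" for a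
  proof (cases "a \<ge> 0")
    case True
    have "((\<lambda>x. x powr (1 / real m - 1)) has_integral (a powr ((1 / real m - 1) + 1) / ((1 / real m - 1) + 1))) {0..a}"
      using m True by (intro has_integral_powr_from_0) (auto simp: field_simps)
    from has_integral_mult_right[OF this, of "pi / real m"]
    have hi: "((\<lambda>x. pi / real m * x powr (1 / real m - 1)) has_integral (pi * a powr (1 / real m))) {0..a}"
      using m by simp
    have "emeasure ?M2 {..a} = (\<integral>\<^sup>+s. ?d s * indicator {..a} s \<partial>lborel)"
      by (subst emeasure_density) auto
    also have "\<dots> = (\<integral>\<^sup>+s. ennreal (indicator {0..a} s * (pi / real m * s powr (1 / real m - 1))) \<partial>lborel)"
      by (intro nn_integral_cong_AE, use AE_lborel_singleton[of 0] in eventually_elim)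
         (auto simp: indicator_def)
    also have "\<dots> = ennreal (pi * a powr (1 / real m))"
      using nn_integral_has_integral_lebesgue[OF _ hi] by simp
    finally show ?thesis using True by simp
  next
    case False
    have "emeasure ?M2 {..a} = (\<integral>\<^sup>+s. ?d s * indicator {..a} s \<partial>lborel)"
      by (subst emeasure_density) auto
    also have "\<dots> = (\<integral>\<^sup>+s. 0 \<partial>(lborel::real measure))" using False by (intro nn_integral_cong) (auto simp: indicator_def)
    finally show ?thesis using False by simp
  qed
  have "?M1 = ?M2"
  proof (rule measure_eqI_generator_eq[where E = ?E and \<Omega> = UNIV and A = "\<lambda>i. {..real i}"])
    show "Int_stable ?E" by (auto simp: Int_stable_def)
    show "sets ?M1 = sigma_sets UNIV ?E" 
      by (simp add: borel_eq_atMost)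
    show "sets ?M2 = sigma_sets UNIV ?E" 
      by (simp add: borel_eq_atMost)
    show "(\<Union>i. {..real i}) = UNIV" using real_arch_simple by auto
    show "emeasure ?M1 {..real i} \<noteq> \<infinity>" for i by (simp add: e1)
  qed (use e1 e2 in auto)
  then have "(\<integral>\<^sup>+s. \<phi> s \<partial>?M1) = (\<integral>\<^sup>+s. \<phi> s \<partial>?M2)" by simp
  then show ?thesis by (simp add: nn_integral_distr nn_integral_density)
qed

lemma lborel_vec_eq_product:
  "(lborel :: ('a::euclidean_space ^ 'k::finite) measure) = distr (\<Pi>\<^sub>M i\<in>UNIV. lborel) borel (\<lambda>f. \<chi> i. f i)"
proof (rule lborel_eqI)
  interpret product_sigma_finite "\<lambda>i::'k. lborel :: 'a measure" ..
  have meas[measurable]: "(\<lambda>f. \<chi> i. f i) \<in> borel_measurable (\<Pi>\<^sub>M i\<in>(UNIV::'k set). (lborel :: 'a measure))"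
    by (rule borel_measurable_euclidean_space[THEN iffD2]) (auto simp: Basis_vec_def inner_axis)
  fix l u :: "'a ^ 'k" assume le: "\<And>b. b \<in> Basis \<Longrightarrow> l \<bullet> b \<le> u \<bullet> b"
  have le': "l $ i \<bullet> b \<le> u $ i \<bullet> b" if "b \<in> Basis" for i b
    using le[of "axis i b"] that by (simp add: Basis_vec_def inner_axis) blast
  have vim: "(\<lambda>f. \<chi> i. f i) -` box l u \<inter> space (\<Pi>\<^sub>M i\<in>(UNIV::'k set). (lborel :: 'a measure)) = (\<Pi>\<^sub>E i\<in>UNIV. box (l $ i) (u $ i))"
    by (auto simp: Pi_iff mem_box Basis_vec_def inner_axis space_PiM PiE_def) 
  have "emeasure (distr (\<Pi>\<^sub>M i\<in>UNIV. lborel) borel (\<lambda>f. \<chi> i. f i)) (box l u) = (\<Prod>i\<in>UNIV. emeasure lborel (box (l $ i) (u $ i)))"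
    by (subst emeasure_distr) (auto simp: vim intro!: emeasure_PiM)
  also have "\<dots> = (\<Prod>i\<in>UNIV. ennreal (\<Prod>b\<in>Basis. (u $ i - l $ i) \<bullet> b))"
    using le' by (intro prod.cong refl) (simp add: emeasure_lborel_box)
  also have "\<dots> = ennreal (\<Prod>i\<in>UNIV. \<Prod>b\<in>Basis. (u $ i - l $ i) \<bullet> b)"
    using le' by (intro prod_ennreal prod_nonneg) (auto simp: inner_diff_left)
  also have "(\<Prod>i\<in>UNIV. \<Prod>b\<in>Basis. (u $ i - l $ i) \<bullet> b) = (\<Prod>(i,b)\<in>UNIV \<times> Basis. (u - l) \<bullet> axis i b)"
    by (simp add: prod.cartesian_product inner_axis)
  also have "\<dots> = (\<Prod>b\<in>Basis. (u - l) \<bullet> b)"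
  proof (rule prod.reindex_bij_betw[where h = "\<lambda>(i,b). axis i b", THEN trans[rotated]])
    show "bij_betw (\<lambda>(i,b). axis i b) (UNIV \<times> Basis) (Basis :: ('a ^ 'k) set)"
      by (auto simp: bij_betw_def inj_on_def axis_eq_axis Basis_vec_def)
  qed (auto intro!: prod.cong)
  finally show "emeasure (distr (\<Pi>\<^sub>M i\<in>UNIV. lborel) borel (\<lambda>f. \<chi> i. f i)) (box l u) = ennreal (\<Prod>b\<in>Basis. (u - l) \<bullet> b)" .
qed simp

lemma nn_integral_vec_prod:
  fixes f :: "'k::finite \<Rightarrow> 'a::euclidean_space \<Rightarrow> ennreal"
  assumes [measurable]: "\<And>i. f i \<in> borel_measurable borel"
  shows "(\<integral>\<^sup>+z. (\<Prod>i\<in>UNIV. f i (z $ i)) \<partial>(lborel :: ('a^'k) measure)) = (\<Prod>i\<in>UNIV. (\<integral>\<^sup>+x. f i x \<partial>lborel))"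
proof -
  interpret product_sigma_finite "\<lambda>i::'k. lborel :: 'a measure" ..
  have meas[measurable]: "(\<lambda>f. \<chi> i. f i) \<in> borel_measurable (\<Pi>\<^sub>M i\<in>(UNIV::'k set). (lborel :: 'a measure))"
    by (rule borel_measurable_euclidean_space[THEN iffD2]) (auto simp: Basis_vec_def inner_axis)
  have [measurable]: "(\<lambda>z::'a^'k. z $ i) \<in> borel_measurable borel" for i
    by (intro borel_measurable_continuous_onI continuous_intros)
  have [measurable]: "(\<lambda>z::'a^'k. (\<Prod>i\<in>UNIV. f i (z $ i))) \<in> borel_measurable borel"
    by measurable
  show ?thesis
    by (subst lborel_vec_eq_product, subst nn_integral_distr) (auto intro!: product_nn_integral_prod)
qed

definition cinner :: "complex ^ 'k \<Rightarrow> complex ^ 'k::finite \<Rightarrow> complex" where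
  "cinner x y = (\<Sum>i\<in>UNIV. x $ i * cnj (y $ i))"

lemma cinner_add_left: "cinner (x + y) z = cinner x z + cinner y z"
  and cinner_add_right: "cinner z (x + y) = cinner z x + cinner z y"
  and cinner_scale_left: "cinner (c *s x) y = c * cinner x y"
  and cinner_scale_right: "cinner x (c *s y) = cnj c * cinner x y"
  and cinner_commute: "cinner x y = cnj (cinner y x)"
  and cinner_axis_right: "cinner x (axis i c) = cnj c * x $ i"
  by (simp_all add: cinner_def algebra_simps sum.distrib sum_distrib_left axis_def if_distrib cong: if_cong)

lemma scaleR_vec_nth_complex: "(r *\<^sub>R (x :: complex ^ 'k)) $ i = of_real r * x $ i"
  by (subst vector_scaleR_component) (rule scaleR_conv_of_real)

lemma norm_axis_complex: "norm (axis i w :: complex ^ 'k::finite) = norm w"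
  by (simp add: norm_vec_def L2_set_def axis_def if_distrib[of norm] if_distrib[of "\<lambda>x. x\<^sup>2"] cong: if_cong)

lemma cinner_scaleR_left: "cinner (r *\<^sub>R x) y = of_real r * cinner x y"
  and cinner_scaleR_right: "cinner x (r *\<^sub>R y) = of_real r * cinner x y"
  unfolding cinner_def sum_distrib_left scaleR_vec_nth_complex by (rule sum.cong; simp)+

lemma cinner_self: "cinner x x = of_real ((norm x)\<^sup>2)"
  by (simp add: cinner_def norm_vec_def L2_set_def complex_norm_square[symmetric] sum_nonneg)

lemma norm_cinner_le: "norm (cinner x y) \<le> norm x * norm y"
proof -
  have "norm (cinner x y) \<le> (\<Sum>i\<in>UNIV. norm (x $ i) * norm (y $ i))"
    unfolding cinner_def by (rule sum_norm_le) (simp add: norm_mult)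
  also have "\<dots> \<le> norm x * norm y"
    unfolding norm_vec_def using L2_set_mult_ineq[of "\<lambda>i. norm (x $ i)" "\<lambda>i. norm (y $ i)" UNIV] by simp
  finally show ?thesis .
qed

lemma continuous_on_cinner [continuous_intros]:
  "continuous_on A f \<Longrightarrow> continuous_on A g \<Longrightarrow> continuous_on A (\<lambda>x. cinner (f x) (g x))"
  unfolding cinner_def by (intro continuous_intros)

text \<open>The complex reflection with axis \<open>e\<close>: it multiplies the component along the unit vector \<open>e\<close> by \<open>c\<close> and fixes the orthogonal complement.\<close>

definition pseudo_reflection :: "complex ^ 'k \<Rightarrow> complex \<Rightarrow> complex ^ 'k \<Rightarrow> complex ^ 'k::finite" where
  "pseudo_reflection e c z = z + ((c - 1) * cinner z e) *s e"

lemma cinner_pseudo_reflection: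
  assumes e: "norm e = 1" and c: "norm c = 1"
  shows "cinner (pseudo_reflection e c z) (pseudo_reflection e c y) = cinner z y"
proof -
  have "cinner e e = 1" using e by (simp add: cinner_self)
  then have "cinner (pseudo_reflection e c z) (pseudo_reflection e c y) =
      cinner z y + cinner z e * cnj (cinner y e) * (c * cnj c - 1)"
    by (simp only: pseudo_reflection_def cinner_add_left cinner_add_right cinner_scale_left cinner_scale_right 
       cinner_commute[of e y]) (simp add: algebra_simps)
  moreover have "c * cnj c = 1" using c by (simp add: complex_norm_square[symmetric])
  ultimately show ?thesis by simp
qed

lemma norm_pseudo_reflection:
  assumes "norm e = 1" "norm c = 1"
  shows "norm (pseudo_reflection e c z) = norm z"
proof -
  have "complex_of_real ((norm (pseudo_reflection e c z))\<^sup>2) = of_real ((norm z)\<^sup>2)"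
    using cinner_pseudo_reflection[OF assms, of z z] by (simp only: cinner_self)
  then have "(norm (pseudo_reflection e c z))\<^sup>2 = (norm z)\<^sup>2" by (simp only: of_real_eq_iff)
  then show ?thesis by simp
qed

lemma linear_pseudo_reflection: "linear (pseudo_reflection e c)"
  by (rule linearI) (simp_all only: pseudo_reflection_def cinner_add_left cinner_scaleR_left,
     simp_all add: vec_eq_iff scaleR_vec_nth_complex algebra_simps del: vector_scaleR_component)

lemma cinner_pseudo_reflection_axis:
  assumes "norm e = 1"
  shows "cinner (pseudo_reflection e c z) e = c * cinner z e"
  using assms by (simp add: pseudo_reflection_def cinner_add_left cinner_scale_left cinner_self) (simp add: algebra_simps)

text \<open>Unitary invariance lets one assume that a unit vector is a coordinate axis. One reflection, along the difference of \<open>e\<close> and a unimodular multiple \<open>a\<close> of the axis vector, suffices once the phase of \<open>a\<close> makes \<open>cinner e a\<close> real.\<close>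

lemma cinner_as_coordinate:
  assumes e: "norm e = 1"
  obtains U :: "complex ^ 'k \<Rightarrow> complex ^ 'k::finite" where "linear U" "\<And>z. norm (U z) = norm z"
    "\<And>z. norm (cinner z e) = norm (U z $ i)"
proof -
  define w where "w = (if e $ i = 0 then 1 else sgn (e $ i))"
  have w: "norm w = 1" by (simp add: w_def norm_sgn)
  have cw: "cnj w * e $ i = of_real (norm (e $ i))"
    by (auto simp: w_def sgn_eq field_simps) (metis complex_norm_square mult.commute of_real_mult power2_eq_square)
  define a where "a = (axis i w :: complex ^ 'k)"
  have na: "norm a = 1" by (simp add: a_def norm_axis_complex w)
  have ea: "cinner e a = of_real (norm (e $ i))" by (simp add: a_def cinner_axis_right cw)
  have za: "norm (cinner z a) = norm (z $ i)" for z by (simp add: a_def cinner_axis_right norm_mult w)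
  show ?thesis
  proof (cases "e = a")
    case True
    show ?thesis by (rule that[of "\<lambda>z. z"]) (use za True in \<open>auto intro: linearI\<close>)
  next
    case False
    define v where "v = e + (-1) *s a"
    have "v \<noteq> 0" using False by (simp add: v_def)
    have cev: "cinner e v = of_real (1 - norm (e $ i))"
      using e by (simp only: v_def cinner_add_right cinner_scale_right ea) (simp add: cinner_self)
    have "cinner v v = of_real (2 * (1 - norm (e $ i)))"
      using e na ea by (simp only: v_def cinner_add_left cinner_add_right cinner_scale_left cinner_scale_right cinner_commute[of a e])
        (simp add: cinner_self)
    then have nv: "(norm v)\<^sup>2 = 2 * (1 - norm (e $ i))" by (simp only: cinner_self of_real_eq_iff)
    define u where "u = (1 / norm v) *\<^sub>R v"
    have nu: "norm u = 1" using \<open>v \<noteq> 0\<close> by (simp add: u_def)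
    have Ue: "pseudo_reflection u (-1) e = a"
    proof -
      have "((-1 - 1) * cinner e u) *s u = (- 2 * cinner e v / of_real ((norm v)\<^sup>2)) *s v"
        by (simp add: u_def cinner_scaleR_right vec_eq_iff scaleR_vec_nth_complex power2_eq_square del: vector_scaleR_component)
      also have "- 2 * cinner e v / of_real ((norm v)\<^sup>2) = - 1"
      proof -
        have "1 - norm (e $ i) \<noteq> 0" using \<open>v \<noteq> 0\<close> nv by auto
        then have "complex_of_real (1 - norm (e $ i)) \<noteq> 0" by (simp only: of_real_eq_0_iff not_False_eq_True)
        then show ?thesis unfolding nv cev of_real_mult by (simp add: divide_simps del: of_real_diff)
      qed
      finally show ?thesis by (simp add: pseudo_reflection_def v_def)
    qed
    have "norm (cinner z e) = norm (pseudo_reflection u (-1) z $ i)" for z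
      using cinner_pseudo_reflection[OF nu, of "-1" z e] by (simp add: Ue za[symmetric])
    then show ?thesis 
      by (rule that[OF linear_pseudo_reflection norm_pseudo_reflection[OF nu], rotated]) simp
  qed
qed

lemma nn_integral_gamma:
  assumes "a > 0" "K \<ge> 0"
  shows "(\<integral>\<^sup>+s. ennreal (indicator {0<..} s * (K * s powr (a - 1) * exp (- s))) \<partial>lborel) = ennreal (K * Gamma a)"
proof -
  have "(\<integral>\<^sup>+s. ennreal (indicator {0<..} s * (K * s powr (a - 1) * exp (- s))) \<partial>lborel) =
    (\<integral>\<^sup>+s. ennreal K * ennreal (indicator {0..} s * s powr (a - 1) / exp s) \<partial>lborel)"
    using assms(2) by (intro nn_integral_cong_AE, use AE_lborel_singleton[of 0] in eventually_elim)
       (auto simp: indicator_def exp_minus field_simps ennreal_mult'[symmetric])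
  also have "\<dots> = ennreal (K * Gamma a)"
    using Gamma_conv_nn_integral_real[OF assms(1)] assms(2) by (simp add: nn_integral_cmult ennreal_mult')
  finally show ?thesis .
qed

lemma nn_integral_complex_gamma:
  assumes m: "m \<ge> 1" and "e \<ge> 0"
  shows "(\<integral>\<^sup>+w. ennreal ((norm w ^ (2 * m)) powr e * exp (- (norm w ^ (2 * m)))) \<partial>(lborel :: complex measure)) =
    ennreal (pi / real m * Gamma (e + 1 / real m))"
proof -
  have "(\<integral>\<^sup>+w. ennreal ((norm w ^ (2 * m)) powr e * exp (- (norm w ^ (2 * m)))) \<partial>(lborel :: complex measure)) =
     (\<integral>\<^sup>+s. ennreal (indicator {0<..} s * (pi / real m * s powr (1 / real m - 1))) * ennreal (s powr e * exp (- s)) \<partial>lborel)"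
    by (rule nn_integral_norm_power_complex[OF m]) measurable
  also have "\<dots> = (\<integral>\<^sup>+s. ennreal (indicator {0<..} s * (pi / real m * s powr ((e + 1 / real m) - 1) * exp (- s))) \<partial>lborel)"
    by (intro nn_integral_cong) (auto simp: indicator_def ennreal_mult''[symmetric] powr_add[symmetric] algebra_simps)
  also have "\<dots> = ennreal (pi / real m * Gamma (e + 1 / real m))"
    using assms by (intro nn_integral_gamma) (auto intro: add_nonneg_pos)
  finally show ?thesis .
qed

lemma nn_integral_coordinate_moment:
  "(\<integral>\<^sup>+z. ennreal (norm (z $ i) ^ (2 * j) * exp (- (norm z)\<^sup>2)) \<partial>(lborel :: (complex ^ 'k::finite) measure)) = ennreal (pi ^ CARD('k) * fact j)"
proof -
  define f :: "'k \<Rightarrow> complex \<Rightarrow> ennreal" where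
    "f l x = ennreal ((if l = i then norm x ^ (2 * j) else 1) * exp (- (norm x)\<^sup>2))" for l x
  have [measurable]: "f l \<in> borel_measurable borel" for l unfolding f_def by (cases "l = i") (simp_all, measurable)
  have g: "(\<integral>\<^sup>+x. ennreal (norm x ^ (2 * j) * exp (- (norm x)\<^sup>2)) \<partial>(lborel :: complex measure)) = ennreal (pi * fact j)" for j
  proof -
    have "norm x ^ (2 * j) * exp (- (norm x)\<^sup>2) = (norm x ^ (2 * 1)) powr real j * exp (- (norm x ^ (2 * 1)))" if "x \<noteq> 0" for x :: complex
      using that by (simp add: powr_realpow power_mult)
    then have "(\<integral>\<^sup>+x. ennreal (norm x ^ (2 * j) * exp (- (norm x)\<^sup>2)) \<partial>(lborel :: complex measure)) = 
       (\<integral>\<^sup>+w. ennreal ((norm w ^ (2 * 1)) powr real j * exp (- (norm w ^ (2 * 1)))) \<partial>(lborel :: complex measure))"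
      by (intro nn_integral_cong_AE, use AE_lborel_singleton[of 0] in eventually_elim) auto
    also have "\<dots> = ennreal (pi * fact j)"
      by (subst nn_integral_complex_gamma) (auto simp: Gamma_fact add.commute)
    finally show ?thesis .
  qed
  have f: "(\<integral>\<^sup>+x. f l x \<partial>lborel) = ennreal (if l = i then pi * fact j else pi)" for l
    using g[of j] g[of 0] by (simp add: f_def)
  have "(\<Prod>l\<in>UNIV. f l (z $ l)) = ennreal (norm (z $ i) ^ (2 * j) * exp (- (norm z)\<^sup>2))" for z :: "complex ^ 'k"
  proof -
    have "(\<Prod>l\<in>UNIV. f l (z $ l)) = ennreal (\<Prod>l\<in>UNIV. (if l = i then norm (z $ l) ^ (2 * j) else 1) * exp (- (norm (z $ l))\<^sup>2))"
      unfolding f_def by (rule prod_ennreal) simp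
    also have "(\<Prod>l\<in>UNIV. (if l = i then norm (z $ l) ^ (2 * j) else 1) * exp (- (norm (z $ l))\<^sup>2)) = 
        norm (z $ i) ^ (2 * j) * exp (- (norm z)\<^sup>2)"
      by (simp add: prod.distrib prod.delta exp_sum[symmetric] norm_vec_def L2_set_def sum_nonneg sum_negf)
    finally show ?thesis .
  qed
  then have "(\<integral>\<^sup>+z. ennreal (norm (z $ i) ^ (2 * j) * exp (- (norm z)\<^sup>2)) \<partial>(lborel :: (complex ^ 'k) measure)) = (\<Prod>l\<in>UNIV. (\<integral>\<^sup>+x. f l x \<partial>lborel))"
    by (subst nn_integral_vec_prod[symmetric]) auto
  also have "\<dots> = ennreal (\<Prod>l\<in>UNIV. if l = i then pi * fact j else pi)"
    unfolding f by (rule prod_ennreal) simp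
  also have "(\<Prod>l\<in>(UNIV::'k set). if l = i then pi * fact j else pi) = (\<Prod>l\<in>(UNIV::'k set). pi * (if l = i then fact j else 1))"
    by (intro prod.cong) auto
  also have "\<dots> = pi ^ CARD('k) * fact j" by (simp add: prod.distrib prod.delta)
  finally show ?thesis .
qed

text \<open>After rotating the direction to an axis the Gaussian factorises over the coordinates.\<close>

lemma nn_integral_cinner_moment:
  fixes e :: "complex ^ 'k::finite"
  assumes "norm e = 1"
  shows "(\<integral>\<^sup>+z. ennreal (norm (cinner z e) ^ (2 * j) * exp (- (norm z)\<^sup>2)) \<partial>lborel) = ennreal (pi ^ CARD('k) * fact j)"
proof -
  obtain i :: 'k where True by blast
  obtain U :: "complex ^ 'k \<Rightarrow> complex ^ 'k" where U: "linear U" "\<And>z. norm (U z) = norm z"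
    "\<And>z. norm (cinner z e) = norm (U z $ i)" using cinner_as_coordinate[OF assms] by metis
  have [measurable]: "(\<lambda>z::complex^'k. z $ i) \<in> borel_measurable borel"
    by (intro borel_measurable_continuous_onI continuous_intros)
  have "(\<integral>\<^sup>+z. ennreal (norm (z $ i) ^ (2 * j) * exp (- (norm z)\<^sup>2)) \<partial>(lborel :: (complex ^ 'k) measure)) =
    ennreal 1 * (\<integral>\<^sup>+z. ennreal (norm (U z $ i) ^ (2 * j) * exp (- (norm (U z))\<^sup>2)) \<partial>lborel)"
    by (rule scales_volumeD[OF scales_volume_isometry[OF U(1,2)]]) (simp, measurable)
  then show ?thesis by (simp add: U(2) U(3)[symmetric] nn_integral_coordinate_moment)
qed

section \<open>Geometry of the egg domain\<close>

text \<open>The defining function plus one. It is homogeneous of degree one for the anisotropic dilations \<open>dilate\<close>, which is what makes radial integration work.\<close>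

definition egg_norm :: "nat \<Rightarrow> 'k::finite pt \<Rightarrow> real" where
  "egg_norm m p = (norm (fst p))\<^sup>2 + norm (snd p) ^ (2 * m)"

definition dilate :: "nat \<Rightarrow> real \<Rightarrow> 'k::finite pt \<Rightarrow> 'k pt" where
  "dilate m s p = (s powr (1 / 2) *\<^sub>R fst p, s powr (1 / (2 * real m)) *\<^sub>R snd p)"

definition radial_proj :: "nat \<Rightarrow> 'k::finite pt \<Rightarrow> 'k pt" where
  "radial_proj m p = dilate m (1 / egg_norm m p) p"

definition egg_sphere :: "nat \<Rightarrow> 'k::finite pt set" where
  "egg_sphere m = {p. egg_norm m p = 1}"

definition egg_grad :: "nat \<Rightarrow> 'k::finite pt \<Rightarrow> 'k pt" where
  "egg_grad m p = (2 *\<^sub>R fst p, (2 * real m * norm (snd p) ^ (2 * m - 2)) *\<^sub>R snd p)"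

lemma egg_norm_nonneg: "egg_norm m p \<ge> 0" by (simp add: egg_norm_def)

lemma egg_norm_eq_0: "m \<ge> 1 \<Longrightarrow> egg_norm m p = 0 \<longleftrightarrow> p = 0"
  by (auto simp: egg_norm_def add_nonneg_eq_0_iff prod_eq_iff)

lemma egg_norm_pos: "m \<ge> 1 \<Longrightarrow> p \<noteq> 0 \<Longrightarrow> egg_norm m p > 0"
  using egg_norm_nonneg[of m p] egg_norm_eq_0[of m p] by linarith

lemma continuous_on_egg_norm [continuous_intros]: "continuous_on A f \<Longrightarrow> continuous_on A (\<lambda>x. egg_norm m (f x))"
  unfolding egg_norm_def by (intro continuous_intros)

lemma borel_measurable_egg_norm [measurable]: "egg_norm m \<in> borel_measurable borel"
  by (intro borel_measurable_continuous_onI continuous_intros)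

lemma egg_eq: "egg m = {p. egg_norm m p < 1}" by (simp add: egg_def egg_norm_def)

lemma open_egg: "open (egg m)"
  unfolding egg_eq by (intro open_Collect_less continuous_intros)

lemma egg_norm_scaleR_le:
  assumes "m \<ge> 1" "0 \<le> t" "t \<le> 1"
  shows "egg_norm m (t *\<^sub>R p) \<le> t\<^sup>2 * egg_norm m p"
proof -
  have "t ^ (2 * m) \<le> t\<^sup>2" using assms by (intro power_decreasing) auto
  then show ?thesis using assms
    by (simp add: egg_norm_def power_mult_distrib distrib_left mult_right_mono)
qed

lemma closure_egg:
  assumes "m \<ge> 1" shows "closure (egg m) = {p :: 'k::finite pt. egg_norm m p \<le> 1}"
proof (rule antisym)
  show "closure (egg m) \<subseteq> {p :: 'k pt. egg_norm m p \<le> 1}"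
    by (rule closure_minimal) (auto simp: egg_eq intro!: closed_Collect_le continuous_intros)
  show "{p :: 'k pt. egg_norm m p \<le> 1} \<subseteq> closure (egg m)"
  proof
    fix p :: "'k pt" assume "p \<in> {p. egg_norm m p \<le> 1}"
    then have p: "egg_norm m p \<le> 1" by simp
    have "(\<lambda>n. (1 - 1 / real (Suc n)) *\<^sub>R p) \<longlonglongrightarrow> (1 - 0) *\<^sub>R p"
      by (intro tendsto_intros LIMSEQ_Suc lim_1_over_n)
    moreover have "(1 - 1 / real (Suc n)) *\<^sub>R p \<in> egg m" for n
    proof -
      let ?t = "1 - 1 / real (Suc n)"
      have t: "0 \<le> ?t" "?t < 1" by auto
      have "egg_norm m (?t *\<^sub>R p) \<le> ?t\<^sup>2 * egg_norm m p" using t assms by (intro egg_norm_scaleR_le) auto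
      also have "\<dots> \<le> ?t\<^sup>2 * 1" using p by (intro mult_left_mono) auto
      also have "\<dots> < 1" using t by (simp add: power_less_one_iff abs_square_less_1 del: of_nat_Suc)
      finally show ?thesis by (simp add: egg_eq)
    qed
    ultimately show "p \<in> closure (egg m)" unfolding closure_sequential 
      by (intro exI[of _ "\<lambda>n. (1 - 1 / real (Suc n)) *\<^sub>R p"]) (simp del: of_nat_Suc)
  qed
qed

lemma frontier_egg: "m \<ge> 1 \<Longrightarrow> frontier (egg m) = egg_sphere m"
  unfolding frontier_def closure_egg interior_open[OF open_egg] by (auto simp: egg_eq egg_sphere_def)

lemma egg_sphere_bounds:
  assumes "m \<ge> 1" "egg_norm m p \<le> 1"
  shows "norm (fst p) \<le> 1" "norm (snd p) \<le> 1"
proof -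
  have "(norm (fst p))\<^sup>2 \<le> 1" "norm (snd p) ^ (2 * m) \<le> 1" 
    using assms(2) zero_le_power2[of "norm (fst p)"] zero_le_power[OF norm_ge_zero, of "snd p" "2*m"]
    unfolding egg_norm_def by linarith+
  then show "norm (fst p) \<le> 1" "norm (snd p) \<le> 1"
    using assms(1) power_le_one_iff[of "norm (snd p)" "2 * m"] by (auto simp: power_le_one_iff)
qed

lemma closed_egg_sphere: "closed (egg_sphere m)"
  unfolding egg_sphere_def by (intro closed_Collect_eq continuous_intros)

lemma borel_egg_sphere [measurable]: "egg_sphere m \<in> sets borel"
  by (rule borel_closed[OF closed_egg_sphere])

lemma compact_closure_egg: "m \<ge> 1 \<Longrightarrow> compact (closure (egg m) :: 'k::finite pt set)"
proof -
  assume m: "m \<ge> 1"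
  have "norm p \<le> 2" if "egg_norm m p \<le> 1" for p :: "'k pt"
    using egg_sphere_bounds[OF m that] norm_Pair_le[of "fst p" "snd p"] by simp
  then have "bounded (closure (egg m) :: 'k pt set)"
    unfolding closure_egg[OF m] by (intro boundedI[of _ 2]) auto
  then show ?thesis by (simp add: compact_eq_bounded_closed)
qed

lemma egg_norm_dilate:
  assumes "m \<ge> 1" "s > 0" shows "egg_norm m (dilate m s p) = s * egg_norm m p"
proof -
  have "(s powr (1 / 2))\<^sup>2 = s" "(s powr (1 / (2 * real m))) ^ (2 * m) = s"
    using assms by (simp_all add: powr_power)
  then show ?thesis by (simp add: egg_norm_def dilate_def power_mult_distrib distrib_left)
qed

lemma dilate_dilate: "s > 0 \<Longrightarrow> t > 0 \<Longrightarrow> dilate m s (dilate m t p) = dilate m (s * t) p"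
  by (simp add: dilate_def powr_mult)

lemma dilate_1: "dilate m 1 p = p" by (simp add: dilate_def)

lemma linear_dilate: "linear (dilate m s)"
  by (rule linearI) (simp_all add: dilate_def algebra_simps)

lemma radial_proj_dilate:
  assumes "m \<ge> 1" "s > 0" "p \<in> egg_sphere m" shows "radial_proj m (dilate m s p) = p"
  using assms by (simp add: radial_proj_def egg_norm_dilate egg_sphere_def dilate_dilate dilate_1)

lemma radial_proj_in_sphere: "m \<ge> 1 \<Longrightarrow> p \<noteq> 0 \<Longrightarrow> radial_proj m p \<in> egg_sphere m"
  using egg_norm_pos[of m p] by (simp add: radial_proj_def egg_sphere_def egg_norm_dilate)

lemma dilate_radial_proj: "m \<ge> 1 \<Longrightarrow> p \<noteq> 0 \<Longrightarrow> dilate m (egg_norm m p) (radial_proj m p) = p"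
  using egg_norm_pos[of m p] by (simp add: radial_proj_def dilate_dilate dilate_1)

lemma radial_proj_0: "radial_proj m 0 = 0" by (simp add: radial_proj_def dilate_def zero_prod_def)

lemma borel_measurable_fst_snd_pt [measurable]: 
  "(fst :: 'k::finite pt \<Rightarrow> _) \<in> borel_measurable borel" "(snd :: 'k::finite pt \<Rightarrow> _) \<in> borel_measurable borel"
  by (intro borel_measurable_continuous_onI continuous_intros)+

lemma borel_measurable_dilate: "f \<in> borel_measurable M \<Longrightarrow> g \<in> borel_measurable M \<Longrightarrow>
   (\<lambda>x. dilate m (f x) (g x :: 'k::finite pt)) \<in> borel_measurable M"
  unfolding dilate_def
  by (intro borel_measurable_Pair borel_measurable_scaleR powr_real_measurable borel_measurable_const
      measurable_compose[OF _ borel_measurable_fst_snd_pt(1)] measurable_compose[OF _ borel_measurable_fst_snd_pt(2)])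

lemma borel_measurable_radial_proj [measurable]: "radial_proj m \<in> borel_measurable (borel :: 'k::finite pt measure)"
  unfolding radial_proj_def by (intro borel_measurable_dilate) measurable

lemma scales_volume_dilate:
  assumes "m \<ge> 1" "s > 0"
  shows "scales_volume (dilate m s :: 'k::finite pt \<Rightarrow> _) (s powr (real CARD('k) + 1 / real m))"
proof -
  have eq: "dilate m s = map_prod (\<lambda>z. s powr (1 / 2) *\<^sub>R z) (\<lambda>w. s powr (1 / (2 * real m)) *\<^sub>R w)"
    by (auto simp: dilate_def)
  have "scales_volume (dilate m s :: 'k pt \<Rightarrow> _) ((s powr (1 / 2)) ^ DIM(complex ^ 'k) * (s powr (1 / (2 * real m))) ^ DIM(complex))"
    unfolding eq using assms by (intro scales_volume_map_prod scales_volume_scaleR) 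
     (auto intro!: borel_measurable_continuous_onI continuous_intros)
  also have "(s powr (1 / 2)) ^ DIM(complex ^ 'k) * (s powr (1 / (2 * real m))) ^ DIM(complex) = s powr (real CARD('k) + 1 / real m)"
  proof -
    have "(s powr (1 / 2)) ^ DIM(complex ^ 'k) = s powr real CARD('k)" using assms by (simp add: powr_power)
    moreover have "(s powr (1 / (2 * real m))) ^ DIM(complex) = s powr (1 / real m)" using assms by (simp add: powr_power)
    ultimately show ?thesis by (simp only: powr_add)
  qed
  finally show ?thesis .
qed

lemma has_derivative_defining_fun:
  assumes "m \<ge> 1"
  shows "(defining_fun m has_derivative (\<lambda>v. egg_grad m p \<bullet> v)) (at p)"
proof -
  have eq: "defining_fun m = (\<lambda>p::'a pt. fst p \<bullet> fst p + (snd p \<bullet> snd p) ^ m - 1)"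
    by (simp add: fun_eq_iff defining_fun_def power2_norm_eq_inner power_mult)
  have e: "norm (snd p) ^ (2 * m - 2) = (snd p \<bullet> snd p) ^ (m - 1)"
    by (simp add: power2_norm_eq_inner[symmetric] power_mult[symmetric] right_diff_distrib')
  show ?thesis unfolding eq egg_grad_def e
    by (rule derivative_eq_intros refl | simp)+ (simp add: inner_prod_def inner_commute algebra_simps)
qed

lemma gradient_eqI:
  fixes f :: "'a::euclidean_space \<Rightarrow> real"
  assumes "(f has_derivative (\<lambda>v. g \<bullet> v)) (at x)"
  shows "gradient f x = g"
  by (simp add: gradient_def frechet_derivative_at[OF assms, symmetric] euclidean_representation)

lemma gradient_defining_fun: "m \<ge> 1 \<Longrightarrow> gradient (defining_fun m) p = egg_grad m p"
  by (rule gradient_eqI) (rule has_derivative_defining_fun)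

lemma has_derivative_gradient:
  fixes f :: "'a::euclidean_space \<Rightarrow> real"
  assumes "f differentiable (at x)"
  shows "(f has_derivative (\<lambda>v. gradient f x \<bullet> v)) (at x)"
proof -
  note d = frechet_derivative_works[THEN iffD1, OF assms]
  have "frechet_derivative f (at x) v = gradient f x \<bullet> v" for v
  proof -
    have "frechet_derivative f (at x) v = frechet_derivative f (at x) (\<Sum>b\<in>Basis. (v \<bullet> b) *\<^sub>R b)"
      by (simp add: euclidean_representation)
    also have "\<dots> = (\<Sum>b\<in>Basis. (v \<bullet> b) * frechet_derivative f (at x) b)"
      by (simp add: linear_sum[OF has_derivative_linear[OF d]] linear_scale[OF has_derivative_linear[OF d]])
    also have "\<dots> = gradient f x \<bullet> v"
      by (simp add: gradient_def inner_sum_left) (rule sum.cong, simp_all add: inner_commute)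
    finally show ?thesis .
  qed
  then have "frechet_derivative f (at x) = (\<lambda>v. gradient f x \<bullet> v)" by (rule ext)
  with d show ?thesis by simp
qed

definition euler_field :: "nat \<Rightarrow> 'k::finite pt \<Rightarrow> 'k pt" where
  "euler_field m p = ((1 / 2) *\<^sub>R fst p, (1 / (2 * real m)) *\<^sub>R snd p)"

lemma egg_grad_euler: "m \<ge> 1 \<Longrightarrow> egg_grad m p \<bullet> euler_field m p = egg_norm m p"
  by (cases m) (simp_all add: egg_grad_def euler_field_def egg_norm_def power2_norm_eq_inner[symmetric] power2_eq_square)

lemma egg_grad_nonzero: "p \<in> egg_sphere m \<Longrightarrow> m \<ge> 1 \<Longrightarrow> egg_grad m p \<noteq> 0"
  using egg_grad_euler[of m p] by (auto simp: egg_sphere_def)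

lemma norm_egg_grad_le:
  assumes "m \<ge> 1" "egg_norm m p \<le> 1" shows "norm (egg_grad m p) \<le> 2 + 2 * real m"
proof -
  note b = egg_sphere_bounds[OF assms]
  have "norm (snd p) ^ (2 * m - 2) * norm (snd p) \<le> 1 * 1"
    using b by (intro mult_mono power_le_one) auto
  then have "2 * real m * norm (snd p) ^ (2 * m - 2) * norm (snd p) \<le> 2 * real m"
    using assms(1) mult_left_mono[of "norm (snd p) ^ (2 * m - 2) * norm (snd p)" 1 "2 * real m"] by (simp add: mult.assoc)
  then show ?thesis using b norm_Pair_le[of "fst (egg_grad m p)" "snd (egg_grad m p)"]
    by (simp add: egg_grad_def abs_mult)
qed

lemma has_derivative_dilate:
  assumes "m \<ge> 1" "s > 0"
  shows "((\<lambda>(s, p). dilate m s p) has_derivative (\<lambda>(t, v). dilate m s (v + (t / s) *\<^sub>R euler_field m p))) (at (s, p))"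
proof -
  have p: "((\<lambda>q. fst q powr c) has_derivative (\<lambda>v. (c * s powr (c - 1)) * fst v)) (at (s, p))" for c
  proof -
    have 1: "(fst has_derivative fst) (at (s, p))" by (rule bounded_linear_imp_has_derivative[OF bounded_linear_fst])
    have "((\<lambda>x. x powr c) has_derivative (\<lambda>t. (c * s powr (c - 1)) * t)) (at (fst (s, p)))"
      using has_real_derivative_powr[OF assms(2), of c] by (simp add: has_field_derivative_def)
    from diff_chain_at[OF 1 this] show ?thesis by (simp add: o_def)
  qed
  have 1: "((\<lambda>q. fst (snd q)) has_derivative (\<lambda>v. fst (snd v))) (at (s, p))"
    and 2: "((\<lambda>q. snd (snd q)) has_derivative (\<lambda>v. snd (snd v))) (at (s, p))"
    by (auto intro!: derivative_eq_intros)
  have pw: "s powr (c - 1) = s powr c / s" for c using assms by (simp add: powr_diff)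
  note D = has_derivative_Pair[OF has_derivative_scaleR[OF p[of "1 / 2"] 1] has_derivative_scaleR[OF p[of "1 / (2 * real m)"] 2], unfolded pw]
  show ?thesis
    unfolding dilate_def split_beta
    by (rule has_derivative_eq_rhs[OF D]) (auto simp: fun_eq_iff euler_field_def scaleR_add_right)
qed

section \<open>The Euclidean surface measure of the boundary\<close>

lemma power_times_exp_le: "0 \<le> x \<Longrightarrow> x ^ j * exp (- x) \<le> fact j * (2 ^ j * exp (- (x / 2)) :: real)"
proof -
  assume x: "0 \<le> x"
  have "(x / 2) ^ j / fact j \<le> exp (x / 2)"
  proof -
    have "(\<Sum>n\<in>{j}. inverse (fact n) * (x / 2) ^ n) \<le> (\<Sum>n. inverse (fact n) * (x / 2) ^ n)"
      by (rule sum_le_suminf[OF summable_exp]) (use x in auto)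
    moreover have "(\<Sum>n. inverse (fact n) * (x / 2) ^ n) = exp (x / 2)" by (simp only: exp_def real_scaleR_def)
    ultimately show ?thesis by (simp add: field_simps)
  qed
  then have "x ^ j \<le> fact j * 2 ^ j * exp (x / 2)" by (simp add: field_simps power_divide)
  then have "x ^ j * exp (- x) \<le> fact j * 2 ^ j * exp (x / 2) * exp (- x)" by (intro mult_right_mono) auto
  also have "exp (x / 2) * exp (- x) = exp (- (x / 2))" by (simp add: exp_add[symmetric])
  then have "fact j * 2 ^ j * exp (x / 2) * exp (- x) = fact j * (2 ^ j * exp (- (x / 2)))" by (simp add: mult.assoc)
  finally show ?thesis .
qed

lemma egg_norm_half_le:
  assumes "m \<ge> 1" shows "egg_norm m ((1 / 2) *\<^sub>R p) \<le> egg_norm m p / 2"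
proof -
  have "egg_norm m ((1 / 2) *\<^sub>R p) \<le> (1 / 2)\<^sup>2 * egg_norm m p" using assms by (intro egg_norm_scaleR_le) auto
  also have "\<dots> \<le> egg_norm m p / 2" using egg_norm_nonneg[of m p] by (simp add: power2_eq_square)
  finally show ?thesis .
qed

text \<open>The integral over all space factorises into Gaussian and Gamma integrals.\<close>

lemma nn_integral_exp_egg_norm_finite:
  assumes "m \<ge> 1"
  shows "(\<integral>\<^sup>+p. ennreal (exp (- egg_norm m p)) \<partial>(lborel :: 'k::finite pt measure)) < \<infinity>"
proof -
  obtain e :: "complex ^ 'k" where e: "norm e = 1" using norm_axis_complex[of undefined 1] by (metis norm_one)
  have "(\<integral>\<^sup>+p. ennreal (exp (- egg_norm m p)) \<partial>(lborel :: 'k pt measure)) =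
    (\<integral>\<^sup>+z. (\<integral>\<^sup>+w. ennreal (exp (- (norm z)\<^sup>2)) * ennreal (exp (- (norm w ^ (2 * m)))) \<partial>(lborel :: complex measure)) \<partial>(lborel :: (complex ^ 'k) measure))"
    by (subst nn_integral_lborel_pair(1)) (auto simp: egg_norm_def exp_diff exp_minus divide_inverse ennreal_mult'[symmetric])
  also have "\<dots> = (\<integral>\<^sup>+z. ennreal (exp (- (norm z)\<^sup>2)) \<partial>(lborel :: (complex ^ 'k) measure)) * 
      (\<integral>\<^sup>+w. ennreal (exp (- (norm w ^ (2 * m)))) \<partial>(lborel :: complex measure))"
    by (simp add: nn_integral_cmult nn_integral_multc)
  also have "(\<integral>\<^sup>+z. ennreal (exp (- (norm z)\<^sup>2)) \<partial>(lborel :: (complex ^ 'k) measure)) = ennreal (pi ^ CARD('k) * fact 0)"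
    using nn_integral_cinner_moment[OF e, of 0] by simp
  also have "(\<integral>\<^sup>+w. ennreal (exp (- (norm w ^ (2 * m)))) \<partial>(lborel :: complex measure)) =
     (\<integral>\<^sup>+w. ennreal ((norm w ^ (2 * m)) powr 0 * exp (- (norm w ^ (2 * m)))) \<partial>(lborel :: complex measure))"
    by (intro nn_integral_cong_AE, use AE_lborel_singleton[of 0] in eventually_elim) auto
  also have "\<dots> = ennreal (pi / real m * Gamma (0 + 1 / real m))" by (rule nn_integral_complex_gamma[OF assms]) simp
  finally show ?thesis by (simp add: ennreal_mult_less_top)
qed

text \<open>The power is absorbed by replacing the exponential with its value at half the point, where the homogeneous norm is at most half as large.\<close>

lemma integrable_egg_weight:
  assumes m: "m \<ge> 1" and "\<theta> \<ge> 0"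
  shows "integrable lborel (\<lambda>p::'k::finite pt. egg_norm m p powr \<theta> * exp (- egg_norm m p))"
proof -
  have "(\<integral>\<^sup>+p. ennreal (exp (- egg_norm m p)) \<partial>(lborel :: 'k pt measure)) = 
     ennreal ((1 / 2) ^ DIM('k pt)) * (\<integral>\<^sup>+p. ennreal (exp (- egg_norm m ((1 / 2) *\<^sub>R p))) \<partial>(lborel :: 'k pt measure))"
    by (rule scales_volumeD[OF scales_volume_scaleR]) auto
  then have "(\<integral>\<^sup>+p. ennreal (exp (- egg_norm m ((1 / 2) *\<^sub>R p))) \<partial>(lborel :: 'k pt measure)) < \<infinity>"
    using nn_integral_exp_egg_norm_finite[OF m, where 'k = 'k] by (auto simp: ennreal_mult_less_top top_unique less_top)
  then have i: "integrable (lborel :: 'k pt measure) (\<lambda>p. exp (- egg_norm m ((1 / 2) *\<^sub>R p)))"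
    by (intro integrableI_nonneg) auto
  obtain j :: nat where j: "\<theta> \<le> real j" using real_arch_simple by blast
  have "integrable (lborel :: 'k pt measure) (\<lambda>p. (1 + fact j * 2 ^ j) * exp (- egg_norm m ((1 / 2) *\<^sub>R p)))"
    using i by simp
  then show ?thesis
  proof (rule Bochner_Integration.integrable_bound)
    show "AE p in lborel. norm (egg_norm m p powr \<theta> * exp (- egg_norm m p)) \<le> norm ((1 + fact j * 2 ^ j) * exp (- egg_norm m ((1 / 2) *\<^sub>R (p::'k pt))))"
    proof (rule AE_I2)
      fix p :: "'k pt"
      let ?N = "egg_norm m p"
      have N: "?N \<ge> 0" by (rule egg_norm_nonneg)
      have "?N powr \<theta> \<le> 1 + ?N ^ j"
      proof (cases "?N \<le> 1")
        case True
        then have "?N powr \<theta> \<le> 1" using N assms(2) by (cases "?N = 0") (auto intro!: powr_le_one_le powr_le1)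
        then show ?thesis using N by (simp add: add_increasing2)
      next
        case False
        then have "?N powr \<theta> \<le> ?N powr real j" using j by (intro powr_mono) auto
        then show ?thesis using False by (simp add: powr_realpow)
      qed
      then have "?N powr \<theta> * exp (- ?N) \<le> (1 + ?N ^ j) * exp (- ?N)" by (intro mult_right_mono) auto
      also have "\<dots> = exp (- ?N) + ?N ^ j * exp (- ?N)" by (simp add: distrib_right)
      also have "\<dots> \<le> exp (- (?N / 2)) + fact j * (2 ^ j * exp (- (?N / 2)))"
        using N by (intro add_mono power_times_exp_le) auto
      also have "\<dots> = (1 + fact j * 2 ^ j) * exp (- (?N / 2))" by (simp add: algebra_simps)
      also have "\<dots> \<le> (1 + fact j * 2 ^ j) * exp (- egg_norm m ((1 / 2) *\<^sub>R p))"
        using egg_norm_half_le[OF m, of p] by (intro mult_left_mono) (auto intro: add_nonneg_nonneg)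
      finally show "norm (?N powr \<theta> * exp (- ?N)) \<le> norm ((1 + fact j * 2 ^ j) * exp (- egg_norm m ((1 / 2) *\<^sub>R p)))"
        by (simp add: abs_mult)
    qed
  qed measurable
qed

text \<open>The Euclidean surface measure, written as the image of a Lebesgue density under the weighted radial projection. The radial factor \<open>N powr \<theta> * exp (- N)\<close> integrates to the Gamma value in the denominator, so the measure does not depend on \<open>\<theta>\<close>; this freedom is used to cancel the degree of a monomial.\<close>

definition sphere_measure :: "nat \<Rightarrow> real \<Rightarrow> 'k::finite pt measure" where
  "sphere_measure m \<theta> = distr (density lborel (\<lambda>x. ennreal (norm (egg_grad m (radial_proj m x)) *
      (egg_norm m x powr \<theta> * exp (- egg_norm m x) / Gamma (real CARD('k) + 1 / real m + \<theta>))))) borel (radial_proj m)"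

lemma borel_measurable_egg_grad [measurable]: "egg_grad m \<in> borel_measurable (borel :: 'k::finite pt measure)"
  unfolding egg_grad_def by (intro borel_measurable_continuous_onI continuous_intros)

lemma sets_sphere_measure [simp, measurable_cong]: "sets (sphere_measure m \<theta>) = sets borel"
  by (simp add: sphere_measure_def)

lemma nn_integral_sphere_measure:
  assumes [measurable]: "\<phi> \<in> borel_measurable borel"
  shows "(\<integral>\<^sup>+p. \<phi> p \<partial>(sphere_measure m \<theta> :: 'k::finite pt measure)) = 
    (\<integral>\<^sup>+x. ennreal (norm (egg_grad m (radial_proj m x)) * (egg_norm m x powr \<theta> * exp (- egg_norm m x) / Gamma (real CARD('k) + 1 / real m + \<theta>))) * \<phi> (radial_proj m x) \<partial>lborel)"
  unfolding sphere_measure_def by (subst nn_integral_distr, simp, simp, subst nn_integral_density) auto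

lemma emeasure_sphere_measure:
  assumes [measurable]: "B \<in> sets borel"
  shows "emeasure (sphere_measure m \<theta> :: 'k::finite pt measure) B = 
    (\<integral>\<^sup>+x. ennreal (indicator (radial_proj m -` B) x * (norm (egg_grad m (radial_proj m x)) * (egg_norm m x powr \<theta> * exp (- egg_norm m x) / Gamma (real CARD('k) + 1 / real m + \<theta>)))) \<partial>lborel)"
proof -
  have "emeasure (sphere_measure m \<theta> :: 'k::finite pt measure) B = (\<integral>\<^sup>+p. indicator B p \<partial>(sphere_measure m \<theta> :: 'k pt measure))"
    by simp
  also have "\<dots> = (\<integral>\<^sup>+x. ennreal (norm (egg_grad m (radial_proj m x)) * (egg_norm m x powr \<theta> * exp (- egg_norm m x) / Gamma (real CARD('k) + 1 / real m + \<theta>))) * indicator B (radial_proj m x) \<partial>lborel)"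
    by (rule nn_integral_sphere_measure) simp
  also have "\<dots> = (\<integral>\<^sup>+x. ennreal (indicator (radial_proj m -` B) x * (norm (egg_grad m (radial_proj m x)) * (egg_norm m x powr \<theta> * exp (- egg_norm m x) / Gamma (real CARD('k) + 1 / real m + \<theta>)))) \<partial>lborel)"
    by (intro nn_integral_cong) (auto simp: indicator_def)
  finally show ?thesis .
qed

lemma emeasure_sphere_measure_off_sphere:
  assumes "m \<ge> 1"
  shows "emeasure (sphere_measure m \<theta> :: 'k::finite pt measure) (- egg_sphere m) = 0"
proof -
  have "emeasure (sphere_measure m \<theta> :: 'k::finite pt measure) (- egg_sphere m) = 
    (\<integral>\<^sup>+x. ennreal (indicator (radial_proj m -` (- egg_sphere m)) x * (norm (egg_grad m (radial_proj m x)) * (egg_norm m x powr \<theta> * exp (- egg_norm m x) / Gamma (real CARD('k) + 1 / real m + \<theta>)))) \<partial>(lborel :: 'k pt measure))"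
    by (rule emeasure_sphere_measure) simp
  also have "\<dots> = (\<integral>\<^sup>+x. 0 \<partial>(lborel :: 'k pt measure))"
  proof (rule nn_integral_cong_AE)
    show "AE x in (lborel :: 'k pt measure). ennreal (indicator (radial_proj m -` (- egg_sphere m)) x * (norm (egg_grad m (radial_proj m x)) * (egg_norm m x powr \<theta> * exp (- egg_norm m x) / Gamma (real CARD('k) + 1 / real m + \<theta>)))) = 0"
      using AE_lborel_singleton[of 0] by eventually_elim (simp add: radial_proj_in_sphere[OF assms])
  qed
  finally show ?thesis by simp
qed

text \<open>The map \<open>(x, s) \<mapsto> dilate m s (L x + h x \<nu>)\<close> parametrises the cone over a graph. By Euler's identity its Jacobian is a power of \<open>s\<close> times the gradient's reciprocal normal component, and the quotient with the gradient length is the area element; the integral over \<open>s\<close> is a Gamma integral.\<close>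

theorem sphere_measure_graph:
  fixes L :: "(complex ^ 'k::finite) \<times> real \<Rightarrow> 'k pt"
  assumes m: "m \<ge> 1" and \<theta>: "\<theta> \<ge> 0"
    and L: "linear L" "\<And>x. norm (L x) = norm x" and \<nu>: "norm \<nu> = 1" "\<And>x. L x \<bullet> \<nu> = 0"
    and U: "open U" and h: "\<And>x. x \<in> U \<Longrightarrow> h differentiable (at x)"
    and sub: "(\<lambda>x. L x + h x *\<^sub>R \<nu>) ` U \<subseteq> egg_sphere m"
    and B[measurable]: "B \<in> sets borel" and BU: "B \<subseteq> (\<lambda>x. L x + h x *\<^sub>R \<nu>) ` U"
  shows "emeasure (sphere_measure m \<theta>) B =
     (\<integral>\<^sup>+x\<in>U. ennreal (sqrt (1 + (norm (gradient h x))\<^sup>2)) * indicator B (L x + h x *\<^sub>R \<nu>) \<partial>lborel)"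
proof -
  interpret hyperplane_coordinates L \<nu>
    by (rule hyperplane_coordinates.intro[OF L \<nu>]) simp
  define \<Gamma> where "\<Gamma> x = L x + h x *\<^sub>R \<nu>" for x
  define Q where "Q = real CARD('k) + 1 / real m"
  have Q: "Q > 0" using m by (simp add: Q_def add_pos_pos)
  let ?D = "\<lambda>x. egg_grad m (\<Gamma> x)"
  have sph: "\<Gamma> x \<in> egg_sphere m" if "x \<in> U" for x using sub that by (auto simp: \<Gamma>_def)
  have \<Gamma>d: "(\<Gamma> has_derivative (\<lambda>v. L v + (gradient h x \<bullet> v) *\<^sub>R \<nu>)) (at x)" if "x \<in> U" for x
  proof -
    have 1: "(L has_derivative L) (at x)" 
      by (rule bounded_linear_imp_has_derivative) (use L(1) in \<open>simp add: linear_conv_bounded_linear\<close>)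
    have 2: "((\<lambda>x. h x *\<^sub>R \<nu>) has_derivative (\<lambda>v. (gradient h x \<bullet> v) *\<^sub>R \<nu>)) (at x)"
      by (rule has_derivative_scaleR_left[OF has_derivative_gradient[OF h[OF that]]])
    show ?thesis unfolding \<Gamma>_def by (rule has_derivative_add[OF 1 2])
  qed
  have tangent: "?D x \<bullet> L v + (gradient h x \<bullet> v) * (?D x \<bullet> \<nu>) = 0" if "x \<in> U" for x v
  proof -
    have "((\<lambda>x. defining_fun m (\<Gamma> x)) has_derivative (\<lambda>v. ?D x \<bullet> (L v + (gradient h x \<bullet> v) *\<^sub>R \<nu>))) (at x)"
      using diff_chain_at[OF \<Gamma>d[OF that] has_derivative_defining_fun[OF m]] by (simp add: o_def)
    moreover have "((\<lambda>x. defining_fun m (\<Gamma> x)) has_derivative (\<lambda>v. 0)) (at x)"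
      by (rule has_derivative_transform_within_open[OF has_derivative_const[of 0] U that])
        (use sph in \<open>auto simp: egg_sphere_def egg_norm_def defining_fun_def\<close>)
    ultimately have "(\<lambda>v. ?D x \<bullet> (L v + (gradient h x \<bullet> v) *\<^sub>R \<nu>)) = (\<lambda>v. 0)"
      by (rule has_derivative_unique)
    from fun_cong[OF this, of v] have "?D x \<bullet> (L v + (gradient h x \<bullet> v) *\<^sub>R \<nu>) = 0" .
    then show ?thesis by (simp add: inner_add_right)
  qed
  have nz: "?D x \<bullet> \<nu> \<noteq> 0" if "x \<in> U" for x
  proof
    assume 0: "?D x \<bullet> \<nu> = 0"
    obtain y where y: "?D x = L y + (?D x \<bullet> \<nu>) *\<^sub>R \<nu>" by (rule decompose)
    have "?D x \<bullet> ?D x = ?D x \<bullet> L y" using y 0 by simp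
    also have "\<dots> = 0" using tangent[OF that, of y] 0 by simp
    finally show False using egg_grad_nonzero[OF sph[OF that] m] by simp
  qed
  define \<Gamma>' where "\<Gamma>' x = indicator U x *\<^sub>R \<Gamma> x" for x
  have [measurable]: "U \<in> sets borel" using U by simp
  have "continuous_on U \<Gamma>" by (rule has_derivative_continuous_on[OF has_derivative_at_withinI[OF \<Gamma>d]])
  then have [measurable]: "\<Gamma>' \<in> borel_measurable borel" unfolding \<Gamma>'_def
    by (intro borel_measurable_continuous_on_indicator) simp
  have \<Gamma>'_eq: "\<Gamma>' x = \<Gamma> x" if "x \<in> U" for x using that by (simp add: \<Gamma>'_def)
  define A where "A = {x \<in> U. \<Gamma> x \<in> B}"
  have "A = U \<inter> (\<Gamma>' -` B)" by (auto simp: A_def \<Gamma>'_eq)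
  also have "\<dots> \<in> sets borel" using measurable_sets[of \<Gamma>' borel borel B] by simp
  finally have A[measurable]: "A \<in> sets borel" .
  have AU: "A \<subseteq> U" by (auto simp: A_def)
  define S where "S = A \<times> {0::real<..}"
  have S[measurable]: "S \<in> sets borel" unfolding S_def by (intro borel_Times) auto
  define g where "g = (\<lambda>(x, s). dilate m s (\<Gamma> x))"
  have gS: "g ` S = radial_proj m -` B"
  proof (intro equalityI subsetI)
    fix y assume "y \<in> g ` S"
    then obtain x s where "x \<in> A" "s > 0" "y = dilate m s (\<Gamma> x)" by (auto simp: g_def S_def)
    then show "y \<in> radial_proj m -` B" using radial_proj_dilate[OF m _ sph] by (auto simp: A_def)
  next
    fix y assume "y \<in> radial_proj m -` B"
    then have y: "radial_proj m y \<in> B" by simp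
    then obtain x where x: "x \<in> U" "radial_proj m y = \<Gamma> x" using BU by (auto simp: \<Gamma>_def)
    have "y \<noteq> 0" using sph[OF x(1)] x(2) egg_norm_eq_0[OF m, of "0 :: 'k pt"] by (auto simp: radial_proj_0 egg_sphere_def)
    then have "y = g (x, egg_norm m y)" "(x, egg_norm m y) \<in> S"
      using dilate_radial_proj[OF m, of y] egg_norm_pos[OF m, of y] x y by (auto simp: g_def S_def A_def)
    then show "y \<in> g ` S" by blast
  qed
  have gS_borel: "g ` S \<in> sets borel" unfolding gS using measurable_sets[of "radial_proj m" borel borel B] by simp
  define g' where "g' = (\<lambda>(x, s). dilate m s \<circ> (\<lambda>(v, t). L v + (gradient h x \<bullet> v) *\<^sub>R \<nu> + t *\<^sub>R ((1 / s) *\<^sub>R euler_field m (\<Gamma> x))))"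
  have g_eq: "g = (\<lambda>q. dilate m (snd q) (\<Gamma> (fst q)))" by (simp add: g_def split_beta fun_eq_iff)
  have der: "(g has_derivative g' p) (at p)" if "p \<in> S" for p
  proof -
    define x s where "x = fst p" and "s = snd p"
    have p: "p = (x, s)" "x \<in> U" "s > 0" using that AU by (auto simp: S_def x_def s_def)
    have 1: "((\<lambda>q. \<Gamma> (fst q)) has_derivative (\<lambda>v. L (fst v) + (gradient h x \<bullet> fst v) *\<^sub>R \<nu>)) (at p)"
    proof -
      have "(\<Gamma> has_derivative (\<lambda>v. L v + (gradient h x \<bullet> v) *\<^sub>R \<nu>)) (at (fst p))" using \<Gamma>d[OF p(2)] p(1) by simp
      from diff_chain_at[OF bounded_linear_imp_has_derivative[OF bounded_linear_fst] this] show ?thesis by (simp add: o_def)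
    qed
    have 2: "(snd has_derivative snd) (at p)" by (rule bounded_linear_imp_has_derivative[OF bounded_linear_snd])
    have "((\<lambda>(s, p). dilate m s p) has_derivative (\<lambda>(t, v). dilate m s (v + (t / s) *\<^sub>R euler_field m (\<Gamma> x)))) (at (snd p, \<Gamma> (fst p)))"
      using has_derivative_dilate[OF m p(3)] p(1) by simp
    from diff_chain_at[OF has_derivative_Pair[OF 2 1] this] show ?thesis
      by (simp add: o_def g_eq g'_def p(1) split_beta add.assoc)
  qed
  have inj: "inj_on g S"
  proof (rule inj_onI)
    fix p q assume pq: "p \<in> S" "q \<in> S" "g p = g q"
    define x s y t where "x = fst p" and "s = snd p" and "y = fst q" and "t = snd q"
    have p: "p = (x, s)" "x \<in> U" "s > 0" using pq(1) AU by (auto simp: S_def x_def s_def)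
    have q: "q = (y, t)" "y \<in> U" "t > 0" using pq(2) AU by (auto simp: S_def y_def t_def)
    have "egg_norm m (g p) = s" "egg_norm m (g q) = t" "radial_proj m (g p) = \<Gamma> x" "radial_proj m (g q) = \<Gamma> y"
      using p q sph[OF p(2)] sph[OF q(2)] m by (auto simp: g_def egg_norm_dilate radial_proj_dilate) (auto simp: egg_sphere_def)
    then have st: "s = t" "\<Gamma> x = \<Gamma> y" using pq(3) by auto
    have "coords (x, h x) = coords (y, h y)" using st(2) by (simp add: coords_def \<Gamma>_def)
    then show "p = q" using inj_coords p q st by (auto dest: injD)
  qed
  define J where "J = (\<lambda>p. snd p powr Q * (1 / (snd p * \<bar>egg_grad m (\<Gamma>' (fst p)) \<bullet> \<nu>\<bar>)))"
  have scale: "scales_volume (g' p) (J p)" "J p > 0" if "p \<in> S" for p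
  proof -
    define x s where "x = fst p" and "s = snd p"
    have p: "p = (x, s)" "x \<in> U" "s > 0" using that AU by (auto simp: S_def x_def s_def)
    have DZ: "?D x \<bullet> ((1 / s) *\<^sub>R euler_field m (\<Gamma> x)) = 1 / s"
      using egg_grad_euler[OF m, of "\<Gamma> x"] sph[OF p(2)] by (simp add: egg_sphere_def)
    have "scales_volume (g' p) (s powr (real CARD('k) + 1 / real m) * \<bar>(?D x \<bullet> ((1 / s) *\<^sub>R euler_field m (\<Gamma> x))) / (?D x \<bullet> \<nu>)\<bar>)"
      unfolding p(1) g'_def split
      by (intro scales_volume_compose scales_volume_dilate scales_volume_graph tangent nz p m borel_measurable_linear linear_dilate)
        (use DZ p in auto)
    also have "s powr (real CARD('k) + 1 / real m) * \<bar>(?D x \<bullet> ((1 / s) *\<^sub>R euler_field m (\<Gamma> x))) / (?D x \<bullet> \<nu>)\<bar> = J p"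
      unfolding DZ J_def using p by (simp add: Q_def \<Gamma>'_eq abs_mult)
    finally show "scales_volume (g' p) (J p)" .
    show "J p > 0" using p nz[OF p(2)] by (simp add: J_def \<Gamma>'_eq)
  qed
  define f where "f y = norm (egg_grad m (radial_proj m y)) * (egg_norm m y powr \<theta> * exp (- egg_norm m y) / Gamma (Q + \<theta>))" for y :: "'k pt"
  have G: "Gamma (Q + \<theta>) > 0" using Q \<theta> by (intro Gamma_real_pos) auto
  have f0: "f y \<ge> 0" for y using G by (auto simp: f_def)
  have [measurable]: "f \<in> borel_measurable borel" unfolding f_def by measurable
  have fint: "integrable lborel f"
  proof (rule Bochner_Integration.integrable_bound)
    show "integrable lborel (\<lambda>y::'k pt. (2 + 2 * real m) / Gamma (Q + \<theta>) * (egg_norm m y powr \<theta> * exp (- egg_norm m y)))"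
      using integrable_egg_weight[OF m \<theta>] by (rule integrable_mult_right)
    show "AE y in lborel. norm (f y) \<le> norm ((2 + 2 * real m) / Gamma (Q + \<theta>) * (egg_norm m y powr \<theta> * exp (- egg_norm m y)))"
    proof (rule AE_I2)
      fix y :: "'k pt"
      have "egg_norm m (radial_proj m y) \<le> 1"
        using radial_proj_in_sphere[OF m, of y] egg_norm_eq_0[OF m, of "0 :: 'k pt"] by (cases "y = 0") (auto simp: radial_proj_0 egg_sphere_def)
      from norm_egg_grad_le[OF m this] 
      have "f y \<le> (2 + 2 * real m) * (egg_norm m y powr \<theta> * exp (- egg_norm m y) / Gamma (Q + \<theta>))"
        unfolding f_def using G by (intro mult_right_mono) auto
      then show "norm (f y) \<le> norm ((2 + 2 * real m) / Gamma (Q + \<theta>) * (egg_norm m y powr \<theta> * exp (- egg_norm m y)))"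
        using f0[of y] G by (simp add: abs_mult)
    qed
  qed measurable
  define F where "F p = indicator S p * (J p * f (g p))" for p
  have F_eq: "F (x, s) = indicator A x * (indicator {0<..} s * (norm (?D x) / \<bar>?D x \<bullet> \<nu>\<bar> / Gamma (Q + \<theta>) * s powr (Q + \<theta> - 1) * exp (- s)))" for x s
  proof (cases "x \<in> A \<and> s > 0")
    case True
    then have x: "x \<in> U" using AU by auto
    have "f (g (x, s)) = norm (?D x) * (s powr \<theta> * exp (- s) / Gamma (Q + \<theta>))"
      using True m sph[OF x] by (simp add: f_def g_def egg_norm_dilate radial_proj_dilate) (simp add: egg_sphere_def)
    moreover have "s powr (Q + \<theta> - 1) = s powr Q * s powr \<theta> / s" using True by (simp add: powr_diff powr_add)
    ultimately show ?thesis using True x by (simp add: F_def J_def \<Gamma>'_eq S_def mult_ac)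
  qed (auto simp: F_def S_def indicator_def)
  have "F = (\<lambda>p. indicator S p * (J p * f (dilate m (snd p) (\<Gamma>' (fst p)))))"
    using AU by (auto simp: F_def g_def fun_eq_iff indicator_def S_def \<Gamma>'_eq)
  also have "\<dots> \<in> borel_measurable (borel \<Otimes>\<^sub>M borel)"
  proof -
    have [measurable]: "(\<lambda>p. dilate m (snd p) (\<Gamma>' (fst p))) \<in> borel_measurable (borel \<Otimes>\<^sub>M borel)"
      by (intro borel_measurable_dilate) measurable
    have [measurable]: "S \<in> sets (borel \<Otimes>\<^sub>M borel)" unfolding S_def by (intro pair_measureI) auto
    show ?thesis unfolding J_def by measurable
  qed
  finally have Fm[measurable]: "F \<in> borel_measurable borel" by (simp add: borel_prod)
  have "emeasure (sphere_measure m \<theta>) B = (\<integral>\<^sup>+y. ennreal (indicator (g ` S) y * f y) \<partial>lborel)"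
    by (simp add: emeasure_sphere_measure gS f_def Q_def)
  also have "\<dots> = (\<integral>\<^sup>+p. ennreal (indicator S p * (J p * f (g p))) \<partial>lborel)"
    by (rule nn_integral_change_of_variables[where 'n = "'k option bit0", OF _ _ S gS_borel der inj scale fint f0])
      (use Fm in \<open>simp_all add: F_def[abs_def]\<close>)
  also have "\<dots> = (\<integral>\<^sup>+p. ennreal (F p) \<partial>lborel)" by (simp add: F_def)
  also have "\<dots> = (\<integral>\<^sup>+x. (\<integral>\<^sup>+s. ennreal (F (x, s)) \<partial>lborel) \<partial>lborel)"
    by (rule nn_integral_lborel_pair) measurable
  also have "\<dots> = (\<integral>\<^sup>+x\<in>U. ennreal (sqrt (1 + (norm (gradient h x))\<^sup>2)) * indicator B (\<Gamma> x) \<partial>lborel)"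
  proof (rule nn_integral_cong)
    fix x
    show "(\<integral>\<^sup>+s. ennreal (F (x, s)) \<partial>lborel) = ennreal (sqrt (1 + (norm (gradient h x))\<^sup>2)) * indicator B (\<Gamma> x) * indicator U x"
    proof (cases "x \<in> A")
      case True
      then have x: "x \<in> U" "\<Gamma> x \<in> B" by (auto simp: A_def)
      have "(\<integral>\<^sup>+s. ennreal (F (x, s)) \<partial>lborel) = ennreal (norm (?D x) / \<bar>?D x \<bullet> \<nu>\<bar> / Gamma (Q + \<theta>) * Gamma (Q + \<theta>))"
        unfolding F_eq indicator_simps(1)[OF True] mult_1_left by (intro nn_integral_gamma) (use Q \<theta> G in auto)
      also have "norm (?D x) / \<bar>?D x \<bullet> \<nu>\<bar> / Gamma (Q + \<theta>) * Gamma (Q + \<theta>) = sqrt (1 + (norm (gradient h x))\<^sup>2)"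
        using G graph_area_element[OF tangent[OF x(1)] nz[OF x(1)]] by simp
      finally show ?thesis using x by simp
    qed (auto simp: F_eq A_def indicator_def)
  qed
  finally show ?thesis by (simp add: \<Gamma>_def)
qed

lemma sphere_measure_is_hypersurface_measure:
  assumes "m \<ge> 1" "\<theta> \<ge> 0"
  shows "is_hypersurface_measure (egg_sphere m) (sphere_measure m \<theta> :: 'k::finite pt measure)"
  unfolding is_hypersurface_measure_def
proof (intro conjI allI impI ballI)
  show "emeasure (sphere_measure m \<theta> :: 'k pt measure) (- egg_sphere m) = 0"
    by (rule emeasure_sphere_measure_off_sphere[OF assms(1)])
next
  fix L :: "(complex ^ 'k) \<times> real \<Rightarrow> 'k pt" and \<nu> U h B
  assume "linear L \<and> (\<forall>x. norm (L x) = norm x) \<and> norm \<nu> = 1 \<and> (\<forall>x. L x \<bullet> \<nu> = 0) \<and> open U \<and>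
    (\<forall>x\<in>U. h differentiable (at x)) \<and> continuous_on U (gradient h) \<and> (\<lambda>x. L x + h x *\<^sub>R \<nu>) ` U \<subseteq> egg_sphere m"
    and B: "B \<in> sets borel" "B \<subseteq> (\<lambda>x. L x + h x *\<^sub>R \<nu>) ` U"
  then have "linear L" "\<And>x. norm (L x) = norm x" "norm \<nu> = 1" "\<And>x. L x \<bullet> \<nu> = 0" "open U"
    "\<And>x. x \<in> U \<Longrightarrow> h differentiable (at x)" "(\<lambda>x. L x + h x *\<^sub>R \<nu>) ` U \<subseteq> egg_sphere m" by blast+
  from sphere_measure_graph[OF assms this B]
  show "emeasure (sphere_measure m \<theta>) B = 
    (\<integral>\<^sup>+x\<in>U. ennreal (sqrt (1 + (norm (gradient h x))\<^sup>2)) * indicator B (L x + h x *\<^sub>R \<nu>) \<partial>lborel)" .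
qed simp

text \<open>A finite cover is made disjoint by removing one member after the other.\<close>

lemma emeasure_eq_on_cover:
  assumes "finite \<G>" "sets \<mu> = sets M" "sets \<nu> = sets M" "\<And>G. G \<in> \<G> \<Longrightarrow> G \<in> sets M"
    and "\<And>G B. G \<in> \<G> \<Longrightarrow> B \<in> sets M \<Longrightarrow> B \<subseteq> G \<Longrightarrow> emeasure \<mu> B = emeasure \<nu> B"
    and "B \<in> sets M" "B \<subseteq> \<Union>\<G>"
  shows "emeasure \<mu> B = emeasure \<nu> B"
  using assms(1,4-)
proof (induction \<G> arbitrary: B)
  case (insert G \<G>)
  have G[measurable]: "G \<in> sets M" and B[measurable]: "B \<in> sets M" using insert by auto
  have "emeasure \<mu> (B \<inter> G) = emeasure \<nu> (B \<inter> G)" by (rule insert.prems(2)[of G]) auto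
  moreover have "emeasure \<mu> (B - G) = emeasure \<nu> (B - G)"
    by (rule insert.IH) (use insert.prems in auto)
  moreover have "emeasure \<kappa> B = emeasure \<kappa> (B \<inter> G) + emeasure \<kappa> (B - G)" if "sets \<kappa> = sets M" for \<kappa>
    using that G B by (subst plus_emeasure) (auto simp: Int_Diff_Un)
  ultimately show ?case using assms(2,3) by simp
qed simp

text \<open>Near a point with a positive coordinate the boundary is the graph of a square root of a smooth function.\<close>

lemma sqrt_graph_regular:
  fixes k :: "'a::euclidean_space \<Rightarrow> real"
  assumes der: "\<And>x. x \<in> U \<Longrightarrow> (k has_derivative D x) (at x)" and pos: "\<And>x. x \<in> U \<Longrightarrow> k x > 0"
    and cont: "\<And>v. continuous_on U (\<lambda>x. D x v)"
  shows "\<And>x. x \<in> U \<Longrightarrow> (\<lambda>x. sqrt (k x)) differentiable (at x)"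
    and "continuous_on U (gradient (\<lambda>x. sqrt (k x)))"
proof -
  have d: "((\<lambda>x. sqrt (k x)) has_derivative (\<lambda>v. D x v * (inverse (sqrt (k x)) / 2))) (at x)" if "x \<in> U" for x
    using has_derivative_compose[OF der[OF that] DERIV_real_sqrt[OF pos[OF that], unfolded has_field_derivative_def]]
    by (simp add: mult.commute)
  show "(\<lambda>x. sqrt (k x)) differentiable (at x)" if "x \<in> U" for x
    using d[OF that] by (auto simp: differentiable_def)
  have g: "gradient (\<lambda>x. sqrt (k x)) x = (\<Sum>b\<in>Basis. (D x b * (inverse (sqrt (k x)) / 2)) *\<^sub>R b)" if "x \<in> U" for x
    unfolding gradient_def frechet_derivative_at[OF d[OF that], symmetric] ..
  have k: "continuous_on U k" by (rule has_derivative_continuous_on[OF has_derivative_at_withinI[OF der]])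
  have "continuous_on U (\<lambda>x. \<Sum>b\<in>Basis. (D x b * (inverse (sqrt (k x)) / 2)) *\<^sub>R b)"
    using pos by (intro continuous_intros cont k) (auto simp: less_imp_neq[symmetric] dest: pos)
  then show "continuous_on U (gradient (\<lambda>x. sqrt (k x)))"
    by (rule continuous_on_cong[THEN iffD1, rotated 2]) (auto simp: g)
qed

lemma hyperplane_isometry_exists:
  fixes \<nu> :: "'k::finite pt"
  assumes "norm \<nu> = 1"
  obtains L :: "(complex ^ 'k) \<times> real \<Rightarrow> 'k pt" where "linear L" "\<And>x. norm (L x) = norm x" "\<And>x. L x \<bullet> \<nu> = 0"
proof -
  have "\<nu> \<noteq> 0" using assms by auto
  then have "dim (UNIV :: ((complex ^ 'k) \<times> real) set) = dim {x. \<nu> \<bullet> x = 0}"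
    by (simp add: dim_hyperplane)
  from isometries_subspaces[OF subspace_UNIV subspace_hyperplane this] obtain L :: "(complex ^ 'k) \<times> real \<Rightarrow> 'k pt" where
    "linear L" "range L = {x. \<nu> \<bullet> x = 0}" "\<And>x. norm (L x) = norm x" by (metis UNIV_I)
  then show ?thesis using that by (metis (mono_tags, lifting) inner_commute mem_Collect_eq rangeI)
qed

lemma hypersurface_measures_agree_on_graph:
  fixes \<sigma> \<tau> :: "'k::finite pt measure" and L :: "(complex ^ 'k) \<times> real \<Rightarrow> 'k pt"
  assumes "is_hypersurface_measure S \<sigma>" "is_hypersurface_measure S \<tau>"
    and L: "linear L" "\<And>x. norm (L x) = norm x" and \<nu>: "norm \<nu> = 1" "\<And>x. L x \<bullet> \<nu> = 0"
    and U: "open U" and k: "\<And>x. x \<in> U \<Longrightarrow> (k has_derivative D x) (at x)" "\<And>x. x \<in> U \<Longrightarrow> k x > 0" "\<And>v. continuous_on U (\<lambda>x. D x v)"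
    and sub: "(\<lambda>x. L x + sqrt (k x) *\<^sub>R \<nu>) ` U \<subseteq> S"
    and B: "B \<in> sets borel" "B \<subseteq> (\<lambda>x. L x + sqrt (k x) *\<^sub>R \<nu>) ` U"
  shows "emeasure \<sigma> B = emeasure \<tau> B"
proof -
  have *: "emeasure \<rho> B = (\<integral>\<^sup>+x\<in>U. ennreal (sqrt (1 + (norm (gradient (\<lambda>x. sqrt (k x)) x))\<^sup>2)) * indicator B (L x + sqrt (k x) *\<^sub>R \<nu>) \<partial>lborel)"
    if "is_hypersurface_measure S \<rho>" for \<rho>
    using conjunct2[OF conjunct2[OF that[unfolded is_hypersurface_measure_def]], rule_format, of L \<nu> U "\<lambda>x. sqrt (k x)" B]
      L \<nu> U sub B sqrt_graph_regular[OF k] by blast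
  show ?thesis unfolding *[OF assms(1)] *[OF assms(2)] ..
qed

text \<open>In a direction with vanishing \<open>w\<close> component the equation of the boundary is solved for a coordinate of \<open>z\<close> by one square root.\<close>

lemma hypersurface_measures_agree_horizontal:
  fixes \<sigma> \<tau> :: "'k::finite pt measure"
  assumes m: "m \<ge> 1" and \<sigma>\<tau>: "is_hypersurface_measure (egg_sphere m) \<sigma>" "is_hypersurface_measure (egg_sphere m) \<tau>"
    and \<nu>: "norm \<nu> = 1" "snd \<nu> = 0"
    and B: "B \<in> sets borel" "B \<subseteq> {p \<in> egg_sphere m. p \<bullet> \<nu> > 0}"
  shows "emeasure \<sigma> B = emeasure \<tau> B"
proof -
  obtain L :: "(complex ^ 'k) \<times> real \<Rightarrow> 'k pt" where L: "linear L" "\<And>x. norm (L x) = norm x" "\<And>x. L x \<bullet> \<nu> = 0"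
    by (rule hyperplane_isometry_exists[OF \<nu>(1)]) blast
  interpret hyperplane_coordinates L \<nu> by (rule hyperplane_coordinates.intro[OF L(1,2) \<nu>(1) L(3)]) simp
  have bl: "bounded_linear L" using L(1) by (simp add: linear_conv_bounded_linear)
  have cL: "continuous_on A L" for A by (rule linear_continuous_on[OF bl])
  let ?k = "\<lambda>x. 1 - egg_norm m (L x)"
  let ?U = "{x. egg_norm m (L x) < 1}"
  have N: "egg_norm m (L x + y *\<^sub>R \<nu>) = egg_norm m (L x) + y\<^sup>2" for x y
  proof -
    have "fst \<nu> \<bullet> fst \<nu> = 1" using unit_inner \<nu>(2) by (simp add: inner_prod_def)
    moreover have "fst (L x) \<bullet> fst \<nu> = 0" using L(3)[of x] \<nu>(2) by (simp add: inner_prod_def)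
    ultimately have "(norm (fst (L x) + y *\<^sub>R fst \<nu>))\<^sup>2 = (norm (fst (L x)))\<^sup>2 + y\<^sup>2"
      unfolding power2_norm_eq_inner by (simp add: inner_add_left inner_add_right inner_commute power2_eq_square)
    then show ?thesis using \<nu>(2) by (simp add: egg_norm_def)
  qed
  show ?thesis
  proof (rule hypersurface_measures_agree_on_graph[OF \<sigma>\<tau> L(1,2) \<nu>(1) L(3)])
    show "open ?U" by (intro open_Collect_less continuous_intros cL)
    show "(?k has_derivative (\<lambda>v. - (egg_grad m (L x) \<bullet> L v))) (at x)" for x
    proof -
      have "((\<lambda>x. defining_fun m (L x)) has_derivative (\<lambda>v. egg_grad m (L x) \<bullet> L v)) (at x)"
        using diff_chain_at[OF bounded_linear_imp_has_derivative[OF bl] has_derivative_defining_fun[OF m]] by (simp add: o_def)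
      from has_derivative_minus[OF this] show ?thesis by (simp add: defining_fun_def egg_norm_def algebra_simps)
    qed
    show "continuous_on ?U (\<lambda>x. - (egg_grad m (L x) \<bullet> L v))" for v
      unfolding egg_grad_def by (intro continuous_intros cL)
    show "(\<lambda>x. L x + sqrt (?k x) *\<^sub>R \<nu>) ` ?U \<subseteq> egg_sphere m" by (auto simp: egg_sphere_def N)
    show "B \<subseteq> (\<lambda>x. L x + sqrt (?k x) *\<^sub>R \<nu>) ` ?U"
    proof
      fix p assume "p \<in> B"
      then have p: "egg_norm m p = 1" "p \<bullet> \<nu> > 0" using B by (auto simp: egg_sphere_def)
      obtain x where x: "p = L x + (p \<bullet> \<nu>) *\<^sub>R \<nu>" by (rule decompose)
      have "1 = egg_norm m (L x) + (p \<bullet> \<nu>)\<^sup>2" using p(1) N[of x "p \<bullet> \<nu>"] x by simp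
      then have "?k x = (p \<bullet> \<nu>)\<^sup>2" by simp
      then have "sqrt (?k x) = p \<bullet> \<nu>" "?k x > 0" using p(2) by (auto simp: real_sqrt_unique)
      then show "p \<in> (\<lambda>x. L x + sqrt (?k x) *\<^sub>R \<nu>) ` ?U" using x by (intro image_eqI[of _ _ x]) auto
    qed
  qed (use B in auto)
qed

text \<open>In a direction of the \<open>w\<close> plane the equation is first solved for \<open>\<bar>w\<bar>\<close> by a root of order \<open>m\<close>, and then for one real coordinate.\<close>

lemma hypersurface_measures_agree_vertical:
  fixes \<sigma> \<tau> :: "'k::finite pt measure"
  assumes m: "m \<ge> 1" and \<sigma>\<tau>: "is_hypersurface_measure (egg_sphere m) \<sigma>" "is_hypersurface_measure (egg_sphere m) \<tau>"
    and \<nu>: "norm \<nu> = 1" "fst \<nu> = 0"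
    and B: "B \<in> sets borel" "B \<subseteq> {p \<in> egg_sphere m. p \<bullet> \<nu> > 0}"
  shows "emeasure \<sigma> B = emeasure \<tau> B"
proof -
  obtain L :: "(complex ^ 'k) \<times> real \<Rightarrow> 'k pt" where L: "linear L" "\<And>x. norm (L x) = norm x" "\<And>x. L x \<bullet> \<nu> = 0"
    by (rule hyperplane_isometry_exists[OF \<nu>(1)]) blast
  interpret hyperplane_coordinates L \<nu> by (rule hyperplane_coordinates.intro[OF L(1,2) \<nu>(1) L(3)]) simp
  have bl: "bounded_linear L" using L(1) by (simp add: linear_conv_bounded_linear)
  have cL: "continuous_on A L" for A by (rule linear_continuous_on[OF bl])
  let ?a = "\<lambda>x. 1 - fst (L x) \<bullet> fst (L x)"
  let ?k = "\<lambda>x. ?a x powr (1 / real m) - snd (L x) \<bullet> snd (L x)"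
  let ?D = "\<lambda>x v. 1 / real m * ?a x powr (1 / real m - 1) * (- (2 * (fst (L x) \<bullet> fst (L v)))) - 2 * (snd (L x) \<bullet> snd (L v))"
  let ?U = "{x. ?a x > 0} \<inter> {x. (snd (L x) \<bullet> snd (L x)) ^ m < ?a x}"
  have N: "egg_norm m (L x + y *\<^sub>R \<nu>) = fst (L x) \<bullet> fst (L x) + (snd (L x) \<bullet> snd (L x) + y\<^sup>2) ^ m" for x y
  proof -
    have "snd \<nu> \<bullet> snd \<nu> = 1" using unit_inner \<nu>(2) by (simp add: inner_prod_def)
    moreover have "snd (L x) \<bullet> snd \<nu> = 0" using L(3)[of x] \<nu>(2) by (simp add: inner_prod_def)
    ultimately have "(norm (snd (L x) + y *\<^sub>R snd \<nu>))\<^sup>2 = snd (L x) \<bullet> snd (L x) + y\<^sup>2"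
      unfolding power2_norm_eq_inner by (simp add: inner_add_left inner_add_right inner_commute power2_eq_square)
    then show ?thesis using \<nu>(2) by (simp add: egg_norm_def power2_norm_eq_inner power_mult)
  qed
  have root: "(s powr (1 / real m)) ^ m = s" "t \<ge> 0 \<Longrightarrow> t ^ m < s \<longleftrightarrow> t < s powr (1 / real m)" "t \<ge> 0 \<Longrightarrow> (t ^ m) powr (1 / real m) = t" 
    if "s > 0" for s t :: real
  proof -
    show 1: "(s powr (1 / real m)) ^ m = s" using that m by (simp add: powr_power)
    show "t ^ m < s \<longleftrightarrow> t < s powr (1 / real m)" if "t \<ge> 0"
      using power_mono_iff[of t "s powr (1 / real m)" m] power_strict_mono[of t "s powr (1 / real m)" m] m that 1
      by (metis linorder_not_le less_le powr_ge_zero power_mono_iff zero_less_iff_neq_zero not_one_le_zero)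
    show "(t ^ m) powr (1 / real m) = t" if "t \<ge> 0"
      using that m by (cases "t = 0") (auto simp: powr_realpow[symmetric] powr_powr)
  qed
  show ?thesis
  proof (rule hypersurface_measures_agree_on_graph[OF \<sigma>\<tau> L(1,2) \<nu>(1) L(3)])
    show "open ?U" by (intro open_Int open_Collect_less continuous_intros cL)
    show "(?k has_derivative ?D x) (at x)" if "x \<in> ?U" for x
    proof -
      have dL: "(L has_derivative L) (at x)" by (rule bounded_linear_imp_has_derivative[OF bl])
      have "(?a has_derivative (\<lambda>v. - (2 * (fst (L x) \<bullet> fst (L v))))) (at x)"
        by (rule derivative_eq_intros dL refl | simp)+ (simp add: inner_commute)
      from diff_chain_at[OF this, of "\<lambda>a. a powr (1 / real m)" "(*) (1 / real m * ?a x powr (1 / real m - 1))"]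
      have "((\<lambda>x. ?a x powr (1 / real m)) has_derivative (\<lambda>v. 1 / real m * ?a x powr (1 / real m - 1) * (- (2 * (fst (L x) \<bullet> fst (L v)))))) (at x)"
        using has_real_derivative_powr[of "?a x" "1 / real m"] that by (simp add: has_field_derivative_def o_def)
      moreover have "((\<lambda>x. snd (L x) \<bullet> snd (L x)) has_derivative (\<lambda>v. 2 * (snd (L x) \<bullet> snd (L v)))) (at x)"
        by (rule derivative_eq_intros dL refl | simp)+ (simp add: inner_commute)
      ultimately show ?thesis by (rule has_derivative_diff)
    qed
    show "continuous_on ?U (\<lambda>x. ?D x v)" for v
      by (intro continuous_intros cL) auto
    show "?k x > 0" if "x \<in> ?U" for x using that root(2)[of "?a x" "snd (L x) \<bullet> snd (L x)"] by auto
    show "(\<lambda>x. L x + sqrt (?k x) *\<^sub>R \<nu>) ` ?U \<subseteq> egg_sphere m"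
    proof (rule image_subsetI)
      fix x assume "x \<in> ?U"
      then have x: "?a x > 0" "(snd (L x) \<bullet> snd (L x)) ^ m < ?a x" by auto
      then have "?k x \<ge> 0" using root(2)[of "?a x" "snd (L x) \<bullet> snd (L x)"] by auto
      then show "L x + sqrt (?k x) *\<^sub>R \<nu> \<in> egg_sphere m"
        using root(1)[OF x(1)] by (simp add: egg_sphere_def N)
    qed
    show "B \<subseteq> (\<lambda>x. L x + sqrt (?k x) *\<^sub>R \<nu>) ` ?U"
    proof
      fix p assume "p \<in> B"
      then have p: "egg_norm m p = 1" "p \<bullet> \<nu> > 0" using B by (auto simp: egg_sphere_def)
      obtain x where x: "p = L x + (p \<bullet> \<nu>) *\<^sub>R \<nu>" by (rule decompose)
      let ?b = "snd (L x) \<bullet> snd (L x)"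
      have e: "?a x = (?b + (p \<bullet> \<nu>)\<^sup>2) ^ m" using p(1) N[of x "p \<bullet> \<nu>"] x by simp
      have "?b + (p \<bullet> \<nu>)\<^sup>2 > 0" using p(2) by (simp add: add_nonneg_pos)
      then have a: "?a x > 0" unfolding e by simp
      have "?b ^ m < ?a x" unfolding e using p(2) m by (intro power_strict_mono) auto
      moreover have "?a x powr (1 / real m) = ?b + (p \<bullet> \<nu>)\<^sup>2" unfolding e using root(3)[OF a, of "?b + (p \<bullet> \<nu>)\<^sup>2"] by simp
      then have "sqrt (?k x) = p \<bullet> \<nu>" using p(2) by simp
      ultimately show "p \<in> (\<lambda>x. L x + sqrt (?k x) *\<^sub>R \<nu>) ` ?U" using x a by (intro image_eqI[of _ _ x]) auto
    qed
  qed (use B in auto)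
qed

text \<open>The open half-boundaries facing the basis directions and their negatives cover the boundary, and on each of them the measure is prescribed by a single graph.\<close>

lemma hypersurface_measure_unique:
  fixes \<sigma> \<tau> :: "'k::finite pt measure"
  assumes m: "m \<ge> 1" and \<sigma>\<tau>: "is_hypersurface_measure (egg_sphere m) \<sigma>" "is_hypersurface_measure (egg_sphere m) \<tau>"
  shows "\<sigma> = \<tau>"
proof (rule measure_eqI)
  have sets: "sets \<sigma> = sets borel" "sets \<tau> = sets borel" and null: "emeasure \<sigma> (- egg_sphere m) = 0" "emeasure \<tau> (- egg_sphere m) = 0"
    using \<sigma>\<tau> by (auto simp: is_hypersurface_measure_def)
  show "sets \<sigma> = sets \<tau>" by (simp add: sets)
  fix B assume "B \<in> sets \<sigma>"
  then have B[measurable]: "B \<in> sets borel" by (simp add: sets)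
  let ?G = "\<lambda>\<nu>::'k pt. {p \<in> egg_sphere m. p \<bullet> \<nu> > 0}"
  let ?N = "Basis \<union> uminus ` Basis :: 'k pt set"
  have meas: "?G \<nu> \<in> sets borel" for \<nu>
    using borel_egg_sphere[of m] by (auto intro!: pred_intros_logic simp: pred_def) 
  have "emeasure \<sigma> (B \<inter> egg_sphere m) = emeasure \<tau> (B \<inter> egg_sphere m)"
  proof (rule emeasure_eq_on_cover[where \<G> = "?G ` ?N" and M = borel])
    show "emeasure \<sigma> C = emeasure \<tau> C" if asm: "G \<in> ?G ` ?N" "C \<in> sets borel" "C \<subseteq> G" for G C
    proof -
      obtain \<nu> where G: "G = ?G \<nu>" and "\<nu> \<in> ?N" using asm(1) by (rule imageE)
      then have \<nu>: "\<nu> \<in> ?N" "C \<subseteq> ?G \<nu>" using asm(3) by simp_all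
      have "norm \<nu> = 1" using \<nu>(1) by (elim UnE imageE) simp_all
      moreover have "fst \<nu> = 0 \<or> snd \<nu> = 0" using \<nu>(1) by (auto simp: Basis_prod_def)
      ultimately show ?thesis
        using hypersurface_measures_agree_horizontal[OF m \<sigma>\<tau> _ _ asm(2) \<nu>(2)] hypersurface_measures_agree_vertical[OF m \<sigma>\<tau> _ _ asm(2) \<nu>(2)] by blast
    qed
    show "B \<inter> egg_sphere m \<subseteq> \<Union> (?G ` ?N)"
    proof
      fix p assume p: "p \<in> B \<inter> egg_sphere m"
      then have "p \<noteq> 0" using egg_norm_eq_0[OF m, of "0 :: 'k pt"] by (auto simp: egg_sphere_def)
      then obtain b where b: "b \<in> Basis" "p \<bullet> b \<noteq> 0" using euclidean_all_zero_iff by blast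
      then have "p \<bullet> b > 0 \<or> p \<bullet> (- b) > 0" by auto
      then show "p \<in> \<Union> (?G ` ?N)" using p b(1) by blast
    qed
    show "G \<in> sets borel" if asm: "G \<in> ?G ` ?N" for G using asm meas by (elim imageE) simp
    show "finite (?G ` ?N)" by simp
  qed (simp_all add: sets)
  moreover have "emeasure \<kappa> B = emeasure \<kappa> (B \<inter> egg_sphere m)" if "sets \<kappa> = sets borel" "emeasure \<kappa> (- egg_sphere m) = 0" for \<kappa> :: "'k pt measure"
  proof (rule emeasure_eq_AE)
    have "- egg_sphere m \<in> null_sets \<kappa>" using that by (auto simp: null_sets_def)
    then show "AE x in \<kappa>. x \<in> B \<longleftrightarrow> x \<in> B \<inter> egg_sphere m" by (rule AE_I') auto
  qed (use that in auto)
  ultimately show "emeasure \<sigma> B = emeasure \<tau> B" using sets null by metis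
qed

theorem hypersurface_measure_eq_sphere_measure:
  assumes "m \<ge> 1" "\<theta> \<ge> 0"
  shows "hypersurface_measure (frontier (egg m)) = (sphere_measure m \<theta> :: 'k::finite pt measure)"
  unfolding hypersurface_measure_def frontier_egg[OF assms(1)]
  using sphere_measure_is_hypersurface_measure[OF assms] hypersurface_measure_unique[OF assms(1)]
  by (intro the_equality)

section \<open>Complex Hessians of functions of the two radii\<close>

text \<open>The \<open>j\<close>-th complex coordinate of a point, in the indexing of \<open>coord_vec\<close>.\<close>

fun coord :: "'k option \<Rightarrow> 'k::finite pt \<Rightarrow> complex" where
  "coord (Some l) p = fst p $ l"
| "coord None p = snd p"

text \<open>Selects between a quantity for the \<open>z\<close> block and one for the \<open>w\<close> index.\<close>

fun block :: "'k option \<Rightarrow> 'a \<Rightarrow> 'a \<Rightarrow> 'a" where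
  "block (Some l) a b = a"
| "block None a b = b"

lemma partial_deriv_eq:
  fixes f :: "'k::finite pt \<Rightarrow> complex"
  assumes "(f has_derivative D) (at p)"
  shows "partial_deriv v f p = D v"
proof -
  have 1: "((\<lambda>t::real. p + t *\<^sub>R v) has_derivative (\<lambda>t. t *\<^sub>R v)) (at 0)"
    by (auto intro!: derivative_eq_intros)
  have "(f has_derivative D) (at (p + 0 *\<^sub>R v))" using assms by simp
  from diff_chain_at[OF 1 this] have "((\<lambda>t::real. f (p + t *\<^sub>R v)) has_derivative (\<lambda>t. D (t *\<^sub>R v))) (at 0)"
    by (simp add: o_def)
  also have "(\<lambda>t. D (t *\<^sub>R v)) = (\<lambda>t. t *\<^sub>R D v)"
    using has_derivative_linear[OF assms] by (simp add: linear_scale)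
  finally show ?thesis unfolding partial_deriv_def by (intro vector_derivative_at) (simp add: has_vector_derivative_def)
qed

lemma wirt_eq:
  assumes "(f has_derivative D) (at p)"
  shows "wirt j f p = (D (coord_vec j 1) - \<i> * D (coord_vec j \<i>)) / 2"
    "wirt_bar j f p = (D (coord_vec j 1) + \<i> * D (coord_vec j \<i>)) / 2"
  by (simp_all add: wirt_def wirt_bar_def partial_deriv_eq[OF assms])

text \<open>All functions in play depend on \<open>p\<close> only through \<open>\<bar>z\<bar>\<^sup>2\<close> and \<open>\<bar>w\<bar>\<^sup>2\<close>; \<open>a\<close> and \<open>b\<close> are the partial derivatives in these two variables.\<close>

definition radial_deriv :: "('k::finite pt \<Rightarrow> real) \<Rightarrow> 'k pt \<Rightarrow> real \<Rightarrow> real \<Rightarrow> bool" where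
  "radial_deriv f p a b \<longleftrightarrow> (f has_derivative (\<lambda>v. 2 * a * (fst p \<bullet> fst v) + 2 * b * (snd p \<bullet> snd v))) (at p)"

lemma radial_deriv_const: "radial_deriv (\<lambda>_. c) p 0 0"
  by (simp add: radial_deriv_def)

lemma radial_deriv_norm_fst: "radial_deriv (\<lambda>q. (norm (fst q))\<^sup>2) p 1 0"
  unfolding radial_deriv_def power2_norm_eq_inner
  by (rule derivative_eq_intros refl)+ (simp add: inner_commute)

lemma radial_deriv_norm_snd: "radial_deriv (\<lambda>q. (norm (snd q))\<^sup>2) p 0 1"
  unfolding radial_deriv_def power2_norm_eq_inner
  by (rule derivative_eq_intros refl)+ (simp add: inner_commute)

lemma radial_deriv_add: "radial_deriv f p a b \<Longrightarrow> radial_deriv g p c d \<Longrightarrow> radial_deriv (\<lambda>q. f q + g q) p (a + c) (b + d)"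
  unfolding radial_deriv_def by (drule (1) has_derivative_add) (simp add: algebra_simps)

lemma radial_deriv_diff: "radial_deriv f p a b \<Longrightarrow> radial_deriv g p c d \<Longrightarrow> radial_deriv (\<lambda>q. f q - g q) p (a - c) (b - d)"
  unfolding radial_deriv_def by (drule (1) has_derivative_diff) (simp add: algebra_simps)

lemma radial_deriv_mult: "radial_deriv f p a b \<Longrightarrow> radial_deriv g p c d \<Longrightarrow>
    radial_deriv (\<lambda>q. f q * g q) p (f p * c + a * g p) (f p * d + b * g p)"
  unfolding radial_deriv_def by (drule (1) has_derivative_mult) (simp add: algebra_simps)

lemma radial_deriv_chain:
  assumes "radial_deriv f p a b" "(g has_real_derivative g') (at (f p))"
  shows "radial_deriv (\<lambda>q. g (f q)) p (g' * a) (g' * b)"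
  using diff_chain_at[OF assms(1)[unfolded radial_deriv_def] assms(2)[unfolded has_field_derivative_def]]
  by (simp add: radial_deriv_def o_def algebra_simps)

lemma radial_deriv_transform:
  "radial_deriv f p a b \<Longrightarrow> open W \<Longrightarrow> p \<in> W \<Longrightarrow> (\<And>q. q \<in> W \<Longrightarrow> f q = g q) \<Longrightarrow> radial_deriv g p a b"
  unfolding radial_deriv_def by (rule has_derivative_transform_within_open)

lemma radial_deriv_eq: "radial_deriv f p a b \<Longrightarrow> a = a' \<Longrightarrow> b = b' \<Longrightarrow> radial_deriv f p a' b'" by simp

lemma inner_coord_vec:
  "fst p \<bullet> fst (coord_vec j c) = block j (coord j p \<bullet> c) 0"
  "snd p \<bullet> snd (coord_vec j c) = block j 0 (coord j p \<bullet> c)"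
  by (cases j; simp add: inner_axis)+

lemma
  assumes "radial_deriv f p a b"
  shows wirt_radial: "wirt j (\<lambda>q. complex_of_real (f q)) p = of_real (block j a b) * cnj (coord j p)"
    and wirt_bar_radial: "wirt_bar j (\<lambda>q. complex_of_real (f q)) p = of_real (block j a b) * coord j p"
proof -
  have d: "((\<lambda>q. complex_of_real (f q)) has_derivative (\<lambda>v. of_real (2 * a * (fst p \<bullet> fst v) + 2 * b * (snd p \<bullet> snd v)))) (at p)"
    using assms unfolding radial_deriv_def by (rule has_derivative_of_real)
  show "wirt j (\<lambda>q. complex_of_real (f q)) p = of_real (block j a b) * cnj (coord j p)"
    by (subst wirt_eq[OF d], cases j) (simp_all add: inner_coord_vec complex_inner_1_right complex_inner_i_right complex_eq_iff del: coord_vec.simps)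
  show "wirt_bar j (\<lambda>q. complex_of_real (f q)) p = of_real (block j a b) * coord j p"
    by (subst wirt_eq[OF d], cases j) (simp_all add: inner_coord_vec complex_inner_1_right complex_inner_i_right complex_eq_iff del: coord_vec.simps)
qed

lemma has_derivative_coord: "(coord l has_derivative coord l) (at p)"
proof (cases l)
  case (Some i)
  have "coord l = (\<lambda>p. fst p $ i)" by (auto simp: Some)
  then show ?thesis by (simp add: bounded_linear_imp_has_derivative[OF bounded_linear_compose[OF bounded_linear_vec_nth bounded_linear_fst]])
next
  case None
  have "coord l = snd" by (auto simp: None)
  then show ?thesis by (simp add: bounded_linear_imp_has_derivative[OF bounded_linear_snd])
qed

lemma coord_coord_vec: "coord l (coord_vec j c) = (if j = l then c else 0)"
  by (cases l; cases j) (auto simp: axis_def)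

text \<open>For \<open>f = \<phi>(\<bar>z\<bar>\<^sup>2, \<bar>w\<bar>\<^sup>2)\<close> the chain rule gives a rank-two part from second derivatives and a diagonal part from first derivatives.\<close>

theorem complex_hessian_radial:
  assumes W: "open W" "p \<in> W"
    and f: "\<And>q. q \<in> W \<Longrightarrow> radial_deriv f q (f1 q) (f2 q)"
    and f1: "radial_deriv f1 p f11 f12" and f2: "radial_deriv f2 p f21 f22"
  shows "complex_hessian f p $ j $ l = of_real (block l (block j f11 f12) (block j f21 f22)) * cnj (coord j p) * coord l p
     + (if j = l then of_real (block l (f1 p) (f2 p)) else 0)"
proof -
  let ?g = "\<lambda>q. block l (f1 q) (f2 q)"
  have g: "radial_deriv ?g p (block l f11 f21) (block l f12 f22)"
    using f1 f2 by (cases l) auto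
  let ?D = "\<lambda>v. 2 * block l f11 f21 * (fst p \<bullet> fst v) + 2 * block l f12 f22 * (snd p \<bullet> snd v)"
  have "((\<lambda>q. complex_of_real (?g q)) has_derivative (\<lambda>v. of_real (?D v))) (at p)"
    using g unfolding radial_deriv_def by (rule has_derivative_of_real)
  from has_derivative_mult[OF this has_derivative_coord]
  have d: "((\<lambda>q. of_real (?g q) * coord l q) has_derivative (\<lambda>v. of_real (?g p) * coord l v + of_real (?D v) * coord l p)) (at p)" .
  have "wirt_bar l (\<lambda>q. complex_of_real (f q)) q = of_real (?g q) * coord l q" if "q \<in> W" for q
    by (rule wirt_bar_radial[OF f[OF that]])
  then have d': "(wirt_bar l (\<lambda>q. complex_of_real (f q)) has_derivative (\<lambda>v. of_real (?g p) * coord l v + of_real (?D v) * coord l p)) (at p)"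
    by (intro has_derivative_transform_within_open[OF d W]) simp
  show ?thesis
    unfolding complex_hessian_def 
    by (simp add: wirt_eq(1)[OF d'] del: coord_vec.simps, cases j; cases l) 
      (simp_all add: coord_coord_vec inner_coord_vec complex_inner_1_right complex_inner_i_right complex_eq_iff algebra_simps del: coord_vec.simps)
qed

section \<open>Determinants of bordered matrices\<close>

lemma sign_map_option:
  fixes q :: "'k::finite \<Rightarrow> 'k"
  assumes "q permutes UNIV"
  shows "map_option q permutes UNIV \<and> sign (map_option q) = sign q"
  using assms finite
proof (induction rule: permutes_induct)
  case id
  show ?case unfolding option.map_id0 by (simp only: permutes_id sign_id simp_thms)
next
  case (swap a b p)
  have eq: "map_option (Transposition.transpose a b \<circ> p) = Transposition.transpose (Some a) (Some b) \<circ> map_option p"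
  proof
    fix x show "map_option (Transposition.transpose a b \<circ> p) x = (Transposition.transpose (Some a) (Some b) \<circ> map_option p) x"
      by (cases x) (auto simp: Transposition.transpose_def)
  qed
  have perm: "permutation p" "permutation (map_option p)" using swap by (auto simp: permutation_permutes)
  have "Transposition.transpose (Some a) (Some b) \<circ> map_option p permutes UNIV"
    using swap by (intro permutes_compose permutes_swap_id) auto
  moreover have "sign (Transposition.transpose (Some a) (Some b) \<circ> map_option p) = sign (Transposition.transpose a b \<circ> p)"
    unfolding sign_compose[OF permutation_swap_id perm(1)] sign_compose[OF permutation_swap_id perm(2)] sign_swap_id
    using swap by simp
  ultimately show ?case unfolding eq by blast
qed

lemma det_option_block:
  fixes A :: "'a::comm_ring_1 ^ ('k::finite option) ^ ('k option)"
  assumes "\<And>i. A $ Some i $ None = 0"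
  shows "det A = A $ None $ None * det (\<chi> i j. A $ Some i $ Some j)"
proof -
  let ?t = "\<lambda>p. of_int (sign p) * (\<Prod>i\<in>UNIV. A $ i $ p i)"
  let ?P = "{p. p permutes (UNIV :: 'k option set)}"
  let ?Q = "{q. q permutes (UNIV :: 'k set)}"
  have sub: "map_option ` ?Q \<subseteq> ?P" using sign_map_option by blast
  have zero: "?t p = 0" if p: "p \<in> ?P - map_option ` ?Q" for p
  proof -
    have bij: "bij p" using p permutes_bij by blast
    have "p None \<noteq> None"
    proof
      assume N: "p None = None"
      have S: "p (Some i) \<noteq> None" for i using N bij by (metis bij_pointE option.distinct(1))
      define q where "q i = the (p (Some i))" for i
      have pq: "p = map_option q" using N S by (intro ext, case_tac x) (auto simp: q_def)
      have "inj q" using bij pq by (metis (no_types, opaque_lifting) bij_is_inj inj_def option.inject option.map(2))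
      then have "q permutes UNIV" using finite_UNIV_inj_surj[of q] by (intro bij_imp_permutes) (auto simp: bij_betw_def)
      then show False using p pq by blast
    qed
    obtain x where x: "p x = None" using bij by (metis bij_pointE)
    then obtain i where "x = Some i" using \<open>p None \<noteq> None\<close> by (cases x) auto
    then have "A $ x $ p x = 0" using x assms by simp
    then have "(\<Prod>i\<in>UNIV. A $ i $ p i) = 0" by (intro prod_zero) auto
    then show ?thesis by simp
  qed
  have inj: "inj_on map_option ?Q"
    by (intro inj_onI ext) (metis option.inject option.map(2))
  have prod: "(\<Prod>i\<in>UNIV. A $ i $ map_option q i) = A $ None $ None * (\<Prod>i\<in>UNIV. A $ Some i $ Some (q i))" for q :: "'k \<Rightarrow> 'k"
    by (simp add: UNIV_option_conv prod.reindex)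
  have "det A = sum ?t ?P" by (simp add: det_def)
  also have "\<dots> = sum ?t (map_option ` ?Q)"
    by (rule sum.mono_neutral_right[OF _ sub]) (use zero in \<open>auto simp: finite_permutations\<close>)
  also have "\<dots> = (\<Sum>q\<in>?Q. ?t (map_option q))" by (simp add: sum.reindex[OF inj])
  also have "\<dots> = (\<Sum>q\<in>?Q. A $ None $ None * (of_int (sign q) * (\<Prod>i\<in>UNIV. A $ Some i $ Some (q i))))"
    by (intro sum.cong) (auto simp: prod conjunct2[OF sign_map_option] mult_ac)
  also have "\<dots> = A $ None $ None * det (\<chi> i j. A $ Some i $ Some j)"
    by (simp add: det_def sum_distrib_left)
  finally show ?thesis .
qed

lemma sum_option: "(\<Sum>x\<in>UNIV. f x) = f None + (\<Sum>i\<in>(UNIV::'k::finite set). f (Some i))"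
  by (simp add: UNIV_option_conv sum.reindex)

lemma sum_delta_mult:
  fixes f :: "'k::finite \<Rightarrow> 'a::comm_ring_1"
  shows "(\<Sum>k\<in>UNIV. (if i = k then 1 else 0) * f k) = f i" "(\<Sum>k\<in>UNIV. f k * (if k = i then g k else 0)) = f i * g i"
proof -
  have "(\<Sum>k\<in>UNIV. (if i = k then 1 else 0) * f k) = (\<Sum>k\<in>UNIV. if i = k then f k else 0)" by (rule sum.cong) auto
  then show "(\<Sum>k\<in>UNIV. (if i = k then 1 else 0) * f k) = f i" by (simp add: sum.delta')
  have "(\<Sum>k\<in>UNIV. f k * (if k = i then g k else 0)) = (\<Sum>k\<in>UNIV. if k = i then f k * g k else 0)" by (rule sum.cong) auto
  then show "(\<Sum>k\<in>UNIV. f k * (if k = i then g k else 0)) = f i * g i" by (simp add: sum.delta)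
qed

text \<open>One step of Gaussian elimination with the last coordinate as pivot.\<close>

lemma det_schur_None:
  fixes A :: "'a::field ^ ('k::finite option) ^ ('k option)"
  assumes a: "A $ None $ None \<noteq> 0"
  shows "det A = A $ None $ None * det (\<chi> i j. A $ Some i $ Some j - A $ Some i $ None * A $ None $ Some j / A $ None $ None)"
proof -
  define C :: "'a ^ ('k option) ^ ('k option)" where
    "C = (\<chi> i j. if i = j then 1 else if j = None then - A $ i $ None / A $ None $ None else 0)"
  have "(\<chi> i j. transpose C $ Some i $ Some j) = mat 1"
    by (simp add: vec_eq_iff transpose_def C_def mat_def eq_commute)
  then have "det (transpose C) = 1"
    by (subst det_option_block) (simp_all add: C_def transpose_def)
  then have "det C = 1" by (simp add: det_transpose)
  have C: "C $ None $ j = (if j = None then 1 else 0)" "C $ Some i $ None = - A $ Some i $ None / A $ None $ None" 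
    "C $ Some i $ Some k = (if i = k then 1 else 0)" for i j k
    by (auto simp: C_def)
  have CN: "(C ** A) $ None $ j = A $ None $ j" for j
    by (simp add: matrix_matrix_mult_def sum_option C)
  have CA: "(C ** A) $ Some i $ j = A $ Some i $ j - A $ Some i $ None * A $ None $ j / A $ None $ None" for i j
    by (simp add: matrix_matrix_mult_def sum_option C sum_delta_mult)
  note \<open>det C = 1\<close>
  then have "det A = det (C ** A)" by (simp add: det_mul)
  also have "\<dots> = (C ** A) $ None $ None * det (\<chi> i j. (C ** A) $ Some i $ Some j)"
    by (rule det_option_block) (use a in \<open>simp add: CA\<close>)
  also have "(\<chi> i j. (C ** A) $ Some i $ Some j) = (\<chi> i j. A $ Some i $ Some j - A $ Some i $ None * A $ None $ Some j / A $ None $ None)"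
    by (simp add: vec_eq_iff CA)
  finally show ?thesis by (simp add: CN)
qed

lemma det_diagonal_matrix: "det (\<chi> i j. if i = j then D i else (0::'a::comm_ring_1)) = (\<Prod>i\<in>(UNIV::'k::finite set). D i)"
  by (subst det_diagonal) auto

text \<open>The border is eliminated against the diagonal block.\<close>

lemma det_arrow:
  fixes D :: "'k::finite \<Rightarrow> 'a::field"
  assumes A: "\<And>i j. A $ Some i $ Some j = (if i = j then D i else 0)" and D: "\<And>i. D i \<noteq> 0"
  shows "det (A :: 'a ^ ('k option) ^ ('k option)) = (A $ None $ None - (\<Sum>i\<in>UNIV. A $ None $ Some i * A $ Some i $ None / D i)) * (\<Prod>i\<in>UNIV. D i)"
proof -
  define C :: "'a ^ ('k option) ^ ('k option)" where
    "C = (\<chi> i j. if i = j then 1 else if i = None then - A $ None $ j / D (the j) else 0)"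
  have "(\<chi> i j. C $ Some i $ Some j) = mat 1"
    by (simp add: vec_eq_iff C_def mat_def)
  then have "det C = 1"
    by (subst det_option_block) (simp_all add: C_def)
  have C: "C $ None $ None = 1" "C $ None $ Some j = - A $ None $ Some j / D j" "C $ Some i $ j' = (if j' = Some i then 1 else 0)" for i j j'
    by (auto simp: C_def)
  have CS: "(C ** A) $ Some i $ j = A $ Some i $ j" for i j
  proof -
    have "(\<Sum>k\<in>UNIV. (if k = i then 1 else 0) * A $ Some k $ j) = A $ Some i $ j"
      using sum_delta_mult(1)[of i "\<lambda>k. A $ Some k $ j"] by (simp add: eq_commute[of _ i])
    then show ?thesis by (simp add: matrix_matrix_mult_def sum_option C)
  qed
  have CNN: "(C ** A) $ None $ None = A $ None $ None - (\<Sum>i\<in>UNIV. A $ None $ Some i * A $ Some i $ None / D i)"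
    by (simp add: matrix_matrix_mult_def sum_option C sum_negf)
  have CNS: "(C ** A) $ None $ Some i = 0" for i
  proof -
    have "(\<Sum>k\<in>UNIV. (- A $ None $ Some k / D k) * (if k = i then D k else 0)) = (- A $ None $ Some i / D i) * D i"
      by (rule sum_delta_mult)
    then show ?thesis using D[of i] by (simp add: matrix_matrix_mult_def sum_option C A)
  qed
  have "det A = det (transpose (C ** A))" using \<open>det C = 1\<close> by (simp add: det_mul det_transpose)
  also have "\<dots> = transpose (C ** A) $ None $ None * det (\<chi> i j. transpose (C ** A) $ Some i $ Some j)"
    by (rule det_option_block) (simp add: transpose_def CNS)
  also have "transpose (C ** A) $ None $ None = A $ None $ None - (\<Sum>i\<in>UNIV. A $ None $ Some i * A $ Some i $ None / D i)"
    by (simp add: transpose_def CNN)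
  also have "(\<chi> i j. transpose (C ** A) $ Some i $ Some j) = (\<chi> i j. if i = j then D i else 0)"
    by (auto simp add: vec_eq_iff transpose_def CS A)
  finally show ?thesis by (simp add: det_diagonal_matrix)
qed

text \<open>The matrix determinant lemma, read off from two evaluations of one arrow determinant.\<close>

lemma det_scalar_plus_rank_one:
  fixes v w :: "'k::finite \<Rightarrow> 'a::field"
  assumes "c \<noteq> 0"
  shows "det (\<chi> i j. (if i = j then c else 0) + v i * w j) = c ^ CARD('k) * (1 + (\<Sum>i\<in>UNIV. v i * w i) / c)"
proof -
  define A :: "'a ^ ('k option) ^ ('k option)" where
    "A = (\<chi> i j. case i of None \<Rightarrow> (case j of None \<Rightarrow> 1 | Some b \<Rightarrow> - w b) | Some a \<Rightarrow> (case j of None \<Rightarrow> v a | Some b \<Rightarrow> if a = b then c else 0))"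
  have "det A = det (\<chi> i j. (if i = j then c else 0) + v i * w j)"
    by (subst det_schur_None) (auto simp: A_def intro!: arg_cong[of _ _ det] simp: vec_eq_iff)
  moreover have "det A = c ^ CARD('k) * (1 + (\<Sum>i\<in>UNIV. v i * w i) / c)"
    using assms by (subst det_arrow[where D = "\<lambda>_. c"]) (auto simp: A_def sum_negf sum_divide_distrib mult_ac)
  ultimately show ?thesis by simp
qed

section \<open>The Fefferman measure and its moments\<close>

lemma radial_deriv_norm_snd_power:
  "radial_deriv (\<lambda>q. ((norm (snd q))\<^sup>2) ^ k) p 0 (real k * ((norm (snd p))\<^sup>2) ^ (k - 1))"
proof -
  have "((\<lambda>x. x ^ k) has_real_derivative (real k * ((norm (snd p))\<^sup>2) ^ (k - 1))) (at ((norm (snd p))\<^sup>2))"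
    by (auto intro!: derivative_eq_intros)
  from radial_deriv_chain[OF radial_deriv_norm_snd this] show ?thesis by simp
qed

lemma radial_deriv_defining_fun:
  "radial_deriv (defining_fun m) p 1 (real m * ((norm (snd p))\<^sup>2) ^ (m - 1))"
proof -
  have "defining_fun m = (\<lambda>q::'a pt. ((norm (fst q))\<^sup>2 + ((norm (snd q))\<^sup>2) ^ m) - 1)"
    by (simp add: fun_eq_iff defining_fun_def power_mult)
  then show ?thesis
    using radial_deriv_diff[OF radial_deriv_add[OF radial_deriv_norm_fst radial_deriv_norm_snd_power[of m]] radial_deriv_const[of 1]] by simp
qed

lemma cnj_mult_self: "cnj z * z = of_real ((norm z)\<^sup>2)" "z * cnj z = of_real ((norm z)\<^sup>2)"
  by (simp_all only: complex_norm_square mult.commute)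

text \<open>In suitable order the bordered Hessian is an arrow matrix; on the boundary the two contributions combine because \<open>\<bar>z\<bar>\<^sup>2 + \<bar>w\<bar> ^ (2 * m) = 1\<close>.\<close>

lemma fefferman_M_sphere:
  fixes p :: "'k::finite pt"
  assumes m: "m \<ge> 1" and p: "p \<in> egg_sphere m"
  shows "fefferman_M (defining_fun m) p = (real m)\<^sup>2 * ((norm (snd p))\<^sup>2) ^ (m - 1)"
proof -
  define b where "b = (norm (snd p))\<^sup>2"
  define f2 where "f2 = real m * b ^ (m - 1)"
  define f22 where "f22 = real m * (real (m - 1) * b ^ (m - 1 - 1))"
  have r2: "radial_deriv (\<lambda>q::'k pt. real m * ((norm (snd q))\<^sup>2) ^ (m - 1)) p 0 f22"
    using radial_deriv_mult[OF radial_deriv_const[of "real m"] radial_deriv_norm_snd_power[of "m - 1" p]]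
    by (simp add: f22_def b_def)
  have hess: "wirt j (wirt_bar l (\<lambda>q. complex_of_real (defining_fun m q))) p = 
    of_real (block l (block j 0 0) (block j 0 f22)) * cnj (coord j p) * coord l p + (if j = l then of_real (block l 1 f2) else 0)" for j l
    using complex_hessian_radial[OF open_UNIV UNIV_I radial_deriv_defining_fun radial_deriv_const r2, of j l]
    by (simp add: complex_hessian_def f2_def b_def)
  have D: "f22 * b + f2 = (real m)\<^sup>2 * b ^ (m - 1)"
  proof (cases "m = 1")
    case False
    then obtain k where "m = Suc (Suc k)" using m by (metis One_nat_def Suc_le_D not0_implies_Suc)
    then show ?thesis by (simp add: f22_def f2_def power2_eq_square algebra_simps)
  qed (simp add: f22_def f2_def)
  define Dj where "Dj j = complex_of_real (block j 1 ((real m)\<^sup>2 * b ^ (m - 1)))" for j :: "'k option"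
  let ?B = "bordered_hessian (defining_fun m) p"
  note fd = radial_deriv_defining_fun[of m p, folded b_def, folded f2_def]
  have B: "?B $ None $ None = 0" "?B $ None $ Some l = of_real (block l 1 f2) * coord l p" 
      "?B $ Some j $ None = of_real (block j 1 f2) * cnj (coord j p)"
      "?B $ Some j $ Some l = (if j = l then Dj j else 0)" for j l
  proof -
    show "?B $ None $ None = 0" by (simp add: bordered_hessian_def)
    show "?B $ None $ Some l = of_real (block l 1 f2) * coord l p" "?B $ Some j $ None = of_real (block j 1 f2) * cnj (coord j p)"
      by (simp_all add: bordered_hessian_def wirt_radial[OF fd] wirt_bar_radial[OF fd])
    have "?B $ Some j $ Some l = of_real (block l (block j 0 0) (block j 0 f22)) * cnj (coord j p) * coord l p + (if j = l then of_real (block l 1 f2) else 0)"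
      by (simp add: bordered_hessian_def hess)
    also have "\<dots> = (if j = l then Dj j else 0)"
    proof (cases j; cases l)
      assume "j = None" "l = None"
      moreover have "of_real f22 * (cnj (snd p) * snd p) + of_real f2 = complex_of_real (f22 * b + f2)"
        by (simp only: cnj_mult_self b_def of_real_add of_real_mult)
      ultimately show ?thesis using D by (simp add: Dj_def mult.assoc del: of_real_add of_real_mult)
    qed (auto simp: Dj_def)
    finally show "?B $ Some j $ Some l = (if j = l then Dj j else 0)" .
  qed
  have "det ?B = - of_real ((real m)\<^sup>2 * b ^ (m - 1))"
  proof (cases "b ^ (m - 1) = 0")
    case True
    then have "f2 = 0" "Dj None = 0" by (simp_all add: f2_def Dj_def)
    then have "row (Some None) ?B = 0"
      unfolding row_def vec_eq_iff
    proof (intro allI)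
      fix i show "(\<chi> l. ?B $ Some None $ l) $ i = 0 $ i"
        using \<open>f2 = 0\<close> \<open>Dj None = 0\<close> by (cases i) (auto simp: B)
    qed
    then show ?thesis using True by (simp add: det_zero_row)
  next
    case False
    then have nz: "Dj j \<noteq> 0" for j using m by (cases j) (auto simp: Dj_def)
    have "det ?B = (?B $ None $ None - (\<Sum>i\<in>UNIV. ?B $ None $ Some i * ?B $ Some i $ None / Dj i)) * (\<Prod>i\<in>UNIV. Dj i)"
      by (rule det_arrow[OF B(4) nz])
    also have "(\<Prod>i\<in>UNIV. Dj i) = of_real ((real m)\<^sup>2 * b ^ (m - 1))"
      by (simp add: UNIV_option_conv prod.reindex Dj_def)
    also have "(\<Sum>i\<in>UNIV. ?B $ None $ Some i * ?B $ Some i $ None / Dj i) = 1"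
    proof -
      have "(\<Sum>i\<in>UNIV. ?B $ None $ Some (Some i) * ?B $ Some (Some i) $ None / Dj (Some i)) = of_real ((norm (fst p))\<^sup>2)"
        by (simp add: B Dj_def norm_vec_def L2_set_def sum_nonneg cnj_mult_self)
      moreover have "?B $ None $ Some None * ?B $ Some None $ None / Dj None = of_real (b ^ m)"
      proof -
        obtain k where k: "m = Suc k" using m by (cases m) auto
        have "?B $ None $ Some None * ?B $ Some None $ None = of_real (f2\<^sup>2) * of_real b"
        proof -
          have "?B $ None $ Some None * ?B $ Some None $ None = of_real f2 * of_real f2 * (snd p * cnj (snd p))" by (simp add: B)
          then show ?thesis by (simp only: cnj_mult_self b_def power2_eq_square of_real_mult)
        qed
        then have "?B $ None $ Some None * ?B $ Some None $ None / Dj None = of_real (f2\<^sup>2 * b / ((real m)\<^sup>2 * b ^ (m - 1)))"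
          by (simp add: Dj_def)
        also have "f2\<^sup>2 * b / ((real m)\<^sup>2 * b ^ (m - 1)) = b ^ m"
        proof -
          have "(c * B)\<^sup>2 * b / (c\<^sup>2 * B) = b * B" if "B \<noteq> 0" "c \<noteq> 0" for c B :: real
            using that by (simp add: power2_eq_square)
          from this[OF False, of "real m"] show ?thesis using m by (simp add: f2_def k)
        qed
        finally show ?thesis .
      qed
      ultimately have "(\<Sum>i\<in>UNIV. ?B $ None $ Some i * ?B $ Some i $ None / Dj i) = of_real (b ^ m + (norm (fst p))\<^sup>2)"
        by (simp add: sum_option)
      also have "b ^ m + (norm (fst p))\<^sup>2 = 1" using p by (simp add: egg_sphere_def egg_norm_def b_def power_mult)
      finally show ?thesis by simp
    qed
    finally show ?thesis by (simp add: B)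
  qed
  then show ?thesis by (simp add: fefferman_M_def b_def)
qed

definition fef_weight :: "nat \<Rightarrow> 'k::finite pt \<Rightarrow> real" where
  "fef_weight m p = ((real m)\<^sup>2 * ((norm (snd p))\<^sup>2) ^ (m - 1)) powr (1 / (real CARD('k) + 2))"

text \<open>The Fefferman measure in radial coordinates. In comparison with \<open>sphere_measure\<close> the length of the gradient has cancelled.\<close>

definition boundary_measure :: "nat \<Rightarrow> real \<Rightarrow> 'k::finite pt measure" where
  "boundary_measure m \<theta> = distr (density lborel (\<lambda>x. ennreal (fef_weight m (radial_proj m x) *
      (egg_norm m x powr \<theta> * exp (- egg_norm m x) / Gamma (real CARD('k) + 1 / real m + \<theta>))))) borel (radial_proj m)"

lemma borel_measurable_fef_weight [measurable]: "fef_weight m \<in> borel_measurable (borel :: 'k::finite pt measure)"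
  unfolding fef_weight_def by measurable

lemma fef_weight_nonneg: "fef_weight m p \<ge> 0" by (simp add: fef_weight_def)

lemma sets_boundary_measure [simp, measurable_cong]: "sets (boundary_measure m \<theta>) = sets borel"
  by (simp add: boundary_measure_def)

lemma space_boundary_measure [simp]: "space (boundary_measure m \<theta>) = UNIV"
  by (simp add: boundary_measure_def)

lemma nn_integral_boundary_measure:
  assumes [measurable]: "\<phi> \<in> borel_measurable borel"
  shows "(\<integral>\<^sup>+p. \<phi> p \<partial>(boundary_measure m \<theta> :: 'k::finite pt measure)) = 
    (\<integral>\<^sup>+x. ennreal (fef_weight m (radial_proj m x) * (egg_norm m x powr \<theta> * exp (- egg_norm m x) / Gamma (real CARD('k) + 1 / real m + \<theta>))) * \<phi> (radial_proj m x) \<partial>lborel)"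
  unfolding boundary_measure_def by (subst nn_integral_distr, simp, simp, subst nn_integral_density) auto

theorem fefferman_measure_eq:
  assumes m: "m \<ge> 1" and \<theta>: "\<theta> \<ge> 0"
  shows "(fefferman_measure m :: 'k::finite pt measure) = restrict_space (boundary_measure m \<theta>) (egg_sphere m)"
proof -
  let ?S = "egg_sphere m :: 'k pt set" and ?\<sigma> = "sphere_measure m \<theta> :: 'k pt measure"
  let ?g = "\<lambda>p::'k pt. ennreal (fef_weight m p / norm (egg_grad m p))"
  have "(fefferman_measure m :: 'k pt measure) = density (restrict_space ?\<sigma> ?S) (\<lambda>p. ennreal (fefferman_M (defining_fun m) p powr (1 / (real CARD('k option) + 1)) / norm (gradient (defining_fun m) p)))"
    using hypersurface_measure_eq_sphere_measure[OF assms, where 'k = 'k] by (simp only: fefferman_measure_def frontier_egg[OF m])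
  also have "\<dots> = density (restrict_space ?\<sigma> ?S) ?g"
  proof -
    have eq: "ennreal (fefferman_M (defining_fun m) p powr (1 / (real CARD('k option) + 1)) / norm (gradient (defining_fun m) p)) = ?g p" if "p \<in> ?S" for p
      using that m by (simp add: fefferman_M_sphere gradient_defining_fun fef_weight_def add.commute)
    have meas: "?g \<in> borel_measurable (restrict_space ?\<sigma> ?S)" by (intro measurable_restrict_space1) measurable
    show ?thesis
    proof (rule density_cong)
      show "(\<lambda>p. ennreal (fefferman_M (defining_fun m) p powr (1 / (real CARD('k option) + 1)) / norm (gradient (defining_fun m) p))) \<in> borel_measurable (restrict_space ?\<sigma> ?S)"
        by (rule measurable_cong[THEN iffD2, OF _ meas]) (use eq in \<open>auto simp: space_restrict_space\<close>)
      show "AE p in restrict_space ?\<sigma> ?S. ennreal (fefferman_M (defining_fun m) p powr (1 / (real CARD('k option) + 1)) / norm (gradient (defining_fun m) p)) = ?g p"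
        by (rule AE_I2) (use eq in \<open>auto simp: space_restrict_space\<close>)
    qed (rule meas)
  qed
  also have "\<dots> = restrict_space (boundary_measure m \<theta>) ?S"
  proof (rule measure_eqI)
    show "sets (density (restrict_space ?\<sigma> ?S) ?g) = sets (restrict_space (boundary_measure m \<theta>) ?S)"
      by (simp add: sets_restrict_space)
    fix A assume "A \<in> sets (density (restrict_space ?\<sigma> ?S) ?g)"
    then have A: "A \<in> sets borel" "A \<subseteq> ?S" "A \<in> sets (restrict_space ?\<sigma> ?S)"
      using borel_egg_sphere[of m] by (auto simp: sets_restrict_space)
    note [measurable] = A(1)
    have "emeasure (density (restrict_space ?\<sigma> ?S) ?g) A = (\<integral>\<^sup>+p. ?g p * indicator A p \<partial>restrict_space ?\<sigma> ?S)"
      using A(3) by (intro emeasure_density measurable_restrict_space1) auto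
    also have "\<dots> = (\<integral>\<^sup>+p. ?g p * indicator A p * indicator ?S p \<partial>?\<sigma>)"
      by (subst nn_integral_restrict_space) auto
    also have "\<dots> = (\<integral>\<^sup>+x. ennreal (norm (egg_grad m (radial_proj m x)) * (egg_norm m x powr \<theta> * exp (- egg_norm m x) / Gamma (real CARD('k) + 1 / real m + \<theta>))) *
       (?g (radial_proj m x) * indicator A (radial_proj m x) * indicator ?S (radial_proj m x)) \<partial>lborel)"
      by (rule nn_integral_sphere_measure) measurable
    also have "\<dots> = (\<integral>\<^sup>+x. ennreal (fef_weight m (radial_proj m x) * (egg_norm m x powr \<theta> * exp (- egg_norm m x) / Gamma (real CARD('k) + 1 / real m + \<theta>))) * indicator A (radial_proj m x) \<partial>lborel)"
    proof (rule nn_integral_cong_AE, use AE_lborel_singleton[of "0::'k pt"] in eventually_elim)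
      fix x :: "'k pt" assume x: "x \<noteq> 0"
      have S: "radial_proj m x \<in> ?S" by (rule radial_proj_in_sphere[OF m x])
      have "norm (egg_grad m (radial_proj m x)) \<noteq> 0" using egg_grad_nonzero[OF S m] by simp
      moreover have "Gamma (real CARD('k) + 1 / real m + \<theta>) > 0" using m \<theta> by (intro Gamma_real_pos) (simp add: add_pos_nonneg)
      ultimately show "ennreal (norm (egg_grad m (radial_proj m x)) * (egg_norm m x powr \<theta> * exp (- egg_norm m x) / Gamma (real CARD('k) + 1 / real m + \<theta>))) *
       (?g (radial_proj m x) * indicator A (radial_proj m x) * indicator ?S (radial_proj m x)) =
        ennreal (fef_weight m (radial_proj m x) * (egg_norm m x powr \<theta> * exp (- egg_norm m x) / Gamma (real CARD('k) + 1 / real m + \<theta>))) * indicator A (radial_proj m x)"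
        using S by (simp add: indicator_def ennreal_mult'[symmetric] fef_weight_nonneg)
    qed
    also have "\<dots> = (\<integral>\<^sup>+p. indicator A p \<partial>boundary_measure m \<theta>)"
      by (rule nn_integral_boundary_measure[symmetric]) simp
    also have "\<dots> = emeasure (restrict_space (boundary_measure m \<theta>) ?S) A"
      using A by (subst emeasure_restrict_space) auto
    finally show "emeasure (density (restrict_space ?\<sigma> ?S) ?g) A = emeasure (restrict_space (boundary_measure m \<theta>) ?S) A" .
  qed
  finally show ?thesis .
qed

lemma dilate_simps: "fst (dilate m s p) = s powr (1 / 2) *\<^sub>R fst p" "snd (dilate m s p) = s powr (1 / (2 * real m)) *\<^sub>R snd p"
  by (simp_all add: dilate_def)

lemma fef_weight_dilate:
  fixes p :: "'k::finite pt"
  assumes "m \<ge> 1" "s > 0"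
  shows "fef_weight m (dilate m s p) = s powr (1 / real m * ((real m - 1) / (real CARD('k) + 2))) * fef_weight m p"
proof -
  have "(norm (snd (dilate m s p)))\<^sup>2 = s powr (1 / real m) * (norm (snd p))\<^sup>2"
    using assms by (simp add: dilate_simps power_mult_distrib powr_power)
  then have "((norm (snd (dilate m s p)))\<^sup>2) ^ (m - 1) = s powr (1 / real m * (real m - 1)) * ((norm (snd p))\<^sup>2) ^ (m - 1)"
    using assms by (simp add: power_mult_distrib powr_power of_nat_diff)
  then have "fef_weight m (dilate m s p) = (s powr (1 / real m * (real m - 1)) * ((real m)\<^sup>2 * ((norm (snd p))\<^sup>2) ^ (m - 1))) powr (1 / (real CARD('k) + 2))"
    by (simp add: fef_weight_def mult_ac)
  also have "\<dots> = (s powr (1 / real m * (real m - 1))) powr (1 / (real CARD('k) + 2)) * fef_weight m p"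
    unfolding fef_weight_def by (rule powr_mult)
  also have "(s powr (1 / real m * (real m - 1))) powr (1 / (real CARD('k) + 2)) = s powr (1 / real m * ((real m - 1) / (real CARD('k) + 2)))"
    by (simp add: powr_powr)
  finally show ?thesis .
qed

text \<open>The argument of the Gamma function contributed by the variable \<open>w\<close>, including the power of \<open>\<bar>w\<bar>\<close> in the Fefferman density.\<close>

definition moment_exp :: "'k::finite itself \<Rightarrow> nat \<Rightarrow> nat \<Rightarrow> real" where
  "moment_exp TYPE('k) m k = (real k + (real m - 1) / (real CARD('k) + 2) + 1) / real m"

definition moment_const :: "'k::finite itself \<Rightarrow> nat \<Rightarrow> real" where
  "moment_const TYPE('k) m = ((real m)\<^sup>2) powr (1 / (real CARD('k) + 2)) * pi ^ Suc (CARD('k)) / real m"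

text \<open>The exponent \<open>\<theta>\<close> is the weighted degree of the integrand. With this choice the powers of the homogeneous norm coming from the projection cancel, and the integral is a product of two Gamma integrals.\<close>

theorem nn_integral_boundary_moment:
  fixes e :: "complex ^ 'k::finite" and m j k :: nat
  assumes m: "m \<ge> 1" and e: "norm e = 1"
  defines "b \<equiv> moment_exp TYPE('k) m k"
  defines "\<theta> \<equiv> real j + (real k + (real m - 1) / (real CARD('k) + 2)) / real m"
  shows "(\<integral>\<^sup>+p. ennreal (norm (cinner (fst p) e) ^ (2 * j) * norm (snd p) ^ (2 * k)) \<partial>boundary_measure m \<theta>) =
     ennreal (moment_const TYPE('k) m * fact j * Gamma b / Gamma (real CARD('k) + real j + b))"
proof -
  define \<delta> where "\<delta> = (real m - 1) / (real CARD('k) + 2)"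
  have \<delta>: "\<delta> \<ge> 0" using m by (simp add: \<delta>_def)
  have b: "b = (real k + \<delta>) / real m + 1 / real m" by (simp add: b_def moment_exp_def \<delta>_def add_divide_distrib)
  have \<theta>_eq: "\<theta> = real j + (real k + \<delta>) / real m" by (simp add: \<theta>_def \<delta>_def)
  have Q: "real CARD('k) + 1 / real m + \<theta> = real CARD('k) + real j + b" by (simp add: b \<theta>_eq)
  have b0: "b > 0" using m \<delta> by (simp add: b add_nonneg_pos)
  have G: "Gamma (real CARD('k) + real j + b) > 0" using b0 by (intro Gamma_real_pos) auto
  let ?G = "Gamma (real CARD('k) + real j + b)"
  define M where "M = ((real m)\<^sup>2) powr (1 / (real CARD('k) + 2))"
  have "M \<ge> 0" by (simp add: M_def)
  have mc[measurable]: "(\<lambda>p::'k pt. cinner (fst p) e) \<in> borel_measurable borel" "(\<lambda>z::complex^'k. cinner z e) \<in> borel_measurable borel"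
    by (intro borel_measurable_continuous_onI continuous_intros)+
  have "(\<integral>\<^sup>+p. ennreal (norm (cinner (fst p) e) ^ (2 * j) * norm (snd p) ^ (2 * k)) \<partial>boundary_measure m \<theta>) =
     (\<integral>\<^sup>+x. ennreal (fef_weight m (radial_proj m x) * (egg_norm m x powr \<theta> * exp (- egg_norm m x) / ?G)) * 
        ennreal (norm (cinner (fst (radial_proj m x)) e) ^ (2 * j) * norm (snd (radial_proj m x)) ^ (2 * k)) \<partial>lborel)"
    unfolding Q[symmetric] by (rule nn_integral_boundary_measure) measurable
  also have "\<dots> = (\<integral>\<^sup>+x. ennreal (norm (cinner (fst x) e) ^ (2 * j) * exp (- (norm (fst x))\<^sup>2)) * 
      ennreal (M / ?G * ((norm (snd x) ^ (2 * m)) powr ((real k + \<delta>) / real m) * exp (- (norm (snd x) ^ (2 * m))))) \<partial>(lborel :: 'k pt measure))"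
  proof (rule nn_integral_cong_AE)
    have ns: "AE x in (lborel :: 'k pt measure). snd x \<noteq> 0"
    proof -
      have "{x::'k pt. snd x = 0} \<in> null_sets lborel"
      proof -
        have "{x::'k pt. snd x = 0} = UNIV \<times> {0}" by auto
        moreover have "emeasure lborel (UNIV \<times> {0} :: 'k pt set) = 0"
          by (simp add: lborel_prod[symmetric] lborel.emeasure_pair_measure_Times)
        moreover have "UNIV \<times> {0} \<in> sets (borel :: 'k pt measure)" by (intro borel_Times) auto
        ultimately show ?thesis by (simp add: null_sets_def)
      qed
      then show ?thesis by (rule AE_I') auto
    qed
    show "AE x in (lborel :: 'k pt measure). ennreal (fef_weight m (radial_proj m x) * (egg_norm m x powr \<theta> * exp (- egg_norm m x) / ?G)) * 
        ennreal (norm (cinner (fst (radial_proj m x)) e) ^ (2 * j) * norm (snd (radial_proj m x)) ^ (2 * k)) =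
      ennreal (norm (cinner (fst x) e) ^ (2 * j) * exp (- (norm (fst x))\<^sup>2)) * 
      ennreal (M / ?G * ((norm (snd x) ^ (2 * m)) powr ((real k + \<delta>) / real m) * exp (- (norm (snd x) ^ (2 * m)))))"
      using ns
    proof eventually_elim
      fix x :: "'k pt" assume w: "snd x \<noteq> 0"
      then have "x \<noteq> 0" by auto
      define N where "N = egg_norm m x"
      have N: "N > 0" using egg_norm_pos[OF m \<open>x \<noteq> 0\<close>] by (simp add: N_def)
      define s where "s = 1 / N"
      have s: "s > 0" using N by (simp add: s_def)
      define t where "t = (norm (snd x))\<^sup>2"
      have t: "t > 0" using w by (simp add: t_def)
      have 1: "norm (cinner (fst (dilate m s x)) e) ^ (2 * j) = s powr real j * norm (cinner (fst x) e) ^ (2 * j)"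
        using s by (simp add: dilate_simps cinner_scaleR_left norm_mult power_mult_distrib powr_power)
      have 2: "norm (snd (dilate m s x)) ^ (2 * k) = s powr (real k / real m) * t ^ k"
        using s m by (simp add: dilate_simps power_mult_distrib powr_power t_def power_mult)
      have 3: "fef_weight m x = M * t powr \<delta>"
      proof -
        have "fef_weight m x = M * (t ^ (m - 1)) powr (1 / (real CARD('k) + 2))"
          unfolding fef_weight_def t_def M_def by (rule powr_mult)
        also have "(t ^ (m - 1)) powr (1 / (real CARD('k) + 2)) = t powr \<delta>"
          using t m by (simp add: powr_realpow[symmetric] powr_powr \<delta>_def of_nat_diff)
        finally show ?thesis .
      qed
      have 4: "t ^ k * t powr \<delta> = (norm (snd x) ^ (2 * m)) powr ((real k + \<delta>) / real m)"
      proof -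
        have n: "norm (snd x) ^ (2 * m) = t powr real m" using t by (simp add: t_def power_mult powr_realpow)
        have "(norm (snd x) ^ (2 * m)) powr ((real k + \<delta>) / real m) = t powr (real m * ((real k + \<delta>) / real m))"
          unfolding n powr_powr ..
        also have "real m * ((real k + \<delta>) / real m) = real k + \<delta>" using m by simp
        also have "t powr (real k + \<delta>) = t ^ k * t powr \<delta>" using t by (simp add: powr_add powr_realpow)
        finally show ?thesis ..
      qed
      have 5: "s powr (1 / real m * \<delta>) * s powr real j * s powr (real k / real m) * N powr \<theta> = 1"
      proof -
        have "s powr (1 / real m * \<delta>) * s powr real j * s powr (real k / real m) = s powr \<theta>"
          using s by (simp add: powr_add[symmetric] \<theta>_eq add_divide_distrib add_ac)
        then show ?thesis using N by (simp add: s_def powr_divide)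
      qed
      have "fef_weight m (dilate m s x) * (N powr \<theta> * exp (- N) / ?G) * (norm (cinner (fst (dilate m s x)) e) ^ (2 * j) * norm (snd (dilate m s x)) ^ (2 * k))
        = (s powr (1 / real m * \<delta>) * s powr real j * s powr (real k / real m) * N powr \<theta>) * (M / ?G * exp (- N) * norm (cinner (fst x) e) ^ (2 * j) * (t ^ k * t powr \<delta>))"
        unfolding 1 2 fef_weight_dilate[OF m s] 3 \<delta>_def[symmetric] by simp
      also have "\<dots> = (norm (cinner (fst x) e) ^ (2 * j) * exp (- (norm (fst x))\<^sup>2)) * 
          (M / ?G * ((norm (snd x) ^ (2 * m)) powr ((real k + \<delta>) / real m) * exp (- (norm (snd x) ^ (2 * m)))))"
        unfolding 5 4 by (simp add: N_def egg_norm_def exp_add[symmetric] exp_diff exp_minus field_simps)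
      finally have K: "fef_weight m (dilate m s x) * (N powr \<theta> * exp (- N) / ?G) * (norm (cinner (fst (dilate m s x)) e) ^ (2 * j) * norm (snd (dilate m s x)) ^ (2 * k))
        = (norm (cinner (fst x) e) ^ (2 * j) * exp (- (norm (fst x))\<^sup>2)) * 
          (M / ?G * ((norm (snd x) ^ (2 * m)) powr ((real k + \<delta>) / real m) * exp (- (norm (snd x) ^ (2 * m)))))" .
      have e1: "ennreal A * ennreal (norm (cinner (fst (dilate m s x)) e) ^ (2 * j) * norm (snd (dilate m s x)) ^ (2 * k)) =
         ennreal (A * (norm (cinner (fst (dilate m s x)) e) ^ (2 * j) * norm (snd (dilate m s x)) ^ (2 * k)))" for A
        by (rule ennreal_mult''[symmetric]) simp
      have e2: "ennreal (norm (cinner (fst x) e) ^ (2 * j) * exp (- (norm (fst x))\<^sup>2)) * ennreal A = 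
         ennreal ((norm (cinner (fst x) e) ^ (2 * j) * exp (- (norm (fst x))\<^sup>2)) * A)" for A
        by (rule ennreal_mult'[symmetric]) simp
      show "ennreal (fef_weight m (radial_proj m x) * (egg_norm m x powr \<theta> * exp (- egg_norm m x) / ?G)) * 
        ennreal (norm (cinner (fst (radial_proj m x)) e) ^ (2 * j) * norm (snd (radial_proj m x)) ^ (2 * k)) =
        ennreal (norm (cinner (fst x) e) ^ (2 * j) * exp (- (norm (fst x))\<^sup>2)) * 
        ennreal (M / ?G * ((norm (snd x) ^ (2 * m)) powr ((real k + \<delta>) / real m) * exp (- (norm (snd x) ^ (2 * m)))))"
        unfolding radial_proj_def N_def[symmetric] s_def[symmetric] e1 e2 K ..
    qed
  qed
  also have "\<dots> = (\<integral>\<^sup>+z. (\<integral>\<^sup>+w. ennreal (norm (cinner z e) ^ (2 * j) * exp (- (norm z)\<^sup>2)) * 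
      ennreal (M / ?G * ((norm w ^ (2 * m)) powr ((real k + \<delta>) / real m) * exp (- (norm w ^ (2 * m))))) \<partial>(lborel :: complex measure)) \<partial>lborel)"
  proof -
    have "(\<lambda>x::'k pt. ennreal (norm (cinner (fst x) e) ^ (2 * j) * exp (- (norm (fst x))\<^sup>2)) * 
      ennreal (M / ?G * ((norm (snd x) ^ (2 * m)) powr ((real k + \<delta>) / real m) * exp (- (norm (snd x) ^ (2 * m)))))) \<in> borel_measurable borel"
      by measurable
    from nn_integral_lborel_pair(1)[OF this] show ?thesis by (simp only: fst_conv snd_conv)
  qed
  also have "\<dots> = (\<integral>\<^sup>+z. ennreal (norm (cinner z e) ^ (2 * j) * exp (- (norm z)\<^sup>2)) * 
      (ennreal (M / ?G) * ennreal (pi / real m * Gamma ((real k + \<delta>) / real m + 1 / real m))) \<partial>lborel)"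
  proof (rule nn_integral_cong)
    fix z :: "complex ^ 'k"
    have MG: "M / ?G \<ge> 0" using \<open>M \<ge> 0\<close> G by simp
    have e\<delta>: "(real k + \<delta>) / real m \<ge> 0" using \<delta> by simp
    show "(\<integral>\<^sup>+w. ennreal (norm (cinner z e) ^ (2 * j) * exp (- (norm z)\<^sup>2)) * 
      ennreal (M / ?G * ((norm w ^ (2 * m)) powr ((real k + \<delta>) / real m) * exp (- (norm w ^ (2 * m))))) \<partial>(lborel :: complex measure)) =
      ennreal (norm (cinner z e) ^ (2 * j) * exp (- (norm z)\<^sup>2)) * 
      (ennreal (M / ?G) * ennreal (pi / real m * Gamma ((real k + \<delta>) / real m + 1 / real m)))"
      unfolding ennreal_mult'[OF MG] nn_integral_complex_gamma[OF m e\<delta>, symmetric]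
      by (subst nn_integral_cmult, measurable, subst nn_integral_cmult, measurable)
  qed
  also have "\<dots> = ennreal (pi ^ CARD('k) * fact j) * (ennreal (M / ?G) * ennreal (pi / real m * Gamma ((real k + \<delta>) / real m + 1 / real m)))"
    unfolding nn_integral_cinner_moment[OF e, of j, symmetric] by (rule nn_integral_multc) measurable
  also have "\<dots> = ennreal (moment_const TYPE('k) m * fact j * Gamma b / ?G)"
    using \<open>M \<ge> 0\<close> G b0 m unfolding b[symmetric]
    by (simp add: ennreal_mult'[symmetric] ennreal_mult''[symmetric] Gamma_real_pos less_imp_le moment_const_def M_def[symmetric] field_simps)
  finally show ?thesis .
qed

section \<open>Averaging over rotations\<close>

lemma AE_boundary_measure:
  assumes "m \<ge> 1"
  shows "AE p in (boundary_measure m \<theta> :: 'k::finite pt measure). p \<in> egg_sphere m"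
proof -
  have "AE x in (lborel :: 'k pt measure). radial_proj m x \<in> egg_sphere m"
    using AE_lborel_singleton[of "0 :: 'k pt"] by eventually_elim (rule radial_proj_in_sphere[OF assms])
  then show ?thesis unfolding boundary_measure_def
    by (subst AE_distr_iff, simp, simp) (subst AE_density, simp, auto)
qed

lemma finite_boundary_measure:
  assumes "m \<ge> 1"
  shows "finite_measure (boundary_measure m ((real m - 1) / (real CARD('k) + 2) / real m) :: 'k::finite pt measure)"
proof -
  obtain e :: "complex ^ 'k" where e: "norm e = 1" using norm_axis_complex[of undefined 1] by (metis norm_one)
  show ?thesis
    using nn_integral_boundary_moment[OF assms e, of 0 0] by (intro finite_measureI) simp
qed

context
  fixes m :: nat
  assumes m: "m \<ge> 1"
begin

abbreviation "base_exp \<equiv> \<lambda>_ :: 'k::finite itself. (real m - 1) / (real CARD('k) + 2) / real m"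

lemma base_exp_nonneg: "base_exp TYPE('k::finite) \<ge> 0" using m by simp

lemma fef_eq: "(fefferman_measure m :: 'k::finite pt measure) = restrict_space (boundary_measure m (base_exp TYPE('k))) (egg_sphere m)"
  by (rule fefferman_measure_eq[OF m base_exp_nonneg])

lemma space_fef: "space (fefferman_measure m :: 'k::finite pt measure) = egg_sphere m"
  by (simp add: fef_eq space_restrict_space)

lemma measurable_fef_iff:
  fixes f :: "'k::finite pt \<Rightarrow> complex"
  shows "f \<in> borel_measurable (fefferman_measure m) \<longleftrightarrow> (\<lambda>p. indicator (egg_sphere m) p *\<^sub>R f p) \<in> borel_measurable borel"
  unfolding fef_eq by (subst borel_measurable_restrict_space_iff) (auto simp: measurable_def)

lemma finite_measure_fef: "finite_measure (fefferman_measure m :: 'k::finite pt measure)"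
  unfolding fef_eq by (rule finite_measure_restrict_space[OF finite_boundary_measure[OF m]]) simp

lemma integral_fef:
  fixes f :: "'k::finite pt \<Rightarrow> complex"
  shows "(\<integral>p. f p \<partial>fefferman_measure m) = (\<integral>p. indicator (egg_sphere m) p *\<^sub>R f p \<partial>boundary_measure m (base_exp TYPE('k)))"
  unfolding fef_eq by (subst integral_restrict_space) (auto simp: set_lebesgue_integral_def)

lemma nn_integral_fef:
  fixes \<phi> :: "'k::finite pt \<Rightarrow> ennreal"
  assumes "\<theta> \<ge> 0"
  shows "(\<integral>\<^sup>+p. \<phi> p \<partial>fefferman_measure m) = (\<integral>\<^sup>+p. \<phi> p \<partial>boundary_measure m \<theta>)"
  unfolding fefferman_measure_eq[OF m assms]
proof (subst nn_integral_restrict_space)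
  show "(\<integral>\<^sup>+p. \<phi> p * indicator (egg_sphere m) p \<partial>boundary_measure m \<theta>) = (\<integral>\<^sup>+p. \<phi> p \<partial>boundary_measure m \<theta>)"
    by (rule nn_integral_cong_AE) (use AE_boundary_measure[OF m] in eventually_elim, auto)
qed auto

lemma integrable_fef_bounded:
  fixes f :: "'k::finite pt \<Rightarrow> complex"
  assumes "f \<in> borel_measurable (fefferman_measure m)" "\<And>p. p \<in> egg_sphere m \<Longrightarrow> norm (f p) \<le> B"
  shows "integrable (fefferman_measure m) f"
proof -
  have "AE p in fefferman_measure m. norm (f p) \<le> B" by (rule AE_I2) (use assms(2) in \<open>simp add: space_fef\<close>)
  then show ?thesis using assms(1) finite_measure.integrable_const_bound[OF finite_measure_fef] by blast
qed

lemma continuous_measurable_fef: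
  fixes f :: "'k::finite pt \<Rightarrow> complex"
  assumes "continuous_on (egg_sphere m) f"
  shows "f \<in> borel_measurable (fefferman_measure m)"
  unfolding measurable_fef_iff by (rule borel_measurable_continuous_on_indicator[OF borel_egg_sphere assms])

text \<open>The symmetries of the domain used below: a real-linear isometry in \<open>z\<close> together with a rotation of \<open>w\<close>.\<close>

definition egg_rotation :: "('k::finite pt \<Rightarrow> 'k pt) \<Rightarrow> bool" where
  "egg_rotation R \<longleftrightarrow> (\<exists>U w. linear U \<and> (\<forall>z. norm (U z) = norm z) \<and> norm w = 1 \<and> R = (\<lambda>p. (U (fst p), w * snd p)))"

lemma egg_rotationI: "linear U \<Longrightarrow> (\<And>z. norm (U z) = norm z) \<Longrightarrow> norm w = 1 \<Longrightarrow> egg_rotation (\<lambda>p. (U (fst p), w * snd p))"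
  unfolding egg_rotation_def by blast

lemma
  assumes "egg_rotation R"
  shows linear_egg_rotation: "linear R"
    and norm_egg_rotation: "norm (R p) = norm p"
    and egg_norm_rotation: "egg_norm m (R p) = egg_norm m p"
    and fef_weight_rotation: "fef_weight m (R p) = fef_weight m p"
    and radial_proj_rotation: "radial_proj m (R p) = R (radial_proj m p)"
    and sphere_rotation: "R p \<in> egg_sphere m \<longleftrightarrow> p \<in> egg_sphere m"
proof -
  obtain U w where R: "linear U" "\<And>z. norm (U z) = norm z" "norm w = 1" "R = (\<lambda>p. (U (fst p), w * snd p))"
    using assms by (auto simp: egg_rotation_def)
  show lin: "linear R" unfolding R(4) using R(1) by (auto intro!: linearI simp: linear_add linear_scale algebra_simps)
  show "norm (R p) = norm p" by (simp add: R(4) norm_prod_def R(2,3) norm_mult)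
  show N: "egg_norm m (R p) = egg_norm m p" by (simp add: R(4) egg_norm_def R(2,3) norm_mult)
  show "fef_weight m (R p) = fef_weight m p" by (simp add: R(4) fef_weight_def R(3) norm_mult)
  show "radial_proj m (R p) = R (radial_proj m p)"
    unfolding radial_proj_def N by (simp add: R(4) dilate_def linear_scale[OF R(1)])
  show "R p \<in> egg_sphere m \<longleftrightarrow> p \<in> egg_sphere m" by (simp add: egg_sphere_def N)
qed

text \<open>Rotations preserve Lebesgue measure, the homogeneous norm and the weight, and commute with the radial projection.\<close>

lemma distr_boundary_measure_rotation:
  fixes R :: "'k::finite pt \<Rightarrow> 'k pt"
  assumes R: "egg_rotation R"
  shows "distr (boundary_measure m \<theta>) borel R = boundary_measure m \<theta>"
proof (rule measure_eqI)
  have [measurable]: "R \<in> borel_measurable borel" by (rule borel_measurable_linear[OF linear_egg_rotation[OF R]])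
  fix A assume "A \<in> sets (distr (boundary_measure m \<theta>) borel R)"
  then have [measurable]: "A \<in> sets borel" by simp
  let ?W = "\<lambda>x::'k pt. ennreal (fef_weight m (radial_proj m x) * (egg_norm m x powr \<theta> * exp (- egg_norm m x) / Gamma (real CARD('k) + 1 / real m + \<theta>)))"
  have "emeasure (distr (boundary_measure m \<theta>) borel R) A = (\<integral>\<^sup>+p. indicator A p \<partial>distr (boundary_measure m \<theta>) borel R)" by simp
  also have "\<dots> = (\<integral>\<^sup>+p. indicator A (R p) \<partial>boundary_measure m \<theta>)" by (rule nn_integral_distr) auto
  also have "\<dots> = (\<integral>\<^sup>+x. ?W x * indicator A (R (radial_proj m x)) \<partial>lborel)"
    by (rule nn_integral_boundary_measure) measurable
  also have "\<dots> = (\<integral>\<^sup>+x. ?W (R x) * indicator A (radial_proj m (R x)) \<partial>lborel)"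
    by (simp add: egg_norm_rotation[OF R] fef_weight_rotation[OF R] radial_proj_rotation[OF R])
  also have "\<dots> = (\<integral>\<^sup>+x. ?W x * indicator A (radial_proj m x) \<partial>lborel)"
    using scales_volumeD[OF scales_volume_isometry[OF linear_egg_rotation[OF R] norm_egg_rotation[OF R] refl], of "\<lambda>x. ?W x * indicator A (radial_proj m x)"]
    by simp
  also have "\<dots> = (\<integral>\<^sup>+p. indicator A p \<partial>boundary_measure m \<theta>)"
    by (rule nn_integral_boundary_measure[symmetric]) measurable
  finally show "emeasure (distr (boundary_measure m \<theta>) borel R) A = emeasure (boundary_measure m \<theta>) A" by simp
qed simp

end

lemma borel_measurable_cnj [measurable]: "cnj \<in> borel_measurable borel"
  by (intro borel_measurable_continuous_onI continuous_intros)

definition circ :: "real \<Rightarrow> complex" where "circ t = exp (2 * of_real pi * \<i> * of_real t)"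

lemma norm_circ [simp]: "norm (circ t) = 1" by (simp add: circ_def)

lemma circ_cnj: "circ t * cnj (circ t) = 1" "cnj (circ t) * circ t = 1"
  by (simp_all add: complex_norm_square[symmetric] mult.commute)

lemma continuous_on_circ [continuous_intros]: "continuous_on A f \<Longrightarrow> continuous_on A (\<lambda>x. circ (f x))"
  unfolding circ_def by (intro continuous_intros)

text \<open>Lebesgue measure on the unit interval, as the normalised measure on the circle via \<open>circ\<close>.\<close>

definition unit_measure :: "real measure" where "unit_measure = density lborel (\<lambda>t. ennreal (indicator {0..1} t))"

lemma sets_unit_measure [simp, measurable_cong]: "sets unit_measure = sets borel" by (simp add: unit_measure_def)

lemma space_unit_measure [simp]: "space unit_measure = UNIV" by (simp add: unit_measure_def)

lemma emeasure_unit_measure: "emeasure unit_measure UNIV = 1"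
  unfolding unit_measure_def by (subst emeasure_density) (auto simp: ennreal_indicator)

lemma finite_unit_measure: "finite_measure unit_measure"
  by (rule finite_measureI) (simp add: emeasure_unit_measure)

definition rotation_mean :: "nat \<Rightarrow> (real \<Rightarrow> 'k::finite pt \<Rightarrow> 'k pt) \<Rightarrow> ('k pt \<Rightarrow> complex) \<Rightarrow> 'k pt \<Rightarrow> complex" where
  "rotation_mean j R g p = (\<integral>t. g (R t p) * cnj (circ t) ^ j \<partial>unit_measure)"

lemma borel_measurable_rotation_mean:
  fixes g :: "'k::finite pt \<Rightarrow> complex"
  assumes [measurable]: "g \<in> borel_measurable borel" and R: "continuous_on UNIV (\<lambda>(t, p). R t p)"
  shows "rotation_mean j R g \<in> borel_measurable borel"
proof -
  interpret finite_measure unit_measure by (rule finite_unit_measure)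
  have [measurable]: "(\<lambda>(t, p). R t p) \<in> borel_measurable (borel \<Otimes>\<^sub>M borel)"
    using borel_measurable_continuous_onI[OF R] by (simp add: borel_prod)
  have [measurable]: "circ \<in> borel_measurable borel" by (intro borel_measurable_continuous_onI continuous_intros)
  have [measurable]: "(\<lambda>x. R (snd x) (fst x)) \<in> borel_measurable (borel \<Otimes>\<^sub>M borel)"
  proof -
    have "(\<lambda>x. (\<lambda>(t, p). R t p) (snd x, fst x)) \<in> borel_measurable (borel \<Otimes>\<^sub>M borel)" by measurable
    then show ?thesis by simp
  qed
  have "(\<lambda>x. g (R (snd x) (fst x)) * cnj (circ (snd x)) ^ j) \<in> borel_measurable (borel \<Otimes>\<^sub>M unit_measure)"
    by measurable
  then have "(\<lambda>(p, t). g (R t p) * cnj (circ t) ^ j) \<in> borel_measurable (borel \<Otimes>\<^sub>M unit_measure)"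
    by (simp add: split_beta)
  then show ?thesis unfolding rotation_mean_def by (rule borel_measurable_lebesgue_integral)
qed

lemma norm_rotation_mean_le:
  fixes g :: "'k::finite pt \<Rightarrow> complex"
  assumes B: "\<And>t. norm (g (R t p)) \<le> B"
  shows "norm (rotation_mean j R g p) \<le> B"
proof -
  interpret finite_measure unit_measure by (rule finite_unit_measure)
  have B0: "B \<ge> 0" using B[of 0] norm_ge_zero order_trans by blast
  have "norm (rotation_mean j R g p) \<le> (\<integral>t. norm (g (R t p) * cnj (circ t) ^ j) \<partial>unit_measure)"
    unfolding rotation_mean_def by (rule integral_norm_bound)
  also have "\<dots> = (\<integral>t. norm (g (R t p)) \<partial>unit_measure)" by (simp add: norm_mult norm_power)
  also have "\<dots> \<le> (\<integral>t. B \<partial>unit_measure)"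
    by (rule integral_mono') (use B B0 in auto)
  also have "\<dots> = B" by (simp add: measure_def emeasure_unit_measure)
  finally show ?thesis .
qed

text \<open>If \<open>\<psi>\<close> has weight \<open>j\<close> under a circle of symmetries, then only the component of \<open>g\<close> of weight \<open>j\<close> contributes to the inner product. This is Fubini's theorem together with invariance of the measure.\<close>

theorem integral_rotation_mean:
  fixes g \<psi> :: "'k::finite pt \<Rightarrow> complex"
  assumes m: "m \<ge> 1"
    and R: "\<And>t. egg_rotation (R t)" "continuous_on UNIV (\<lambda>(t, p). R t p)"
    and g: "(\<lambda>p. indicator (egg_sphere m) p *\<^sub>R g p) \<in> borel_measurable borel" "\<And>p. p \<in> egg_sphere m \<Longrightarrow> norm (g p) \<le> B"
    and \<psi>: "continuous_on UNIV \<psi>" "\<And>t p. \<psi> (R t p) = circ t ^ j * \<psi> p"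
  shows "(\<integral>p. g p * cnj (\<psi> p) \<partial>fefferman_measure m) = (\<integral>p. rotation_mean j R g p * cnj (\<psi> p) \<partial>fefferman_measure m)"
    and "(\<lambda>p. indicator (egg_sphere m) p *\<^sub>R rotation_mean j R g p) \<in> borel_measurable borel"
    and "p \<in> egg_sphere m \<Longrightarrow> norm (rotation_mean j R g p) \<le> B"
proof -
  let ?S = "egg_sphere m :: 'k pt set"
  let ?\<nu> = "boundary_measure m ((real m - 1) / (real CARD('k) + 2) / real m) :: 'k pt measure"
  interpret \<nu>: finite_measure ?\<nu> by (rule finite_boundary_measure[OF m])
  interpret U: finite_measure unit_measure by (rule finite_unit_measure)
  interpret P: pair_sigma_finite ?\<nu> unit_measure ..
  define h where "h p = indicator ?S p *\<^sub>R g p" for p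
  have [measurable]: "h \<in> borel_measurable borel" using g(1) by (simp add: h_def[abs_def])
  have S: "R t p \<in> ?S \<longleftrightarrow> p \<in> ?S" for t p by (rule sphere_rotation[OF m R(1)])
  have mean_eq: "indicator ?S p *\<^sub>R rotation_mean j R g p = rotation_mean j R h p" for p
    by (cases "p \<in> ?S") (simp_all add: rotation_mean_def h_def S)
  show meas: "(\<lambda>p. indicator ?S p *\<^sub>R rotation_mean j R g p) \<in> borel_measurable borel"
    unfolding mean_eq by (rule borel_measurable_rotation_mean[OF _ R(2)]) simp
  show "norm (rotation_mean j R g p) \<le> B" if "p \<in> ?S"
    by (rule norm_rotation_mean_le) (use that S g(2) in auto)
  have [measurable]: "\<psi> \<in> borel_measurable borel" using \<psi>(1) by (rule borel_measurable_continuous_onI)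
  have "compact ?S" using compact_closure_egg[OF m, where 'k = 'k] closed_egg_sphere[of m] 
    by (rule compact_Int_closed[THEN back_subst[of compact]]) (auto simp: closure_egg[OF m] egg_sphere_def)
  then have "bounded (\<psi> ` ?S)"
    by (intro compact_imp_bounded compact_continuous_image continuous_on_subset[OF \<psi>(1)]) auto
  then obtain C where "\<forall>y\<in>\<psi> ` ?S. norm y \<le> C" unfolding bounded_iff by blast
  then have C: "norm (\<psi> p) \<le> C" if "p \<in> ?S" for p using that by simp
  have [measurable]: "(\<lambda>(t, p). R t p) \<in> borel_measurable (borel \<Otimes>\<^sub>M borel)"
    using borel_measurable_continuous_onI[OF R(2)] by (simp add: borel_prod)
  have [measurable]: "(\<lambda>x. R (snd x) (fst x)) \<in> borel_measurable (borel \<Otimes>\<^sub>M borel)"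
  proof -
    have "(\<lambda>x. (\<lambda>(t, p). R t p) (snd x, fst x)) \<in> borel_measurable (borel \<Otimes>\<^sub>M borel)" by measurable
    then show ?thesis by simp
  qed
  have [measurable]: "R t \<in> borel_measurable borel" for t by (rule borel_measurable_linear[OF linear_egg_rotation[OF m R(1)]])
  have [measurable]: "circ \<in> borel_measurable borel" by (intro borel_measurable_continuous_onI continuous_intros)
  define F where "F p t = h (R t p) * cnj (\<psi> (R t p))" for p t
  have F: "F p t = (h (R t p) * cnj (circ t) ^ j) * cnj (\<psi> p)" for p t by (simp add: F_def \<psi>(2) mult_ac)
  have "norm (F p t) \<le> B * C" for p t
  proof (cases "p \<in> ?S")
    case True
    then show ?thesis using g(2)[of "R t p"] C[of "R t p"] S[of t p] 
      by (auto simp: F_def h_def norm_mult intro!: mult_mono order_trans[OF norm_ge_zero g(2)])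
  next
    case False
    obtain e :: "complex ^ 'k" where e: "norm e = 1" using norm_axis_complex[of undefined 1] by (metis norm_one)
    have "(e, 0) \<in> ?S" using e m by (simp add: egg_sphere_def egg_norm_def)
    then have "0 \<le> B * C" by (intro mult_nonneg_nonneg order_trans[OF norm_ge_zero g(2)] order_trans[OF norm_ge_zero C])
    then show ?thesis using False S[of t p] by (simp add: F_def h_def)
  qed
  moreover have "case_prod F \<in> borel_measurable (?\<nu> \<Otimes>\<^sub>M unit_measure)"
    unfolding F_def split_beta by measurable
  ultimately have int: "integrable (?\<nu> \<Otimes>\<^sub>M unit_measure) (case_prod F)"
    by (intro finite_measure.integrable_const_bound[where B = "B * C"] finite_measure_pair_measure \<nu>.finite_measure_axioms U.finite_measure_axioms) auto
  have inv: "(\<integral>p. F p t \<partial>?\<nu>) = (\<integral>p. h p * cnj (\<psi> p) \<partial>?\<nu>)" for t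
  proof -
    have "(\<integral>p. h p * cnj (\<psi> p) \<partial>?\<nu>) = (\<integral>p. h p * cnj (\<psi> p) \<partial>distr ?\<nu> borel (R t))"
      by (simp add: distr_boundary_measure_rotation[OF m R(1)])
    also have "\<dots> = (\<integral>p. F p t \<partial>?\<nu>)" unfolding F_def by (rule integral_distr) measurable
    finally show ?thesis ..
  qed
  have "(\<integral>p. g p * cnj (\<psi> p) \<partial>fefferman_measure m) = (\<integral>p. h p * cnj (\<psi> p) \<partial>?\<nu>)"
    unfolding integral_fef[OF m] by (simp add: h_def)
  also have "\<dots> = (\<integral>t. (\<integral>p. F p t \<partial>?\<nu>) \<partial>unit_measure)"
    unfolding inv by (simp add: measure_def emeasure_unit_measure)
  also have "\<dots> = (\<integral>p. (\<integral>t. F p t \<partial>unit_measure) \<partial>?\<nu>)" by (rule P.Fubini_integral[OF int])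
  also have "\<dots> = (\<integral>p. rotation_mean j R h p * cnj (\<psi> p) \<partial>?\<nu>)"
    unfolding F rotation_mean_def by simp
  also have "\<dots> = (\<integral>p. rotation_mean j R g p * cnj (\<psi> p) \<partial>fefferman_measure m)"
    unfolding integral_fef[OF m] mean_eq[symmetric] by simp
  finally show "(\<integral>p. g p * cnj (\<psi> p) \<partial>fefferman_measure m) = (\<integral>p. rotation_mean j R g p * cnj (\<psi> p) \<partial>fefferman_measure m)" .
qed

section \<open>Expansion of holomorphic functions in Hartogs monomials\<close>

text \<open>Absolutely convergent double series, enumerated by the pairing function so that the theorems on ordinary series apply.\<close>

lemma sums_prod_decode:
  fixes a :: "nat \<Rightarrow> nat \<Rightarrow> 'a::banach"
  assumes n: "\<And>k. (\<lambda>j. norm (a k j)) sums B k" "summable B" and s: "\<And>k. (\<lambda>j. a k j) sums b k"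
  shows "summable (\<lambda>n. norm (case_prod a (prod_decode n)))" "(\<lambda>n. case_prod a (prod_decode n)) sums (\<Sum>k. b k)"
proof -
  have hs: "((\<lambda>j. norm (a k j)) has_sum B k) UNIV" for k using n(1) by (rule sums_nonneg_imp_has_sum) simp
  have B0: "B k \<ge> 0" for k by (rule sums_le[OF _ sums_zero n(1)]) simp
  have abs: "(\<lambda>x. norm (case_prod a x)) summable_on (UNIV \<times> UNIV)"
    unfolding Infinite_Sum.abs_summable_on_Sigma_iff
  proof (intro conjI ballI)
    show "(\<lambda>j. norm (case_prod a (k, j))) summable_on UNIV" for k using hs[of k] by (auto simp: summable_on_def)
    have "infsum (\<lambda>j. norm (case_prod a (k, j))) UNIV = B k" for k using hs[of k] by (simp add: infsumI)
    then have "(\<lambda>k. norm (infsum (\<lambda>j. norm (case_prod a (k, j))) UNIV)) = B" using B0 by (simp only: real_norm_def abs_of_nonneg)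
    moreover have "B summable_on UNIV" by (subst summable_on_UNIV_nonneg_real_iff[OF B0]) (rule n(2))
    ultimately show "(\<lambda>k. norm (infsum (\<lambda>j. norm (case_prod a (k, j))) UNIV)) summable_on UNIV" by (simp only:)
  qed
  have bij: "bij_betw prod_decode UNIV (UNIV \<times> UNIV)" using bij_prod_decode by simp
  have "(\<lambda>n. norm (case_prod a (prod_decode n))) summable_on UNIV"
    using abs summable_on_reindex_bij_betw[OF bij, of "\<lambda>x. norm (case_prod a x)"] by simp
  then show "summable (\<lambda>n. norm (case_prod a (prod_decode n)))" by (rule summable_on_imp_summable)
  have "(case_prod a) summable_on (UNIV \<times> UNIV)" using abs by (rule abs_summable_summable)
  then have S: "(case_prod a has_sum infsum (case_prod a) (UNIV \<times> UNIV)) (UNIV \<times> UNIV)" by (rule has_sum_infsum)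
  have hb: "((\<lambda>j. a k j) has_sum b k) UNIV" for k
    using n(1)[of k] s[of k] by (intro norm_summable_imp_has_sum) (auto simp: sums_iff)
  have "(b has_sum infsum (case_prod a) (UNIV \<times> UNIV)) UNIV"
    by (rule has_sum_SigmaD[OF S]) (use hb in auto)
  then have "infsum (case_prod a) (UNIV \<times> UNIV) = (\<Sum>k. b k)" using has_sum_imp_sums sums_unique by blast
  moreover have "((\<lambda>n. case_prod a (prod_decode n)) has_sum infsum (case_prod a) (UNIV \<times> UNIV)) UNIV"
    using S has_sum_reindex_bij_betw[OF bij, of "case_prod a"] by simp
  ultimately show "(\<lambda>n. case_prod a (prod_decode n)) sums (\<Sum>k. b k)" using has_sum_imp_sums by metis
qed

lemma geometric_sums_prod_decode:
  fixes u v :: complex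
  assumes "norm u < 1" "norm v < 1"
  shows "summable (\<lambda>n. norm (case prod_decode n of (k, j) \<Rightarrow> u ^ k * v ^ j))"
    "(\<lambda>n. case prod_decode n of (k, j) \<Rightarrow> u ^ k * v ^ j) sums (1 / (1 - u) * (1 / (1 - v)))"
proof -
  have 1: "(\<lambda>j. norm (u ^ k * v ^ j)) sums (norm u ^ k * (1 / (1 - norm v)))" for k
    unfolding norm_mult norm_power by (intro sums_mult geometric_sums) (use assms in simp)
  have 2: "(\<lambda>j. u ^ k * v ^ j) sums (u ^ k * (1 / (1 - v)))" for k
    by (intro sums_mult geometric_sums assms)
  have 3: "summable (\<lambda>k. norm u ^ k * (1 / (1 - norm v)))"
    by (intro summable_mult2 summable_geometric) (use assms in simp)
  show "summable (\<lambda>n. norm (case prod_decode n of (k, j) \<Rightarrow> u ^ k * v ^ j))"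
    using sums_prod_decode(1)[OF 1 3 2] .
  have "(\<Sum>k. u ^ k * (1 / (1 - v))) = 1 / (1 - u) * (1 / (1 - v))"
    by (rule sums_unique[symmetric]) (intro sums_mult2 geometric_sums assms)
  then show "(\<lambda>n. case prod_decode n of (k, j) \<Rightarrow> u ^ k * v ^ j) sums (1 / (1 - u) * (1 / (1 - v)))"
    using sums_prod_decode(2)[OF 1 3 2] by simp
qed

lemma integral_unit_measure:
  fixes f :: "real \<Rightarrow> complex"
  assumes "continuous_on UNIV f"
  shows "(\<integral>t. f t \<partial>unit_measure) = integral {0..1} f"
proof -
  have [measurable]: "f \<in> borel_measurable borel" using assms by (rule borel_measurable_continuous_onI)
  have si: "set_integrable lborel {0..1} f"
    by (rule borel_integrable_atLeastAtMost'[OF continuous_on_subset[OF assms]]) simp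
  have "(\<integral>t. f t \<partial>unit_measure) = (\<integral>t. indicator {0..1} t *\<^sub>R f t \<partial>lborel)"
    unfolding unit_measure_def by (rule integral_density) auto
  also have "\<dots> = integral {0..1} f"
    using set_borel_integral_eq_integral(2)[OF si] by (simp add: set_lebesgue_integral_def)
  finally show ?thesis .
qed

lemma circle_integral:
  fixes f :: "complex \<Rightarrow> complex"
  assumes "(f has_contour_integral I) (circlepath 0 1)"
  shows "((\<lambda>t. f (circ t) * circ t) has_integral (I / (2 * of_real pi * \<i>))) {0..1}"
proof -
  have "((\<lambda>t. f (circlepath 0 1 t) * vector_derivative (circlepath 0 1) (at t within {0..1})) has_integral I) {0..1}"
    using assms by (simp add: has_contour_integral_def)
  then have "((\<lambda>t. 2 * of_real pi * \<i> * (f (circ t) * circ t)) has_integral I) {0..1}"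
  proof (rule has_integral_eq[rotated])
    fix t :: real assume "t \<in> {0..1}"
    then show "f (circlepath 0 1 t) * vector_derivative (circlepath 0 1) (at t within {0..1}) = 2 * of_real pi * \<i> * (f (circ t) * circ t)"
      by (subst vector_derivative_circlepath01) (auto simp: circlepath circ_def)
  qed
  from has_integral_mult_right[OF this, of "1 / (2 * of_real pi * \<i>)"]
  show ?thesis by simp
qed

lemma
  fixes H :: "complex \<Rightarrow> complex"
  assumes H: "continuous_on (cball 0 1) H" "H holomorphic_on ball 0 1"
  shows circle_mean_coeff: "(\<integral>t. H (circ t) * cnj (circ t) ^ j \<partial>unit_measure) = (deriv ^^ j) H 0 / fact j"
    and circle_mean_kernel: "norm x < 1 \<Longrightarrow> (\<integral>t. H (circ t) / (1 - x * cnj (circ t)) \<partial>unit_measure) = H x"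
proof -
  have cH: "continuous_on UNIV (\<lambda>t. H (circ t))"
    by (rule continuous_on_compose2[OF H(1)]) (auto intro!: continuous_intros)
  have inv: "circ t \<noteq> 0" "1 / circ t = cnj (circ t)" for t
  proof -
    show "circ t \<noteq> 0" by (simp add: circ_def)
    then show "1 / circ t = cnj (circ t)" using circ_cnj(2)[of t] by (simp add: divide_eq_eq)
  qed
  have "((\<lambda>t. H (circ t) * cnj (circ t) ^ j) has_integral ((deriv ^^ j) H 0 / fact j)) {0..1}"
  proof -
    have "((\<lambda>u. H u / u ^ Suc j) has_contour_integral (2 * of_real pi * \<i> / fact j * (deriv ^^ j) H 0)) (circlepath 0 1)"
      using Cauchy_has_contour_integral_higher_derivative_circlepath[OF H, of 0 j] by simp
    from circle_integral[OF this] have "((\<lambda>t. H (circ t) / circ t ^ Suc j * circ t) has_integral ((deriv ^^ j) H 0 / fact j)) {0..1}"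
      by simp
    moreover have "H (circ t) / circ t ^ Suc j * circ t = H (circ t) * cnj (circ t) ^ j" for t
      using inv(1)[of t] unfolding inv(2)[symmetric] by (simp add: power_divide)
    ultimately show ?thesis by simp
  qed
  then show "(\<integral>t. H (circ t) * cnj (circ t) ^ j \<partial>unit_measure) = (deriv ^^ j) H 0 / fact j"
    by (subst integral_unit_measure) (auto intro!: continuous_intros cH integral_unique)
  assume x: "norm x < 1"
  have nz: "1 - x * cnj (circ t) \<noteq> 0" for t
  proof
    assume "1 - x * cnj (circ t) = 0"
    then have "x * cnj (circ t) = 1" by simp
    then have "norm (x * cnj (circ t)) = 1" by (simp only: norm_one)
    then show False using x by (simp add: norm_mult)
  qed
  have "((\<lambda>t. H (circ t) / (1 - x * cnj (circ t))) has_integral H x) {0..1}"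
  proof -
    have "((\<lambda>u. H u / (u - x)) has_contour_integral (2 * of_real pi * \<i> * H x)) (circlepath 0 1)"
      by (rule Cauchy_integral_circlepath[OF H]) (use x in simp)
    from circle_integral[OF this] have "((\<lambda>t. H (circ t) / (circ t - x) * circ t) has_integral H x) {0..1}" by simp
    moreover have "H (circ t) / (circ t - x) * circ t = H (circ t) / (1 - x * cnj (circ t))" for t
    proof -
      have "circ t - x = circ t * (1 - x * cnj (circ t))" using circ_cnj(1)[of t] by (simp add: algebra_simps)
      moreover have "H (circ t) / (circ t * y) * circ t = H (circ t) / y" for y using inv(1)[of t] by simp
      ultimately show ?thesis by simp
    qed
    ultimately show ?thesis by simp
  qed
  then show "(\<integral>t. H (circ t) / (1 - x * cnj (circ t)) \<partial>unit_measure) = H x"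
    by (subst integral_unit_measure) (use nz in \<open>auto intro!: continuous_intros cH integral_unique\<close>)
qed

text \<open>The \<open>j\<close>-th Fourier coefficient of a holomorphic function is its Taylor coefficient, hence homogeneous of degree \<open>j\<close>.\<close>

lemma circle_mean_scale:
  fixes H :: "complex \<Rightarrow> complex"
  assumes H: "continuous_on (cball 0 1) H" "H holomorphic_on ball 0 1" and a: "norm a \<le> 1"
  shows "(\<integral>t. H (a * circ t) * cnj (circ t) ^ j \<partial>unit_measure) = a ^ j * (\<integral>t. H (circ t) * cnj (circ t) ^ j \<partial>unit_measure)"
proof -
  have sub: "a * z \<in> cball 0 1" if "z \<in> cball 0 1" for z
    using that a by (simp add: norm_mult mult_le_one)
  have sub': "a * z \<in> ball 0 1" if "z \<in> ball 0 1" for z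
    using that a mult_left_le_one_le[of "norm z" "norm a"] by (simp add: norm_mult)
  have c: "continuous_on (cball 0 1) (\<lambda>z. H (a * z))"
    by (rule continuous_on_compose2[OF H(1)]) (use sub in \<open>auto intro!: continuous_intros\<close>)
  have h: "(\<lambda>z. H (a * z)) holomorphic_on ball 0 1"
    by (rule holomorphic_on_compose_gen[OF _ H(2), unfolded o_def]) (use sub' in \<open>auto intro!: holomorphic_intros\<close>)
  have "(deriv ^^ j) (\<lambda>z. H (a * z)) 0 = a ^ j * (deriv ^^ j) H (a * 0)"
    by (rule higher_deriv_compose_linear[OF H(2), of "ball 0 1"]) (use sub' in auto)
  then show ?thesis unfolding circle_mean_coeff[OF c h] circle_mean_coeff[OF H] by simp
qed

text \<open>The restriction of a function to the two-dimensional domain \<open>\<bar>u\<bar>\<^sup>2 + \<bar>w\<bar> ^ (2 * m) \<le> 1\<close>; separate holomorphy along rays is all that Cauchy's formula in each variable requires.\<close>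

locale egg2_holomorphic =
  fixes m :: nat and G :: "complex \<Rightarrow> complex \<Rightarrow> complex"
  assumes m: "m \<ge> 1"
    and cont: "continuous_on {(u, w). (norm u)\<^sup>2 + norm w ^ (2 * m) \<le> 1} (\<lambda>(u, w). G u w)"
    and hol1: "\<And>u w. (norm u)\<^sup>2 + norm w ^ (2 * m) \<le> 1 \<Longrightarrow> (\<lambda>l. G (l * u) w) holomorphic_on ball 0 1"
    and hol2: "\<And>u w. (norm u)\<^sup>2 + norm w ^ (2 * m) \<le> 1 \<Longrightarrow> (\<lambda>l. G u (l * w)) holomorphic_on ball 0 1"
begin

abbreviation D :: "(complex \<times> complex) set" where "D \<equiv> {(u, w). (norm u)\<^sup>2 + norm w ^ (2 * m) \<le> 1}"

lemma shrink: 
  assumes "(u, w) \<in> D" "norm a \<le> 1" "norm b \<le> 1" shows "(a * u, b * w) \<in> D"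
proof -
  have "(norm (a * u))\<^sup>2 \<le> (norm u)\<^sup>2"
    using assms(2) by (intro power_mono) (simp_all add: norm_mult mult_left_le_one_le)
  moreover have "norm (b * w) ^ (2 * m) \<le> norm w ^ (2 * m)"
    using assms(3) by (intro power_mono) (simp_all add: norm_mult mult_left_le_one_le)
  moreover have "(norm u)\<^sup>2 + norm w ^ (2 * m) \<le> 1" using assms(1) by simp
  ultimately show ?thesis unfolding mem_Collect_eq split by linarith
qed

lemma torus: "(u, w) \<in> D \<Longrightarrow> (circ s * u, circ t * w) \<in> D"
  by (rule shrink) auto

lemma cont1: "(u, w) \<in> D \<Longrightarrow> continuous_on (cball 0 1) (\<lambda>l. G (l * u) w)"
  using shrink[of u w _ 1] by (intro continuous_on_compose2[OF cont, of _ "\<lambda>l. (l * u, w)", unfolded split]) (auto intro!: continuous_intros)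

lemma cont2: "(u, w) \<in> D \<Longrightarrow> continuous_on (cball 0 1) (\<lambda>l. G u (l * w))"
  using shrink[of u w 1] by (intro continuous_on_compose2[OF cont, of _ "\<lambda>l. (u, l * w)", unfolded split]) (auto intro!: continuous_intros)

lemma cont_torus:
  "(u, w) \<in> D \<Longrightarrow> continuous_on UNIV (\<lambda>p. G (circ (fst p) * u) (circ (snd p) * w))"
  using torus by (intro continuous_on_compose2[OF cont, of _ "\<lambda>p. (circ (fst p) * u, circ (snd p) * w)", unfolded split]) (auto intro!: continuous_intros)

lemma bounded_G: obtains B where "\<And>u w. (u, w) \<in> D \<Longrightarrow> norm (G u w) \<le> B"
proof -
  have "closed D" unfolding case_prod_unfold by (intro closed_Collect_le continuous_intros)
  moreover have "bounded D"
  proof (rule boundedI[of _ 2])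
    fix p assume "p \<in> D"
    then have p: "(norm (fst p))\<^sup>2 \<le> 1" "norm (snd p) ^ (2 * m) \<le> 1"
      by (auto simp: case_prod_unfold intro: order_trans[rotated])
    then have "norm (fst p) \<le> 1" "norm (snd p) \<le> 1"
      using m power_le_one_iff[of "norm (snd p)" "2 * m"] by (auto simp: power_le_one_iff)
    then show "norm p \<le> 2" using norm_Pair_le[of "fst p" "snd p"] by simp
  qed
  ultimately have "compact D" by (simp add: compact_eq_bounded_closed)
  then have "bounded ((\<lambda>(u, w). G u w) ` D)" by (intro compact_imp_bounded compact_continuous_image cont)
  then obtain B where "\<forall>y\<in>(\<lambda>(u, w). G u w) ` D. norm y \<le> B" unfolding bounded_iff by blast
  then show ?thesis by (intro that[of B]) auto
qed

text \<open>The component of bidegree \<open>(j, k)\<close>, as a mean over the torus.\<close>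

definition coeff :: "nat \<Rightarrow> nat \<Rightarrow> complex \<Rightarrow> complex \<Rightarrow> complex" where
  "coeff j k u w = (\<integral>s. (\<integral>t. G (circ s * u) (circ t * w) * cnj (circ t) ^ k \<partial>unit_measure) * cnj (circ s) ^ j \<partial>unit_measure)"

lemma torus_integrable:
  fixes h :: "real \<times> real \<Rightarrow> complex"
  assumes "(u, w) \<in> D" and h: "continuous_on UNIV h" "\<And>p. norm (h p) \<le> C"
  shows "integrable (unit_measure \<Otimes>\<^sub>M unit_measure) (\<lambda>p. G (circ (fst p) * u) (circ (snd p) * w) * h p)"
proof -
  interpret U: finite_measure unit_measure by (rule finite_unit_measure)
  obtain B where B: "\<And>u w. (u, w) \<in> D \<Longrightarrow> norm (G u w) \<le> B" by (rule bounded_G) blast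
  have "continuous_on UNIV (\<lambda>p. G (circ (fst p) * u) (circ (snd p) * w) * h p)"
    by (intro continuous_intros cont_torus assms h)
  then have meas: "(\<lambda>p. G (circ (fst p) * u) (circ (snd p) * w) * h p) \<in> borel_measurable (unit_measure \<Otimes>\<^sub>M unit_measure)"
    unfolding measurable_cong_sets[OF sets_pair_measure_cong[OF sets_unit_measure sets_unit_measure] refl] borel_prod
    by (rule borel_measurable_continuous_onI)
  have "norm (G (circ (fst p) * u) (circ (snd p) * w) * h p) \<le> B * C" for p
    unfolding norm_mult using B[OF torus[OF assms(1)], of "fst p" "snd p"] h(2)[of p]
    by (intro mult_mono) (auto intro: order_trans[OF norm_ge_zero])
  then show ?thesis using meas
    by (intro finite_measure.integrable_const_bound[where B = "B * C"] finite_measure_pair_measure U.finite_measure_axioms) auto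
qed

lemma torus_fubini:
  fixes h1 h2 :: "real \<Rightarrow> complex"
  assumes "(u, w) \<in> D" and h: "continuous_on UNIV h1" "\<And>p. norm (h1 p) \<le> C1" "continuous_on UNIV h2" "\<And>p. norm (h2 p) \<le> C2"
  shows "(\<integral>s. (\<integral>t. G (circ s * u) (circ t * w) * h2 t \<partial>unit_measure) * h1 s \<partial>unit_measure) = 
      (\<integral>p. G (circ (fst p) * u) (circ (snd p) * w) * (h1 (fst p) * h2 (snd p)) \<partial>(unit_measure \<Otimes>\<^sub>M unit_measure))" (is "?A = ?B")
    and "(\<integral>t. (\<integral>s. G (circ s * u) (circ t * w) * h1 s \<partial>unit_measure) * h2 t \<partial>unit_measure) = 
      (\<integral>p. G (circ (fst p) * u) (circ (snd p) * w) * (h1 (fst p) * h2 (snd p)) \<partial>(unit_measure \<Otimes>\<^sub>M unit_measure))" (is "?C = ?B")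
proof -
  interpret U: finite_measure unit_measure by (rule finite_unit_measure)
  interpret P: pair_sigma_finite unit_measure unit_measure ..
  let ?f = "\<lambda>s t. G (circ s * u) (circ t * w) * (h1 s * h2 t)"
  have int: "integrable (unit_measure \<Otimes>\<^sub>M unit_measure) (\<lambda>(s, t). ?f s t)"
    unfolding split_beta
  proof (rule torus_integrable[OF assms(1), of "\<lambda>p. h1 (fst p) * h2 (snd p)" "C1 * C2"])
    show "continuous_on UNIV (\<lambda>p. h1 (fst p) * h2 (snd p))"
      by (intro continuous_intros continuous_on_compose2[OF h(1)] continuous_on_compose2[OF h(3)]) auto
    show "norm (h1 (fst p) * h2 (snd p)) \<le> C1 * C2" for p
      unfolding norm_mult by (intro mult_mono h(2,4) order_trans[OF norm_ge_zero h(2)[of 0]] norm_ge_zero)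
  qed
  have "?A = (\<integral>s. (\<integral>t. ?f s t \<partial>unit_measure) \<partial>unit_measure)"
    by (simp add: mult_ac flip: integral_mult_right_zero)
  also have "\<dots> = (\<integral>p. (case p of (s, t) \<Rightarrow> ?f s t) \<partial>(unit_measure \<Otimes>\<^sub>M unit_measure))" by (rule P.integral_fst'[OF int, unfolded split])
  finally show "?A = ?B" by (simp add: split_beta)
  have "?C = (\<integral>t. (\<integral>s. ?f s t \<partial>unit_measure) \<partial>unit_measure)"
    by (simp add: mult_ac flip: integral_mult_right_zero)
  also have "\<dots> = (\<integral>p. (case p of (s, t) \<Rightarrow> ?f s t) \<partial>(unit_measure \<Otimes>\<^sub>M unit_measure))" by (rule P.integral_snd[OF int])
  finally show "?C = ?B" by (simp add: split_beta)
qed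

lemma cont_circ_power: "continuous_on UNIV (\<lambda>t. cnj (circ t) ^ k)" "norm (cnj (circ t) ^ k) \<le> 1"
  by (auto intro!: continuous_intros simp: norm_power)

lemma coeff_swap:
  assumes "(u, w) \<in> D"
  shows "coeff j k u w = (\<integral>t. (\<integral>s. G (circ s * u) (circ t * w) * cnj (circ s) ^ j \<partial>unit_measure) * cnj (circ t) ^ k \<partial>unit_measure)"
  unfolding coeff_def torus_fubini(1)[OF assms cont_circ_power cont_circ_power] torus_fubini(2)[OF assms cont_circ_power cont_circ_power] ..

lemma coeff_scale2:
  assumes D: "(u, w) \<in> D" and a: "norm a \<le> 1"
  shows "coeff j k u (a * w) = a ^ k * coeff j k u w"
proof -
  have "(\<integral>t. G (circ s * u) (circ t * (a * w)) * cnj (circ t) ^ k \<partial>unit_measure) = 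
     a ^ k * (\<integral>t. G (circ s * u) (circ t * w) * cnj (circ t) ^ k \<partial>unit_measure)" for s
  proof -
    have D': "(circ s * u, w) \<in> D" using shrink[OF D, of "circ s" 1] by simp
    have h: "(\<lambda>l. G (circ s * u) (l * w)) holomorphic_on ball 0 1" using D' by (intro hol2) simp
    have "(\<integral>t. G (circ s * u) ((a * circ t) * w) * cnj (circ t) ^ k \<partial>unit_measure) = 
     a ^ k * (\<integral>t. G (circ s * u) (circ t * w) * cnj (circ t) ^ k \<partial>unit_measure)"
      by (rule circle_mean_scale[OF cont2[OF D'] h a])
    then show ?thesis by (simp add: mult_ac)
  qed
  then show ?thesis unfolding coeff_def by (simp add: mult.assoc)
qed

lemma coeff_scale1:
  assumes D: "(u, w) \<in> D" and a: "norm a \<le> 1"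
  shows "coeff j k (a * u) w = a ^ j * coeff j k u w"
proof -
  have "(\<integral>s. G (circ s * (a * u)) (circ t * w) * cnj (circ s) ^ j \<partial>unit_measure) = 
     a ^ j * (\<integral>s. G (circ s * u) (circ t * w) * cnj (circ s) ^ j \<partial>unit_measure)" for t
  proof -
    have D': "(u, circ t * w) \<in> D" using shrink[OF D, of 1 "circ t"] by simp
    have h: "(\<lambda>l. G (l * u) (circ t * w)) holomorphic_on ball 0 1" using D' by (intro hol1) simp
    have "(\<integral>s. G ((a * circ s) * u) (circ t * w) * cnj (circ s) ^ j \<partial>unit_measure) = 
     a ^ j * (\<integral>s. G (circ s * u) (circ t * w) * cnj (circ s) ^ j \<partial>unit_measure)"
      by (rule circle_mean_scale[OF cont1[OF D'] h a])
    then show ?thesis by (simp add: mult_ac)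
  qed
  moreover have "(a * u, w) \<in> D" using shrink[OF D a, of 1] by simp
  ultimately show ?thesis unfolding coeff_swap[OF D] by (simp add: coeff_swap mult.assoc)
qed

text \<open>Homogeneity under contraction in both variables makes the component a multiple of a monomial. The value at \<open>(1/2, 1/2)\<close>, a point of the closed domain for every \<open>m \<ge> 1\<close>, fixes the factor.\<close>

lemma coeff_monomial:
  assumes D: "(u, w) \<in> D"
  shows "coeff j k u w = (2 ^ j * 2 ^ k * coeff j k (1 / 2) (1 / 2)) * u ^ j * w ^ k"
proof -
  have uw: "norm u \<le> 1" "norm w \<le> 1"
  proof -
    have "(norm u)\<^sup>2 \<le> 1" "norm w ^ (2 * m) \<le> 1" using D by (auto intro: order_trans[rotated])
    then show "norm u \<le> 1" "norm w \<le> 1"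
      using m power_le_one_iff[of "norm w" "2 * m"] by (auto simp: power_le_one_iff)
  qed
  have base: "(1 / 2, 1 / 2) \<in> D"
  proof -
    have "(1 / 2 :: real) ^ (2 * m) \<le> (1 / 2) ^ 2" using m by (intro power_decreasing) auto
    then show ?thesis by (simp add: power2_eq_square norm_divide)
  qed
  have "coeff j k (1 / 2 * u) (1 / 2 * w) = (1 / 2) ^ j * ((1 / 2) ^ k * coeff j k u w)"
    using coeff_scale1[of u "1 / 2 * w" "1 / 2" j k] coeff_scale2[OF D, of "1 / 2" j k] shrink[OF D, of 1 "1 / 2"] by simp
  moreover have "coeff j k (u * (1 / 2)) (w * (1 / 2)) = u ^ j * (w ^ k * coeff j k (1 / 2) (1 / 2))"
    using coeff_scale1[of "1 / 2" "w * (1 / 2)" u j k] coeff_scale2[OF base, of w j k] shrink[OF base, of 1 w] uw by simp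
  ultimately have "(1 / 2) ^ j * ((1 / 2) ^ k * coeff j k u w) = u ^ j * (w ^ k * coeff j k (1 / 2) (1 / 2))" by (simp add: mult.commute)
  then show ?thesis by (simp add: power_divide field_simps)
qed

text \<open>The product of two Cauchy kernels is expanded into a geometric double series, which may be integrated termwise after the contraction by \<open>x\<close>.\<close>

theorem sums_coeff:
  assumes D: "(u, w) \<in> D" and x: "norm x < 1"
  shows "(\<lambda>n. case prod_decode n of (k, j) \<Rightarrow> x ^ (j + k) * coeff j k u w) sums G (x * u) (x * w)"
proof -
  interpret U: finite_measure unit_measure by (rule finite_unit_measure)
  let ?M = "unit_measure \<Otimes>\<^sub>M unit_measure"
  let ?g = "\<lambda>p. G (circ (fst p) * u) (circ (snd p) * w)"
  define f where "f n p = ?g p * (case prod_decode n of (k, j) \<Rightarrow> (x * cnj (circ (snd p))) ^ k * (x * cnj (circ (fst p))) ^ j)" for n p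
  obtain B where B: "\<And>u w. (u, w) \<in> D \<Longrightarrow> norm (G u w) \<le> B" by (rule bounded_G) blast
  have B0: "B \<ge> 0" using B[OF D] norm_ge_zero order_trans by blast
  let ?N = "\<lambda>n. norm (case prod_decode n of (k, j) \<Rightarrow> x ^ k * x ^ j)"
  have N: "summable ?N" by (rule geometric_sums_prod_decode(1)[OF x x])
  have fb: "norm (f n p) \<le> B * ?N n" for n p
  proof -
    have "norm (case prod_decode n of (k, j) \<Rightarrow> (x * cnj (circ (snd p))) ^ k * (x * cnj (circ (fst p))) ^ j) = ?N n"
      by (simp add: split_beta norm_mult norm_power)
    then show ?thesis unfolding f_def norm_mult using B[OF torus[OF D]] by (intro mult_mono order_trans[OF norm_ge_zero B[OF torus[OF D]]]) auto
  qed
  have int: "integrable ?M (f n)" for n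
    unfolding f_def
  proof (rule torus_integrable[OF D])
    show "norm (case prod_decode n of (k, j) \<Rightarrow> (x * cnj (circ (snd p))) ^ k * (x * cnj (circ (fst p))) ^ j) \<le> ?N n" for p
      by (simp add: split_beta norm_mult norm_power)
  qed (auto simp: split_beta intro!: continuous_intros)
  have sf: "(\<lambda>n. f n p) sums (?g p * (1 / (1 - x * cnj (circ (snd p))) * (1 / (1 - x * cnj (circ (fst p))))))" for p
    unfolding f_def by (intro sums_mult geometric_sums_prod_decode) (use x in \<open>auto simp: norm_mult\<close>)
  have s: "summable (\<lambda>n. norm (f n p))" for p
    by (rule summable_comparison_test'[OF summable_mult[OF N, of B], of 0]) (use fb in simp)
  have s2: "summable (\<lambda>n. \<integral>p. norm (f n p) \<partial>?M)"
  proof (rule summable_comparison_test'[OF summable_mult[OF N, of B], of 0])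
    fix n :: nat
    have "emeasure ?M (UNIV \<times> UNIV) = emeasure unit_measure UNIV * emeasure unit_measure UNIV"
      by (rule U.emeasure_pair_measure_Times) auto
    then have P1: "measure ?M (space ?M) = 1"
      by (simp add: measure_def space_pair_measure emeasure_unit_measure)
    have "(\<integral>p. norm (f n p) \<partial>?M) \<le> (\<integral>p. B * ?N n \<partial>?M)"
      by (rule integral_mono_AE) (use fb int[of n] finite_measure.integrable_const[OF finite_measure_pair_measure[OF U.finite_measure_axioms U.finite_measure_axioms]] in auto)
    also have "\<dots> = B * ?N n" using P1 by simp
    finally show "norm (\<integral>p. norm (f n p) \<partial>?M) \<le> B * ?N n" by (simp add: integral_nonneg_AE)
  qed
  have "(\<lambda>n. integral\<^sup>L ?M (f n)) sums (\<integral>p. (\<Sum>n. f n p) \<partial>?M)"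
    by (rule sums_integral[OF int _ s2]) (use s in auto)
  moreover have "integral\<^sup>L ?M (f n) = (case prod_decode n of (k, j) \<Rightarrow> x ^ (j + k) * coeff j k u w)" for n
  proof -
    obtain k j where n: "prod_decode n = (k, j)" by (cases "prod_decode n")
    have "integral\<^sup>L ?M (f n) = (\<integral>p. x ^ (j + k) * (?g p * (cnj (circ (fst p)) ^ j * cnj (circ (snd p)) ^ k)) \<partial>?M)"
      unfolding f_def n by (simp add: power_mult_distrib power_add mult_ac)
    also have "\<dots> = x ^ (j + k) * coeff j k u w"
      unfolding coeff_def torus_fubini(1)[OF D cont_circ_power cont_circ_power] by simp
    finally show ?thesis by (simp add: n)
  qed
  moreover have "(\<integral>p. (\<Sum>n. f n p) \<partial>?M) = G (x * u) (x * w)"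
  proof -
    let ?k = "\<lambda>t. 1 / (1 - x * cnj (circ t))"
    have nz: "1 - x * cnj (circ t) \<noteq> 0" for t
    proof
      assume "1 - x * cnj (circ t) = 0"
      then have "x * cnj (circ t) = 1" by simp
      then have "norm (x * cnj (circ t)) = 1" by (simp only: norm_one)
      then show False using x by (simp add: norm_mult)
    qed
    have kc: "continuous_on UNIV ?k" using nz by (auto intro!: continuous_intros)
    have kb: "norm (?k t) \<le> 1 / (1 - norm x)" for t
    proof -
      have "1 - norm x \<le> norm (1 - x * cnj (circ t))"
        using norm_triangle_ineq2[of 1 "x * cnj (circ t)"] by (simp add: norm_mult)
      then show ?thesis using x by (simp add: norm_divide frac_le)
    qed
    have "(\<integral>p. (\<Sum>n. f n p) \<partial>?M) = (\<integral>p. ?g p * (?k (fst p) * ?k (snd p)) \<partial>?M)"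
      using sf by (intro Bochner_Integration.integral_cong refl) (simp add: sums_iff mult_ac)
    also have "\<dots> = (\<integral>s. (\<integral>t. G (circ s * u) (circ t * w) * ?k t \<partial>unit_measure) * ?k s \<partial>unit_measure)"
      by (rule torus_fubini(1)[OF D kc kb kc kb, symmetric])
    also have "\<dots> = (\<integral>s. G (circ s * u) (x * w) * ?k s \<partial>unit_measure)"
    proof -
      have "(\<integral>t. G (circ s * u) (circ t * w) * ?k t \<partial>unit_measure) = G (circ s * u) (x * w)" for s
      proof -
        have D': "(circ s * u, w) \<in> D" using shrink[OF D, of "circ s" 1] by simp
        have h: "(\<lambda>l. G (circ s * u) (l * w)) holomorphic_on ball 0 1" using D' by (intro hol2) simp
        show ?thesis using circle_mean_kernel[OF cont2[OF D'] h x] by simp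
      qed
      then show ?thesis by simp
    qed
    also have "\<dots> = G (x * u) (x * w)"
    proof -
      have D': "(u, x * w) \<in> D" using shrink[OF D, of 1 x] x by simp
      have h: "(\<lambda>l. G (l * u) (x * w)) holomorphic_on ball 0 1" using D' by (intro hol1) simp
      show ?thesis using circle_mean_kernel[OF cont1[OF D'] h x] by simp
    qed
    finally show ?thesis .
  qed
  ultimately show ?thesis by simp
qed

end

section \<open>The curvature equation has no rational solution\<close>

text \<open>The numerator of the derivative of \<open>N / q ^ k\<close>, over the denominator \<open>q ^ (k + 1)\<close>.\<close>

definition quotient_deriv :: "nat \<Rightarrow> 'a::field poly \<Rightarrow> 'a poly \<Rightarrow> 'a poly" where
  "quotient_deriv k q N = pderiv N * q - of_nat k * N * pderiv q"

lemma has_field_derivative_quotient: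
  fixes q N :: "'a::real_normed_field poly"
  assumes "poly q x \<noteq> 0" "k \<ge> 1"
  shows "((\<lambda>x. poly N x / poly q x ^ k) has_field_derivative poly (quotient_deriv k q N) x / poly q x ^ Suc k) (at x)"
proof -
  have "((\<lambda>x. poly N x / poly q x ^ k) has_field_derivative
    (poly (pderiv N) x * poly q x ^ k - poly N x * (of_nat k * (poly (pderiv q) x * poly q x ^ (k - 1)))) / (poly q x ^ k * poly q x ^ k)) (at x)"
    using assms by (auto intro!: derivative_eq_intros poly_DERIV)
  moreover have "(poly (pderiv N) x * poly q x ^ k - poly N x * (of_nat k * (poly (pderiv q) x * poly q x ^ (k - 1)))) / (poly q x ^ k * poly q x ^ k)
    = poly (quotient_deriv k q N) x / poly q x ^ Suc k"
  proof -
    obtain l where l: "k = Suc l" using assms(2) by (cases k) auto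
    have num: "poly (pderiv N) x * poly q x ^ k - poly N x * (of_nat k * (poly (pderiv q) x * poly q x ^ (k - 1))) = 
       poly q x ^ l * poly (quotient_deriv k q N) x"
      by (simp add: l quotient_deriv_def algebra_simps)
    have den: "poly q x ^ k * poly q x ^ k = poly q x ^ l * poly q x ^ Suc k" by (simp add: l)
    show ?thesis unfolding num den by (rule mult_divide_mult_cancel_left) (use assms(1) in simp)
  qed
  ultimately show ?thesis by simp
qed

text \<open>A real function known to agree with a complex rational function on an interval has derivatives that agree with the formal ones.\<close>

lemma real_derivative_of_complex_quotient:
  fixes q N :: "complex poly" and P :: "real \<Rightarrow> real"
  assumes I: "open I" "x \<in> I" and q: "\<And>x. x \<in> I \<Longrightarrow> poly q (of_real x) \<noteq> 0" and k: "k \<ge> 1"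
    and P: "\<And>x. x \<in> I \<Longrightarrow> of_real (P x) = poly N (of_real x) / poly q (of_real x) ^ k"
    and der: "(P has_real_derivative D) (at x)"
  shows "of_real D = poly (quotient_deriv k q N) (of_real x) / poly q (of_real x) ^ Suc k"
proof -
  have "((\<lambda>x. complex_of_real (P x)) has_vector_derivative of_real D) (at x)"
    using der by (intro has_vector_derivative_of_real) (simp add: has_real_derivative_iff_has_vector_derivative)
  then have "((\<lambda>x. poly N (of_real x) / poly q (of_real x) ^ k) has_vector_derivative of_real D) (at x)"
    by (rule has_vector_derivative_transform_within_open[OF _ I]) (use P in auto)
  moreover have "((\<lambda>x. poly N (of_real x) / poly q (of_real x) ^ k) has_vector_derivative poly (quotient_deriv k q N) (of_real x) / poly q (of_real x) ^ Suc k) (at x)"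
    by (rule has_vector_derivative_real_field[OF has_field_derivative_quotient[OF q[OF I(2)] k]])
  ultimately show ?thesis by (rule vector_derivative_unique_at)
qed

text \<open>The equation `scalar curvature equals \<open>S\<close>' on the axis \<open>z = 0\<close>, cleared of denominators; \<open>P1\<close>, \<open>P2\<close>, \<open>P3\<close> are the derivatives of \<open>P\<close>. The weight \<open>q\<close> in the middle term makes the expression homogeneous when \<open>P = N / q\<close>.\<close>

definition curvature_expr :: "'a::comm_ring_1 \<Rightarrow> 'a \<Rightarrow> 'a \<Rightarrow> 'a \<Rightarrow> 'a \<Rightarrow> 'a \<Rightarrow> 'a \<Rightarrow> 'a \<Rightarrow> 'a \<Rightarrow> 'a \<Rightarrow> 'a" where
  "curvature_expr S d n h x q P P1 P2 P3 = S * P\<^sup>2 * P1 ^ 3 + q * ((d * (n + h) + h * d) * P * P1 ^ 3 + h * P\<^sup>2 * P2 * P1)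
     + h * x * (d * (d * P1 ^ 4 + P * P2 * P1\<^sup>2) + d * (P * P2 * P1\<^sup>2 - P1 ^ 4) + P\<^sup>2 * P1 * P3 - P\<^sup>2 * P2\<^sup>2)"

lemma curvature_expr_rational:
  fixes q :: "'a::field"
  assumes "q \<noteq> 0"
  shows "curvature_expr S d n h x 1 (N / q) (N1 / q\<^sup>2) (N2 / q ^ 3) (N3 / q ^ 4) * q ^ 8 = curvature_expr S d n h x q N N1 N2 N3"
proof -
  have eq: "N = (N / q) * q" "N1 = (N1 / q\<^sup>2) * q\<^sup>2" "N2 = (N2 / q ^ 3) * q ^ 3" "N3 = (N3 / q ^ 4) * q ^ 4"
    using assms by simp_all
  define a b c e where "a = N / q" and "b = N1 / q\<^sup>2" and "c = N2 / q ^ 3" and "e = N3 / q ^ 4"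
  have "curvature_expr S d n h x q (a * q) (b * q\<^sup>2) (c * q ^ 3) (e * q ^ 4) = curvature_expr S d n h x 1 a b c e * q ^ 8"
    unfolding curvature_expr_def by algebra
  then show ?thesis using eq by (simp add: a_def b_def c_def e_def)
qed

text \<open>The cleared equation holds at infinitely many points, hence identically, and is evaluated at a simple pole of \<open>P\<close>, where only the leading Laurent coefficients of the derivatives survive.\<close>

lemma curvature_pole:
  fixes S d n h :: complex and q N :: "complex poly" and P P1 P2 P3 :: "real \<Rightarrow> real"
  assumes \<epsilon>: "\<epsilon> > 0"
    and q: "\<And>x. x \<in> {0<..<\<epsilon>} \<Longrightarrow> poly q (of_real x) \<noteq> 0"
    and P: "\<And>x. x \<in> {0<..<\<epsilon>} \<Longrightarrow> of_real (P x) = poly N (of_real x) / poly q (of_real x)"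
    and d1: "\<And>x. x \<in> {0<..<\<epsilon>} \<Longrightarrow> (P has_real_derivative P1 x) (at x)"
    and d2: "\<And>x. x \<in> {0<..<\<epsilon>} \<Longrightarrow> (P1 has_real_derivative P2 x) (at x)"
    and d3: "\<And>x. x \<in> {0<..<\<epsilon>} \<Longrightarrow> (P2 has_real_derivative P3 x) (at x)"
    and eq: "\<And>x. x \<in> {0<..<\<epsilon>} \<Longrightarrow> curvature_expr S d n h (of_real x) 1 (of_real (P x)) (of_real (P1 x)) (of_real (P2 x)) (of_real (P3 x)) = 0"
    and r: "poly q r = 0" "poly (pderiv q) r \<noteq> 0" "poly N r \<noteq> 0"
  shows "S * poly N r = h * r * poly (pderiv q) r * (d + 1) * (d + 2)"
proof -
  let ?I = "{0<..<\<epsilon>}"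
  define N1 N2 N3 where "N1 = quotient_deriv 1 q N" and "N2 = quotient_deriv 2 q N1" and "N3 = quotient_deriv 3 q N2"
  have P1: "of_real (P1 x) = poly N1 (of_real x) / poly q (of_real x) ^ 2" if "x \<in> ?I" for x
    using real_derivative_of_complex_quotient[of ?I x q 1 P N] that q P d1 by (simp add: N1_def power2_eq_square)
  have P2: "of_real (P2 x) = poly N2 (of_real x) / poly q (of_real x) ^ 3" if "x \<in> ?I" for x
    using real_derivative_of_complex_quotient[of ?I x q 2 P1 N1] that q P1 d2 by (simp add: N2_def numeral_3_eq_3 numeral_2_eq_2)
  have P3: "of_real (P3 x) = poly N3 (of_real x) / poly q (of_real x) ^ 4" if "x \<in> ?I" for x
    using real_derivative_of_complex_quotient[of ?I x q 3 P2 N2] that q P2 d3 by (simp add: N3_def eval_nat_numeral)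
  define E where "E = curvature_expr [:S:] [:d:] [:n:] [:h:] [:0, 1:] q N N1 N2 N3"
  have pE: "poly E z = curvature_expr S d n h z (poly q z) (poly N z) (poly N1 z) (poly N2 z) (poly N3 z)" for z
    by (simp add: E_def curvature_expr_def)
  have "poly E (of_real x) = 0" if "x \<in> ?I" for x
    using curvature_expr_rational[OF q[OF that], symmetric, of S d n h "of_real x" "poly N (of_real x)" "poly N1 (of_real x)" "poly N2 (of_real x)" "poly N3 (of_real x)"]
      eq[OF that] by (simp add: pE P[OF that] P1[OF that] P2[OF that] P3[OF that])
  then have "of_real ` ?I \<subseteq> {z. poly E z = 0}" by auto
  moreover have "infinite (of_real ` ?I :: complex set)"
    using \<epsilon> by (subst finite_image_iff) (auto simp: inj_on_def)
  ultimately have "E = 0" using poly_roots_finite finite_subset by blast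
  then have "poly E r = 0" by simp
  define u v where "u = poly N r" and "v = poly (pderiv q) r"
  have N1r: "poly N1 r = - u * v" using r(1) by (simp add: N1_def quotient_deriv_def u_def v_def)
  have N2r: "poly N2 r = 2 * u * v\<^sup>2" using r(1) N1r by (simp add: N2_def quotient_deriv_def v_def power2_eq_square)
  have N3r: "poly N3 r = - 6 * u * v ^ 3" using r(1) N2r by (simp add: N3_def quotient_deriv_def v_def power2_eq_square power3_eq_cube)
  have "u ^ 4 * v ^ 3 * (h * r * v * (d + 1) * (d + 2) - S * u) = 0"
    using \<open>poly E r = 0\<close> unfolding pE r(1) N1r N2r N3r u_def[symmetric] curvature_expr_def by algebra
  then show ?thesis using r(2,3) by (simp add: u_def v_def)
qed

text \<open>The pole at 1 forces \<open>S = - (d + 2)\<close>. A root of \<open>p\<close> of order \<open>\<mu>\<close> makes \<open>x p' / p\<close> have a simple pole with residue proportional to \<open>\<mu>\<close> and forces \<open>S \<mu> = (d + 1) (d + 2)\<close>, which is positive.\<close>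

theorem no_constant_curvature:
  fixes A S h :: real and d :: nat and p :: "complex poly" and P P1 P2 P3 :: "real \<Rightarrow> real"
  assumes \<epsilon>: "\<epsilon> > 0" "\<epsilon> \<le> 1" and h: "h > 0"
    and p: "\<And>x. x \<in> {0<..<\<epsilon>} \<Longrightarrow> poly p (of_real x) \<noteq> 0" "poly p 0 \<noteq> 0" "poly p 1 \<noteq> 0" "degree p > 0"
    and P: "\<And>x. x \<in> {0<..<\<epsilon>} \<Longrightarrow> complex_of_real (P x) = of_real A + of_real h * (of_real x * poly (pderiv p) (of_real x) / poly p (of_real x) 
        + of_nat (d + 1) * of_real x / (1 - of_real x))"
    and d1: "\<And>x. x \<in> {0<..<\<epsilon>} \<Longrightarrow> (P has_real_derivative P1 x) (at x)"
    and d2: "\<And>x. x \<in> {0<..<\<epsilon>} \<Longrightarrow> (P1 has_real_derivative P2 x) (at x)"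
    and d3: "\<And>x. x \<in> {0<..<\<epsilon>} \<Longrightarrow> (P2 has_real_derivative P3 x) (at x)"
    and eq: "\<And>x. x \<in> {0<..<\<epsilon>} \<Longrightarrow> curvature_expr S (real d) (real (d + 1)) h x 1 (P x) (P1 x) (P2 x) (P3 x) = 0"
  shows False
proof -
  let ?I = "{0<..<\<epsilon>}"
  let ?x = "[:0, 1:] :: complex poly"
  have eq': "curvature_expr (of_real S) (of_nat d) (of_nat (d + 1)) (of_real h) (of_real x) 1 (of_real (P x)) (of_real (P1 x)) (of_real (P2 x)) (of_real (P3 x)) = (0 :: complex)"
    if "x \<in> ?I" for x
    using arg_cong[OF eq[OF that], of complex_of_real] by (simp add: curvature_expr_def)
  have pole: "of_real S * poly N r = of_real h * r * poly (pderiv q) r * (of_nat d + 1) * (of_nat d + 2)"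
    if "\<And>x. x \<in> ?I \<Longrightarrow> poly q (of_real x) \<noteq> 0" "\<And>x. x \<in> ?I \<Longrightarrow> of_real (P x) = poly N (of_real x) / poly q (of_real x)"
      "poly q r = 0" "poly (pderiv q) r \<noteq> 0" "poly N r \<noteq> 0" for q N :: "complex poly" and r
    by (rule curvature_pole[OF \<epsilon>(1) that(1,2) d1 d2 d3 eq' that(3-5)])
  have x1: "1 - complex_of_real x \<noteq> 0" if "x \<in> ?I" for x
    using that \<epsilon> by (metis greaterThanLessThan_iff eq_iff_diff_eq_0 less_irrefl of_real_1 of_real_eq_iff order_less_le_trans)
  have hn: "complex_of_real h \<noteq> 0" using h by simp
  have "of_real S = - (of_nat (d + 2) :: complex)"
  proof -
    (* At the simple pole x = 1 of P = N / q. *)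
    define q where "q = (1 - ?x) * p"
    define N where "N = [:of_real A:] * q + [:of_real h:] * (?x * pderiv p * (1 - ?x) + of_nat (d + 1) * ?x * p)"
    have "of_real S * poly N 1 = of_real h * 1 * poly (pderiv q) 1 * (of_nat d + 1) * (of_nat d + 2)"
    proof (rule pole)
      show "poly q (of_real x) \<noteq> 0" if "x \<in> ?I" for x using p(1)[OF that] x1[OF that] by (simp add: q_def)
      show "of_real (P x) = poly N (of_real x) / poly q (of_real x)" if "x \<in> ?I" for x
        using p(1)[OF that] x1[OF that] unfolding P[OF that] by (simp add: N_def q_def field_simps)
    qed (use p(3) hn of_nat_neq_0[of d, where 'a = complex] in \<open>auto simp: N_def q_def pderiv_mult pderiv_smult pderiv_diff pderiv_pCons\<close>)
    moreover have "poly N 1 = of_real h * (of_nat d + 1) * poly p 1" "poly (pderiv q) 1 = - poly p 1"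
      by (simp_all add: N_def q_def pderiv_mult pderiv_smult pderiv_diff pderiv_pCons)
    ultimately have "(of_real S + (of_nat d + 2)) * (of_real h * (of_nat d + 1) * poly p 1) = 0" by algebra
    moreover have "(of_nat d + 1 :: complex) \<noteq> 0" using of_nat_neq_0[of d, where 'a = complex] by (simp add: add.commute)
    ultimately have "of_real S + (of_nat d + 2) = (0 :: complex)" using hn p(3) by (simp only: mult_eq_0_iff) simp
    then show ?thesis by (simp only: eq_neg_iff_add_eq_0 of_nat_add of_nat_numeral)
  qed
  moreover obtain r where r: "poly p r = 0"
    using alg_closed_imp_poly_has_root[OF p(4)] by blast
  define \<mu> where "\<mu> = order r p"
  have p0: "p \<noteq> 0" using p(2) by auto
  have \<mu>: "\<mu> > 0" using r p0 by (simp add: \<mu>_def order_root)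
  obtain p1 where p1: "p = [:- r, 1:] ^ \<mu> * p1" "\<not> [:- r, 1:] dvd p1" using order_decomp[OF p0, of r] by (auto simp: \<mu>_def)
  have p1r: "poly p1 r \<noteq> 0" using p1(2) by (simp add: poly_eq_0_iff_dvd)
  have rn: "r \<noteq> 0" "1 - r \<noteq> 0" using r p(2,3) by auto
  have "of_real S * of_nat \<mu> = (of_nat ((d + 1) * (d + 2)) :: complex)"
  proof -
    (* One factor of each root suffices as denominator: p' / p has simple poles only. *)
    define q where "q = [:- r, 1:] * (1 - ?x) * p1"
    define N where "N = [:of_real A:] * q + [:of_real h:] * (of_nat \<mu> * ?x * (1 - ?x) * p1 + ?x * [:- r, 1:] * (1 - ?x) * pderiv p1 + of_nat (d + 1) * ?x * [:- r, 1:] * p1)"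
    have nz: "of_real x - r \<noteq> 0" "poly p1 (of_real x) \<noteq> 0" if "x \<in> ?I" for x
      using p(1)[OF that] \<mu> by (auto simp: p1(1))
    have pd: "poly (pderiv p) z = of_nat \<mu> * (z - r) ^ (\<mu> - 1) * poly p1 z + (z - r) ^ \<mu> * poly (pderiv p1) z" for z
      by (simp add: p1(1) pderiv_mult pderiv_power pderiv_pCons algebra_simps)
    have "of_real S * poly N r = of_real h * r * poly (pderiv q) r * (of_nat d + 1) * (of_nat d + 2)"
    proof (rule pole)
      show "poly q (of_real x) \<noteq> 0" if "x \<in> ?I" for x using nz[OF that] x1[OF that] by (simp add: q_def)
      show "of_real (P x) = poly N (of_real x) / poly q (of_real x)" if "x \<in> ?I" for x
      proof -
        have "poly (pderiv p) (of_real x) / poly p (of_real x) = of_nat \<mu> / (of_real x - r) + poly (pderiv p1) (of_real x) / poly p1 (of_real x)"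
        proof -
          obtain l where l: "\<mu> = Suc l" using \<mu> by (cases \<mu>) auto
          have "poly p (of_real x) = (of_real x - r) ^ \<mu> * poly p1 (of_real x)" by (simp add: p1(1))
          then show ?thesis unfolding pd using nz[OF that] by (simp add: l divide_simps) (simp add: algebra_simps)
        qed
        then have Y: "of_real x * poly (pderiv p) (of_real x) / poly p (of_real x) = of_real x * (of_nat \<mu> / (of_real x - r) + poly (pderiv p1) (of_real x) / poly p1 (of_real x))"
          by (simp only: times_divide_eq_right[symmetric])
        have alg: "A + h * (X * (M / a + c' / c) + n * X / b) = (A * (a * b * c) + h * (M * X * b * c + X * a * b * c' + n * X * a * c)) / (a * b * c)"
          if "a \<noteq> 0" "b \<noteq> 0" "c \<noteq> 0" for A h X M a b c c' n :: complex
          using that by (simp add: field_simps)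
        have qX: "poly q (of_real x) = (of_real x - r) * (1 - of_real x) * poly p1 (of_real x)" by (simp add: q_def algebra_simps)
        have NX: "poly N (of_real x) = of_real A * ((of_real x - r) * (1 - of_real x) * poly p1 (of_real x)) + of_real h * (of_nat \<mu> * of_real x * (1 - of_real x) * poly p1 (of_real x)
            + of_real x * (of_real x - r) * (1 - of_real x) * poly (pderiv p1) (of_real x) + of_nat (d + 1) * of_real x * (of_real x - r) * poly p1 (of_real x))"
          by (simp add: N_def q_def algebra_simps)
        show ?thesis unfolding P[OF that] Y qX NX by (rule alg) (use nz[OF that] x1[OF that] in auto)
      qed
    qed (use p1r hn rn \<mu> in \<open>auto simp: N_def q_def pderiv_mult pderiv_smult pderiv_diff pderiv_pCons\<close>)
    moreover have "poly N r = of_real h * of_nat \<mu> * r * (1 - r) * poly p1 r" "poly (pderiv q) r = (1 - r) * poly p1 r"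
      by (simp_all add: N_def q_def pderiv_mult pderiv_smult pderiv_diff pderiv_pCons)
    ultimately have "(of_real S * of_nat \<mu> - of_nat ((d + 1) * (d + 2))) * (of_real h * r * (1 - r) * poly p1 r) = 0"
      by (simp add: algebra_simps)
    then show ?thesis using hn rn p1r by simp
  qed
  ultimately have "- (of_nat (d + 2) * of_nat \<mu>) = (of_nat ((d + 1) * (d + 2)) :: complex)" by (simp only: mult_minus_left)
  then have "- (of_nat ((d + 2) * \<mu>)) = (of_nat ((d + 1) * (d + 2)) :: complex)" by (simp only: of_nat_mult)
  then have "of_nat ((d + 2) * \<mu>) + of_nat ((d + 1) * (d + 2)) = (0 :: complex)" by (simp only: neg_eq_iff_add_eq_0)
  then have "of_nat ((d + 2) * \<mu> + (d + 1) * (d + 2)) = (0 :: complex)" by (simp only: of_nat_add)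
  then show False by (simp only: of_nat_eq_0_iff) simp
qed

section \<open>The numerator polynomials\<close>

text \<open>The recursion comes from applying \<open>h x d/dx + (h c + j)\<close> to \<open>p(x) / (1 - x) ^ (j + 1)\<close>, which multiplies the \<open>k\<close>-th coefficient by \<open>(k + c) h + j\<close>. The type is left open because the poles are complex.\<close>

fun pochhammer_numerator :: "real \<Rightarrow> real \<Rightarrow> nat \<Rightarrow> 'a::real_field poly" where
  "pochhammer_numerator h c 0 = 1"
| "pochhammer_numerator h c (Suc j) = smult (of_real (h * c + real j)) ([:1, -1:] * pochhammer_numerator h c j) +
     smult (of_real h) ([:0, 1:] * ([:1, -1:] * pderiv (pochhammer_numerator h c j)) + smult (of_nat (Suc j)) ([:0, 1:] * pochhammer_numerator h c j))"

lemma coeff_gnum_of_real: "coeff (pochhammer_numerator h c j :: complex poly) i = of_real (coeff (pochhammer_numerator h c j) i)"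
proof (induction j arbitrary: i)
  case (Suc j)
  show ?case by (cases i rule: nat.exhaust[case_product nat.exhaust])
      (auto simp: Suc coeff_pderiv coeff_pCons split: nat.splits)
qed (simp add: coeff_pCons one_pCons split: nat.splits)

lemma pochhammer_numerator_of_real: "(pochhammer_numerator h c j :: complex poly) = map_poly of_real (pochhammer_numerator h c j)"
  by (rule poly_eqI) (simp add: coeff_map_poly coeff_gnum_of_real)

lemma poly_gnum_of_real: 
  "poly (pochhammer_numerator h c j :: complex poly) (of_real x) = of_real (poly (pochhammer_numerator h c j) x)"
  "poly (pderiv (pochhammer_numerator h c j) :: complex poly) (of_real x) = of_real (poly (pderiv (pochhammer_numerator h c j)) x)"
proof -
  have eq: "poly q (complex_of_real x) = of_real (poly r x)" if "\<And>i. coeff q i = of_real (coeff r i)" for q and r :: "real poly"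
  proof -
    have "degree q = degree r"
      using that by (intro antisym; intro degree_le) (auto simp: coeff_eq_0, metis coeff_eq_0 of_real_eq_0_iff)
    then show ?thesis by (simp add: poly_altdef that)
  qed
  show "poly (pochhammer_numerator h c j :: complex poly) (of_real x) = of_real (poly (pochhammer_numerator h c j) x)"
    by (rule eq) (rule coeff_gnum_of_real)
  show "poly (pderiv (pochhammer_numerator h c j) :: complex poly) (of_real x) = of_real (poly (pderiv (pochhammer_numerator h c j)) x)"
    by (rule eq) (simp add: coeff_pderiv coeff_gnum_of_real)
qed

lemma pochhammer_numerator_0: "poly (pochhammer_numerator h c j) (0::real) = pochhammer (h * c) j"
  by (induction j) (simp_all add: pochhammer_rec' mult_ac)

lemma pochhammer_numerator_1: "poly (pochhammer_numerator h c j) (1::real) = h ^ j * fact j"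
  by (induction j) (simp_all add: algebra_simps)

text \<open>The left side is the coefficient of \<open>x\<close> in the power series of \<open>p(x) / (1 - x) ^ (j + 1)\<close>.\<close>

lemma pochhammer_numerator_deriv_0: "poly (pderiv (pochhammer_numerator h c j)) (0::real) + real (Suc j) * poly (pochhammer_numerator h c j) 0 = pochhammer (h * c + h) j"
proof (induction j)
  case (Suc j)
  have "poly (pderiv (pochhammer_numerator h c (Suc j))) (0::real) + real (Suc (Suc j)) * poly (pochhammer_numerator h c (Suc j)) 0 =
     (h * c + h + real j) * (poly (pderiv (pochhammer_numerator h c j)) 0 + real (Suc j) * poly (pochhammer_numerator h c j) 0)"
    by (simp add: pderiv_add pderiv_smult pderiv_mult pderiv_pCons algebra_simps)
  then show ?case by (simp only: Suc pochhammer_rec')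
qed simp

lemma pochhammer_numerator_unit: "pochhammer_numerator 1 1 j = (of_nat (fact j) :: 'a::real_field poly)"
proof (induction j)
  case (Suc j)
  have "pderiv (of_nat (fact j) :: 'a poly) = 0" by (simp add: of_nat_poly)
  then show ?case by (simp add: Suc of_nat_poly algebra_simps)
qed simp

text \<open>Increasing \<open>j\<close> multiplies the coefficients by a linear function of \<open>k\<close>, which is a first-order differential operator on the sum.\<close>

theorem sums_pochhammer:
  fixes x h c :: real
  assumes "\<bar>x\<bar> < 1"
  shows "(\<lambda>k. pochhammer ((real k + c) * h) j * x ^ k) sums (poly (pochhammer_numerator h c j) x / (1 - x) ^ Suc j)"
  using assms
proof (induction j arbitrary: x)
  case 0
  then show ?case using geometric_sums[of x] by simp
next
  case (Suc j)
  let ?a = "\<lambda>k. pochhammer ((real k + c) * h) j"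
  let ?p = "pochhammer_numerator h c j :: real poly"
  let ?F = "\<lambda>x. poly ?p x / (1 - x) ^ Suc j"
  have x1: "1 - x \<noteq> 0" using Suc.prems by auto
  have der: "(?F has_real_derivative (poly (pderiv ?p) x / (1 - x) ^ Suc j + real (Suc j) * poly ?p x / (1 - x) ^ Suc (Suc j))) (at x)"
  proof -
    have "((\<lambda>x. poly ?p x / poly [:1, -1:] x ^ Suc j) has_real_derivative poly (quotient_deriv (Suc j) [:1, -1:] ?p) x / poly [:1, -1:] x ^ Suc (Suc j)) (at x)"
      by (rule has_field_derivative_quotient) (use x1 in auto)
    moreover have "poly (quotient_deriv (Suc j) [:1, -1:] ?p) x = poly (pderiv ?p) x * (1 - x) + real (Suc j) * poly ?p x"
      by (simp add: quotient_deriv_def pderiv_pCons algebra_simps)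
    moreover have "(q * y + n) / y ^ Suc (Suc j) = q / y ^ Suc j + n / y ^ Suc (Suc j)" if "y \<noteq> 0" for q y n :: real
      using that by (simp add: add_divide_distrib)
    from this[OF x1] have "(poly (pderiv ?p) x * (1 - x) + real (Suc j) * poly ?p x) / (1 - x) ^ Suc (Suc j) = 
      poly (pderiv ?p) x / (1 - x) ^ Suc j + real (Suc j) * poly ?p x / (1 - x) ^ Suc (Suc j)" .
    moreover have "poly [:1, -1:] y = 1 - y" for y :: real by simp
    ultimately show ?thesis by (simp only:)
  qed
  obtain K where K: "\<bar>x\<bar> < K" "K < 1" using Suc.prems dense by blast
  have "(\<lambda>k. diffs ?a k * x ^ k) sums (poly (pderiv ?p) x / (1 - x) ^ Suc j + real (Suc j) * poly ?p x / (1 - x) ^ Suc (Suc j))"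
  proof (rule termdiffs_sums_strong[of K])
    show "(\<lambda>k. ?a k * z ^ k) sums ?F z" if "norm z < K" for z using Suc.IH[of z] that K by simp
    show "norm x < K" using K by simp
  qed (rule der)
  then have "(\<lambda>k. real (Suc k) * ?a (Suc k) * x ^ k) sums (poly (pderiv ?p) x / (1 - x) ^ Suc j + real (Suc j) * poly ?p x / (1 - x) ^ Suc (Suc j))"
    by (simp add: diffs_def)
  from sums_mult[OF this, of x]
  have "(\<lambda>k. real (Suc k) * ?a (Suc k) * x ^ Suc k) sums (x * (poly (pderiv ?p) x / (1 - x) ^ Suc j + real (Suc j) * poly ?p x / (1 - x) ^ Suc (Suc j)))"
    by (simp add: mult_ac)
  then have d: "(\<lambda>k. real k * ?a k * x ^ k) sums (x * (poly (pderiv ?p) x / (1 - x) ^ Suc j + real (Suc j) * poly ?p x / (1 - x) ^ Suc (Suc j)))"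
    by (subst (asm) sums_Suc_iff) simp
  have "(\<lambda>k. (h * c + real j) * (?a k * x ^ k) + h * (real k * ?a k * x ^ k)) sums 
     ((h * c + real j) * ?F x + h * (x * (poly (pderiv ?p) x / (1 - x) ^ Suc j + real (Suc j) * poly ?p x / (1 - x) ^ Suc (Suc j))))"
    by (intro sums_add sums_mult d Suc)
  also have "(\<lambda>k. (h * c + real j) * (?a k * x ^ k) + h * (real k * ?a k * x ^ k)) = (\<lambda>k. pochhammer ((real k + c) * h) (Suc j) * x ^ k)"
    by (simp add: fun_eq_iff pochhammer_rec' algebra_simps)
  also have "(h * c + real j) * ?F x + h * (x * (poly (pderiv ?p) x / (1 - x) ^ Suc j + real (Suc j) * poly ?p x / (1 - x) ^ Suc (Suc j))) =
     poly (pochhammer_numerator h c (Suc j)) x / (1 - x) ^ Suc (Suc j)"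
  proof -
    have "A * (p / y ^ Suc j) + h * (x * (q / y ^ Suc j + n * p / y ^ Suc (Suc j))) = (A * (y * p) + h * (x * (y * q) + n * (x * p))) / y ^ Suc (Suc j)"
      if "y \<noteq> 0" for A p q y n :: real
      using that by (simp add: field_simps)
    note eq = this[OF x1]
    have g: "poly (pochhammer_numerator h c (Suc j)) x = (h * c + real j) * ((1 - x) * poly ?p x) + h * (x * ((1 - x) * poly (pderiv ?p) x) + real (Suc j) * (x * poly ?p x))"
      by (simp add: algebra_simps)
    show ?thesis unfolding g by (rule eq)
  qed
  finally show ?case .
qed

text \<open>The values at 0 and 1 are \<open>pochhammer (h c) j\<close> and \<open>h ^ j * fact j\<close>. They differ because each factor \<open>h c + i\<close> of the first is larger than the factor \<open>h (i + 1)\<close> of the second.\<close>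

lemma pochhammer_numerator_nonconstant:
  assumes h: "h > 0" "h \<le> 1" and c: "c > 1" and j: "j > 0"
  shows "degree (pochhammer_numerator h c j :: complex poly) > 0"
proof (rule ccontr)
  assume "\<not> ?thesis"
  then obtain a where "(pochhammer_numerator h c j :: complex poly) = [:a:]" by (metis degree_eq_zeroE neq0_conv)
  then have "poly (pochhammer_numerator h c j :: complex poly) (of_real 0) = poly (pochhammer_numerator h c j :: complex poly) (of_real 1)" by simp
  then have "pochhammer (h * c) j = h ^ j * fact j"
    unfolding poly_gnum_of_real of_real_eq_iff pochhammer_numerator_0 pochhammer_numerator_1 .
  moreover have "h ^ j * fact j = (\<Prod>i<j. h * (1 + real i))"
    by (simp add: prod.distrib fact_prod_Suc atLeast0LessThan)
  moreover have "pochhammer (h * c) j = (\<Prod>i<j. h * c + real i)"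
    by (simp add: pochhammer_prod atLeast0LessThan)
  moreover have "(\<Prod>i<j. h * (1 + real i)) < (\<Prod>i<j. h * c + real i)"
  proof -
    have le: "h * (1 + real i) < h * c + real i" for i
    proof -
      have "h * 1 < h * c" using h c by (intro mult_strict_left_mono) auto
      moreover have "h * real i \<le> 1 * real i" using h by (intro mult_right_mono) auto
      ultimately show ?thesis by (simp add: distrib_left)
    qed
    have pos: "0 < h * (1 + real i)" for i using h by simp
    show ?thesis
    proof (rule prod_mono_strict[of 0])
      show "h * (1 + real 0) < h * c + real 0" by (rule le)
      show "0 \<le> h * (1 + real i) \<and> h * (1 + real i) \<le> h * c + real i" for i
        using pos[of i] le[of i] by (simp only: less_imp_le simp_thms)
      show "0 < h * c + real i" for i using pos[of i] le[of i] by (rule less_trans)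
    qed (use j in auto)
  qed
  ultimately show False by simp
qed

section \<open>The kernel series\<close>

definition weight_exp :: "'k::finite itself \<Rightarrow> nat \<Rightarrow> real" where
  "weight_exp TYPE('k) m = 1 + (real m - 1) / (real CARD('k) + 2)"

lemma moment_exp_eq: "moment_exp TYPE('k::finite) m k = (real k + weight_exp TYPE('k) m) * (1 / real m)"
  by (simp add: moment_exp_def weight_exp_def)

lemma weight_exp_ge: "m \<ge> 1 \<Longrightarrow> weight_exp TYPE('k::finite) m \<ge> 1"
  by (simp add: weight_exp_def)

lemma moment_exp_pos: "m \<ge> 1 \<Longrightarrow> moment_exp TYPE('k::finite) m k > 0"
  unfolding moment_exp_eq using weight_exp_ge[of m, where 'k = 'k] by (intro mult_pos_pos add_nonneg_pos) auto

lemma moment_const_pos: "m \<ge> 1 \<Longrightarrow> moment_const TYPE('k::finite) m > 0"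
  by (simp add: moment_const_def)

text \<open>The reciprocal of the squared norm of a monomial, see \<open>moment_eq_inverse_kernel_coeff\<close>.\<close>

definition kernel_coeff :: "'k::finite itself \<Rightarrow> nat \<Rightarrow> nat \<Rightarrow> nat \<Rightarrow> real" where
  "kernel_coeff TYPE('k) m j k =
     pochhammer (moment_exp TYPE('k) m k) (CARD('k) + j) / (moment_const TYPE('k) m * fact j)"

lemma kernel_coeff_pos: "m \<ge> 1 \<Longrightarrow> kernel_coeff TYPE('k::finite) m j k > 0"
  unfolding kernel_coeff_def using moment_exp_pos[of m, where 'k = 'k] moment_const_pos[of m, where 'k = 'k]
  by (intro divide_pos_pos pochhammer_pos) auto

lemma moment_eq_inverse_kernel_coeff:
  fixes k :: nat
  assumes m: "m \<ge> 1"
  defines "b \<equiv> moment_exp TYPE('k::finite) m k"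
  shows "moment_const TYPE('k) m * fact j * Gamma b / Gamma (real CARD('k) + real j + b) = 1 / kernel_coeff TYPE('k) m j k"
proof -
  have b: "b > 0" unfolding b_def by (rule moment_exp_pos[OF m])
  then have "b \<notin> \<int>\<^sub>\<le>\<^sub>0" by (auto elim!: nonpos_Ints_cases)
  then have "pochhammer b (CARD('k) + j) = Gamma (b + of_nat (CARD('k) + j)) / Gamma b" by (rule pochhammer_Gamma)
  then show ?thesis using b unfolding kernel_coeff_def b_def[symmetric] by (simp add: add_ac)
qed

definition kernel_term :: "nat \<Rightarrow> nat \<Rightarrow> 'k::finite pt \<Rightarrow> 'k pt \<Rightarrow> complex" where
  "kernel_term m n p q = (case prod_decode n of (k, j) \<Rightarrow>
     of_real (kernel_coeff TYPE('k) m j k) * cinner (fst p) (fst q) ^ j * (snd p * cnj (snd q)) ^ k)"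

definition egg_kernel :: "nat \<Rightarrow> 'k::finite pt \<Rightarrow> 'k pt \<Rightarrow> complex" where
  "egg_kernel m p q = (\<Sum>n. kernel_term m n p q)"

lemma sums_negative_binomial:
  fixes a \<beta> :: real
  assumes "\<bar>a\<bar> < 1"
  shows "(\<lambda>j. pochhammer \<beta> j / fact j * a ^ j) sums ((1 - a) powr (- \<beta>))"
proof -
  have "(\<lambda>j. ((- \<beta>) gchoose j) * (- a) ^ j) sums ((1 + (- a)) powr (- \<beta>))"
    by (rule gen_binomial_real) (use assms in simp)
  moreover have "((- \<beta>) gchoose j) * (- a) ^ j = pochhammer \<beta> j / fact j * a ^ j" for j
  proof -
    have "((- \<beta>) gchoose j) * (- a) ^ j = ((- 1) ^ j * (- 1) ^ j) * (pochhammer \<beta> j / fact j * a ^ j)"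
      unfolding gbinomial_pochhammer power_minus[of a] by simp
    then show ?thesis by (simp flip: power_mult_distrib)
  qed
  ultimately show ?thesis by simp
qed

context
  fixes m :: nat and d h c C0 and T :: "'k::finite itself"
  assumes m: "m \<ge> 1"
  defines "d \<equiv> CARD('k)" and "h \<equiv> 1 / real m" and "c \<equiv> weight_exp TYPE('k) m"
    and "C0 \<equiv> 1 / moment_const TYPE('k) m"
begin

text \<open>For fixed \<open>k\<close> the Pochhammer symbol splits off a factor free of \<open>j\<close>, and the remaining series is the binomial series.\<close>

lemma kernel_coeff_row:
  assumes a: "0 \<le> a" "a < 1"
  shows "(\<lambda>j. kernel_coeff TYPE('k) m j k * a ^ j) sums
     (C0 * (1 - a) powr (- (real d + h * c)) * (pochhammer ((real k + c) * h) d * ((1 - a) powr (- h)) ^ k))"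
proof -
  define \<beta> where "\<beta> = (real k + c) * h"
  have "kernel_coeff TYPE('k) m j k * a ^ j = C0 * pochhammer \<beta> d * (pochhammer (\<beta> + real d) j / fact j * a ^ j)" for j
    unfolding kernel_coeff_def moment_exp_eq c_def[symmetric] h_def[symmetric] d_def[symmetric] C0_def \<beta>_def[symmetric] pochhammer_product' by simp
  moreover have "(\<lambda>j. C0 * pochhammer \<beta> d * (pochhammer (\<beta> + real d) j / fact j * a ^ j)) sums
      (C0 * pochhammer \<beta> d * (1 - a) powr (- (\<beta> + real d)))"
    by (intro sums_mult sums_negative_binomial) (use a in simp)
  moreover have "(1 - a) powr (- (\<beta> + real d)) = (1 - a) powr (- (real d + h * c)) * ((1 - a) powr (- h)) ^ k"
    using a unfolding \<beta>_def by (simp add: powr_power algebra_simps flip: powr_add)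
  ultimately show ?thesis unfolding \<beta>_def by (simp add: mult_ac)
qed

lemma sums_kernel_diagonal:
  assumes a: "0 \<le> a" "a < 1" and b: "0 \<le> b" and x: "b * (1 - a) powr (- h) < 1"
  defines "x \<equiv> b * (1 - a) powr (- h)"
  shows "(\<lambda>n. case prod_decode n of (k, j) \<Rightarrow> kernel_coeff TYPE('k) m j k * a ^ j * b ^ k) sums
     (C0 * (1 - a) powr (- (real d + h * c)) * (poly (pochhammer_numerator h c d) x / (1 - x) ^ Suc d))"
proof -
  let ?K = "C0 * (1 - a) powr (- (real d + h * c))"
  define t where "t k j = kernel_coeff TYPE('k) m j k * a ^ j * b ^ k" for k j
  have t0: "t k j \<ge> 0" for k j using a b kernel_coeff_pos[OF m, where 'k = 'k, of j k] by (simp add: t_def)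
  have row: "t k sums (?K * (pochhammer ((real k + c) * h) d * x ^ k))" for k
    using sums_mult2[OF kernel_coeff_row[OF a, of k], of "b ^ k"]
    by (simp add: t_def[abs_def] x_def power_mult_distrib mult_ac)
  have x': "\<bar>x\<bar> < 1" using x b by (simp add: x_def)
  have cols: "(\<lambda>k. ?K * (pochhammer ((real k + c) * h) d * x ^ k)) sums (?K * (poly (pochhammer_numerator h c d) x / (1 - x) ^ Suc d))"
    by (intro sums_mult sums_pochhammer x')
  have nrow: "(\<lambda>j. norm (t k j)) sums (?K * (pochhammer ((real k + c) * h) d * x ^ k))" for k
    using row[of k] t0 by simp
  have "(\<lambda>n. case_prod t (prod_decode n)) sums (\<Sum>k. ?K * (pochhammer ((real k + c) * h) d * x ^ k))"
    by (rule sums_prod_decode(2)[OF nrow sums_summable[OF cols] row])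
  then show ?thesis unfolding sums_unique[OF cols, symmetric] by (simp add: t_def[abs_def])
qed

text \<open>A single term is bounded by the whole row sum at the contracted point. The constraint on \<open>(s, t)\<close> bounds \<open>t\<close> by a power that cancels the growth of the row sum in \<open>k\<close>.\<close>

lemma kernel_coeff_bound:
  assumes \<sigma>: "0 < \<sigma>" "\<sigma> < 1" and st: "0 \<le> s" "0 \<le> t" "s\<^sup>2 + t ^ (2 * m) \<le> 1"
  shows "kernel_coeff TYPE('k) m j k * \<sigma> ^ j * (s ^ j * t ^ k)\<^sup>2 \<le>
     C0 * (1 - \<sigma>) powr (- (real d + h * c)) * pochhammer ((real k + c) * h) d"
proof -
  define a where "a = s\<^sup>2"
  have tm: "0 \<le> t ^ (2 * m)" using st by simp
  have a: "0 \<le> a" "a \<le> 1" using st tm by (auto simp: a_def intro: order_trans[OF _ st(3)])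
  have sa: "0 \<le> \<sigma> * a" "\<sigma> * a < 1" "\<sigma> * a \<le> a" "\<sigma> * a \<le> \<sigma>"
  proof -
    show le: "\<sigma> * a \<le> \<sigma>" using \<sigma> a by (simp add: mult_left_le)
    show "\<sigma> * a < 1" by (rule le_less_trans[OF le \<sigma>(2)])
    show "0 \<le> \<sigma> * a" "\<sigma> * a \<le> a" using \<sigma> a mult_left_le_one_le[of a \<sigma>] by auto
  qed
  have poc: "pochhammer ((real k + c) * h) d \<ge> 0" 
    using moment_exp_pos[OF m, where 'k = 'k, of k] unfolding moment_exp_eq c_def[symmetric] h_def[symmetric] 
    by (intro less_imp_le pochhammer_pos) simp
  have C: "C0 \<ge> 0" using moment_const_pos[OF m, where 'k = 'k] by (simp add: C0_def)
  have hc: "h \<ge> 0" "c \<ge> 0" "h * c \<ge> 0" using weight_exp_ge[OF m, where 'k = 'k] by (auto simp: h_def c_def)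
  let ?S = "\<lambda>a. C0 * (1 - a) powr (- (real d + h * c)) * (pochhammer ((real k + c) * h) d * ((1 - a) powr (- h)) ^ k)"
  have "(\<lambda>i. kernel_coeff TYPE('k) m i k * (\<sigma> * a) ^ i) sums ?S (\<sigma> * a)" by (rule kernel_coeff_row[OF sa(1,2)])
  moreover have "0 \<le> kernel_coeff TYPE('k) m i k * (\<sigma> * a) ^ i" for i
    using sa(1) kernel_coeff_pos[OF m, where 'k = 'k, of i k] by simp
  ultimately have "(\<Sum>i\<in>{j}. kernel_coeff TYPE('k) m i k * (\<sigma> * a) ^ i) \<le> ?S (\<sigma> * a)"
    unfolding sums_iff using sum_le_suminf[of "\<lambda>i. kernel_coeff TYPE('k) m i k * (\<sigma> * a) ^ i" "{j}"] by simp
  then have 1: "kernel_coeff TYPE('k) m j k * \<sigma> ^ j * (s ^ j)\<^sup>2 \<le> ?S (\<sigma> * a)"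
    by (simp add: a_def power_mult_distrib mult_ac flip: power_mult)
  have t2: "(t\<^sup>2) ^ k * ((1 - \<sigma> * a) powr (- h)) ^ k \<le> 1"
  proof -
    have "t\<^sup>2 = (t ^ (2 * m)) powr h"
    proof (cases "t = 0")
      case False
      then have t: "t > 0" using st by simp
      have "(t ^ (2 * m)) powr h = t powr (real (2 * m) * h)" 
        unfolding powr_realpow[OF t, symmetric] powr_powr ..
      also have "real (2 * m) * h = real 2" using m by (simp add: h_def)
      also have "t powr real 2 = t\<^sup>2" by (rule powr_realpow[OF t])
      finally show ?thesis ..
    qed (use m in \<open>simp add: h_def\<close>)
    also have "\<dots> \<le> (1 - \<sigma> * a) powr h" 
      by (rule powr_mono2[OF hc(1) tm]) (use st(3) sa(3) in \<open>simp add: a_def\<close>)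
    finally have "t\<^sup>2 * (1 - \<sigma> * a) powr (- h) \<le> (1 - \<sigma> * a) powr h * (1 - \<sigma> * a) powr (- h)"
      by (intro mult_right_mono) auto
    also have "\<dots> = 1" using sa by (simp flip: powr_add)
    finally show ?thesis unfolding power_mult_distrib[symmetric] by (intro power_le_one) auto
  qed
  have "kernel_coeff TYPE('k) m j k * \<sigma> ^ j * (s ^ j * t ^ k)\<^sup>2 = (kernel_coeff TYPE('k) m j k * \<sigma> ^ j * (s ^ j)\<^sup>2) * (t\<^sup>2) ^ k"
    by (simp add: power_mult_distrib mult_ac flip: power_mult)
  also have "\<dots> \<le> ?S (\<sigma> * a) * (t\<^sup>2) ^ k" by (intro mult_right_mono 1) simp
  also have "\<dots> = C0 * pochhammer ((real k + c) * h) d * (1 - \<sigma> * a) powr (- (real d + h * c)) * ((t\<^sup>2) ^ k * ((1 - \<sigma> * a) powr (- h)) ^ k)"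
    by (simp add: mult_ac)
  also have "\<dots> \<le> C0 * pochhammer ((real k + c) * h) d * (1 - \<sigma> * a) powr (- (real d + h * c)) * 1"
    by (intro mult_left_mono t2) (use C poc in simp)
  also have "\<dots> \<le> C0 * pochhammer ((real k + c) * h) d * (1 - \<sigma>) powr (- (real d + h * c)) * 1"
  proof (intro mult_right_mono mult_left_mono powr_mono2')
    show "- (real d + h * c) \<le> 0" using hc(3) by simp
  qed (use C poc \<sigma> sa in auto)
  finally show ?thesis by (simp add: mult_ac)
qed

lemma egg_enlarge:
  fixes q :: "'k pt"
  assumes "q \<in> egg m"
  obtains R where "R > 1" "R *\<^sub>R q \<in> egg m"
proof -
  have "continuous_on UNIV (\<lambda>t. t *\<^sub>R q)" by (intro continuous_intros)
  then have "open ((\<lambda>t. t *\<^sub>R q) -` egg m)" by (rule open_vimage[OF open_egg])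
  moreover have "1 \<in> (\<lambda>t. t *\<^sub>R q) -` egg m" using assms by simp
  ultimately obtain e where e: "e > 0" "ball 1 e \<subseteq> (\<lambda>t. t *\<^sub>R q) -` egg m" unfolding open_contains_ball by blast
  have "1 + e / 2 \<in> ball 1 e" using e(1) by (simp add: dist_real_def)
  then have "1 + e / 2 \<in> (\<lambda>t. t *\<^sub>R q) -` egg m" using e(2) by (rule subsetD[rotated])
  then have "(1 + e / 2) *\<^sub>R q \<in> egg m" by (rule vimageD)
  then show ?thesis using e(1) by (intro that[of "1 + e / 2"]) simp_all
qed

text \<open>Moving \<open>q\<close> outwards by a factor \<open>R > 1\<close> gains a geometric factor in the degree. Half of it, the square root \<open>\<sigma>\<close>, pays for the bound on the coefficients and the other half for convergence.\<close>

lemma kernel_majorant: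
  fixes q :: "'k pt"
  assumes q: "q \<in> egg m"
  obtains D where "summable D" "\<And>n p. p \<in> closure (egg m) \<Longrightarrow> norm (kernel_term m n p q) \<le> D n"
proof -
  obtain R where R: "R > 1" "R *\<^sub>R q \<in> egg m" by (rule egg_enlarge[OF q])
  define \<rho> where "\<rho> = 1 / R"
  define \<sigma> where "\<sigma> = sqrt \<rho>"
  have \<rho>: "0 < \<rho>" "\<rho> < 1" using R by (auto simp: \<rho>_def)
  have \<sigma>: "0 < \<sigma>" "\<sigma> < 1" "\<rho> = \<sigma> * \<sigma>" using \<rho> by (auto simp: \<sigma>_def)
  define M where "M = C0 * (1 - \<sigma>) powr (- (real d + h * c))"
  have M0: "M \<ge> 0" using moment_const_pos[OF m, where 'k = 'k] by (simp add: M_def C0_def)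
  have poc: "pochhammer ((real k + c) * h) d \<ge> 0" for k
    using moment_exp_pos[OF m, where 'k = 'k, of k] unfolding moment_exp_eq c_def[symmetric] h_def[symmetric] 
    by (intro less_imp_le pochhammer_pos) simp
  define t where "t k j = M * (pochhammer ((real k + c) * h) d * \<rho> ^ k) * \<sigma> ^ j" for k j
  have row: "t k sums (M * (pochhammer ((real k + c) * h) d * \<rho> ^ k) * (1 / (1 - \<sigma>)))" for k
    unfolding t_def by (intro sums_mult geometric_sums) (use \<sigma> in simp)
  have t0: "t k j \<ge> 0" for k j unfolding t_def using M0 poc[of k] \<rho> \<sigma>(1) by (intro mult_nonneg_nonneg zero_le_power) auto
  then have nrow: "(\<lambda>j. norm (t k j)) sums (M * (pochhammer ((real k + c) * h) d * \<rho> ^ k) * (1 / (1 - \<sigma>)))" for k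
    using row[of k] by simp
  have cols: "summable (\<lambda>k. M * (pochhammer ((real k + c) * h) d * \<rho> ^ k) * (1 / (1 - \<sigma>)))"
    by (intro summable_mult2 summable_mult sums_summable[OF sums_pochhammer]) (use \<rho> in simp)
  have "summable (\<lambda>n. norm (case_prod t (prod_decode n)))" by (rule sums_prod_decode(1)[OF nrow cols row])
  moreover have "norm (kernel_term m n p q) \<le> norm (case_prod t (prod_decode n))" if p: "p \<in> closure (egg m)" for n p
  proof -
    obtain k j where n: "prod_decode n = (k, j)" by (cases "prod_decode n")
    let ?c = "kernel_coeff TYPE('k) m j k"
    define s1 t1 s2 t2 where "s1 = norm (fst p)" "t1 = norm (snd p)" "s2 = R * norm (fst q)" "t2 = R * norm (snd q)"
    note st = this
    have nn: "0 \<le> s1" "0 \<le> t1" "0 \<le> s2" "0 \<le> t2" using R by (auto simp: st)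
    have le: "s1\<^sup>2 + t1 ^ (2 * m) \<le> 1" "s2\<^sup>2 + t2 ^ (2 * m) \<le> 1"
    proof -
      show "s1\<^sup>2 + t1 ^ (2 * m) \<le> 1" using p unfolding closure_egg[OF m] by (simp add: egg_norm_def st)
      show "s2\<^sup>2 + t2 ^ (2 * m) \<le> 1" using R by (simp add: egg_def st)
    qed
    have q12: "norm (fst q) = \<rho> * s2" "norm (snd q) = \<rho> * t2" using R by (simp_all add: st \<rho>_def)
    have c: "norm (cinner (fst p) (fst q)) \<le> s1 * (\<rho> * s2)" using norm_cinner_le[of "fst p" "fst q"] by (simp add: q12 st(1))
    have amgm: "x * y \<le> (x\<^sup>2 + y\<^sup>2) / 2" for x y :: real using sum_squares_bound[of x y] by simp
    have "norm (kernel_term m n p q) = ?c * norm (cinner (fst p) (fst q)) ^ j * (t1 * (\<rho> * t2)) ^ k"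
      using kernel_coeff_pos[OF m, where 'k = 'k, of j k]
      by (simp add: kernel_term_def n norm_mult norm_power q12 st(2) less_imp_le)
    also have "\<dots> \<le> ?c * (s1 * (\<rho> * s2)) ^ j * (t1 * (\<rho> * t2)) ^ k"
      using kernel_coeff_pos[OF m, where 'k = 'k, of j k] nn \<rho>
      by (intro mult_right_mono mult_left_mono power_mono c) (auto intro: less_imp_le)
    also have "\<dots> = \<rho> ^ k * \<sigma> ^ j * (?c * \<sigma> ^ j * ((s1 ^ j * t1 ^ k) * (s2 ^ j * t2 ^ k)))"
      unfolding \<sigma>(3) by (simp add: power_mult_distrib mult_ac)
    also have "\<dots> \<le> \<rho> ^ k * \<sigma> ^ j * (?c * \<sigma> ^ j * (((s1 ^ j * t1 ^ k)\<^sup>2 + (s2 ^ j * t2 ^ k)\<^sup>2) / 2))"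
      using kernel_coeff_pos[OF m, where 'k = 'k, of j k] \<rho> \<sigma> by (intro mult_left_mono amgm) auto
    also have "\<dots> = \<rho> ^ k * \<sigma> ^ j * ((?c * \<sigma> ^ j * (s1 ^ j * t1 ^ k)\<^sup>2 + ?c * \<sigma> ^ j * (s2 ^ j * t2 ^ k)\<^sup>2) / 2)"
      by (simp add: algebra_simps)
    also have "\<dots> \<le> \<rho> ^ k * \<sigma> ^ j * ((M * pochhammer ((real k + c) * h) d + M * pochhammer ((real k + c) * h) d) / 2)"
      unfolding M_def using \<rho> \<sigma>
      by (intro mult_left_mono divide_right_mono add_mono kernel_coeff_bound nn le) auto
    also have "\<dots> = t k j" by (simp add: t_def mult_ac)
    finally show ?thesis by (simp add: n)
  qed
  ultimately show ?thesis by (rule that)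
qed

end

section \<open>The reproducing kernel of the Hardy space\<close>

lemma holomorphic_several_on_const: "holomorphic_several_on (\<lambda>p. c) U"
  unfolding holomorphic_several_on_def by (auto intro!: exI[of _ "\<lambda>v. 0"])

lemma holomorphic_several_on_linear:
  assumes "linear f" "\<And>c v. f (c *s fst v, c * snd v) = c * f v"
  shows "holomorphic_several_on f (U :: 'k::finite pt set)"
  unfolding holomorphic_several_on_def
  using assms by (auto intro!: exI[of _ f] bounded_linear_imp_has_derivative simp: linear_conv_bounded_linear)

lemma holomorphic_several_on_mult:
  assumes "holomorphic_several_on f U" "holomorphic_several_on g U"
  shows "holomorphic_several_on (\<lambda>p. f p * g p) (U :: 'k::finite pt set)"
  unfolding holomorphic_several_on_def
proof
  fix p assume "p \<in> U"
  then obtain D E where D: "(f has_derivative D) (at p)" "\<And>c v. D (c *s fst v, c * snd v) = c * D v"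
    and E: "(g has_derivative E) (at p)" "\<And>c v. E (c *s fst v, c * snd v) = c * E v"
    using assms unfolding holomorphic_several_on_def by blast
  show "\<exists>D. ((\<lambda>p. f p * g p) has_derivative D) (at p) \<and> (\<forall>c v. D (c *s fst v, c * snd v) = c * D v)"
    by (intro exI[of _ "\<lambda>v. f p * E v + D v * g p"] conjI has_derivative_mult D(1) E(1))
       (simp add: D(2) E(2) algebra_simps)
qed

lemma holomorphic_several_on_add:
  assumes "holomorphic_several_on f U" "holomorphic_several_on g U"
  shows "holomorphic_several_on (\<lambda>p. f p + g p) (U :: 'k::finite pt set)"
  unfolding holomorphic_several_on_def
proof
  fix p assume "p \<in> U"
  then obtain D E where D: "(f has_derivative D) (at p)" "\<And>c v. D (c *s fst v, c * snd v) = c * D v"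
    and E: "(g has_derivative E) (at p)" "\<And>c v. E (c *s fst v, c * snd v) = c * E v"
    using assms unfolding holomorphic_several_on_def by blast
  show "\<exists>D. ((\<lambda>p. f p + g p) has_derivative D) (at p) \<and> (\<forall>c v. D (c *s fst v, c * snd v) = c * D v)"
    by (intro exI[of _ "\<lambda>v. D v + E v"] conjI has_derivative_add D(1) E(1))
       (simp add: D(2) E(2) algebra_simps)
qed

lemma holomorphic_several_on_sum:
  "(\<And>i. holomorphic_several_on (f i) U) \<Longrightarrow> holomorphic_several_on (\<lambda>p. \<Sum>i<(N::nat). f i p) (U :: 'k::finite pt set)"
  by (induction N) (simp_all add: holomorphic_several_on_const holomorphic_several_on_add)

lemma holomorphic_several_on_power:
  "holomorphic_several_on f U \<Longrightarrow> holomorphic_several_on (\<lambda>p. f p ^ (N::nat)) (U :: 'k::finite pt set)"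
  by (induction N) (simp_all add: holomorphic_several_on_const holomorphic_several_on_mult)

lemma holomorphic_several_on_kernel_term: "holomorphic_several_on (\<lambda>p. kernel_term m n p q) (U :: 'k::finite pt set)"
proof -
  have "holomorphic_several_on (\<lambda>p. cinner (fst p) (fst q)) U"
    by (rule holomorphic_several_on_linear) (auto intro!: linearI simp: cinner_add_left cinner_scaleR_left cinner_scale_left scaleR_conv_of_real[of _ "x :: complex" for x])
  moreover have "holomorphic_several_on (\<lambda>p. snd p) U"
    by (rule holomorphic_several_on_linear) (auto intro!: linearI simp: algebra_simps)
  ultimately show ?thesis unfolding kernel_term_def case_prod_unfold
    by (intro holomorphic_several_on_mult holomorphic_several_on_power holomorphic_several_on_const)
qed

lemma continuous_on_kernel_term: "continuous_on A (\<lambda>p. kernel_term m n p (q :: 'k::finite pt))"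
  unfolding kernel_term_def case_prod_unfold by (intro continuous_intros)

lemma holomorphic_near_closure_continuous:
  assumes "holomorphic_near_closure m f"
  shows "continuous_on (closure (egg m)) (f :: 'k::finite pt \<Rightarrow> complex)"
proof -
  obtain U where U: "closure (egg m) \<subseteq> U" "holomorphic_several_on f U" 
    using assms unfolding holomorphic_near_closure_def by auto
  have "isCont f p" if p: "p \<in> closure (egg m)" for p
  proof -
    obtain D where "(f has_derivative D) (at p)" using U p unfolding holomorphic_several_on_def by blast
    then show ?thesis by (rule has_derivative_continuous)
  qed
  then show ?thesis by (simp add: continuous_at_imp_continuous_on)
qed

text \<open>A complex-linear derivative restricts to a complex derivative on every complex line.\<close>

lemma holomorphic_line:
  fixes f :: "'k::finite pt \<Rightarrow> complex"
  assumes "holomorphic_near_closure m f" and "\<And>l. l \<in> S \<Longrightarrow> (y + l *s z, b + l * w) \<in> closure (egg m)"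
  shows "(\<lambda>l. f (y + l *s z, b + l * w)) holomorphic_on S"
proof -
  obtain U where U: "closure (egg m) \<subseteq> U" "holomorphic_several_on f U" 
    using assms(1) unfolding holomorphic_near_closure_def by auto
  have "((\<lambda>l. f (y + l *s z, b + l * w)) has_field_derivative D (z, w)) (at l)"
    if D: "(f has_derivative D) (at (y + l *s z, b + l * w))" "\<And>c v. D (c *s fst v, c * snd v) = c * D v" for D l
  proof -
    have lin: "bounded_linear (\<lambda>x. x *s z)"
      by (intro linear_conv_bounded_linear[THEN iffD1] linearI) (auto simp: vec_eq_iff scaleR_vec_nth_complex algebra_simps scaleR_conv_of_real[of _ "x :: complex" for x] simp del: vector_scaleR_component)
    have "((\<lambda>l. (y + l *s z, b + l * w)) has_derivative (\<lambda>x. (x *s z, x * w))) (at l)"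
      by (intro has_derivative_Pair) (auto intro!: derivative_eq_intros bounded_linear.has_derivative[OF lin])
    then have "((\<lambda>l. f (y + l *s z, b + l * w)) has_derivative (\<lambda>x. D (x *s z, x * w))) (at l)"
      by (rule has_derivative_compose[where g = f and f = "\<lambda>l. (y + l *s z, b + l * w)", OF _ D(1)])
    moreover have "D (x *s z, x * w) = D (z, w) * x" for x using D(2)[of x "(z, w)"] by (simp add: mult.commute)
    ultimately show ?thesis by (simp add: has_field_derivative_def)
  qed
  note deriv = this
  show ?thesis
  proof (rule holomorphic_onI)
    fix l assume "l \<in> S"
    then have "(y + l *s z, b + l * w) \<in> U" using assms(2) U(1) by blast
    then obtain D where "(f has_derivative D) (at (y + l *s z, b + l * w))" "\<And>c v. D (c *s fst v, c * snd v) = c * D v"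
      using U(2) unfolding holomorphic_several_on_def by blast
    from deriv[OF this] have "(\<lambda>l. f (y + l *s z, b + l * w)) field_differentiable at l" unfolding field_differentiable_def by (rule exI)
    then show "(\<lambda>l. f (y + l *s z, b + l * w)) field_differentiable at l within S" by (rule field_differentiable_at_within)
  qed
qed

context
  fixes m :: nat
  assumes m: "m \<ge> 1"
begin

lemma kernel_series:
  fixes q :: "'k::finite pt"
  assumes q: "q \<in> egg m"
  shows "p \<in> closure (egg m) \<Longrightarrow> (\<lambda>n. kernel_term m n p q) sums egg_kernel m p q"
    and "p \<in> closure (egg m) \<Longrightarrow> summable (\<lambda>n. norm (kernel_term m n p q))"
    and "uniform_limit (closure (egg m)) (\<lambda>N p. \<Sum>n<N. kernel_term m n p q) (\<lambda>p. egg_kernel m p q) sequentially"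
    and "continuous_on (closure (egg m)) (\<lambda>p. egg_kernel m p q)"
proof -
  obtain D where D: "summable D" "\<And>n p. p \<in> closure (egg m) \<Longrightarrow> norm (kernel_term m n p q) \<le> D n"
    by (rule kernel_majorant[OF m q]) blast
  show s: "summable (\<lambda>n. norm (kernel_term m n p q))" if "p \<in> closure (egg m)" for p
    by (rule summable_comparison_test'[OF D(1), of 0]) (use D(2) that in simp)
  show "(\<lambda>n. kernel_term m n p q) sums egg_kernel m p q" if "p \<in> closure (egg m)" for p
    unfolding egg_kernel_def by (rule summable_sums[OF summable_norm_cancel[OF s[OF that]]])
  show u: "uniform_limit (closure (egg m)) (\<lambda>N p. \<Sum>n<N. kernel_term m n p q) (\<lambda>p. egg_kernel m p q) sequentially"
    unfolding egg_kernel_def by (rule Weierstrass_m_test[OF D(2) D(1)])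
  show "continuous_on (closure (egg m)) (\<lambda>p. egg_kernel m p q)"
    by (rule uniform_limit_theorem[OF _ u]) (auto intro!: always_eventually continuous_intros continuous_on_kernel_term)
qed

lemma sphere_subset_closure: "(egg_sphere m :: 'k::finite pt set) \<subseteq> closure (egg m)"
  by (auto simp: closure_egg[OF m] egg_sphere_def)

lemma egg_subset_closure: "p \<in> egg m \<Longrightarrow> p \<in> closure (egg m)"
  using closure_subset by blast

lemma bounded_on_closure:
  fixes f :: "'k::finite pt \<Rightarrow> complex"
  assumes "continuous_on (closure (egg m)) f"
  obtains B where "B \<ge> 0" "\<And>p. p \<in> closure (egg m) \<Longrightarrow> norm (f p) \<le> B"
proof -
  have "bounded (f ` closure (egg m))"
    by (intro compact_imp_bounded compact_continuous_image assms compact_closure_egg[OF m])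
  then obtain B where B: "\<forall>y\<in>f ` closure (egg m). norm y \<le> B" unfolding bounded_iff by blast
  show ?thesis by (rule that[of "max B 0"]) (use B in \<open>auto simp: le_max_iff_disj\<close>)
qed

lemma continuous_closure_measurable:
  fixes f :: "'k::finite pt \<Rightarrow> complex"
  assumes "continuous_on (closure (egg m)) f"
  shows "f \<in> borel_measurable (fefferman_measure m)"
  by (rule continuous_measurable_fef[OF m continuous_on_subset[OF assms sphere_subset_closure]])

text \<open>The partial sums are polynomials in \<open>p\<close> and converge uniformly on the closed domain.\<close>

lemma egg_kernel_in_hardy_space:
  fixes q :: "'k::finite pt"
  assumes q: "q \<in> egg m"
  shows "(\<lambda>p. egg_kernel m p q) \<in> hardy_space m"
  unfolding hardy_space_def
proof (intro CollectI conjI exI[of _ "\<lambda>N p. \<Sum>n<N. kernel_term m n p q"] allI ballI)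
  show "(\<lambda>p. egg_kernel m p q) \<in> borel_measurable (fefferman_measure m)"
    by (rule continuous_closure_measurable[OF kernel_series(4)[OF q]])
  show "holomorphic_near_closure m (\<lambda>p. \<Sum>n<N. kernel_term m n p q)" for N
    unfolding holomorphic_near_closure_def
    by (intro exI[of _ UNIV] conjI holomorphic_several_on_sum holomorphic_several_on_kernel_term) auto
  show "(\<lambda>N. \<Sum>n<N. kernel_term m n p q) \<longlonglongrightarrow> egg_kernel m p q" if "p \<in> egg m" for p
    using kernel_series(1)[OF q egg_subset_closure[OF that]] by (simp add: sums_def)
  let ?I = "\<lambda>N. \<integral>\<^sup>+p. ennreal ((norm ((\<Sum>n<N. kernel_term m n p q) - egg_kernel m p q))\<^sup>2) \<partial>fefferman_measure m"
  define V where "V = measure (fefferman_measure m :: 'k pt measure) (egg_sphere m)"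
  have V: "emeasure (fefferman_measure m :: 'k pt measure) (egg_sphere m) = ennreal V" "V \<ge> 0"
    using finite_measure.emeasure_eq_measure[OF finite_measure_fef[OF m]] by (auto simp: V_def)
  show "?I \<longlonglongrightarrow> 0"
  proof (rule tendsto_zero_ennreal)
    fix r :: real assume "r > 0"
    define e where "e = r / 2"
    have "e > 0" using \<open>r > 0\<close> by (simp add: e_def)
    define \<epsilon> where "\<epsilon> = sqrt (e / (V + 1))"
    have \<epsilon>: "\<epsilon> > 0" "\<epsilon>\<^sup>2 * V \<le> e" using \<open>e > 0\<close> V(2) by (auto simp: \<epsilon>_def field_simps)
    have "\<forall>\<^sub>F N in sequentially. \<forall>p\<in>closure (egg m). dist (\<Sum>n<N. kernel_term m n p q) (egg_kernel m p q) < \<epsilon>"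
      by (rule uniform_limitD[OF kernel_series(3)[OF q] \<epsilon>(1)])
    then show "\<forall>\<^sub>F N in sequentially. ?I N < ennreal r"
    proof eventually_elim
      case (elim N)
      have "?I N \<le> (\<integral>\<^sup>+p. ennreal (\<epsilon>\<^sup>2) \<partial>(fefferman_measure m :: 'k pt measure))"
      proof (rule nn_integral_mono)
        fix p :: "'k pt" assume "p \<in> space (fefferman_measure m)"
        then have "p \<in> closure (egg m)" using sphere_subset_closure by (auto simp: space_fef[OF m])
        then have "norm ((\<Sum>n<N. kernel_term m n p q) - egg_kernel m p q) \<le> \<epsilon>" using elim by (auto simp: dist_norm intro: less_imp_le)
        then show "ennreal ((norm ((\<Sum>n<N. kernel_term m n p q) - egg_kernel m p q))\<^sup>2) \<le> ennreal (\<epsilon>\<^sup>2)"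
          by (intro ennreal_leI power_mono) auto
      qed
      also have "\<dots> = ennreal (\<epsilon>\<^sup>2 * V)" using V by (simp add: space_fef[OF m] ennreal_mult)
      also have "\<dots> < ennreal r" using \<epsilon>(2) \<open>r > 0\<close> by (intro ennreal_lessI) (auto simp: e_def)
      finally show ?case .
    qed
  qed
qed

end

lemma continuous_on_smult [continuous_intros]:
  "continuous_on A f \<Longrightarrow> continuous_on A g \<Longrightarrow> continuous_on A (\<lambda>x. f x *s (g x :: complex ^ 'k::finite))"
  unfolding vector_scalar_mult_def by (intro continuous_intros)

lemma norm_smult: "norm (c *s (v :: complex ^ 'k::finite)) = norm c * norm v"
proof -
  have "complex_of_real ((norm (c *s v))\<^sup>2) = (c * cnj c) * cinner v v"
    unfolding cinner_self[symmetric] cinner_scale_left cinner_scale_right by simp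
  also have "\<dots> = of_real ((norm c * norm v)\<^sup>2)" by (simp add: cinner_self power_mult_distrib flip: complex_norm_square)
  finally have "(norm (c *s v))\<^sup>2 = (norm c * norm v)\<^sup>2" by (simp only: of_real_eq_iff)
  then show ?thesis by (intro power2_eq_imp_eq[of _ "norm c * norm v"]) simp_all
qed

lemma smult_of_real: "of_real r *s (v :: complex ^ 'k::finite) = r *\<^sub>R v"
  by (simp add: vec_eq_iff scaleR_vec_nth_complex del: vector_scaleR_component)

definition axis_monomial :: "complex ^ 'k \<Rightarrow> nat \<Rightarrow> nat \<Rightarrow> 'k::finite pt \<Rightarrow> complex" where
  "axis_monomial e j k p = cinner (fst p) e ^ j * snd p ^ k"

lemma continuous_on_axis_monomial: "continuous_on A (axis_monomial e j k)"
  unfolding axis_monomial_def by (intro continuous_intros)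

context
  fixes m :: nat
  assumes m: "m \<ge> 1"
begin

lemma integral_axis_monomial:
  fixes e :: "complex ^ 'k::finite"
  assumes e: "norm e = 1"
  shows "(\<integral>p. axis_monomial e j k p * cnj (axis_monomial e j k p) \<partial>fefferman_measure m) = of_real (1 / kernel_coeff TYPE('k) m j k)"
proof -
  let ?\<mu> = "fefferman_measure m :: 'k pt measure"
  define \<theta> where "\<theta> = real j + (real k + (real m - 1) / (real CARD('k) + 2)) / real m"
  have \<theta>: "\<theta> \<ge> 0" using m by (simp add: \<theta>_def)
  have [measurable]: "axis_monomial e j k \<in> borel_measurable ?\<mu>"
    by (rule continuous_measurable_fef[OF m continuous_on_axis_monomial])
  have "(\<integral>\<^sup>+p. ennreal ((norm (axis_monomial e j k p))\<^sup>2) \<partial>?\<mu>) =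
      (\<integral>\<^sup>+p. ennreal (norm (cinner (fst p) e) ^ (2 * j) * norm (snd p) ^ (2 * k)) \<partial>boundary_measure m \<theta>)"
    unfolding nn_integral_fef[OF m \<theta>]
    by (simp add: axis_monomial_def norm_mult norm_power power_mult_distrib mult.commute flip: power_mult)
  also have "\<dots> = ennreal (1 / kernel_coeff TYPE('k) m j k)"
    unfolding \<theta>_def nn_integral_boundary_moment[OF m e] moment_eq_inverse_kernel_coeff[OF m] ..
  finally have "(\<integral>p. (norm (axis_monomial e j k p))\<^sup>2 \<partial>?\<mu>) = 1 / kernel_coeff TYPE('k) m j k"
    using kernel_coeff_pos[OF m, where 'k = 'k, of j k] by (subst integral_eq_nn_integral) (auto simp: less_imp_le)
  then show ?thesis unfolding complex_norm_square[symmetric] by (simp only: integral_complex_of_real)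
qed

lemma egg2_restriction:
  fixes e :: "complex ^ 'k::finite"
  assumes f: "holomorphic_near_closure m f" and e: "norm e = 1"
  shows "egg2_holomorphic m (\<lambda>u w. f (u *s e, w))"
proof
  have cl: "(u *s e, w) \<in> closure (egg m)" if "(norm u)\<^sup>2 + norm w ^ (2 * m) \<le> 1" for u w
    unfolding closure_egg[OF m] using that by (simp add: egg_norm_def norm_smult e)
  have shrink: "(norm (a * u))\<^sup>2 + norm (b * w) ^ (2 * m) \<le> 1" 
    if "(norm u)\<^sup>2 + norm w ^ (2 * m) \<le> 1" "norm a \<le> 1" "norm b \<le> 1" for a b u w :: complex
  proof -
    have "(norm (a * u))\<^sup>2 \<le> (norm u)\<^sup>2"
      using that(2) by (intro power_mono) (simp_all add: norm_mult mult_left_le_one_le)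
    moreover have "norm (b * w) ^ (2 * m) \<le> norm w ^ (2 * m)"
      using that(3) by (intro power_mono) (simp_all add: norm_mult mult_left_le_one_le)
    ultimately show ?thesis using that(1) by linarith
  qed
  show "continuous_on {(u, w). (norm u)\<^sup>2 + norm w ^ (2 * m) \<le> 1} (\<lambda>(u, w). f (u *s e, w))"
    unfolding case_prod_unfold
    by (rule continuous_on_compose2[OF holomorphic_near_closure_continuous[OF f], of _ "\<lambda>p. (fst p *s e, snd p)"])
       (auto intro!: continuous_intros cl)
  fix u w :: complex assume uw: "(norm u)\<^sup>2 + norm w ^ (2 * m) \<le> 1"
  show "(\<lambda>l. f ((l * u) *s e, w)) holomorphic_on ball 0 1"
  proof -
    have "(\<lambda>l. f (0 + l *s (u *s e), w + l * 0)) holomorphic_on ball 0 1"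
    proof (rule holomorphic_line[OF f])
      fix l :: complex assume "l \<in> ball 0 1"
      then have "((l * u) *s e, 1 * w) \<in> closure (egg m)" by (intro cl shrink uw) auto
      then show "(0 + l *s (u *s e), w + l * 0) \<in> closure (egg m)" by (simp add: vector_smult_assoc)
    qed
    then show ?thesis by (simp add: vector_smult_assoc)
  qed
  show "(\<lambda>l. f (u *s e, l * w)) holomorphic_on ball 0 1"
  proof -
    have "(\<lambda>l. f (u *s e + l *s 0, 0 + l * w)) holomorphic_on ball 0 1"
    proof (rule holomorphic_line[OF f])
      fix l :: complex assume "l \<in> ball 0 1"
      then have "((1 * u) *s e, l * w) \<in> closure (egg m)" by (intro cl shrink uw) auto
      then show "(u *s e + l *s 0, 0 + l * w) \<in> closure (egg m)" by simp
    qed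
    then show ?thesis by simp
  qed
qed (rule m)

text \<open>Rotating only the component of \<open>z\<close> orthogonal to \<open>e\<close> and averaging removes that component, by the mean value property on the disc that it spans.\<close>

lemma perpendicular_rotation_mean:
  fixes e :: "complex ^ 'k::finite"
  assumes f: "holomorphic_near_closure m f" and e: "norm e = 1" and p: "p \<in> closure (egg m)"
  shows "rotation_mean 0 (\<lambda>t p. (pseudo_reflection e (cnj (circ t)) (circ t *s fst p), snd p)) f p =
    f (cinner (fst p) e *s e, snd p)"
proof -
  define u where "u = cinner (fst p) e"
  define y where "y = fst p - u *s e"
  have y: "cinner y e = 0"
  proof -
    have "cinner y e + cinner (u *s e) e = u" unfolding cinner_add_left[symmetric] y_def u_def by simp
    then show ?thesis by (simp add: cinner_scale_left cinner_self e)
  qed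
  have pyth: "(norm (u *s e + l *s y))\<^sup>2 = (norm u)\<^sup>2 + (norm l * norm y)\<^sup>2" for l
  proof -
    have y': "cinner e y = 0" using y by (subst cinner_commute) simp
    have "complex_of_real ((norm (u *s e + l *s y))\<^sup>2) = of_real ((norm u)\<^sup>2) + of_real ((norm l * norm y)\<^sup>2)"
      unfolding cinner_self[symmetric] cinner_add_left cinner_add_right cinner_scale_left cinner_scale_right y y'
        power_mult_distrib of_real_mult complex_norm_square[of u] complex_norm_square[of l]
      by (simp add: cinner_self e algebra_simps)
    then show ?thesis by (simp only: of_real_eq_iff flip: of_real_add)
  qed
  have cl: "(u *s e + l *s y, snd p + l * 0) \<in> closure (egg m)" if "norm l \<le> 1" for l
  proof -
    have "(norm l * norm y)\<^sup>2 \<le> (norm (1 :: complex) * norm y)\<^sup>2" using that by (intro power_mono mult_right_mono) auto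
    then have "(norm (u *s e + l *s y))\<^sup>2 \<le> (norm (u *s e + 1 *s y))\<^sup>2" unfolding pyth by simp
    also have "u *s e + 1 *s y = fst p" by (simp add: y_def)
    finally have "(norm (u *s e + l *s y))\<^sup>2 \<le> (norm (fst p))\<^sup>2" .
    moreover have "(norm (fst p))\<^sup>2 + norm (snd p) ^ (2 * m) \<le> 1" using p unfolding closure_egg[OF m] by (simp add: egg_norm_def)
    ultimately have "(norm (u *s e + l *s y))\<^sup>2 + norm (snd p) ^ (2 * m) \<le> 1" by linarith
    then show ?thesis unfolding closure_egg[OF m] by (simp add: egg_norm_def)
  qed
  define H where "H l = f (u *s e + l *s y, snd p + l * 0)" for l
  have "continuous_on (cball 0 1) H" unfolding H_def
    by (rule continuous_on_compose2[OF holomorphic_near_closure_continuous[OF f], of _ "\<lambda>l. (u *s e + l *s y, snd p + l * 0)"])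
       (use cl in \<open>auto intro!: continuous_intros\<close>)
  moreover have "H holomorphic_on ball 0 1" unfolding H_def by (intro holomorphic_line[OF f] cl) auto
  ultimately have "(\<integral>t. H (circ t) * cnj (circ t) ^ 0 \<partial>unit_measure) = (deriv ^^ 0) H 0 / fact 0"
    by (rule circle_mean_coeff)
  moreover have "H (circ t) = f (pseudo_reflection e (cnj (circ t)) (circ t *s fst p), snd p)" for t
  proof -
    have "(cnj (circ t) - 1) * (circ t * u) = u - circ t * u" using circ_cnj(2)[of t] 
      by (simp add: algebra_simps)
    then have "pseudo_reflection e (cnj (circ t)) (circ t *s fst p) = circ t *s fst p + (u - circ t * u) *s e"
      unfolding pseudo_reflection_def cinner_scale_left u_def[symmetric] by simp
    also have "\<dots> = u *s e + circ t *s y" by (simp add: y_def vec_eq_iff algebra_simps)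
    finally show ?thesis by (simp add: H_def)
  qed
  ultimately show ?thesis unfolding rotation_mean_def by (simp add: H_def u_def)
qed

text \<open>Three averages, over rotations orthogonal to \<open>e\<close>, of \<open>w\<close> and along \<open>e\<close>, all compatible with the monomial, replace \<open>f\<close> by the multiple of the monomial that occurs in its expansion.\<close>

lemma integral_against_monomial:
  fixes e :: "complex ^ 'k::finite"
  assumes f: "holomorphic_near_closure m f" and e: "norm e = 1"
  shows "(\<integral>p. f p * cnj (axis_monomial e j k p) \<partial>fefferman_measure m) =
    2 ^ j * 2 ^ k * egg2_holomorphic.coeff (\<lambda>u w. f (u *s e, w)) j k (1 / 2) (1 / 2) * of_real (1 / kernel_coeff TYPE('k) m j k)"
proof -
  interpret G: egg2_holomorphic m "\<lambda>u w. f (u *s e, w)" by (rule egg2_restriction[OF f e])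
  let ?S = "egg_sphere m :: 'k pt set" and ?\<psi> = "axis_monomial e j k"
  (* R1 rotates the complement of e, R2 rotates w, R3 rotates along e. *)
  define R1 where "R1 t p = (pseudo_reflection e (cnj (circ t)) (circ t *s fst p), snd p)" for t and p :: "'k pt"
  define R2 where "R2 t p = (fst p, circ t * snd p)" for t and p :: "'k pt"
  define R3 where "R3 t p = (pseudo_reflection e (circ t) (fst p), snd p)" for t and p :: "'k pt"
  define g1 where "g1 p = f (cinner (fst p) e *s e, snd p)" for p :: "'k pt"
  define g2 where "g2 = rotation_mean k R2 g1"
  have R1: "egg_rotation (R1 t)" for t
  proof -
    have "linear (\<lambda>z. pseudo_reflection e (cnj (circ t)) (circ t *s z))"
      by (rule linear_compose[OF _ linear_pseudo_reflection, unfolded o_def])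
         (auto intro!: linearI simp: vec_eq_iff scaleR_vec_nth_complex algebra_simps simp del: vector_scaleR_component)
    then have "egg_rotation (\<lambda>p. (pseudo_reflection e (cnj (circ t)) (circ t *s fst p), 1 * snd p))"
      by (rule egg_rotationI[OF m, of "\<lambda>z. pseudo_reflection e (cnj (circ t)) (circ t *s z)"]) (simp_all add: norm_pseudo_reflection e norm_smult)
    then show ?thesis by (simp add: R1_def[abs_def])
  qed
  have R2: "egg_rotation (R2 t)" for t
    using egg_rotationI[OF m, of "\<lambda>z. z" "circ t"] by (simp add: R2_def[abs_def] linear_id[unfolded id_def])
  have R3: "egg_rotation (R3 t)" for t
    using egg_rotationI[OF m linear_pseudo_reflection, of e "circ t" 1] by (simp add: R3_def[abs_def] norm_pseudo_reflection e)
  have c1: "continuous_on UNIV (\<lambda>(t, p). R1 t p)" and c2: "continuous_on UNIV (\<lambda>(t, p). R2 t p)" and c3: "continuous_on UNIV (\<lambda>(t, p). R3 t p)"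
    unfolding R1_def R2_def R3_def pseudo_reflection_def case_prod_unfold by (intro continuous_intros)+
  have \<psi>1: "?\<psi> (R1 t p) = circ t ^ 0 * ?\<psi> p" for t p
    by (simp add: axis_monomial_def R1_def cinner_pseudo_reflection_axis[OF e] cinner_scale_left circ_cnj(2) flip: mult.assoc)
  have \<psi>2: "?\<psi> (R2 t p) = circ t ^ k * ?\<psi> p" for t p
    by (simp add: axis_monomial_def R2_def power_mult_distrib)
  have \<psi>3: "?\<psi> (R3 t p) = circ t ^ j * ?\<psi> p" for t p
    by (simp add: axis_monomial_def R3_def cinner_pseudo_reflection_axis[OF e] power_mult_distrib)
  have cf: "continuous_on (closure (egg m)) f" by (rule holomorphic_near_closure_continuous[OF f])
  obtain B where B: "B \<ge> 0" "\<And>p. p \<in> closure (egg m) \<Longrightarrow> norm (f p) \<le> B" by (rule bounded_on_closure[OF m cf]) blast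
  have bound: "(norm (cinner (fst p) e))\<^sup>2 + norm (snd p) ^ (2 * m) \<le> 1" if "p \<in> closure (egg m)" for p :: "'k pt"
  proof -
    have "(norm (cinner (fst p) e))\<^sup>2 \<le> (norm (fst p))\<^sup>2" using norm_cinner_le[of "fst p" e] e by (intro power_mono) auto
    moreover have "(norm (fst p))\<^sup>2 + norm (snd p) ^ (2 * m) \<le> 1" using that unfolding closure_egg[OF m] by (simp add: egg_norm_def)
    ultimately show ?thesis by linarith
  qed
  have proj: "(cinner (fst p) e *s e, snd p) \<in> closure (egg m)" if "p \<in> closure (egg m)" for p :: "'k pt"
    using bound[OF that] unfolding closure_egg[OF m] by (simp add: egg_norm_def norm_smult e)
  have cg1: "continuous_on (closure (egg m)) g1" unfolding g1_def
    by (rule continuous_on_compose2[OF cf, of _ "\<lambda>p. (cinner (fst p) e *s e, snd p)"]) (auto intro!: continuous_intros proj)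
  have S: "p \<in> closure (egg m)" if "p \<in> ?S" for p using that sphere_subset_closure[OF m] by blast
  have mf: "(\<lambda>p. indicator ?S p *\<^sub>R f p) \<in> borel_measurable borel" "\<And>p. p \<in> ?S \<Longrightarrow> norm (f p) \<le> B"
    using continuous_closure_measurable[OF m cf] B(2) S unfolding measurable_fef_iff[OF m] by auto
  have mg1: "(\<lambda>p. indicator ?S p *\<^sub>R g1 p) \<in> borel_measurable borel" "\<And>p. p \<in> ?S \<Longrightarrow> norm (g1 p) \<le> B"
    using continuous_closure_measurable[OF m cg1] B(2) S proj unfolding measurable_fef_iff[OF m] by (auto simp: g1_def)
  note \<psi>c = continuous_on_axis_monomial[of UNIV e j k]
  have mg2: "(\<lambda>p. indicator ?S p *\<^sub>R g2 p) \<in> borel_measurable borel" "\<And>p. p \<in> ?S \<Longrightarrow> norm (g2 p) \<le> B"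
    unfolding g2_def by (rule integral_rotation_mean(2)[OF m R2 c2 mg1 \<psi>c \<psi>2]; simp) (rule integral_rotation_mean(3)[OF m R2 c2 mg1 \<psi>c \<psi>2])
  have "(\<integral>p. f p * cnj (?\<psi> p) \<partial>fefferman_measure m) = (\<integral>p. rotation_mean 0 R1 f p * cnj (?\<psi> p) \<partial>fefferman_measure m)"
    by (rule integral_rotation_mean(1)[OF m R1 c1 mf \<psi>c \<psi>1])
  also have "\<dots> = (\<integral>p. g1 p * cnj (?\<psi> p) \<partial>fefferman_measure m)"
    using perpendicular_rotation_mean[OF f e S] 
    by (intro Bochner_Integration.integral_cong refl) (simp add: space_fef[OF m] g1_def R1_def[abs_def])
  also have "\<dots> = (\<integral>p. g2 p * cnj (?\<psi> p) \<partial>fefferman_measure m)"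
    unfolding g2_def by (rule integral_rotation_mean(1)[OF m R2 c2 mg1 \<psi>c \<psi>2])
  also have "\<dots> = (\<integral>p. rotation_mean j R3 g2 p * cnj (?\<psi> p) \<partial>fefferman_measure m)"
    by (rule integral_rotation_mean(1)[OF m R3 c3 mg2 \<psi>c \<psi>3])
  also have "\<dots> = (\<integral>p. (2 ^ j * 2 ^ k * G.coeff j k (1 / 2) (1 / 2)) * (?\<psi> p * cnj (?\<psi> p)) \<partial>fefferman_measure m)"
  proof (intro Bochner_Integration.integral_cong refl)
    fix p :: "'k pt" assume "p \<in> space (fefferman_measure m)"
    then have p: "p \<in> closure (egg m)" using S by (simp add: space_fef[OF m])
    have "rotation_mean j R3 g2 p = G.coeff j k (cinner (fst p) e) (snd p)"
      unfolding G.coeff_def g2_def rotation_mean_def by (simp add: R2_def R3_def g1_def cinner_pseudo_reflection_axis[OF e])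
    also have "\<dots> = (2 ^ j * 2 ^ k * G.coeff j k (1 / 2) (1 / 2)) * cinner (fst p) e ^ j * snd p ^ k"
      by (rule G.coeff_monomial) (use bound[OF p] in simp)
    finally show "rotation_mean j R3 g2 p * cnj (?\<psi> p) = (2 ^ j * 2 ^ k * G.coeff j k (1 / 2) (1 / 2)) * (?\<psi> p * cnj (?\<psi> p))"
      by (simp add: axis_monomial_def mult_ac)
  qed
  also have "\<dots> = (2 ^ j * 2 ^ k * G.coeff j k (1 / 2) (1 / 2)) * of_real (1 / kernel_coeff TYPE('k) m j k)"
    unfolding integral_mult_right_zero integral_axis_monomial[OF e] ..
  finally show ?thesis .
qed

end

lemma axis_exists:
  fixes z :: "complex ^ 'k::finite"
  obtains e where "norm e = 1" "z = norm z *\<^sub>R e"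
proof (cases "z = 0")
  case True
  have "norm (axis undefined 1 :: complex ^ 'k) = 1" by (simp add: norm_axis_complex)
  then show ?thesis using True by (intro that[of "axis undefined 1"]) simp_all
next
  case False
  then show ?thesis by (intro that[of "(1 / norm z) *\<^sub>R z"]) simp_all
qed

context
  fixes m :: nat
  assumes m: "m \<ge> 1"
begin

text \<open>The point \<open>q\<close> lies on the complex plane through \<open>e = z / \<bar>z\<bar>\<close> and the \<open>w\<close> axis. Each term of the kernel picks one monomial of the restriction of \<open>f\<close> to that plane.\<close>

theorem egg_kernel_reproduces_holomorphic:
  fixes f :: "'k::finite pt \<Rightarrow> complex"
  assumes f: "holomorphic_near_closure m f" and q: "q \<in> egg m"
  shows "(\<integral>p. f p * cnj (egg_kernel m p q) \<partial>fefferman_measure m) = f q"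
proof -
  let ?\<mu> = "fefferman_measure m :: 'k pt measure"
  interpret \<mu>: finite_measure ?\<mu> by (rule finite_measure_fef[OF m])
  define r where "r = norm (fst q)"
  obtain e where e: "norm e = 1" "fst q = r *\<^sub>R e" unfolding r_def by (rule axis_exists)
  interpret G: egg2_holomorphic m "\<lambda>u w. f (u *s e, w)" by (rule egg2_restriction[OF m f e(1)])
  define C where "C j k = 2 ^ j * 2 ^ k * G.coeff j k (1 / 2) (1 / 2)" for j k
  obtain R where R: "R > 1" "R *\<^sub>R q \<in> egg m" by (rule egg_enlarge[OF m q])
  have cf: "continuous_on (closure (egg m)) f" by (rule holomorphic_near_closure_continuous[OF f])
  obtain B where B: "B \<ge> 0" "\<And>p. p \<in> closure (egg m) \<Longrightarrow> norm (f p) \<le> B" by (rule bounded_on_closure[OF m cf]) blast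
  obtain M where M: "summable M" "\<And>n p. p \<in> closure (egg m) \<Longrightarrow> norm (kernel_term m n p q) \<le> M n"
    by (rule kernel_majorant[OF m q]) blast
  have S: "p \<in> closure (egg m)" if "p \<in> space ?\<mu>" for p using that sphere_subset_closure[OF m] by (auto simp: space_fef[OF m])
  define t where "t n p = f p * cnj (kernel_term m n p q)" for n p
  have t_bound: "norm (t n p) \<le> B * M n" if "p \<in> space ?\<mu>" for n p
    using B(2)[OF S[OF that]] M(2)[OF S[OF that], of n] B(1) unfolding t_def norm_mult complex_mod_cnj
    by (intro mult_mono) auto
  have t_int: "integrable ?\<mu> (t n)" for n
  proof (rule integrable_fef_bounded[OF m])
    have "continuous_on (closure (egg m)) (t n)" unfolding t_def by (intro continuous_intros cf continuous_on_kernel_term)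
    then show "t n \<in> borel_measurable ?\<mu>" by (rule continuous_closure_measurable[OF m])
  qed (use t_bound in \<open>simp add: space_fef[OF m]\<close>)
  have BM: "summable (\<lambda>n. B * M n)" by (intro summable_mult M)
  have "(\<lambda>n. integral\<^sup>L ?\<mu> (t n)) sums (\<integral>p. (\<Sum>n. t n p) \<partial>?\<mu>)"
  proof (rule sums_integral[OF t_int])
    show "AE p in ?\<mu>. summable (\<lambda>n. norm (t n p))"
      by (rule AE_I2, rule summable_comparison_test'[OF BM, of 0]) (use t_bound in simp)
    show "summable (\<lambda>n. \<integral>p. norm (t n p) \<partial>?\<mu>)"
    proof (rule summable_comparison_test'[OF summable_mult2[OF BM, of "measure ?\<mu> (space ?\<mu>)"], of 0])
      fix n :: nat
      have "(\<integral>p. norm (t n p) \<partial>?\<mu>) \<le> (\<integral>p. B * M n \<partial>?\<mu>)"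
        by (rule integral_mono) (use t_int t_bound in auto)
      then show "norm (\<integral>p. norm (t n p) \<partial>?\<mu>) \<le> B * M n * measure ?\<mu> (space ?\<mu>)" by (simp add: mult_ac)
    qed
  qed
  moreover have "(\<integral>p. (\<Sum>n. t n p) \<partial>?\<mu>) = (\<integral>p. f p * cnj (egg_kernel m p q) \<partial>?\<mu>)"
  proof (intro Bochner_Integration.integral_cong refl)
    fix p assume "p \<in> space ?\<mu>"
    then have "(\<lambda>n. t n p) sums (f p * cnj (egg_kernel m p q))" unfolding t_def
      by (intro sums_mult sums_cnj[THEN iffD2] kernel_series(1)[OF m q] S)
    then show "(\<Sum>n. t n p) = f p * cnj (egg_kernel m p q)" by (rule sums_unique[symmetric])
  qed
  moreover have "integral\<^sup>L ?\<mu> (t n) = (case prod_decode n of (k, j) \<Rightarrow> C j k * of_real r ^ j * snd q ^ k)" for n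
  proof -
    obtain k j where n: "prod_decode n = (k, j)" by (cases "prod_decode n")
    let ?c = "kernel_coeff TYPE('k) m j k"
    have t: "t n = (\<lambda>p. (of_real ?c * of_real r ^ j * snd q ^ k) * (f p * cnj (axis_monomial e j k p)))"
      by (rule ext) (simp add: t_def kernel_term_def n axis_monomial_def e(2) cinner_scaleR_right power_mult_distrib mult_ac)
    have "integral\<^sup>L ?\<mu> (t n) = (of_real ?c * of_real r ^ j * snd q ^ k) * (\<integral>p. f p * cnj (axis_monomial e j k p) \<partial>?\<mu>)"
      unfolding t by (rule integral_mult_right_zero)
    also have "\<dots> = (of_real ?c * of_real r ^ j * snd q ^ k) * (C j k * of_real (1 / ?c))"
      unfolding C_def integral_against_monomial[OF m f e(1)] ..
    finally show ?thesis using kernel_coeff_pos[OF m, where 'k = 'k, of j k] by (simp add: n mult_ac)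
  qed
  moreover have "(\<lambda>n. case prod_decode n of (k, j) \<Rightarrow> C j k * of_real r ^ j * snd q ^ k) sums f q"
  proof -
    (* The expansion converges after a contraction, so it is applied at the enlarged point R q. *)
    define u w x :: complex where "u = of_real (R * r)" "w = of_real R * snd q" "x = of_real (1 / R)"
    note defs = this
    have D: "(u, w) \<in> G.D" using R unfolding egg_def
      by (auto simp: defs norm_mult r_def power_mult_distrib intro: less_imp_le)
    have "(\<lambda>n. case prod_decode n of (k, j) \<Rightarrow> x ^ (j + k) * G.coeff j k u w) sums f ((x * u) *s e, x * w)"
      by (rule G.sums_coeff[OF D]) (use R in \<open>simp add: defs norm_divide\<close>)
    moreover have "x ^ (j + k) * G.coeff j k u w = C j k * of_real r ^ j * snd q ^ k" for j k
    proof -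
      have "G.coeff j k u w = C j k * u ^ j * w ^ k" unfolding C_def by (rule G.coeff_monomial[OF D])
      then have "x ^ (j + k) * G.coeff j k u w = C j k * (x * u) ^ j * (x * w) ^ k"
        by (simp add: power_add power_mult_distrib mult_ac)
      then show ?thesis using R by (simp add: defs)
    qed
    moreover have "((x * u) *s e, x * w) = q" using R e(2) by (simp add: defs smult_of_real prod_eq_iff)
    ultimately show ?thesis by simp
  qed
  ultimately show ?thesis using sums_unique2 by fastforce
qed

text \<open>Both sides are continuous for convergence in mean square: the kernel is bounded on the boundary, and the mean is controlled by the mean square on a finite measure.\<close>

theorem egg_kernel_reproducing: "is_reproducing_kernel m (egg_kernel m :: 'k::finite pt \<Rightarrow> _)"
  unfolding is_reproducing_kernel_def
proof (intro ballI conjI)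
  fix q :: "'k pt" assume q: "q \<in> egg m"
  show "(\<lambda>p. egg_kernel m p q) \<in> hardy_space m" by (rule egg_kernel_in_hardy_space[OF m q])
  fix u :: "'k pt \<Rightarrow> complex" assume "u \<in> hardy_space m"
  let ?\<mu> = "fefferman_measure m :: 'k pt measure" and ?K = "\<lambda>p. cnj (egg_kernel m p q)"
  interpret \<mu>: finite_measure ?\<mu> by (rule finite_measure_fef[OF m])
  from \<open>u \<in> hardy_space m\<close> obtain f where u[measurable]: "u \<in> borel_measurable ?\<mu>"
    and f: "\<And>i. holomorphic_near_closure m (f i)"
    and lim: "(\<lambda>i. \<integral>\<^sup>+p. ennreal ((norm (f i p - u p))\<^sup>2) \<partial>?\<mu>) \<longlonglongrightarrow> 0"
    and lq: "(\<lambda>i. f i q) \<longlonglongrightarrow> u q"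
    unfolding hardy_space_def using q by auto
  have cf: "continuous_on (closure (egg m)) (f i)" for i by (rule holomorphic_near_closure_continuous[OF f])
  have [measurable]: "f i \<in> borel_measurable ?\<mu>" for i by (rule continuous_closure_measurable[OF m cf])
  have S: "p \<in> closure (egg m)" if "p \<in> space ?\<mu>" for p using that sphere_subset_closure[OF m] by (auto simp: space_fef[OF m])
  have f_int: "integrable ?\<mu> (f i)" for i
  proof -
    obtain B where "\<And>p. p \<in> closure (egg m) \<Longrightarrow> norm (f i p) \<le> B" by (rule bounded_on_closure[OF m cf[of i]]) blast
    then show ?thesis using S by (intro integrable_fef_bounded[OF m, of _ B]) (auto simp: space_fef[OF m])
  qed
  have cK: "continuous_on (closure (egg m)) ?K" by (intro continuous_intros kernel_series(4)[OF m q])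
  have [measurable]: "?K \<in> borel_measurable ?\<mu>" by (rule continuous_closure_measurable[OF m cK])
  obtain B where B: "B \<ge> 0" "\<And>p. p \<in> closure (egg m) \<Longrightarrow> norm (?K p) \<le> B" by (rule bounded_on_closure[OF m cK]) blast
  define V where "V = measure ?\<mu> (space ?\<mu>)"
  have V: "emeasure ?\<mu> (space ?\<mu>) = ennreal V" "V \<ge> 0" by (auto simp: V_def \<mu>.emeasure_eq_measure)
  define N where "N i = (\<integral>\<^sup>+p. ennreal (norm (f i p - u p)) \<partial>?\<mu>)" for i
  have N_small: "\<forall>\<^sub>F i in sequentially. N i < ennreal r" if r: "r > 0" for r
  proof -
    have "r\<^sup>2 / (V + 1) > 0" using r V(2) by simp
    then have "\<forall>\<^sub>F i in sequentially. (\<integral>\<^sup>+p. ennreal ((norm (f i p - u p))\<^sup>2) \<partial>?\<mu>) < ennreal (r\<^sup>2 / (V + 1))"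
      by (intro order_tendstoD(2)[OF lim]) simp
    then show ?thesis
    proof eventually_elim
      case (elim i)
      show "N i < ennreal r"
      proof (rule ccontr)
        assume "\<not> ?thesis"
        then have "(ennreal r)\<^sup>2 \<le> (N i)\<^sup>2" by (intro power_mono) auto
        also have "\<dots> \<le> (\<integral>\<^sup>+p. (ennreal (norm (f i p - u p)))\<^sup>2 \<partial>?\<mu>) * (\<integral>\<^sup>+p. 1\<^sup>2 \<partial>?\<mu>)"
          using Cauchy_Schwarz_nn_integral[of "\<lambda>p. ennreal (norm (f i p - u p))" ?\<mu> "\<lambda>p. 1"] by (simp add: N_def)
        also have "\<dots> \<le> ennreal (r\<^sup>2 / (V + 1)) * ennreal V"
          using elim V by (intro mult_mono) (auto simp: ennreal_power)
        also have "\<dots> = ennreal (r\<^sup>2 / (V + 1) * V)"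
          by (rule ennreal_mult[symmetric]) (use V(2) in simp_all)
        also have "\<dots> < ennreal (r\<^sup>2)"
          using r V(2) by (intro ennreal_lessI) (auto simp: field_simps)
        also have "\<dots> = (ennreal r)\<^sup>2" using r by (simp add: ennreal_power)
        finally show False by simp
      qed
    qed
  qed
  have diff_int: "integrable ?\<mu> (\<lambda>p. f i p - u p)" if "N i < ennreal r" for i r
    using that by (intro integrableI_bounded) (auto simp: N_def intro: less_trans[OF _ ennreal_less_top])
  obtain i where "N i < ennreal 1" using eventually_happens[OF N_small[of 1]] by auto
  have u_int: "integrable ?\<mu> u"
    using Bochner_Integration.integrable_diff[OF f_int[of i] diff_int[OF \<open>N i < ennreal 1\<close>]] by simp
  have times_K: "integrable ?\<mu> (\<lambda>p. g p * ?K p)" if g: "integrable ?\<mu> g" for g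
  proof (rule Bochner_Integration.integrable_bound[of _ "\<lambda>p. B * norm (g p)"])
    show "integrable ?\<mu> (\<lambda>p. B * norm (g p))" using g by simp
    show "(\<lambda>p. g p * ?K p) \<in> borel_measurable ?\<mu>" using borel_measurable_integrable[OF g] by measurable
    show "AE p in ?\<mu>. norm (g p * ?K p) \<le> norm (B * norm (g p))"
    proof (rule AE_I2)
      fix p assume "p \<in> space ?\<mu>"
      then show "norm (g p * ?K p) \<le> norm (B * norm (g p))"
        using mult_right_mono[OF B(2)[OF S], of p "norm (g p)"] B(1) by (simp add: norm_mult mult.commute abs_mult)
    qed
  qed
  have "(\<lambda>i. \<integral>p. f i p * ?K p \<partial>?\<mu>) \<longlonglongrightarrow> (\<integral>p. u p * ?K p \<partial>?\<mu>)"
  proof (rule tendstoI)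
    fix \<epsilon> :: real assume \<epsilon>: "\<epsilon> > 0"
    define r where "r = \<epsilon> / (B + 1)"
    have r: "r > 0" "B * r < \<epsilon>" using \<epsilon> B(1) by (auto simp: r_def field_simps)
    show "\<forall>\<^sub>F i in sequentially. dist (\<integral>p. f i p * ?K p \<partial>?\<mu>) (\<integral>p. u p * ?K p \<partial>?\<mu>) < \<epsilon>"
      using N_small[OF r(1)]
    proof eventually_elim
      case (elim i)
      have "(\<integral>p. f i p * ?K p \<partial>?\<mu>) - (\<integral>p. u p * ?K p \<partial>?\<mu>) = (\<integral>p. (f i p - u p) * ?K p \<partial>?\<mu>)"
        unfolding left_diff_distrib by (intro Bochner_Integration.integral_diff[symmetric] times_K f_int u_int)
      then have "ennreal (dist (\<integral>p. f i p * ?K p \<partial>?\<mu>) (\<integral>p. u p * ?K p \<partial>?\<mu>)) = ennreal (norm (\<integral>p. (f i p - u p) * ?K p \<partial>?\<mu>))"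
        by (simp only: dist_norm)
      also have "\<dots> \<le> (\<integral>\<^sup>+p. ennreal (norm ((f i p - u p) * ?K p)) \<partial>?\<mu>)"
        by (rule integral_norm_bound_ennreal[OF times_K[OF diff_int[OF elim]]])
      also have "\<dots> \<le> (\<integral>\<^sup>+p. ennreal B * ennreal (norm (f i p - u p)) \<partial>?\<mu>)"
      proof (rule nn_integral_mono)
        fix p assume "p \<in> space ?\<mu>"
        then show "ennreal (norm ((f i p - u p) * ?K p)) \<le> ennreal B * ennreal (norm (f i p - u p))"
          using mult_right_mono[OF B(2)[OF S], of p "norm (f i p - u p)"] B(1)
          by (simp add: norm_mult mult.commute ennreal_leI flip: ennreal_mult)
      qed
      also have "\<dots> = ennreal B * N i" unfolding N_def by (rule nn_integral_cmult) simp
      also have "\<dots> \<le> ennreal B * ennreal r" using elim by (intro mult_left_mono) auto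
      also have "\<dots> = ennreal (B * r)" using B(1) r(1) by (simp add: ennreal_mult)
      also have "\<dots> < ennreal \<epsilon>" using r(2) \<epsilon> by (intro ennreal_lessI) auto
      finally show ?case using \<epsilon> by (subst (asm) ennreal_less_iff) auto
    qed
  qed
  then have "(\<lambda>i. f i q) \<longlonglongrightarrow> (\<integral>p. u p * ?K p \<partial>?\<mu>)"
    unfolding egg_kernel_reproduces_holomorphic[OF f q] .
  with lq show "u q = (\<integral>p. u p * ?K p \<partial>?\<mu>)" by (rule LIMSEQ_unique)
qed

text \<open>Two reproducing kernels determine each other: pairing one with the other and applying both reproducing properties gives the same integral up to conjugation.\<close>

lemma fs_kernel_diagonal:
  fixes q :: "'k::finite pt"
  assumes q: "q \<in> egg m"
  shows "fs_kernel m q q = cnj (egg_kernel m q q)"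
proof -
  let ?\<mu> = "fefferman_measure m :: 'k pt measure"
  have K: "is_reproducing_kernel m (fs_kernel m :: 'k pt \<Rightarrow> _)"
    unfolding fs_kernel_def by (rule someI[where x = "egg_kernel m"]) (rule egg_kernel_reproducing)
  have rep: "u q = (\<integral>p. u p * cnj (K' p q) \<partial>?\<mu>)" if "is_reproducing_kernel m K'" "u \<in> hardy_space m" for K' u
    using that q unfolding is_reproducing_kernel_def by blast
  have "fs_kernel m q q = (\<integral>p. fs_kernel m p q * cnj (egg_kernel m p q) \<partial>?\<mu>)"
    by (rule rep[OF egg_kernel_reproducing]) (use K q in \<open>auto simp: is_reproducing_kernel_def\<close>)
  also have "\<dots> = (\<integral>p. cnj (egg_kernel m p q * cnj (fs_kernel m p q)) \<partial>?\<mu>)" by (simp add: mult.commute)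
  also have "\<dots> = cnj (\<integral>p. egg_kernel m p q * cnj (fs_kernel m p q) \<partial>?\<mu>)" by (simp only: Bochner_Integration.integral_cnj)
  also have "\<dots> = cnj (egg_kernel m q q)"
    unfolding rep[OF K egg_kernel_in_hardy_space[OF m q], symmetric] ..
  finally show ?thesis .
qed

text \<open>Summing the kernel on the diagonal first over \<open>j\<close> and then over \<open>k\<close>. The condition \<open>x < 1\<close> is the equation of the domain.\<close>

theorem fs_potential_eq:
  fixes p :: "'k::finite pt"
  assumes p: "p \<in> egg m"
  defines "h \<equiv> 1 / real m" and "c \<equiv> weight_exp TYPE('k) m"
  defines "x \<equiv> (norm (snd p))\<^sup>2 * (1 - (norm (fst p))\<^sup>2) powr (- h)"
  shows "x < 1" and "(norm (fst p))\<^sup>2 < 1"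
    and "fs_potential m p = ln (1 / moment_const TYPE('k) m * (1 - (norm (fst p))\<^sup>2) powr (- (real CARD('k) + h * c)) *
        (poly (pochhammer_numerator h c CARD('k)) x / (1 - x) ^ Suc CARD('k)))"
proof -
  define a b where "a = (norm (fst p))\<^sup>2" "b = (norm (snd p))\<^sup>2"
  note ab = this
  have ab1: "a + b ^ m < 1" using p by (simp add: egg_def ab power_mult)
  moreover have b0: "0 \<le> b" "0 \<le> b ^ m" by (simp_all add: ab)
  ultimately have a: "0 \<le> a" "a < 1" by (simp add: ab, linarith)
  show "(norm (fst p))\<^sup>2 < 1" using a by (simp add: ab)
  have xb: "b * (1 - a) powr (- h) < 1"
  proof -
    have "b < (1 - a) powr h"
    proof (cases "b = 0")
      case False
      then have b: "b > 0" using b0 by simp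
      have "b = b powr (real m * h)" using m b by (simp add: h_def)
      also have "\<dots> = (b ^ m) powr h" unfolding powr_realpow[OF b, symmetric] powr_powr ..
      also have "\<dots> < (1 - a) powr h" using ab1 b0 m by (intro powr_less_mono2) (auto simp: h_def)
      finally show ?thesis .
    qed (use a in simp)
    then have "b * (1 - a) powr (- h) < (1 - a) powr h * (1 - a) powr (- h)" using a by (intro mult_strict_right_mono) auto
    also have "\<dots> = 1" using a by (simp flip: powr_add)
    finally show ?thesis .
  qed
  then show "x < 1" by (simp add: x_def ab)
  let ?F = "1 / moment_const TYPE('k) m * (1 - a) powr (- (real CARD('k) + h * c)) * (poly (pochhammer_numerator h c CARD('k)) x / (1 - x) ^ Suc CARD('k))"
  have "(\<lambda>n. case prod_decode n of (k, j) \<Rightarrow> kernel_coeff TYPE('k) m j k * a ^ j * b ^ k) sums ?F"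
    using sums_kernel_diagonal[OF m a b0(1) xb[unfolded h_def], where 'k = 'k] by (simp add: x_def ab h_def c_def)
  then have "(\<lambda>n. complex_of_real (case prod_decode n of (k, j) \<Rightarrow> kernel_coeff TYPE('k) m j k * a ^ j * b ^ k)) sums of_real ?F"
    by (simp only: sums_of_real_iff)
  moreover have "complex_of_real (case prod_decode n of (k, j) \<Rightarrow> kernel_coeff TYPE('k) m j k * a ^ j * b ^ k) = kernel_term m n p p" for n
    unfolding kernel_term_def case_prod_unfold cinner_self complex_norm_square[symmetric] by (simp add: ab)
  ultimately have "egg_kernel m p p = of_real ?F" unfolding egg_kernel_def by (simp add: sums_iff)
  then show "fs_potential m p = ln (1 / moment_const TYPE('k) m * (1 - (norm (fst p))\<^sup>2) powr (- (real CARD('k) + h * c)) *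
        (poly (pochhammer_numerator h c CARD('k)) x / (1 - x) ^ Suc CARD('k)))"
    unfolding fs_potential_def fs_kernel_diagonal[OF p] ab(1) by simp
qed

end

section \<open>Curvature of radial potentials\<close>

lemma matrix_inv_eqI:
  fixes G :: "'a::semiring_1 ^ 'n ^ 'n::finite"
  assumes "G ** D = mat 1" "D ** G = mat 1"
  shows "matrix_inv G = D"
  unfolding matrix_inv_def
proof (rule some_equality)
  fix D' assume D': "G ** D' = mat 1 \<and> D' ** G = mat 1"
  have "D' = D' ** (G ** D)" by (simp add: assms)
  also have "\<dots> = D" using D' by (simp add: matrix_mul_assoc)
  finally show "D' = D" .
qed (use assms in simp)

text \<open>The invariant \<open>x = \<bar>w\<bar>\<^sup>2 (1 - \<bar>z\<bar>\<^sup>2) powr (- h)\<close> of the automorphisms that move the points with \<open>w = 0\<close>.\<close>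

definition ratio :: "real \<Rightarrow> 'k::finite pt \<Rightarrow> real" where
  "ratio h q = (norm (snd q))\<^sup>2 * (1 - (norm (fst q))\<^sup>2) powr (- h)"

lemma radial_deriv_powr:
  assumes "(norm (fst p))\<^sup>2 < 1"
  shows "radial_deriv (\<lambda>q. (1 - (norm (fst q))\<^sup>2) powr (- h)) p (h * (1 - (norm (fst p))\<^sup>2) powr (- h) / (1 - (norm (fst p))\<^sup>2)) 0"
proof -
  let ?r = "1 - (norm (fst p))\<^sup>2"
  have "radial_deriv (\<lambda>q. 1 - (norm (fst q))\<^sup>2) p (0 - 1) (0 - 0)"
    by (intro radial_deriv_diff radial_deriv_const radial_deriv_norm_fst)
  moreover have "((\<lambda>r. r powr (- h)) has_real_derivative (- h) * ?r powr (- h - 1)) (at ?r)"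
    using assms by (intro has_real_derivative_powr) simp
  ultimately have "radial_deriv (\<lambda>q. (1 - (norm (fst q))\<^sup>2) powr (- h)) p (((- h) * ?r powr (- h - 1)) * (0 - 1)) (((- h) * ?r powr (- h - 1)) * (0 - 0))"
    by (rule radial_deriv_chain)
  moreover have "?r powr (- h - 1) = ?r powr (- h) / ?r" using assms by (simp add: powr_diff)
  ultimately show ?thesis by (simp add: radial_deriv_def)
qed

lemma radial_deriv_ln:
  assumes "(norm (fst p))\<^sup>2 < 1"
  shows "radial_deriv (\<lambda>q. ln (1 - (norm (fst q))\<^sup>2)) p (- 1 / (1 - (norm (fst p))\<^sup>2)) 0"
proof -
  have "radial_deriv (\<lambda>q. 1 - (norm (fst q))\<^sup>2) p (0 - 1) (0 - 0)"
    by (intro radial_deriv_diff radial_deriv_const radial_deriv_norm_fst)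
  from radial_deriv_chain[OF this DERIV_ln_divide] assms show ?thesis by simp
qed

lemma radial_deriv_inverse:
  assumes "(norm (fst p))\<^sup>2 < 1"
  shows "radial_deriv (\<lambda>q. 1 / (1 - (norm (fst q))\<^sup>2)) p (1 / (1 - (norm (fst p))\<^sup>2)\<^sup>2) 0"
proof -
  have 1: "radial_deriv (\<lambda>q. 1 - (norm (fst q))\<^sup>2) p (0 - 1) (0 - 0)"
    by (intro radial_deriv_diff radial_deriv_const radial_deriv_norm_fst)
  have "((\<lambda>r. 1 / r) has_real_derivative - 1 / (1 - (norm (fst p))\<^sup>2)\<^sup>2) (at (1 - (norm (fst p))\<^sup>2))"
    using assms by (auto intro!: derivative_eq_intros simp: power2_eq_square)
  from radial_deriv_chain[OF 1 this] show ?thesis by simp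
qed

lemma radial_deriv_ratio:
  assumes "(norm (fst p))\<^sup>2 < 1"
  shows "radial_deriv (ratio h) p (h * ratio h p / (1 - (norm (fst p))\<^sup>2)) ((1 - (norm (fst p))\<^sup>2) powr (- h))"
  using radial_deriv_mult[OF radial_deriv_norm_snd radial_deriv_powr[OF assms, of h]]
  by (simp add: ratio_def[abs_def] mult_ac)

text \<open>Here \<open>P = A + h x \<psi>'\<close>, \<open>V = (x \<psi>')'\<close>, so that \<open>P' = h V\<close>; these two functions govern all entries.\<close>

theorem complex_hessian_potential:
  fixes p :: "'k::finite pt"
  assumes W: "open W" "p \<in> W" and a: "\<And>q. q \<in> W \<Longrightarrow> (norm (fst q))\<^sup>2 < 1"
    and \<psi>: "\<And>q. q \<in> W \<Longrightarrow> (\<psi> has_real_derivative \<psi>1 (ratio h q)) (at (ratio h q))"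
    and \<psi>1: "(\<psi>1 has_real_derivative \<psi>2) (at (ratio h p))"
    and F: "\<And>q. q \<in> W \<Longrightarrow> F q = C - A * ln (1 - (norm (fst q))\<^sup>2) + \<psi> (ratio h q)"
  defines "s \<equiv> 1 - (norm (fst p))\<^sup>2" and "x \<equiv> ratio h p"
  defines "y \<equiv> s powr (- h)" and "P \<equiv> A + h * x * \<psi>1 x" and "V \<equiv> \<psi>1 x + x * \<psi>2"
  shows "complex_hessian F p $ j $ l = of_real (block l (block j ((P + h * x * (h * V)) / s\<^sup>2) (h * V * y / s))
       (block j (h * V * y / s) (\<psi>2 * y\<^sup>2))) * cnj (coord j p) * coord l p
     + (if j = l then of_real (block l (P / s) (\<psi>1 x * y)) else 0)"
proof -
  (* f1 and f2 are the partial derivatives of F in |z|^2 and |w|^2. *)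
  define f1 where "f1 q = (A + h * (ratio h q * \<psi>1 (ratio h q))) * (1 / (1 - (norm (fst q))\<^sup>2))" for q :: "'k pt"
  define f2 where "f2 q = \<psi>1 (ratio h q) * (1 - (norm (fst q))\<^sup>2) powr (- h)" for q :: "'k pt"
  have s: "s > 0" using a[OF W(2)] by (simp add: s_def)
  note ap = a[OF W(2)]
  have d: "radial_deriv F q (f1 q) (f2 q)" if q: "q \<in> W" for q
  proof (rule radial_deriv_transform[OF _ W(1) q])
    show "radial_deriv (\<lambda>q. C - A * ln (1 - (norm (fst q))\<^sup>2) + \<psi> (ratio h q)) q (f1 q) (f2 q)"
      by (rule radial_deriv_eq[OF radial_deriv_add[OF radial_deriv_diff[OF radial_deriv_const radial_deriv_mult[OF radial_deriv_const radial_deriv_ln[OF a[OF q]]]]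
         radial_deriv_chain[OF radial_deriv_ratio[OF a[OF q]] \<psi>[OF q]]]])
        (simp_all add: f1_def f2_def add_divide_distrib)
  qed (use F in simp)
  have r\<psi>: "radial_deriv (\<lambda>q. \<psi>1 (ratio h q)) p (\<psi>2 * (h * x / s)) (\<psi>2 * y)"
    using radial_deriv_chain[OF radial_deriv_ratio[OF ap] \<psi>1] by (simp add: s_def x_def y_def)
  have rr: "radial_deriv (ratio h) p (h * x / s) y" using radial_deriv_ratio[OF ap] by (simp add: s_def x_def y_def)
  have 1: "radial_deriv f1 p ((P + h * x * (h * V)) / s\<^sup>2) (h * V * y / s)"
    unfolding f1_def
    by (rule radial_deriv_eq[OF radial_deriv_mult[OF radial_deriv_add[OF radial_deriv_const radial_deriv_mult[OF radial_deriv_const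
          radial_deriv_mult[OF rr r\<psi>]]] radial_deriv_inverse[OF ap]]])
      (use s in \<open>simp_all add: P_def V_def flip: s_def x_def, simp_all add: field_simps power2_eq_square\<close>)
  have 2: "radial_deriv f2 p (h * V * y / s) (\<psi>2 * y\<^sup>2)"
    unfolding f2_def
    by (rule radial_deriv_eq[OF radial_deriv_mult[OF r\<psi> radial_deriv_powr[OF ap]]])
      (use s in \<open>simp_all add: V_def flip: s_def x_def y_def, simp_all add: field_simps power2_eq_square\<close>)
  have e: "f1 p = P / s" "f2 p = \<psi>1 x * y" by (simp_all add: f1_def f2_def P_def s_def x_def y_def)
  show ?thesis using complex_hessian_radial[OF W d 1 2, of j l] by (simp only: e)
qed

text \<open>Eliminating the \<open>w\<close> coordinate leaves a scalar matrix plus a rank-one matrix, in which the derivative of \<open>P\<close> has cancelled.\<close>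

theorem det_potential_hessian:
  fixes p :: "'k::finite pt" and H :: "complex ^ ('k option) ^ ('k option)"
  assumes H: "\<And>j l. H $ j $ l = of_real (block l (block j ((P + h * x * (h * V)) / s\<^sup>2) (h * V * y / s))
       (block j (h * V * y / s) (\<psi>2 * y\<^sup>2))) * cnj (coord j p) * coord l p
     + (if j = l then of_real (block l (P / s) (\<psi>1 * y)) else 0)"
    and s: "s = 1 - (norm (fst p))\<^sup>2" "s > 0" and x: "x = (norm (snd p))\<^sup>2 * y" and y: "y > 0"
    and V: "V = \<psi>1 + x * \<psi>2" "V \<noteq> 0" and P: "P \<noteq> 0"
  shows "det H = of_real (y * V * P ^ CARD('k) / s ^ Suc CARD('k))"
proof -
  let ?z = "\<lambda>i. fst p $ i" and ?w = "snd p"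
  let ?b = "(norm (snd p))\<^sup>2"
  have NN: "H $ None $ None = of_real (y * V)"
  proof -
    have "H $ None $ None = of_real (\<psi>2 * y\<^sup>2) * (?w * cnj ?w) + of_real (\<psi>1 * y)" by (simp add: H mult_ac)
    also have "\<dots> = of_real (\<psi>2 * y\<^sup>2 * ?b + \<psi>1 * y)" by (simp only: complex_norm_square[symmetric] of_real_mult of_real_add)
    also have "\<psi>2 * y\<^sup>2 * ?b + \<psi>1 * y = y * V" by (simp add: V(1) x power2_eq_square algebra_simps)
    finally show ?thesis .
  qed
  have nz: "H $ None $ None \<noteq> 0" using y V(2) by (simp add: NN)
  have entry: "H $ Some i $ Some j - H $ Some i $ None * H $ None $ Some j / H $ None $ None =
      (if i = j then of_real (P / s) else 0) + (of_real (P / s\<^sup>2) * cnj (?z i)) * ?z j" for i j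
  proof -
    have "H $ Some i $ None * H $ None $ Some j = of_real ((h * V * y / s)\<^sup>2) * (?w * cnj ?w) * (cnj (?z i) * ?z j)"
      by (simp add: H power2_eq_square mult_ac)
    also have "\<dots> = of_real ((h * V * y / s)\<^sup>2 * ?b) * (cnj (?z i) * ?z j)"
      by (simp only: complex_norm_square[symmetric] of_real_mult)
    finally have "H $ Some i $ None * H $ None $ Some j / H $ None $ None = of_real ((h * V * y / s)\<^sup>2 * ?b / (y * V)) * (cnj (?z i) * ?z j)"
      unfolding NN by (simp add: divide_inverse mult_ac)
    also have "(h * V * y / s)\<^sup>2 * ?b / (y * V) = h * x * (h * V) / s\<^sup>2"
      using y V(2) s(2) by (simp add: x field_simps power2_eq_square)
    finally have 1: "H $ Some i $ None * H $ None $ Some j / H $ None $ None = of_real (h * x * (h * V) / s\<^sup>2) * (cnj (?z i) * ?z j)" .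
    have 2: "H $ Some i $ Some j = of_real (P / s\<^sup>2 + h * x * (h * V) / s\<^sup>2) * (cnj (?z i) * ?z j) + (if i = j then of_real (P / s) else 0)"
      by (simp add: H add_divide_distrib mult_ac)
    show ?thesis unfolding 1 2 by (simp add: algebra_simps)
  qed
  have Ps: "complex_of_real (P / s) \<noteq> 0" using P s(2) by simp
  have sum: "(\<Sum>i\<in>UNIV. of_real (P / s\<^sup>2) * cnj (?z i) * ?z i) = of_real (P / s\<^sup>2 * (norm (fst p))\<^sup>2)"
  proof -
    have "(norm (fst p))\<^sup>2 = (\<Sum>i\<in>UNIV. (norm (?z i))\<^sup>2)" by (simp add: norm_vec_def L2_set_def sum_nonneg)
    then have "complex_of_real ((norm (fst p))\<^sup>2) = (\<Sum>i\<in>UNIV. ?z i * cnj (?z i))"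
      by (simp only: of_real_sum complex_norm_square)
    then show ?thesis by (simp only: of_real_mult sum_distrib_left mult_ac)
  qed
  have "det H = of_real (y * V) * (of_real (P / s) ^ CARD('k) * (1 + of_real (P / s\<^sup>2 * (norm (fst p))\<^sup>2) / of_real (P / s)))"
  proof -
    have "det H = H $ None $ None * (of_real (P / s) ^ CARD('k) * (1 + of_real (P / s\<^sup>2 * (norm (fst p))\<^sup>2) / of_real (P / s)))"
      unfolding det_schur_None[OF nz] entry det_scalar_plus_rank_one[OF Ps] sum ..
    then show ?thesis by (simp only: NN)
  qed
  also have "\<dots> = of_real (y * V * ((P / s) ^ CARD('k) * (1 + P / s\<^sup>2 * (norm (fst p))\<^sup>2 / (P / s))))" by simp
  also have "1 + P / s\<^sup>2 * (norm (fst p))\<^sup>2 / (P / s) = 1 / s"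
    using P s by (simp add: field_simps power2_eq_square)
  also have "y * V * ((P / s) ^ CARD('k) * (1 / s)) = y * V * P ^ CARD('k) / s ^ Suc CARD('k)" by (simp add: power_divide)
  finally show ?thesis .
qed

text \<open>A potential of the form \<open>- A ln (1 - \<bar>z\<bar>\<^sup>2) + \<psi>(x)\<close> on an open set \<open>W\<close>, with positivity conditions that make the metric positive definite there. Since the logarithm of its determinant has the same form, the Hessian formula applies twice.\<close>

locale radial_metric =
  fixes F :: "'k::finite pt \<Rightarrow> real" and W :: "'k pt set" and J :: "real set" and A C h :: real
    and \<psi> \<psi>1 \<psi>2 \<psi>3 \<psi>4 :: "real \<Rightarrow> real"
  assumes W: "open W" "\<And>q. q \<in> W \<Longrightarrow> (norm (fst q))\<^sup>2 < 1" "\<And>q. q \<in> W \<Longrightarrow> ratio h q \<in> J"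
    and F: "\<And>q. q \<in> W \<Longrightarrow> F q = C - A * ln (1 - (norm (fst q))\<^sup>2) + \<psi> (ratio h q)"
    and \<psi>: "\<And>x. x \<in> J \<Longrightarrow> (\<psi> has_real_derivative \<psi>1 x) (at x)" "\<And>x. x \<in> J \<Longrightarrow> (\<psi>1 has_real_derivative \<psi>2 x) (at x)"
      "\<And>x. x \<in> J \<Longrightarrow> (\<psi>2 has_real_derivative \<psi>3 x) (at x)" "\<And>x. x \<in> J \<Longrightarrow> (\<psi>3 has_real_derivative \<psi>4 x) (at x)"
    and P_pos: "\<And>x. x \<in> J \<Longrightarrow> A + h * x * \<psi>1 x > 0" and V_pos: "\<And>x. x \<in> J \<Longrightarrow> \<psi>1 x + x * \<psi>2 x > 0"
begin

definition "P x = A + h * x * \<psi>1 x"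
definition "V x = \<psi>1 x + x * \<psi>2 x"
definition "V1 x = 2 * \<psi>2 x + x * \<psi>3 x"
definition "V2 x = 3 * \<psi>3 x + x * \<psi>4 x"
definition "\<omega> x = real CARD('k) * ln (P x) + ln (V x)"
definition "\<omega>1 x = real CARD('k) * (h * V x / P x) + V1 x / V x"
definition "\<omega>2 x = real CARD('k) * (h * V1 x / P x - (h * V x / P x)\<^sup>2) + (V2 x / V x - (V1 x / V x)\<^sup>2)"

lemma pos: "x \<in> J \<Longrightarrow> P x > 0" "x \<in> J \<Longrightarrow> V x > 0" using P_pos V_pos by (auto simp: P_def V_def)

lemma derivs:
  assumes "x \<in> J"
  shows "(P has_real_derivative h * V x) (at x)" "(V has_real_derivative V1 x) (at x)" "(V1 has_real_derivative V2 x) (at x)"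
  unfolding P_def V_def V1_def V2_def by (auto intro!: derivative_eq_intros \<psi>[OF assms] simp: algebra_simps)

lemma derivs_log_det:
  assumes x: "x \<in> J"
  shows "(\<omega> has_real_derivative \<omega>1 x) (at x)" "(\<omega>1 has_real_derivative \<omega>2 x) (at x)"
proof -
  note d = derivs[OF x] and pos = pos[OF x]
  have "((\<lambda>x. real CARD('k) * ln (P x) + ln (V x)) has_real_derivative
      real CARD('k) * (1 / P x * (h * V x)) + 1 / V x * V1 x) (at x)"
    by (intro DERIV_add DERIV_cmult DERIV_chain2[OF DERIV_ln_divide] d pos)
  then show "(\<omega> has_real_derivative \<omega>1 x) (at x)" by (simp add: \<omega>_def[abs_def] \<omega>1_def)
  have nz: "P x \<noteq> 0" "V x \<noteq> 0" using pos by auto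
  have "((\<lambda>x. real CARD('k) * (h * V x / P x) + V1 x / V x) has_real_derivative
      real CARD('k) * (((h * V1 x) * P x - (h * V x) * (h * V x)) / (P x * P x)) + (V2 x * V x - V1 x * V1 x) / (V x * V x)) (at x)"
    by (intro DERIV_add DERIV_cmult DERIV_divide d nz)
  moreover have "((h * V1 x) * P x - (h * V x) * (h * V x)) / (P x * P x) = h * V1 x / P x - (h * V x / P x)\<^sup>2"
    using nz by (simp add: diff_divide_distrib power2_eq_square)
  moreover have "(V2 x * V x - V1 x * V1 x) / (V x * V x) = V2 x / V x - (V1 x / V x)\<^sup>2"
    using nz by (simp add: diff_divide_distrib power2_eq_square)
  ultimately show "(\<omega>1 has_real_derivative \<omega>2 x) (at x)" by (simp only: \<omega>1_def[abs_def] \<omega>2_def)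
qed

abbreviation "sq q \<equiv> 1 - (norm (fst (q::'k pt)))\<^sup>2"

lemma metric_entry:
  assumes p: "p \<in> W"
  shows "complex_hessian F p $ j $ l = of_real (block l (block j ((P (ratio h p) + h * ratio h p * (h * V (ratio h p))) / (sq p)\<^sup>2) (h * V (ratio h p) * sq p powr (- h) / sq p))
       (block j (h * V (ratio h p) * sq p powr (- h) / sq p) (\<psi>2 (ratio h p) * (sq p powr (- h))\<^sup>2))) * cnj (coord j p) * coord l p
     + (if j = l then of_real (block l (P (ratio h p) / sq p) (\<psi>1 (ratio h p) * sq p powr (- h))) else 0)"
  unfolding P_def V_def by (rule complex_hessian_potential[OF W(1) p W(2) \<psi>(1)[OF W(3)] \<psi>(2)[OF W(3)[OF p]] F])

lemma det_metric:
  assumes p: "p \<in> W"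
  shows "det (complex_hessian F p) = of_real (sq p powr (- h) * V (ratio h p) * P (ratio h p) ^ CARD('k) / sq p ^ Suc CARD('k))"
  using W(2)[OF p] pos[OF W(3)[OF p]]
  by (intro det_potential_hessian[OF metric_entry[OF p]]) (auto simp: ratio_def V_def)

lemma det_metric_nonzero:
  assumes p: "p \<in> W" shows "det (complex_hessian F p) \<noteq> 0"
proof -
  have "sq p > 0" using W(2)[OF p] by simp
  moreover from this have "sq p powr (- h) > 0" unfolding powr_gt_zero by linarith
  ultimately have "sq p powr (- h) * V (ratio h p) * P (ratio h p) ^ CARD('k) / sq p ^ Suc CARD('k) > 0"
    using pos[OF W(3)[OF p]] by (intro divide_pos_pos mult_pos_pos zero_less_power)
  then show ?thesis unfolding det_metric[OF p] of_real_eq_0_iff by (rule less_imp_neq[symmetric])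
qed

lemma log_det:
  assumes p: "p \<in> W"
  shows "ln (Re (det (complex_hessian F p))) = 0 - (real CARD('k) + 1 + h) * ln (sq p) + \<omega> (ratio h p)"
proof -
  have s: "sq p > 0" using W(2)[OF p] by simp
  have "ln (s powr (- h) * v * u ^ d / s ^ Suc d) = 0 - (real d + 1 + h) * ln s + (real d * ln u + ln v)"
    if "s > 0" "u > 0" "v > 0" for s u v :: real and d
    using that by (simp add: ln_div ln_mult ln_realpow ln_powr algebra_simps)
  from this[OF s pos[OF W(3)[OF p]]] show ?thesis unfolding det_metric[OF p] Re_complex_of_real \<omega>_def .
qed

lemma log_det_hessian_entry:
  assumes p: "p \<in> W"
  shows "complex_hessian (\<lambda>q. ln (Re (det (complex_hessian F q)))) p $ j $ l = 
     of_real (block l (block j ((real CARD('k) + 1 + h + h * ratio h p * \<omega>1 (ratio h p) + h * ratio h p * (h * (\<omega>1 (ratio h p) + ratio h p * \<omega>2 (ratio h p)))) / (sq p)\<^sup>2)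
          (h * (\<omega>1 (ratio h p) + ratio h p * \<omega>2 (ratio h p)) * sq p powr (- h) / sq p))
       (block j (h * (\<omega>1 (ratio h p) + ratio h p * \<omega>2 (ratio h p)) * sq p powr (- h) / sq p) (\<omega>2 (ratio h p) * (sq p powr (- h))\<^sup>2))) * cnj (coord j p) * coord l p
     + (if j = l then of_real (block l ((real CARD('k) + 1 + h + h * ratio h p * \<omega>1 (ratio h p)) / sq p) (\<omega>1 (ratio h p) * sq p powr (- h))) else 0)"
  by (rule complex_hessian_potential[OF W(1) p W(2) derivs_log_det(1)[OF W(3)] derivs_log_det(2)[OF W(3)[OF p]] log_det])

text \<open>At \<open>z = 0\<close> all mixed entries vanish and the metric and the Ricci form are diagonal.\<close>

theorem axis_scalar_curvature:
  assumes p: "(0, w) \<in> W"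
  defines "x \<equiv> (norm w)\<^sup>2"
  shows "trace ((- complex_hessian (\<lambda>q. ln (Re (det (complex_hessian F q)))) (0, w)) ** matrix_inv (complex_hessian F (0, w))) =
     of_real (- (real CARD('k) * (real CARD('k) + 1 + h + h * x * \<omega>1 x) / P x + (\<omega>1 x + x * \<omega>2 x) / V x))"
proof -
  have rx: "ratio h (0, w) = x" "sq (0, w) = 1" by (simp_all add: ratio_def x_def)
  have J: "x \<in> J" using W(3)[OF p] by (simp add: rx)
  note pos = pos[OF J]
  define G where "G = complex_hessian F (0, w)"
  define E where "E = complex_hessian (\<lambda>q. ln (Re (det (complex_hessian F q)))) (0, w)"
  define g where "g j = (block j (P x) (V x))" for j :: "'k option"
  define e where "e j = (block j (real CARD('k) + 1 + h + h * x * \<omega>1 x) (\<omega>1 x + x * \<omega>2 x))" for j :: "'k option"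
  have ww: "cnj w * w = of_real x" unfolding x_def complex_norm_square by simp
  have sum2: "of_real u * cnj w * w + of_real v = complex_of_real (v + x * u)" for u v
  proof -
    have "of_real u * cnj w * w + of_real v = of_real u * of_real x + complex_of_real v" by (simp only: mult.assoc ww)
    then show ?thesis by (simp add: mult.commute add.commute)
  qed
  have G: "G $ j $ l = (if j = l then of_real (g j) else 0)" for j l
    unfolding G_def metric_entry[OF p] rx g_def by (cases j; cases l) (auto simp: sum2 V_def)
  have E: "E $ j $ l = (if j = l then of_real (e j) else 0)" for j l
    unfolding E_def log_det_hessian_entry[OF p] rx e_def by (cases j; cases l) (auto simp: sum2)
  have gpos: "g j > 0" for j using pos by (cases j) (auto simp: g_def)
  define D where "D = (\<chi> j l. if j = l then complex_of_real (1 / g j) else 0)"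
  have GD: "G ** D = mat 1" "D ** G = mat 1"
    using gpos[THEN less_imp_neq]
    by (auto simp: vec_eq_iff matrix_matrix_mult_def G D_def mat_def if_distrib[of "\<lambda>x. x * _"] if_distrib[of "\<lambda>x. _ * x"] cong: if_cong
        simp flip: of_real_mult)
  have inv: "matrix_inv G = D" by (rule matrix_inv_eqI[OF GD])
  have "((- E) ** D) $ j $ j = of_real (- (e j / g j))" for j
    unfolding matrix_matrix_mult_def by (simp add: E D_def if_distrib[of "\<lambda>x. x * _"] if_distrib[of "\<lambda>x. _ * x"] if_distrib[of uminus] cong: if_cong)
  then have "trace ((- E) ** matrix_inv G) = (\<Sum>j\<in>UNIV. of_real (- (e j / g j)))" unfolding inv trace_def by simp
  also have "\<dots> = of_real (- (real CARD('k) * (real CARD('k) + 1 + h + h * x * \<omega>1 x) / P x + (\<omega>1 x + x * \<omega>2 x) / V x))"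
    unfolding sum_option by (simp add: e_def g_def algebra_simps)
  finally show ?thesis by (simp add: E_def G_def)
qed

end

section \<open>Eigenvalues and the trace\<close>

lemma prod_mset_linear_factors:
  fixes M :: "'a::idom multiset"
  shows "degree (\<Prod>x\<in>#M. [:- x, 1:]) = size M \<and> coeff (\<Prod>x\<in>#M. [:- x, 1:]) (size M) = 1 \<and>
     (M \<noteq> {#} \<longrightarrow> coeff (\<Prod>x\<in>#M. [:- x, 1:]) (size M - 1) = - \<Sum>\<^sub># M) \<and> proots (\<Prod>x\<in>#M. [:- x, 1:]) = M"
proof (induction M)
  case (add a M)
  let ?p = "\<Prod>x\<in>#M. [:- x, 1:]"
  have ne: "?p \<noteq> 0" using add by (metis coeff_0 zero_neq_one)
  have "degree ([:- a, 1:] * ?p) = Suc (size M)"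
    using add ne by (subst degree_mult_eq) auto
  moreover have "coeff ([:- a, 1:] * ?p) (Suc (size M)) = 1"
    using add by (simp add: coeff_eq_0)
  moreover have "coeff ([:- a, 1:] * ?p) (size M) = - (a + \<Sum>\<^sub># M)"
  proof (cases "M = {#}")
    case False
    then obtain k where k: "size M = Suc k" by (metis size_eq_0_iff_empty not0_implies_Suc)
    then show ?thesis using add False by simp
  qed simp
  moreover have "proots ([:- a, 1:] * ?p) = add_mset a M"
    using add ne by (subst proots_mult) auto
  ultimately show ?case by simp
qed simp

lemma prod_mod_fixed_le:
  fixes p :: "'n::finite \<Rightarrow> 'n"
  assumes p: "p permutes UNIV" "p \<noteq> id"
  shows "degree (\<Prod>i\<in>UNIV. (if i = p i then [:0, 1:] else 0) - [:A i (p i) :: complex:]) < CARD('n) - 1"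
proof -
  obtain x where x: "p x \<noteq> x" using p(2) by (auto simp: fun_eq_iff)
  then have x': "p (p x) \<noteq> p x" using permutes_inj[OF p(1)] by (auto dest: injD)
  let ?f = "\<lambda>i. (if i = p i then [:0, 1:] else 0) - [:A i (p i):]"
  have "degree (\<Prod>i\<in>UNIV. ?f i) \<le> (\<Sum>i\<in>UNIV. degree (?f i))"
    using degree_prod_sum_le[of UNIV ?f] by (simp add: o_def)
  also have "\<dots> \<le> (\<Sum>i\<in>UNIV. if i = x \<or> i = p x then 0 else 1)"
    using x x' by (intro sum_mono) (auto simp: degree_pCons_le intro: order_trans[OF degree_diff_le_max])
  also have "\<dots> = card (UNIV - {x, p x})"
    by (simp add: sum.If_cases Compl_eq_Diff_UNIV insert_compr[symmetric]) (rule arg_cong[of _ _ card], auto)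
  also have "\<dots> = CARD('n) - 2" using x by (simp add: card_Diff_subset)
  also have "\<dots> < CARD('n) - 1"
  proof -
    have "card {x, p x} \<le> CARD('n)" by (intro card_mono) auto
    then show ?thesis using x by simp
  qed
  finally show ?thesis .
qed

text \<open>In the Leibniz expansion a permutation other than the identity moves at least two indices, so only the diagonal product reaches the two top degrees.\<close>

lemma charpoly_facts:
  fixes A :: "complex ^ 'n ^ 'n::finite"
  shows "degree (charpoly A) = CARD('n)" "coeff (charpoly A) CARD('n) = 1" "coeff (charpoly A) (CARD('n) - 1) = - trace A"
proof -
  let ?P = "{p. p permutes (UNIV :: 'n set)}"
  let ?t = "\<lambda>p. of_int (sign p) * (\<Prod>i\<in>UNIV. (if i = p i then [:0, 1:] else 0) - [:A $ i $ p i:])"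
  define R where "R = (\<Sum>p\<in>?P - {id}. ?t p)"
  define T where "T = (\<Prod>i\<in>UNIV. [:- A $ i $ i, 1:])"
  have "charpoly A = (\<Sum>p\<in>?P. ?t p)" by (simp add: charpoly_def det_def)
  also have "\<dots> = ?t id + R" unfolding R_def
    by (rule sum.remove) (auto simp: finite_permutations permutes_id)
  also have "?t id = T" by (simp add: T_def)
  finally have eq: "charpoly A = T + R" .
  have R0: "coeff R k = 0" if "k \<ge> CARD('n) - 1" for k
  proof -
    have "coeff (?t p) k = 0" if p: "p \<in> ?P - {id}" for p
    proof -
      have "degree (\<Prod>i\<in>UNIV. (if i = p i then [:0, 1:] else 0) - [:A $ i $ p i:]) < k"
        using prod_mod_fixed_le[of p "\<lambda>i j. A $ i $ j"] p \<open>k \<ge> CARD('n) - 1\<close> by auto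
      then show ?thesis by (cases p rule: sign_cases) (simp_all add: coeff_eq_0)
    qed
    then show ?thesis by (simp add: R_def coeff_sum)
  qed
  have T: "degree T = CARD('n)" "coeff T CARD('n) = 1" "coeff T (CARD('n) - 1) = - trace A"
  proof -
    define M where "M = image_mset (\<lambda>i. A $ i $ i) (mset_set UNIV)"
    have "T = (\<Prod>x\<in>#M. [:- x, 1:])" by (simp add: T_def M_def prod_unfold_prod_mset image_mset.compositionality o_def)
    moreover have "size M = CARD('n)" "\<Sum>\<^sub># M = trace A" by (simp_all add: M_def trace_def sum_unfold_sum_mset)
    moreover from this have "M \<noteq> {#}" by (metis size_empty zero_less_card_finite less_irrefl)
    ultimately show "degree T = CARD('n)" "coeff T CARD('n) = 1" "coeff T (CARD('n) - 1) = - trace A"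
      using prod_mset_linear_factors[of M] by auto
  qed
  show 1: "coeff (charpoly A) CARD('n) = 1" by (simp add: eq R0 T)
  show "coeff (charpoly A) (CARD('n) - 1) = - trace A"
    using T(3) R0[of "CARD('n) - 1"] by (simp add: eq)
  show "degree (charpoly A) = CARD('n)"
  proof (rule antisym)
    show "degree (charpoly A) \<le> CARD('n)"
      by (rule degree_le) (use T(1) R0 in \<open>auto simp: eq coeff_eq_0\<close>)
    show "CARD('n) \<le> degree (charpoly A)" by (rule le_degree) (simp add: 1)
  qed
qed

text \<open>Comparing the subleading coefficient of the factorised characteristic polynomial.\<close>

theorem sum_eigenvalues_eq_trace:
  fixes A :: "complex ^ 'n ^ 'n::finite"
  shows "\<Sum>\<^sub># (proots (charpoly A)) = trace A"
proof -
  have "charpoly A \<noteq> 0" using charpoly_facts(2)[of A] by auto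
  then obtain M where M: "size M = degree (charpoly A)" "charpoly A = smult (lead_coeff (charpoly A)) (\<Prod>x\<in>#M. [:- x, 1:])"
    using alg_closed_imp_factorization by blast
  then have eq: "charpoly A = (\<Prod>x\<in>#M. [:- x, 1:])" using charpoly_facts[of A] by simp
  have "M \<noteq> {#}" using M(1) charpoly_facts(1)[of A] by auto
  then have "- trace A = - \<Sum>\<^sub># M" "proots (charpoly A) = M"
    using prod_mset_linear_factors[of M] charpoly_facts(1,3)[of A] M(1) unfolding eq[symmetric] by auto
  then show ?thesis by simp
qed

section \<open>Constant scalar curvature\<close>

lemma ratio_continuous: "continuous_on (egg m) (ratio h :: 'k::finite pt \<Rightarrow> real)" if "m \<ge> 1"
proof -
  have "1 - (norm (fst q))\<^sup>2 \<noteq> 0" if "q \<in> egg m" for q :: "'k pt"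
    using fs_potential_eq(2)[OF \<open>m \<ge> 1\<close> that] by simp
  then show ?thesis unfolding ratio_def by (auto intro!: continuous_intros)
qed

theorem matrix_inv_scaled:
  fixes G E :: "complex ^ 'n ^ 'n::finite"
  assumes "\<And>j l. E $ j $ l = c * G $ j $ l" "det G \<noteq> 0"
  shows "E ** matrix_inv G = (\<chi> j l. if j = l then c else 0)"
proof -
  obtain D where D: "G ** D = mat 1" "D ** G = mat 1" using assms(2) invertible_det_nz[of G] unfolding invertible_def by blast
  have "G ** matrix_inv G = mat 1" using D(1) unfolding matrix_inv_eqI[OF D] .
  moreover have "(E ** B) $ j $ l = c * (G ** B) $ j $ l" for B :: "complex ^ 'n ^ 'n" and j l
    by (simp add: matrix_matrix_mult_def assms(1) sum_distrib_left mult.assoc)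
  ultimately show ?thesis by (simp add: vec_eq_iff mat_def)
qed

text \<open>With \<open>h = c = 1\<close> the numerator polynomial is constant, and every term of the Hessian formula is proportional to the coefficient of the logarithm. The potential has coefficient \<open>d + 1\<close> and the logarithm of the determinant has \<open>d + 2\<close>.\<close>

theorem ball_ricci_endo:
  assumes p: "(p :: 'k::finite pt) \<in> egg 1"
  shows "ricci_endo 1 p = (\<chi> j l. if j = l then - of_real ((real CARD('k) + 2) / (real CARD('k) + 1)) else 0)"
proof -
  let ?d = "real CARD('k)"
  define \<kappa> where "\<kappa> = ?d + 1"
  define C where "C = ln (1 / moment_const TYPE('k) 1 * fact CARD('k))"
  have \<kappa>: "\<kappa> > 0" by (simp add: \<kappa>_def add_nonneg_pos)
  have w: "weight_exp TYPE('k) 1 = 1" by (simp add: weight_exp_def)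
  interpret radial_metric "fs_potential 1 :: 'k pt \<Rightarrow> real" "egg 1" "{..<1}" \<kappa> C 1
    "\<lambda>x. - \<kappa> * ln (1 - x)" "\<lambda>x. \<kappa> / (1 - x)" "\<lambda>x. \<kappa> / (1 - x) ^ 2" "\<lambda>x. 2 * \<kappa> / (1 - x) ^ 3" "\<lambda>x. 6 * \<kappa> / (1 - x) ^ 4"
  proof
    show "open (egg 1 :: 'k pt set)" by (rule open_egg)
    fix q :: "'k pt" assume q: "q \<in> egg 1"
    note pot = fs_potential_eq[of 1, OF order_refl q]
    show a: "(norm (fst q))\<^sup>2 < 1" by (rule pot(2))
    show x: "ratio 1 q \<in> {..<1}" using pot(1) by (simp add: ratio_def)
    define s where "s = 1 - (norm (fst q))\<^sup>2"
    have "s > 0" using a by (simp add: s_def)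
    have gg: "poly (pochhammer_numerator 1 1 CARD('k)) y = fact CARD('k)" for y :: real by (simp add: pochhammer_numerator_unit of_nat_poly)
    have n: "1 / real 1 = (1 :: real)" by simp
    have "fs_potential 1 q = ln ((1 / moment_const TYPE('k) 1 * fact CARD('k)) * s powr (- \<kappa>) / (1 - ratio 1 q) ^ Suc CARD('k))"
      unfolding pot(3) n w gg unfolding ratio_def[of 1 q, symmetric] unfolding s_def[symmetric] by (simp add: \<kappa>_def mult.commute del: power_Suc)
    also have "\<dots> = C - \<kappa> * ln s - \<kappa> * ln (1 - ratio 1 q)"
    proof -
      have 1: "ln ((u * s powr (- \<kappa>)) / r ^ Suc CARD('k)) = ln u - \<kappa> * ln s - \<kappa> * ln r" if "u > 0" "r > 0" for u r :: real
      proof -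
        have "ln ((u * s powr (- \<kappa>)) / r ^ Suc CARD('k)) = ln u + ln (s powr (- \<kappa>)) - ln (r ^ Suc CARD('k))"
          using that \<open>s > 0\<close> by (simp add: ln_div ln_mult del: power_Suc)
        moreover have "ln (r ^ Suc CARD('k)) = \<kappa> * ln r" using that ln_realpow[of r "Suc CARD('k)"] by (simp add: \<kappa>_def add.commute)
        ultimately show ?thesis using \<open>s > 0\<close> by (simp add: ln_powr)
      qed
      show ?thesis unfolding C_def by (rule 1) (use moment_const_pos[of 1, where 'k = 'k] x in auto)
    qed
    finally show "fs_potential 1 q = C - \<kappa> * ln (1 - (norm (fst q))\<^sup>2) + - \<kappa> * ln (1 - ratio 1 q)" by (simp add: s_def)
  next
    fix x :: real assume "x \<in> {..<1}"
    then have x: "1 - x > 0" by simp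
    show "((\<lambda>x. - \<kappa> * ln (1 - x)) has_real_derivative \<kappa> / (1 - x)) (at x)"
      using x by (auto intro!: derivative_eq_intros simp: field_simps)
    show "((\<lambda>x. \<kappa> / (1 - x)) has_real_derivative \<kappa> / (1 - x) ^ 2) (at x)"
      using x by (auto intro!: derivative_eq_intros simp: field_simps power2_eq_square)
    show "((\<lambda>x. \<kappa> / (1 - x) ^ 2) has_real_derivative 2 * \<kappa> / (1 - x) ^ 3) (at x)"
      using x by (auto intro!: derivative_eq_intros simp: divide_simps; simp add: eval_nat_numeral algebra_simps)
    show "((\<lambda>x. 2 * \<kappa> / (1 - x) ^ 3) has_real_derivative 6 * \<kappa> / (1 - x) ^ 4) (at x)"
      using x by (auto intro!: derivative_eq_intros simp: divide_simps; simp add: eval_nat_numeral algebra_simps)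
    have "\<kappa> + 1 * x * (\<kappa> / (1 - x)) = \<kappa> / (1 - x)" using x by (simp add: field_simps)
    then show "\<kappa> + 1 * x * (\<kappa> / (1 - x)) > 0" using \<kappa> x by simp
    have "\<kappa> / (1 - x) = (\<kappa> * (1 - x)) / (1 - x) ^ 2" using x by (simp add: power2_eq_square)
    then have "\<kappa> / (1 - x) + x * (\<kappa> / (1 - x) ^ 2) = (\<kappa> * (1 - x) + x * \<kappa>) / (1 - x) ^ 2" by (simp add: add_divide_distrib)
    also have "\<kappa> * (1 - x) + x * \<kappa> = \<kappa>" by (simp add: algebra_simps)
    finally show "\<kappa> / (1 - x) + x * (\<kappa> / (1 - x) ^ 2) > 0" using \<kappa> x by simp
  qed
  define x where "x = ratio 1 p"
  have x: "1 - x > 0" using W(3)[OF p] by (simp add: x_def)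
  have PV: "P x = \<kappa> / (1 - x)" "V x = \<kappa> / (1 - x)\<^sup>2" "V1 x = 2 * \<kappa> / (1 - x) ^ 3" "V2 x = 6 * \<kappa> / (1 - x) ^ 4"
    unfolding P_def V_def V1_def V2_def using x by (simp_all add: divide_simps) (simp_all add: eval_nat_numeral algebra_simps)
  have q: "1 * V x / P x = 1 / (1 - x)" "V1 x / V x = 2 / (1 - x)" "1 * V1 x / P x = 2 / (1 - x)\<^sup>2" "V2 x / V x = 6 / (1 - x)\<^sup>2"
    unfolding PV using x \<kappa> by (simp_all add: divide_simps) (simp_all add: eval_nat_numeral algebra_simps)
  have om1: "\<omega>1 x = (\<kappa> + 1) / (1 - x)" unfolding \<omega>1_def q by (simp add: \<kappa>_def add_divide_distrib)
  have om2: "\<omega>2 x = (\<kappa> + 1) / (1 - x)\<^sup>2" unfolding \<omega>2_def q by (simp add: \<kappa>_def power_divide algebra_simps add_divide_distrib diff_divide_distrib)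
  define K where "K = (\<kappa> + 1) / \<kappa>"
  have sc: "?d + 1 + 1 + x * \<omega>1 x = K * P x" "\<omega>1 x + x * \<omega>2 x = K * V x" "\<omega>2 x = K * (\<kappa> / (1 - x)\<^sup>2)" "\<omega>1 x = K * (\<kappa> / (1 - x))"
  proof -
    have K\<kappa>: "K * \<kappa> = \<kappa> + 1" using \<kappa> by (simp add: K_def)
    have r1: "a + x * (a / (1 - x)) = a / (1 - x)" for a using x by (simp add: field_simps)
    have r2: "a / (1 - x) + x * (a / (1 - x)\<^sup>2) = a / (1 - x)\<^sup>2" for a
    proof -
      have "a / (1 - x) = (a * (1 - x)) / (1 - x) ^ 2" using x by (simp add: power2_eq_square)
      then have "a / (1 - x) + x * (a / (1 - x) ^ 2) = (a * (1 - x) + x * a) / (1 - x) ^ 2" by (simp add: add_divide_distrib)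
      also have "a * (1 - x) + x * a = a" by (simp add: algebra_simps)
      finally show ?thesis .
    qed
    show "\<omega>1 x = K * (\<kappa> / (1 - x))" "\<omega>2 x = K * (\<kappa> / (1 - x)\<^sup>2)" unfolding om1 om2 times_divide_eq_right K\<kappa> by (rule refl)+
    show "\<omega>1 x + x * \<omega>2 x = K * V x" unfolding om1 om2 PV r2 times_divide_eq_right[of K] K\<kappa> ..
    have "?d + 1 + 1 = \<kappa> + 1" by (simp add: \<kappa>_def)
    then show "?d + 1 + 1 + x * \<omega>1 x = K * P x" unfolding om1 PV times_divide_eq_right[of K] K\<kappa> by (simp only: r1)
  qed
  have entries: "ricci_form 1 p $ j $ l = (- of_real K) * fs_metric 1 p $ j $ l" for j l
  proof -
    have "block l (block j (K * a1) (K * a2)) (block j (K * a3) (K * a4)) = K * block l (block j a1 a2) (block j a3 a4)"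
      "block l (K * a1) (K * a2) = K * block l a1 a2" for a1 a2 a3 a4 :: real
      by (cases j; cases l; simp)+
    note bl = this
    let ?s = "1 - (norm (fst p))\<^sup>2"
    have e1: "(?d + 1 + 1 + x * \<omega>1 x + x * (\<omega>1 x + x * \<omega>2 x)) / ?s\<^sup>2 = K * ((P x + x * V x) / ?s\<^sup>2)"
      unfolding sc(1,2) by (simp add: algebra_simps)
    have e2: "(\<omega>1 x + x * \<omega>2 x) * ?s powr (- 1) / ?s = K * (V x * ?s powr (- 1) / ?s)"
      unfolding sc(2) by simp
    have e3: "\<omega>2 x * (?s powr (- 1))\<^sup>2 = K * (\<kappa> / (1 - x)\<^sup>2 * (?s powr (- 1))\<^sup>2)"
      unfolding sc(3) by simp
    have e4: "(?d + 1 + 1 + x * \<omega>1 x) / ?s = K * (P x / ?s)"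
      unfolding sc(1) by simp
    have e5: "\<omega>1 x * ?s powr (- 1) = K * (\<kappa> / (1 - x) * ?s powr (- 1))"
      unfolding sc(4) by simp
    note e = e1 e2 e3 e4 e5
    have "complex_hessian (\<lambda>q. ln (Re (det (complex_hessian (fs_potential 1) q)))) p $ j $ l = of_real K * complex_hessian (fs_potential 1) p $ j $ l"
      unfolding log_det_hessian_entry[OF p] metric_entry[OF p] x_def[symmetric] mult_1_left e bl of_real_mult
      by (simp add: distrib_left mult.assoc)
    then show ?thesis unfolding ricci_form_def fs_metric_def by simp
  qed
  have "det (fs_metric 1 p) \<noteq> 0" unfolding fs_metric_def by (rule det_metric_nonzero[OF p])
  note inv = matrix_inv_scaled[OF entries this]
  have "(\<kappa> + 1) / \<kappa> = (?d + 2) / (?d + 1)" by (simp add: \<kappa>_def)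
  with inv[unfolded K_def] show ?thesis unfolding ricci_endo_def by (simp only:)
qed


text \<open>Clearing denominators in the formula for the scalar curvature on the axis.\<close>

lemma axis_curvature_identity:
  fixes d h x P V V1 V2 :: real
  assumes P: "P \<noteq> 0" and V: "V \<noteq> 0"
  defines "w1 \<equiv> d * (h * V / P) + V1 / V" and "w2 \<equiv> d * (h * V1 / P - (h * V / P)\<^sup>2) + (V2 / V - (V1 / V)\<^sup>2)"
  shows "curvature_expr (- (d * (d + 1 + h + h * x * w1) / P + (w1 + x * w2) / V)) d (d + 1) h x 1 P (h * V) (h * V1) (h * V2) = 0"
proof -
  define k1 where "k1 = d * h * V\<^sup>2 + V1 * P"
  define k2 where "k2 = d * (h * V1 * P * V\<^sup>2 - h\<^sup>2 * V ^ 4) + (V2 * V * P\<^sup>2 - V1\<^sup>2 * P\<^sup>2)"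
  define S where "S = - (d * (d + 1 + h + h * x * w1) / P + (w1 + x * w2) / V)"
  have 1: "w1 * (P * V) = k1" using P V by (simp add: w1_def k1_def field_simps power2_eq_square)
  have 2: "w2 * (P\<^sup>2 * V\<^sup>2) = k2" using P V by (simp add: w2_def k2_def field_simps eval_nat_numeral)
  have "S * (P * V) = - (d * (d + 1 + h + h * x * w1) * V + (w1 + x * w2) * P)"
    using P V by (simp add: S_def field_simps)
  then have "S * P\<^sup>2 * V ^ 3 = - (d * (d + 1 + h) * P * V ^ 3 + d * h * x * (w1 * (P * V)) * V\<^sup>2 + w1 * (P * V) * P * V + x * (w2 * (P\<^sup>2 * V\<^sup>2)))"
    by algebra
  then have 3: "S * P\<^sup>2 * V ^ 3 = - (d * (d + 1 + h) * P * V ^ 3 + d * h * x * k1 * V\<^sup>2 + k1 * P * V + x * k2)"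
    unfolding 1 2 .
  have "curvature_expr S d (d + 1) h x 1 P (h * V) (h * V1) (h * V2) = 0"
    using 3 unfolding curvature_expr_def k1_def k2_def by algebra
  then show ?thesis unfolding S_def .
qed

text \<open>The formulas are used only at points \<open>(0, w)\<close> with small \<open>w\<close>, where positivity of the quantities under the logarithms follows from their values at \<open>x = 0\<close>; a short interval suffices for the rational identity.\<close>

theorem scalar_curvature_not_constant:
  assumes m: "m \<ge> 2" and const: "scalar_curvature m constant_on (egg m :: 'k::finite pt set)"
  shows False
proof -
  have m1: "m \<ge> 1" using m by simp
  define d h c where "d = CARD('k)" and "h = 1 / real m" and "c = weight_exp TYPE('k) m"
  have h: "0 < h" "h \<le> 1" using m by (auto simp: h_def)
  have c: "c > 1" using m by (simp add: c_def weight_exp_def add_nonneg_pos)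
  have d: "d > 0" by (simp add: d_def)
  define g where "g = (pochhammer_numerator h c d :: real poly)"
  define A where "A = real d + h * c"
  have hc: "h * c > 0" using h c by simp
  have A: "A > 0" using hc by (simp add: A_def add_nonneg_pos)
  have g0: "poly g 0 > 0" unfolding g_def pochhammer_numerator_0 by (rule pochhammer_pos[OF hc])
  define q N0 where "q = [:1, -1:] * g" and "N0 = pderiv g * [:1, -1:] + smult (real (Suc d)) g"
  define N1 N2 N3 where "N1 = quotient_deriv 1 q N0" and "N2 = quotient_deriv 2 q N1" and "N3 = quotient_deriv 3 q N2"
  (* psi = log (g / (1 - x)^(d+1)); its derivatives are kept as quotients by powers of q. *)
  define \<psi> \<psi>1 \<psi>2 \<psi>3 \<psi>4 where "\<psi> = (\<lambda>x. ln (poly g x) - real (Suc d) * ln (1 - x))"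
    and "\<psi>1 = (\<lambda>x. poly N0 x / poly q x ^ 1)" and "\<psi>2 = (\<lambda>x. poly N1 x / poly q x ^ 2)"
    and "\<psi>3 = (\<lambda>x. poly N2 x / poly q x ^ 3)" and "\<psi>4 = (\<lambda>x. poly N3 x / poly q x ^ 4)"
  have chain: "(\<psi>1 has_real_derivative \<psi>2 x) (at x)" "(\<psi>2 has_real_derivative \<psi>3 x) (at x)" "(\<psi>3 has_real_derivative \<psi>4 x) (at x)"
    if "poly q x \<noteq> 0" for x
    using has_field_derivative_quotient[OF that, of 1 N0] has_field_derivative_quotient[OF that, of 2 N1] has_field_derivative_quotient[OF that, of 3 N2]
    by (simp_all add: \<psi>1_def \<psi>2_def \<psi>3_def \<psi>4_def N1_def N2_def N3_def eval_nat_numeral)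
  have q0: "poly q 0 \<noteq> 0" using g0 by (simp add: q_def)
  have \<psi>10: "\<psi>1 0 > 0"
  proof -
    have "poly (pderiv g) 0 + real (Suc d) * poly g 0 = pochhammer (h * c + h) d" unfolding g_def by (rule pochhammer_numerator_deriv_0)
    also have "\<dots> > 0" using hc h by (intro pochhammer_pos) simp
    finally show ?thesis using g0 by (simp add: \<psi>1_def N0_def q_def)
  qed
  have nhds: "\<forall>\<^sub>F x in nhds 0. f x > 0" if "isCont f 0" "f 0 > 0" for f :: "real \<Rightarrow> real"
    using order_tendstoD(1)[of f "f 0" "nhds 0" 0] that by (simp add: isCont_def tendsto_at_iff_tendsto_nhds)
  have cont: "isCont \<psi>1 0" "isCont \<psi>2 0" using chain[OF q0] by (auto intro: DERIV_isCont)
  have "\<forall>\<^sub>F x in nhds 0. poly g x > 0 \<and> A + h * x * \<psi>1 x > 0 \<and> \<psi>1 x + x * \<psi>2 x > 0"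
    by (intro eventually_conj nhds) (use g0 A \<psi>10 cont in \<open>auto intro!: continuous_intros\<close>)
  then obtain e where e: "e > 0" "\<And>x. \<bar>x\<bar> < e \<Longrightarrow> poly g x > 0 \<and> A + h * x * \<psi>1 x > 0 \<and> \<psi>1 x + x * \<psi>2 x > 0"
    unfolding eventually_nhds_metric dist_real_def by auto
  define \<epsilon> where "\<epsilon> = min e 1"
  have \<epsilon>: "0 < \<epsilon>" "\<epsilon> \<le> 1" using e(1) by (auto simp: \<epsilon>_def)
  define J where "J = {-\<epsilon><..<\<epsilon>}"
  have J: "poly g x > 0" "A + h * x * \<psi>1 x > 0" "\<psi>1 x + x * \<psi>2 x > 0" "x < 1" if "x \<in> J" for x
    using e(2)[of x] that by (auto simp: J_def \<epsilon>_def)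
  have qJ: "poly q x \<noteq> 0" if "x \<in> J" for x using J[OF that] by (simp add: q_def)
  define W where "W = (egg m :: 'k pt set) \<inter> ratio h -` J"
  have openW: "open W" unfolding W_def
    by (rule continuous_open_preimage[OF ratio_continuous[OF m1] open_egg]) (simp add: J_def)
  interpret radial_metric "fs_potential m" W J A "ln (1 / moment_const TYPE('k) m)" h \<psi> \<psi>1 \<psi>2 \<psi>3 \<psi>4
  proof
    show "open W" by (rule openW)
    fix p assume p: "p \<in> W"
    then have pe: "p \<in> egg m" and x: "ratio h p \<in> J" by (auto simp: W_def)
    note pot = fs_potential_eq[OF m1 pe]
    show a: "(norm (fst p))\<^sup>2 < 1" by (rule pot(2))
    show "ratio h p \<in> J" by (rule x)
    have "ln (u * s powr (- A) * (v / r ^ Suc d)) = ln u - A * ln s + (ln v - real (Suc d) * ln r)"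
      if "u > 0" "s > 0" "v > 0" "r > 0" for u s v r :: real
      using that by (simp add: ln_div ln_mult ln_powr ln_realpow algebra_simps)
    from this[of "1 / moment_const TYPE('k) m" "1 - (norm (fst p))\<^sup>2" "poly g (ratio h p)" "1 - ratio h p"]
    show "fs_potential m p = ln (1 / moment_const TYPE('k) m) - A * ln (1 - (norm (fst p))\<^sup>2) + \<psi> (ratio h p)"
      unfolding pot(3) using a J[OF x] moment_const_pos[OF m1, where 'k = 'k]
      by (simp add: \<psi>_def A_def g_def h_def c_def d_def ratio_def del: power_Suc)
  next
    fix x assume x: "x \<in> J"
    have "((\<lambda>x. ln (poly g x) - real (Suc d) * ln (1 - x)) has_real_derivative 
        1 / poly g x * poly (pderiv g) x - real (Suc d) * (1 / (1 - x) * (0 - 1))) (at x)"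
      by (intro DERIV_diff DERIV_cmult DERIV_chain2[OF DERIV_ln_divide] poly_DERIV DERIV_const DERIV_ident) (use J[OF x] in auto)
    moreover have "1 / poly g x * poly (pderiv g) x - real (Suc d) * (1 / (1 - x) * (0 - 1)) = \<psi>1 x"
      using J[OF x] by (simp add: \<psi>1_def N0_def q_def field_simps)
    ultimately show "(\<psi> has_real_derivative \<psi>1 x) (at x)" by (simp add: \<psi>_def)
  qed (use chain qJ J in auto)
  obtain S where S: "\<And>p. p \<in> (egg m :: 'k pt set) \<Longrightarrow> scalar_curvature m p = S" using const unfolding constant_on_def by blast
  have curv: "Re S = - (real d * (real d + 1 + h + h * x * \<omega>1 x) / P x + (\<omega>1 x + x * \<omega>2 x) / V x)" if x: "x \<in> {0<..<\<epsilon>}" for x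
  proof -
    let ?w = "complex_of_real (sqrt x)"
    have w: "(norm ?w)\<^sup>2 = x" using x by simp
    have r: "ratio h (0 :: complex ^ 'k, ?w) = x" using x by (simp add: ratio_def)
    have "x ^ m \<le> x ^ 1" using x \<epsilon> m1 by (intro power_decreasing) auto
    then have "x ^ m < 1" using x \<epsilon> by simp
    then have pe: "(0, ?w) \<in> (egg m :: 'k pt set)" using x by (simp add: egg_def power_mult)
    then have "(0, ?w) \<in> W" using r x by (simp add: W_def J_def)
    from axis_scalar_curvature[OF this] S[OF pe] show ?thesis
      unfolding scalar_curvature_def ricci_endo_def ricci_form_def fs_metric_def w d_def by simp
  qed
  have sub: "x \<in> J" if "x \<in> {0<..<\<epsilon>}" for x using that by (simp add: J_def)
  show False
  proof (rule no_constant_curvature[OF \<epsilon> h(1), of "pochhammer_numerator h c d" P A d "\<lambda>x. h * V x" "\<lambda>x. h * V1 x" "\<lambda>x. h * V2 x" "Re S"])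
    show "degree (pochhammer_numerator h c d :: complex poly) > 0" by (rule pochhammer_numerator_nonconstant[OF h c d])
    show "poly (pochhammer_numerator h c d) (0 :: complex) \<noteq> 0" using poly_gnum_of_real(1)[of h c d 0] g0 by (simp add: g_def)
    show "poly (pochhammer_numerator h c d) (1 :: complex) \<noteq> 0" using poly_gnum_of_real(1)[of h c d 1] h by (simp add: pochhammer_numerator_1)
    fix x assume x: "x \<in> {0<..<\<epsilon>}"
    note xJ = sub[OF x]
    show "poly (pochhammer_numerator h c d) (complex_of_real x) \<noteq> 0" using J(1)[OF xJ] by (simp add: poly_gnum_of_real g_def)
    have "P x = A + h * (x * poly (pderiv g) x / poly g x + real (d + 1) * x / (1 - x))"
    proof -
      have "\<psi>1 x = poly (pderiv g) x / poly g x + real (d + 1) / (1 - x)"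
        using J[OF xJ] by (simp add: \<psi>1_def N0_def q_def field_simps)
      then show ?thesis unfolding P_def by (simp add: distrib_left mult_ac)
    qed
    then show "complex_of_real (P x) = of_real A + of_real h * (of_real x * poly (pderiv (pochhammer_numerator h c d)) (of_real x) / poly (pochhammer_numerator h c d) (of_real x)
        + of_nat (d + 1) * of_real x / (1 - of_real x))"
      by (simp add: poly_gnum_of_real g_def)
    show "(P has_real_derivative h * V x) (at x)" by (rule derivs(1)[OF xJ])
    show "((\<lambda>x. h * V x) has_real_derivative h * V1 x) (at x)" by (intro DERIV_cmult derivs(2)[OF xJ])
    show "((\<lambda>x. h * V1 x) has_real_derivative h * V2 x) (at x)" by (intro DERIV_cmult derivs(3)[OF xJ])
    show "curvature_expr (Re S) (real d) (real (d + 1)) h x 1 (P x) (h * V x) (h * V1 x) (h * V2 x) = 0"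
      using axis_curvature_identity[of "P x" "V x" "real d" h x "V1 x" "V2 x"] pos[OF xJ]
      unfolding curv[OF x] \<omega>1_def \<omega>2_def d_def[symmetric] by (simp add: add.commute)
  qed
qed

theorem theorem6p6:
  fixes m :: nat
  assumes "m \<ge> 1"
  shows "(scalar_curvature m constant_on (egg m :: 'k::finite pt set) \<longrightarrow> m = 1) \<and>
         (ricci_eigenvalues m constant_on (egg m :: 'k::finite pt set) \<longrightarrow> m = 1) \<and>
         (m = 1 \<longrightarrow>
            scalar_curvature m constant_on (egg m :: 'k::finite pt set) \<and>
            ricci_eigenvalues m constant_on (egg m :: 'k::finite pt set))"
proof (intro conjI impI)
  show one: "m = 1" if "scalar_curvature m constant_on (egg m :: 'k pt set)"
    using scalar_curvature_not_constant[of m, OF _ that] assms by fastforce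
  show "m = 1" if "ricci_eigenvalues m constant_on (egg m :: 'k pt set)"
  proof (rule one)
    have "scalar_curvature m = (\<lambda>p::'k pt. \<Sum>\<^sub># (ricci_eigenvalues m p))"
      by (rule ext) (simp add: scalar_curvature_def ricci_eigenvalues_def sum_eigenvalues_eq_trace)
    then show "scalar_curvature m constant_on (egg m :: 'k pt set)" using that unfolding constant_on_def by auto
  qed
  show "scalar_curvature m constant_on (egg m :: 'k pt set)" if "m = 1"
    unfolding that constant_on_def scalar_curvature_def by (intro exI ballI, subst ball_ricci_endo, assumption, rule refl)
  show "ricci_eigenvalues m constant_on (egg m :: 'k pt set)" if "m = 1"
    unfolding that constant_on_def ricci_eigenvalues_def by (intro exI ballI, subst ball_ricci_endo, assumption, rule refl)
qed

end
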